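(* Let $r\ge1$ and let $\underline{\lambda},\underline{\mu},\underline{\nu}\in\mathcal{P}_r$ with $|\underline{\lambda}|+|\underline{\mu}|=|\underline{\nu}|$. Let $K$ be a positive integer with $$\frac{\lambda_1-\lambda_r+\mu_1-\mu_r+\nu_1-\nu_r}{K}<\frac1r .$$ Then the Littlewood–Richardson coefficient is given by $$c_{\underline{\lambda}\,\underline{\mu}}^{\underline{\nu}}=\frac{1}{r(r+K)^{r-1}}\sum_{\overrightarrow{v}}\exp\Bigl(2\pi i\Bigl(-\frac{|\Sigma|}{r(r+K)}\Bigr)\sum_{i=1}^{r}v_i\Bigr)\Bigl(\prod_{i<j}\Bigl(2\sin\frac{\pi(v_i-v_j)}{r+K}\Bigr)^{2}\Bigr)S_{\Sigma}\Bigl(\exp 2\pi i\frac{\overrightarrow{v}}{r+K}\Bigr),$$ where $|\Sigma|=|{}^K\underline{\lambda}|+|{}^K\underline{\mu}|+|{}^K\underline{\nu}^*|$, $S_\Sigma=S_{{}^K\underline{\lambda}}S_{{}^K\underline{\mu}}S_{{}^K\underline{\nu}^*}$ is the product of Schur polynomials, and $\overrightarrow{v}=(v_1,\dots,v_r)$ runs through the integer vectors with $0=v_r<\cdots<v_2<v_1<r+K$.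
   Context: $\mathcal{P}_r=\{\underline{\lambda}=(\lambda_1\ge\cdots\ge\lambda_r)\mid\lambda_i\in\mathbb{Z}\}$ (entries may be negative), and $|\underline{\lambda}|=\sum_i\lambda_i$. $V(\underline{\lambda})$ is the irreducible representation of $\operatorname{GL}_r$ (over $\mathbb{C}$) with highest weight $\underline{\lambda}$. The Littlewood–Richardson coefficients are defined by $V(\underline{\lambda})\otimes V(\underline{\mu})\cong\bigoplus_{\underline{\nu}\in\mathcal{P}_r}V(\underline{\nu})^{\oplus c_{\underline{\lambda}\,\underline{\mu}}^{\underline{\nu}}}$. The dual partition is $\underline{\nu}^*=(-\nu_r\ge\cdots\ge-\nu_1)$. For $\underline{\lambda}\in\mathcal{P}_r$, ${}^K\underline{\lambda}$ is the partition with entries ${}^K\lambda_i=K-\lambda_1+\lambda_i$; ${}^K\underline{\mu}$ and ${}^K\underline{\nu}^*$ are obtained by applying the same operation to $\underline{\mu}$ and to $\underline{\nu}^*$. The Schur polynomial is $S_{\underline{\lambda}}(z_1,\dots,z_r)=\det(z_j^{\lambda_i+r-i})/\det(z_j^{r-i})$, and $\exp 2\pi i\frac{\overrightarrow{v}}{r+K}$ denotes the tuple $(\exp(2\pi i v_1/(r+K)),\dots,\exp(2\pi i v_r/(r+K)))$. Inside the exponentials $2\pi i$, $i=\sqrt{-1}$. *)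

theory Defs
  imports Complex_Main "Jordan_Normal_Form.Determinant" "Jordan_Normal_Form.VS_Connect"
begin

(* Elements (lambda_1 >= ... >= lambda_r) of P_r are integer lists of length r. Lists and
   matrices are indexed from 0, so lambda_i is lam ! (i - 1). *)

definition partitions :: "nat \<Rightarrow> int list set" where
  "partitions r = {lam. length lam = r \<and> sorted_wrt (\<ge>) lam}"

definition dual_partition :: "int list \<Rightarrow> int list" where
  "dual_partition nu = map uminus (rev nu)"

definition shift_partition :: "nat \<Rightarrow> int list \<Rightarrow> int list" where
  "shift_partition K lam = map (\<lambda>x. int K - lam ! 0 + x) lam"


section \<open>Rational representations of the general linear group\<close>

definition GL :: "nat \<Rightarrow> complex mat monoid" where
  "GL r = units_of (ring_mat TYPE(complex) r ())"

text \<open>The coordinate ring of the algebraic group GL(r): the algebra of functions generated by the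
  matrix entries and the inverse of the determinant. Only the values on the group matter.\<close>

inductive_set regular_functions :: "nat \<Rightarrow> (complex mat \<Rightarrow> complex) set" for r :: nat where
  const: "(\<lambda>A. c) \<in> regular_functions r"
| entry: "i < r \<Longrightarrow> j < r \<Longrightarrow> (\<lambda>A. A $$ (i, j)) \<in> regular_functions r"
| inverse_det: "(\<lambda>A. inverse (det A)) \<in> regular_functions r"
| add: "f \<in> regular_functions r \<Longrightarrow> g \<in> regular_functions r \<Longrightarrow> (\<lambda>A. f A + g A) \<in> regular_functions r"
| mult: "f \<in> regular_functions r \<Longrightarrow> g \<in> regular_functions r \<Longrightarrow> (\<lambda>A. f A * g A) \<in> regular_functions r"

text \<open>A representation of GL(r) always means a rational (i.e. algebraic) one; up to isomorphism it
  acts on column vectors of some length d.\<close>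

definition rational_rep :: "nat \<Rightarrow> nat \<Rightarrow> (complex mat \<Rightarrow> complex mat) \<Rightarrow> bool" where
  "rational_rep r d \<rho> \<longleftrightarrow>
     \<rho> \<in> hom (GL r) (GL d) \<and>
     (\<forall>i<d. \<forall>j<d. \<exists>f\<in>regular_functions r. \<forall>A\<in>carrier (GL r). \<rho> A $$ (i, j) = f A)"

definition irreducible_rep :: "nat \<Rightarrow> nat \<Rightarrow> (complex mat \<Rightarrow> complex mat) \<Rightarrow> bool" where
  "irreducible_rep r d \<rho> \<longleftrightarrow>
     rational_rep r d \<rho> \<and> d > 0 \<and>
     (\<forall>W. VectorSpace.subspace class_ring W (module_vec TYPE(complex) d) \<longrightarrow>
          (\<forall>A\<in>carrier (GL r). \<forall>w\<in>W. \<rho> A *\<^sub>v w \<in> W) \<longrightarrow>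
          W = {0\<^sub>v d} \<or> W = carrier_vec d)"

text \<open>A highest weight vector of weight lam: the Borel subgroup of upper triangular matrices acts
  on it through the character given by lam, i.e. it is fixed by the unipotent upper triangular
  matrices and the diagonal torus acts on it with weight lam.\<close>

definition has_highest_weight ::
    "nat \<Rightarrow> nat \<Rightarrow> int list \<Rightarrow> (complex mat \<Rightarrow> complex mat) \<Rightarrow> bool" where
  "has_highest_weight r d lam \<rho> \<longleftrightarrow>
     (\<exists>v\<in>carrier_vec d. v \<noteq> 0\<^sub>v d \<and>
        (\<forall>B\<in>carrier (GL r). upper_triangular B \<longrightarrow>
           \<rho> B *\<^sub>v v = (\<Prod>i<r. B $$ (i, i) powi (lam ! i)) \<cdot>\<^sub>v v))"

definition rep_iso ::
    "nat \<Rightarrow> (complex mat \<Rightarrow> complex mat) \<Rightarrow> (complex mat \<Rightarrow> complex mat) \<Rightarrow> bool" where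
  "rep_iso r \<rho> \<sigma> \<longleftrightarrow>
     (\<exists>d. rational_rep r d \<rho> \<and> rational_rep r d \<sigma> \<and>
        (\<exists>P\<in>carrier (GL d). \<forall>A\<in>carrier (GL r). P * \<rho> A = \<sigma> A * P))"

definition kronecker :: "complex mat \<Rightarrow> complex mat \<Rightarrow> complex mat" where
  "kronecker A B =
     mat (dim_row A * dim_row B) (dim_col A * dim_col B)
       (\<lambda>(i, j). A $$ (i div dim_row B, j div dim_col B) * B $$ (i mod dim_row B, j mod dim_col B))"

definition tensor_rep ::
    "(complex mat \<Rightarrow> complex mat) \<Rightarrow> (complex mat \<Rightarrow> complex mat) \<Rightarrow> complex mat \<Rightarrow> complex mat" where
  "tensor_rep \<rho> \<sigma> A = kronecker (\<rho> A) (\<sigma> A)"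

definition direct_sum_rep :: "(complex mat \<Rightarrow> complex mat) list \<Rightarrow> complex mat \<Rightarrow> complex mat" where
  "direct_sum_rep \<rho>s A = diag_block_mat (map (\<lambda>\<rho>. \<rho> A) \<rho>s)"

text \<open>The irreducible representation with highest weight lam is determined up to isomorphism only;
  highest_weight_rep r lam is a chosen one, below written V(lam).\<close>

definition highest_weight_rep :: "nat \<Rightarrow> int list \<Rightarrow> complex mat \<Rightarrow> complex mat" where
  "highest_weight_rep r lam = (SOME \<rho>. \<exists>d. irreducible_rep r d \<rho> \<and> has_highest_weight r d lam \<rho>)"

text \<open>The finitely supported multiplicity function c, with support contained in the set of entries
  of ks, for which V(lam) tensor V(mu) is isomorphic to the direct sum of c(k) copies of V(k).\<close>

definition LR_coeff :: "nat \<Rightarrow> int list \<Rightarrow> int list \<Rightarrow> int list \<Rightarrow> nat" where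
  "LR_coeff r lam mu =
     (THE c. \<exists>ks. distinct ks \<and> set ks \<subseteq> partitions r \<and> (\<forall>k. k \<notin> set ks \<longrightarrow> c k = 0) \<and>
        rep_iso r (tensor_rep (highest_weight_rep r lam) (highest_weight_rep r mu))
          (direct_sum_rep (concat (map (\<lambda>k. replicate (c k) (highest_weight_rep r k)) ks))))"


section \<open>Schur polynomials\<close>

text \<open>With 0-based i and j the exponent lam(i) + r - i becomes lam ! i + (r - 1 - i). Exponents may
  be negative, so this is a function of nonzero arguments, pairwise distinct so that the
  denominator does not vanish.\<close>

definition schur :: "int list \<Rightarrow> complex list \<Rightarrow> complex" where
  "schur lam z = (let r = length lam in
     det (mat r r (\<lambda>(i, j). z ! j powi (lam ! i + int (r - 1 - i)))) /
     det (mat r r (\<lambda>(i, j). z ! j ^ (r - 1 - i))))"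

definition exp_tuple :: "nat \<Rightarrow> nat \<Rightarrow> int list \<Rightarrow> complex list" where
  "exp_tuple r K v = map (\<lambda>x. exp (2 * pi * \<i> * of_int x / of_nat (r + K))) v"

definition verlinde_vectors :: "nat \<Rightarrow> nat \<Rightarrow> int list set" where
  "verlinde_vectors r K =
     {v. length v = r \<and> v ! (r - 1) = 0 \<and> sorted_wrt (>) v \<and> v ! 0 < int (r + K)}"

end

theory Submission
  imports Defs "HOL-Library.FuncSet" "Jordan_Normal_Form.Char_Poly"
begin

text \<open>Put n = r + K and write a(k) for the determinant of the matrix of the z_j^(k_i). By Weyl's
  character formula, ch V(lam) a(rho) = a(lam + rho), hence a(lam + rho) ch V(mu) is the sum of the
  c(k) a(k + rho), where c(k) is the multiplicity of V(k) in V(lam) tensor V(mu). The product of the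
  squared sines is |a(rho)|^2, and the exponential factor cancels the powers of z_1 ... z_r that come
  from shifting the partitions; so the summand is the value of a(lam + rho) ch V(mu) conj a(nu + rho)
  at n-th roots of unity. It vanishes when two arguments coincide and does not change when the
  arguments are permuted or multiplied by a common root of unity. Therefore its sum over all r-tuples
  of n-th roots of unity is n (r - 1)! times the sum of the theorem. On the other hand the sum of
  a(k + rho) conj a(nu + rho) over these tuples is n^r r! for k = nu and 0 for the other k: only
  monomials with all exponents divisible by n contribute, the exponents add up to 0, and by the bound
  on K any two of them differ by less than 2 n, so they all vanish.

  Conjugating by a one-parameter subgroup of the torus and passing to the limit shows how triangular
  matrices move weights; with the density of the matrices L U this gives the dominance order on
  weights and the uniqueness of irreducible representations. The character formula comes from the
  Casimir element: it makes a(rho) ch V(m) an eigenfunction of the Laplacian of the torus, so all its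
  exponents have the norm of m + rho. Complete reducibility is proved for representations that are
  compatible with conjugate transposes, and the irreducible representations are found in tensor
  products of a power of the inverse determinant with copies of the standard representation.\<close>

section \<open>Laurent polynomials on the torus\<close>

text \<open>V(lam) is a choice among representations and the coefficient is a definite description,
  so the formula presupposes the basic theory of GL(r): existence and uniqueness for every highest
  weight, decomposition of tensor products, and independence of characters. A few devices keep this
  elementary. Torus identities are compared through Laurent coefficients, whose uniqueness rests on
  the same averages over roots of unity that later produce the theorem. The weight projections are
  matrices of Laurent coefficients, so no simultaneous diagonalisation has to be carried out. Limits
  and derivatives are taken entrywise along curves in one complex variable, so matrices carry no
  topology. Compatibility with conjugate transposes replaces averaging over the unitary group: it
  makes orthogonal complements of invariant subspaces invariant, passes to subrepresentations and
  tensor products, and holds for the standard representation and the powers of the inverse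
  determinant. The character formula stays multiplied by the Vandermonde determinant, so that it
  also makes sense where coordinates coincide.\<close>

definition lmon :: "nat \<Rightarrow> (nat \<Rightarrow> int) \<Rightarrow> (nat \<Rightarrow> complex) \<Rightarrow> complex" where
  "lmon r m t = (\<Prod>i<r. t i powi m i)"

definition torus :: "nat \<Rightarrow> (nat \<Rightarrow> complex) set" where
  "torus r = {t. \<forall>i<r. t i \<noteq> 0}"

text \<open>Tuples are functions on the natural numbers of which only the first r values matter. Exponents
  vanish from r on, so that distinct exponents give distinct monomials.\<close>

definition expo :: "nat \<Rightarrow> (nat \<Rightarrow> int) set" where
  "expo r = {m. \<forall>i\<ge>r. m i = 0}"

lemma torusD: "t \<in> torus r \<Longrightarrow> i < r \<Longrightarrow> t i \<noteq> 0"
  by (simp add: torus_def)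

lemma torus_mult: "t \<in> torus r \<Longrightarrow> s \<in> torus r \<Longrightarrow> (\<lambda>i. t i * s i) \<in> torus r"
  by (simp add: torus_def)

lemma lmon_add: "t \<in> torus r \<Longrightarrow> lmon r (\<lambda>i. m i + m' i) t = lmon r m t * lmon r m' t"
  unfolding lmon_def prod.distrib[symmetric] by (rule prod.cong[OF refl]) (simp add: power_int_add torus_def)

lemma lmon_mult: "lmon r m (\<lambda>i. t i * s i) = lmon r m t * lmon r m s"
  unfolding lmon_def power_int_mult_distrib by (rule prod.distrib)

lemma lmon_zero [simp]: "lmon r (\<lambda>i. 0) t = 1"
  by (simp add: lmon_def)

lemma lmon_one [simp]: "lmon r m (\<lambda>i. 1) = 1"
  by (simp add: lmon_def)

lemma lmon_uminus: "lmon r (\<lambda>i. - m i) t = inverse (lmon r m t)"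
  unfolding lmon_def power_int_minus by (rule prod_inversef[unfolded o_def])

lemma lmon_diff: "t \<in> torus r \<Longrightarrow> lmon r (\<lambda>i. m i - m' i) t = lmon r m t / lmon r m' t"
  using lmon_add[of t r m "\<lambda>i. - m' i"] unfolding lmon_uminus by (simp add: divide_inverse)

lemma lmon_permute:
  assumes "p permutes {..<r}"
  shows "lmon r (m \<circ> p) (t \<circ> p) = lmon r m t"
  using prod.permute[OF assms, of "\<lambda>i. t i powi m i"] by (simp add: lmon_def o_def)

lemma lmon_unit: "i < r \<Longrightarrow> lmon r (\<lambda>j. if j = i then 1 else 0) t = t i"
proof -
  assume "i < r"
  have "lmon r (\<lambda>j. if j = i then 1 else 0) t = (\<Prod>j<r. if j = i then t i else 1)"
    unfolding lmon_def by (rule prod.cong) auto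
  also have "\<dots> = t i" using \<open>i < r\<close> by simp
  finally show ?thesis .
qed

lemma expo_add: "m \<in> expo r \<Longrightarrow> m' \<in> expo r \<Longrightarrow> (\<lambda>i. m i + m' i) \<in> expo r"
  by (simp add: expo_def)

lemma expo_permute: "p permutes {..<r} \<Longrightarrow> m \<in> expo r \<Longrightarrow> m \<circ> p \<in> expo r"
  by (simp add: expo_def permutes_not_in)

lemma expo_eqI: "m \<in> expo r \<Longrightarrow> m' \<in> expo r \<Longrightarrow> (\<And>i. i < r \<Longrightarrow> m i = m' i) \<Longrightarrow> m = m'"
proof
  fix i assume "m \<in> expo r" "m' \<in> expo r" "\<And>i. i < r \<Longrightarrow> m i = m' i"
  thus "m i = m' i" by (cases "i < r") (simp_all add: expo_def)
qed

section \<open>Sums over tuples of roots of unity\<close>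

definition root_tuple :: "nat \<Rightarrow> (nat \<Rightarrow> int) \<Rightarrow> nat \<Rightarrow> complex" where
  "root_tuple n v = (\<lambda>i. cis (2 * pi * of_int (v i) / of_nat n))"

text \<open>Extensional functions on \<open>{..<r}\<close>, so that every class of tuples modulo n
  has exactly one representative and sums over the set factor coordinatewise.\<close>

definition residues :: "nat \<Rightarrow> nat \<Rightarrow> (nat \<Rightarrow> int) set" where
  "residues r n = (PiE {..<r} (\<lambda>_. {0..<int n}))"

lemma root_tuple_torus: "root_tuple n v \<in> torus r"
  by (simp add: root_tuple_def torus_def)

lemma cis_root_eq_1:
  assumes "n > 0"
  shows "cis (2 * pi * of_int k / of_nat n) = 1 \<longleftrightarrow> int n dvd k"
proof
  assume "cis (2 * pi * of_int k / of_nat n) = 1"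
  hence "cos (2 * pi * of_int k / of_nat n) = 1" by (metis cis.simps(1) one_complex.simps(1))
  then obtain m :: int where "2 * pi * of_int k / of_nat n = of_int m * 2 * pi"
    using cos_one_2pi_int by auto
  hence "real_of_int k = of_int m * of_nat n" using assms by (simp add: field_simps)
  hence "real_of_int k = real_of_int (m * int n)" by simp
  hence "k = m * int n" by linarith
  thus "int n dvd k" by simp
next
  assume "int n dvd k"
  then obtain m where "k = int n * m" by (elim dvdE)
  hence "2 * pi * of_int k / of_nat n = 2 * pi * of_int m" using assms by simp
  thus "cis (2 * pi * of_int k / of_nat n) = 1" by (metis Ints_of_int cis_multiple_2pi)
qed

lemma root_sum:
  assumes n: "n > 0"
  shows "(\<Sum>x\<in>{0..<int n}. cis (2 * pi * of_int x / of_nat n) powi k) =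
         (if int n dvd k then of_nat n else 0)"
proof -
  \<comment> \<open>Exchanging the roles of x and k makes the sum a geometric series with ratio
    w.\<close>
  define w where "w = cis (2 * pi * of_int k / of_nat n)"
  have w: "cis (2 * pi * of_int (int x) / of_nat n) powi k = w ^ x" for x
    by (simp add: w_def cis_power_int DeMoivre algebra_simps)
  have im: "{0..<int n} = int ` {0..<n}"
    by (simp add: image_int_atLeastLessThan)
  have "(\<Sum>x\<in>{0..<int n}. cis (2 * pi * of_int x / of_nat n) powi k) = (\<Sum>x\<in>{0..<n}. w ^ x)"
    unfolding im by (subst sum.reindex) (simp_all only: o_def w inj_on_of_nat)
  also have "\<dots> = (if int n dvd k then of_nat n else 0)"
  proof (cases "int n dvd k")
    case True
    hence "w = 1" using cis_root_eq_1[OF n] by (simp add: w_def)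
    thus ?thesis using True by simp
  next
    case False
    hence "w \<noteq> 1" using cis_root_eq_1[OF n] by (simp add: w_def)
    moreover have "w ^ n = 1"
    proof -
      have "w ^ n = cis (2 * pi * of_int k)" using n by (simp add: w_def DeMoivre)
      thus ?thesis by (metis Ints_of_int cis_multiple_2pi)
    qed
    ultimately show ?thesis using False
      by (simp add: geometric_sum lessThan_atLeast0[symmetric])
  qed
  finally show ?thesis .
qed

lemma root_tuple_sum:
  assumes "n > 0"
  shows "(\<Sum>v\<in>residues r n. lmon r k (root_tuple n v)) =
         (if \<forall>i<r. int n dvd k i then of_nat n ^ r else 0)"
proof -
  have "(\<Sum>v\<in>residues r n. lmon r k (root_tuple n v)) =
        (\<Prod>i<r. \<Sum>x\<in>{0..<int n}. cis (2 * pi * of_int x / of_nat n) powi k i)"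
    unfolding residues_def lmon_def root_tuple_def by (rule prod_sum_PiE[symmetric]) auto
  also have "\<dots> = (\<Prod>i<r. if int n dvd k i then of_nat n else 0)"
    by (simp only: root_sum[OF assms])
  also have "\<dots> = (if \<forall>i<r. int n dvd k i then of_nat n ^ r else 0)"
    using assms by auto
  finally show ?thesis .
qed

text \<open>Discrete Fourier inversion. When n exceeds all differences of exponents, congruence
  modulo n is equality, so dividing the relation by the monomial of \<open>m0\<close> and summing
  over tuples of n-th roots of unity leaves \<open>b m0\<close> alone.\<close>

lemma lmon_independent:
  assumes S: "finite S" "S \<subseteq> expo r"
    and zero: "\<And>t. t \<in> torus r \<Longrightarrow> (\<Sum>m\<in>S. b m * lmon r m t) = 0"
    and m0: "m0 \<in> S"
  shows "b m0 = 0"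
proof -
  define B where "B = (\<Sum>m\<in>S. \<Sum>i<r. \<bar>m i\<bar>)"
  have B: "\<bar>m i\<bar> \<le> B" if "m \<in> S" "i < r" for m i
  proof -
    have "\<bar>m i\<bar> \<le> (\<Sum>i<r. \<bar>m i\<bar>)" using that by (intro member_le_sum) auto
    also have "\<dots> \<le> B" unfolding B_def using that S by (intro member_le_sum) (auto intro: sum_nonneg)
    finally show ?thesis .
  qed
  \<comment> \<open>Two entries bounded by B in absolute value differ by at most 2 B, hence by less
    than n.\<close>
  define n where "n = nat (2 * B + 1)"
  have "B \<ge> 0" unfolding B_def by (intro sum_nonneg) auto
  hence n: "n > 0" "int n = 2 * B + 1" unfolding n_def by auto
  have dvd: "(\<forall>i<r. int n dvd m i - m0 i) \<longleftrightarrow> m = m0" if m: "m \<in> S" for m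
  proof
    assume *: "\<forall>i<r. int n dvd m i - m0 i"
    show "m = m0"
    proof (rule expo_eqI)
      show "m \<in> expo r" "m0 \<in> expo r" using m m0 S by auto
      fix i assume i: "i < r"
      have "\<bar>m i - m0 i\<bar> < int n" using B[OF m i] B[OF m0 i] n by linarith
      with * i show "m i = m0 i" by (metis dvd_imp_le_int eq_iff_diff_eq_0 nat_int_comparison(3) abs_of_nat not_less)
    qed
  qed auto
  have "0 = (\<Sum>v\<in>residues r n. (\<Sum>m\<in>S. b m * lmon r m (root_tuple n v)) / lmon r m0 (root_tuple n v))"
    by (simp add: zero root_tuple_torus)
  also have "\<dots> = (\<Sum>v\<in>residues r n. \<Sum>m\<in>S. b m * lmon r (\<lambda>i. m i - m0 i) (root_tuple n v))"
    by (simp add: lmon_diff[OF root_tuple_torus] sum_divide_distrib)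
  also have "\<dots> = (\<Sum>m\<in>S. b m * (\<Sum>v\<in>residues r n. lmon r (\<lambda>i. m i - m0 i) (root_tuple n v)))"
    by (subst sum.swap) (simp add: sum_distrib_left)
  also have "\<dots> = (\<Sum>m\<in>S. if m = m0 then b m * of_nat n ^ r else 0)"
    unfolding root_tuple_sum[OF n(1)] using dvd by (intro sum.cong) auto
  also have "\<dots> = b m0 * of_nat n ^ r" using S m0 by simp
  finally show ?thesis using n by simp
qed

text \<open>A relation instead of a coefficient map: F matters only on the torus, and b is
  determined by F once monomials are known to be independent.\<close>

definition laurent :: "nat \<Rightarrow> ((nat \<Rightarrow> complex) \<Rightarrow> complex) \<Rightarrow> ((nat \<Rightarrow> int) \<Rightarrow> complex) \<Rightarrow> bool" where
  "laurent r F b \<longleftrightarrow> finite {m. b m \<noteq> 0} \<and> {m. b m \<noteq> 0} \<subseteq> expo r \<and>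
     (\<forall>t\<in>torus r. F t = (\<Sum>m | b m \<noteq> 0. b m * lmon r m t))"

lemma laurentD:
  assumes "laurent r F b" "finite S" "{m. b m \<noteq> 0} \<subseteq> S" "t \<in> torus r"
  shows "F t = (\<Sum>m\<in>S. b m * lmon r m t)"
proof -
  have "F t = (\<Sum>m | b m \<noteq> 0. b m * lmon r m t)" using assms by (simp add: laurent_def)
  also have "\<dots> = (\<Sum>m\<in>S. b m * lmon r m t)"
    using assms by (intro sum.mono_neutral_left) auto
  finally show ?thesis .
qed

lemma laurentI:
  assumes "finite S" "S \<subseteq> expo r" "\<And>m. m \<notin> S \<Longrightarrow> b m = 0"
    "\<And>t. t \<in> torus r \<Longrightarrow> F t = (\<Sum>m\<in>S. b m * lmon r m t)"
  shows "laurent r F b"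
proof -
  have sub: "{m. b m \<noteq> 0} \<subseteq> S" using assms(3) by blast
  moreover have "(\<Sum>m\<in>S. b m * lmon r m t) = (\<Sum>m | b m \<noteq> 0. b m * lmon r m t)" for t
    using assms(1) sub by (intro sum.mono_neutral_right) auto
  ultimately show ?thesis using assms finite_subset[OF sub] unfolding laurent_def by auto
qed

lemma laurent_finite: "laurent r F b \<Longrightarrow> finite {m. b m \<noteq> 0}"
  and laurent_expo: "laurent r F b \<Longrightarrow> b m \<noteq> 0 \<Longrightarrow> m \<in> expo r"
  by (auto simp: laurent_def)

text \<open>The passage from an identity on the torus to an identity of weights or multiplicities is
  always made through this comparison.\<close>

lemma laurent_unique:
  assumes "laurent r F b" "laurent r G c" "\<And>t. t \<in> torus r \<Longrightarrow> F t = G t"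
  shows "b = c"
proof
  fix m
  let ?S = "{m. b m \<noteq> 0} \<union> {m. c m \<noteq> 0}"
  have S: "finite ?S" "?S \<subseteq> expo r" using assms(1,2) by (auto simp: laurent_def)
  have "(\<Sum>m\<in>?S. (b m - c m) * lmon r m t) = 0" if "t \<in> torus r" for t
    using laurentD[OF assms(1) S(1) _ that] laurentD[OF assms(2) S(1) _ that] assms(3)[OF that]
    by (auto simp: left_diff_distrib sum_subtractf)
  from lmon_independent[OF S this] have "m \<in> ?S \<Longrightarrow> b m - c m = 0" .
  thus "b m = c m" by (cases "m \<in> ?S") auto
qed

lemma laurent_cong: "laurent r F b \<Longrightarrow> (\<And>t. t \<in> torus r \<Longrightarrow> F t = G t) \<Longrightarrow> laurent r G b"
  by (simp add: laurent_def)

lemma laurent_add: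
  assumes "laurent r F b" "laurent r G c"
  shows "laurent r (\<lambda>t. F t + G t) (\<lambda>m. b m + c m)"
proof (rule laurentI)
  let ?S = "{m. b m \<noteq> 0} \<union> {m. c m \<noteq> 0}"
  show S: "finite ?S" "?S \<subseteq> expo r" using assms(1,2) by (auto simp: laurent_def)
  show "F t + G t = (\<Sum>m\<in>?S. (b m + c m) * lmon r m t)" if "t \<in> torus r" for t
    using laurentD[OF assms(1) S(1) _ that] laurentD[OF assms(2) S(1) _ that]
    by (auto simp: distrib_right sum.distrib)
qed auto

lemma laurent_zero: "laurent r (\<lambda>t. 0) (\<lambda>m. 0)"
  by (rule laurentI[of "{}"]) auto

lemma laurent_scale:
  assumes "laurent r F b"
  shows "laurent r (\<lambda>t. a * F t) (\<lambda>m. a * b m)"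
proof (rule laurentI)
  show "finite {m. b m \<noteq> 0}" "{m. b m \<noteq> 0} \<subseteq> expo r" using assms by (auto simp: laurent_def)
  show "a * F t = (\<Sum>m | b m \<noteq> 0. a * b m * lmon r m t)" if "t \<in> torus r" for t
    using assms that by (simp add: laurent_def sum_distrib_left mult.assoc)
qed auto

lemma laurent_sum:
  assumes "finite A" "\<And>x. x \<in> A \<Longrightarrow> laurent r (F x) (b x)"
  shows "laurent r (\<lambda>t. \<Sum>x\<in>A. F x t) (\<lambda>m. \<Sum>x\<in>A. b x m)"
  using assms
proof (induction A rule: finite_induct)
  case empty
  show ?case using laurent_zero by simp
next
  case (insert x A)
  have "laurent r (\<lambda>t. F x t + (\<Sum>x\<in>A. F x t)) (\<lambda>m. b x m + (\<Sum>x\<in>A. b x m))"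
    by (rule laurent_add) (use insert in simp_all)
  thus ?case using insert by simp
qed

lemma laurent_lmon: "k \<in> expo r \<Longrightarrow> laurent r (lmon r k) (\<lambda>m. if m = k then 1 else 0)"
  by (rule laurentI[of "{k}"]) auto

lemma laurent_lmon_mult:
  assumes "laurent r F b" "k \<in> expo r"
  shows "laurent r (\<lambda>t. lmon r k t * F t) (\<lambda>m. b (\<lambda>i. m i - k i))"
proof (rule laurentI)
  let ?f = "\<lambda>m i. m i + k i"
  let ?S = "?f ` {m. b m \<noteq> 0}"
  show "finite ?S" "?S \<subseteq> expo r" using assms by (auto simp: laurent_def intro: expo_add)
  show "b (\<lambda>i. m i - k i) = 0" if "m \<notin> ?S" for m
  proof (rule ccontr)
    assume "b (\<lambda>i. m i - k i) \<noteq> 0"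
    hence "?f (\<lambda>i. m i - k i) \<in> ?S" by (intro imageI) simp
    thus False using that by simp
  qed
  have inj: "inj_on ?f A" for A by (rule inj_onI) (auto simp: fun_eq_iff)
  show "lmon r k t * F t = (\<Sum>m\<in>?S. b (\<lambda>i. m i - k i) * lmon r m t)" if t: "t \<in> torus r" for t
  proof -
    have "lmon r k t * F t = (\<Sum>m | b m \<noteq> 0. lmon r k t * (b m * lmon r m t))"
      using assms(1) t by (simp add: laurent_def sum_distrib_left)
    also have "\<dots> = (\<Sum>m | b m \<noteq> 0. b m * lmon r (?f m) t)"
      by (rule sum.cong) (simp_all add: lmon_add[OF t])
    also have "\<dots> = (\<Sum>m\<in>?S. b (\<lambda>i. m i - k i) * lmon r m t)"
      by (subst sum.reindex[OF inj]) simp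
    finally show ?thesis .
  qed
qed

lemma laurent_mult:
  assumes "laurent r F b" "laurent r G c"
  shows "laurent r (\<lambda>t. F t * G t) (\<lambda>m. \<Sum>k | b k \<noteq> 0. b k * c (\<lambda>i. m i - k i))"
proof (rule laurent_cong)
  show "laurent r (\<lambda>t. \<Sum>k | b k \<noteq> 0. b k * (lmon r k t * G t)) (\<lambda>m. \<Sum>k | b k \<noteq> 0. b k * c (\<lambda>i. m i - k i))"
    by (rule laurent_sum, rule laurent_finite[OF assms(1)], rule laurent_scale, rule laurent_lmon_mult[OF assms(2)])
       (use laurent_expo[OF assms(1)] in auto)
  show "(\<Sum>k | b k \<noteq> 0. b k * (lmon r k t * G t)) = F t * G t" if "t \<in> torus r" for t
    using assms(1) that by (simp add: laurent_def sum_distrib_right mult.assoc)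
qed

section \<open>Alternants\<close>

definition altern :: "nat \<Rightarrow> (nat \<Rightarrow> int) \<Rightarrow> (nat \<Rightarrow> complex) \<Rightarrow> complex" where
  "altern r k t = (\<Sum>p | p permutes {..<r}. of_int (sign p) * lmon r (k \<circ> p) t)"

text \<open>A full signed sum, since k may have repeated entries; several permutations then give the
  same exponent and their signs cancel.\<close>

definition altern_coeff :: "nat \<Rightarrow> (nat \<Rightarrow> int) \<Rightarrow> (nat \<Rightarrow> int) \<Rightarrow> complex" where
  "altern_coeff r k m = (\<Sum>p | p permutes {..<r}. of_int (sign p) * (if m = k \<circ> p then 1 else 0))"

lemma laurent_altern: "k \<in> expo r \<Longrightarrow> laurent r (altern r k) (altern_coeff r k)"
  unfolding altern_def[abs_def] altern_coeff_def[abs_def]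
  by (rule laurent_sum, simp add: finite_permutations, rule laurent_scale, rule laurent_lmon, rule expo_permute) simp_all

text \<open>Leibniz permutes the variables; substituting inverse permutations and reindexing each
  product moves the permutation to the exponents.\<close>

lemma det_eq_altern: "det (mat r r (\<lambda>(i, j). t j powi k i)) = altern r k t"
proof -
  have "det (mat r r (\<lambda>(i, j). t j powi k i)) =
        (\<Sum>p | p permutes {..<r}. of_int (sign p) * (\<Prod>i<r. t (p i) powi k i))"
    unfolding Determinant.det_def by (auto simp: lessThan_atLeast0 permutes_in_image intro!: sum.cong prod.cong)
  also have "\<dots> = (\<Sum>p | p permutes {..<r}. of_int (sign (Hilbert_Choice.inv p)) * (\<Prod>i<r. t (Hilbert_Choice.inv p i) powi k i))"
    by (rule sum_permutations_inverse)
  also have "\<dots> = (\<Sum>p | p permutes {..<r}. of_int (sign p) * lmon r (k \<circ> p) t)"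
  proof (rule sum.cong[OF refl], goal_cases)
    case (1 p)
    hence p: "p permutes {..<r}" by simp
    have "(\<Prod>i<r. t (Hilbert_Choice.inv p i) powi k i) = (\<Prod>i<r. t (Hilbert_Choice.inv p (p i)) powi k (p i))"
      using prod.permute[OF p, of "\<lambda>i. t (Hilbert_Choice.inv p i) powi k i"] by (simp add: o_def)
    also have "\<dots> = lmon r (k \<circ> p) t" by (simp add: lmon_def permutes_inverses(2)[OF p])
    finally show ?case using p by (simp add: sign_inverse permutation_permutes exI[of _ "{..<r}"])
  qed
  finally show ?thesis by (simp add: altern_def)
qed

lemma altern_permute:
  assumes q: "q permutes {..<r}"
  shows "altern r k (t \<circ> q) = of_int (sign q) * altern r k t"
proof -
  have "altern r k (t \<circ> q) = (\<Sum>p | p permutes {..<r}. of_int (sign (p \<circ> q)) * lmon r (k \<circ> (p \<circ> q)) (t \<circ> q))"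
    unfolding altern_def by (rule sum_permutations_compose_right[OF q])
  also have "\<dots> = (\<Sum>p | p permutes {..<r}. of_int (sign q) * (of_int (sign p) * lmon r (k \<circ> p) t))"
  proof (rule sum.cong[OF refl], goal_cases)
    case (1 p)
    hence p: "p permutes {..<r}" by simp
    have "permutation p" "permutation q" using p q by (auto simp: permutation_permutes)
    thus ?case using lmon_permute[OF q, of "k \<circ> p" t] by (simp add: sign_compose o_assoc)
  qed
  finally show ?thesis by (simp add: altern_def sum_distrib_left)
qed

lemma altern_coincide:
  assumes "i < r" "j < r" "i \<noteq> j" "t i = t j"
  shows "altern r k t = 0"
proof -
  let ?q = "Transposition.transpose i j"
  have q: "?q permutes {..<r}" using assms by (simp add: permutes_swap_id)
  have "t \<circ> ?q = t" using assms by (auto simp: fun_eq_iff Transposition.transpose_def)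
  thus ?thesis using altern_permute[OF q, of k t] assms by (simp add: sign_swap_id)
qed

text \<open>Two sorted arrangements of one multiset agree entrywise. With ties in k, p itself may
  move positions.\<close>

lemma permute_antitone_eq:
  fixes k :: "nat \<Rightarrow> int"
  assumes p: "p permutes {..<r}"
    and k: "\<And>i j. i \<le> j \<Longrightarrow> j < r \<Longrightarrow> k j \<le> k i"
    and kp: "\<And>i j. i \<le> j \<Longrightarrow> j < r \<Longrightarrow> k (p j) \<le> k (p i)"
    and i: "i < r"
  shows "k (p i) = k i"
proof -
  \<comment> \<open>Negated entries, because \<open>sorted\<close> is ascending.\<close>
  let ?xs = "map (\<lambda>i. - k i) [0..<r]" and ?ys = "map (\<lambda>i. - k (p i)) [0..<r]"
  have "mset ?ys = image_mset (\<lambda>i. - k i) (image_mset p (mset_set {..<r}))"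
    by (simp add: mset_set_upto_eq_mset_upto lessThan_atLeast0 multiset.map_comp o_def)
  also have "image_mset p (mset_set {..<r}) = mset_set {..<r}"
    using permutes_inj_on[OF p] permutes_image[OF p] by (simp add: image_mset_mset_set)
  also have "image_mset (\<lambda>i. - k i) (mset_set {..<r}) = mset ?xs"
    by (simp add: mset_set_upto_eq_mset_upto lessThan_atLeast0)
  finally have "mset ?ys = mset ?xs" .
  moreover have "sorted ?xs" "sorted ?ys" using k kp by (auto simp: sorted_iff_nth_mono)
  ultimately have "?ys = ?xs" by (metis properties_for_sort)
  hence "?ys ! i = ?xs ! i" by (rule arg_cong)
  thus ?thesis using i by simp
qed

lemma permute_antitone_exists:
  fixes k :: "nat \<Rightarrow> int"
  obtains p where "p permutes {..<r}" "\<And>i j. i \<le> j \<Longrightarrow> j < r \<Longrightarrow> k (p j) \<le> k (p i)"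
proof -
  let ?xs = "map k [0..<r]"
  obtain p where p: "p permutes {..<length ?xs}" "permute_list p ?xs = rev (sort ?xs)"
    by (rule mset_eq_permutation[of "rev (sort ?xs)" ?xs]) auto
  have "k (p j) \<le> k (p i)" if "i \<le> j" "j < r" for i j
  proof -
    have pr: "p x < r" if "x < r" for x using permutes_in_image[OF p(1)] that by auto
    have nth: "rev (sort ?xs) ! x = k (p x)" if "x < r" for x
      using that pr[OF that] p by (simp flip: p(2) add: permute_list_nth)
    have "rev (sort ?xs) ! j \<le> rev (sort ?xs) ! i"
      by (rule sorted_rev_nth_mono) (use that in auto)
    thus ?thesis using nth that by simp
  qed
  thus ?thesis using p(1) that by simp
qed

lemma altern_coeff_dominant:
  assumes k: "k \<in> expo r" "\<And>i j. i \<le> j \<Longrightarrow> j < r \<Longrightarrow> k j \<le> k i"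
    and m: "m \<in> expo r" "\<And>i j. i < j \<Longrightarrow> j < r \<Longrightarrow> m j < m i"
  shows "altern_coeff r k m = (if m = k then 1 else 0)"
proof -
  have mono: "m j \<le> m i" if "i \<le> j" "j < r" for i j using m(2)[of i j] that by (cases "i = j") auto
  have "(if m = k \<circ> p then 1 else 0 :: complex) = (if m = k \<and> p = id then 1 else 0)"
    if p: "p permutes {..<r}" for p
  proof (cases "m = k \<circ> p")
    case True
    have "k (p i) = k i" if "i < r" for i
      by (rule permute_antitone_eq[OF p k(2) _ that]) (use mono in \<open>simp_all add: True\<close>)
    hence mk: "m = k" by (intro expo_eqI[OF m(1) k(1)]) (simp add: True)
    have "p i = i" for i
    proof (cases "i < r")
      case i: True
      hence "p i < r" using permutes_in_image[OF p] by auto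
      have "m (p i) = m i" using mk True by (metis comp_apply)
      thus ?thesis using m(2)[of "p i" i] m(2)[of i "p i"] i \<open>p i < r\<close>
        by (metis less_irrefl nat_neq_iff)
    next
      case False thus ?thesis using p by (simp add: permutes_def)
    qed
    thus ?thesis using mk True by (auto simp: fun_eq_iff)
  qed auto
  hence "altern_coeff r k m = (\<Sum>p | p permutes {..<r}. if p = id then (if m = k then 1 else 0) else 0)"
    unfolding altern_coeff_def by (intro sum.cong) auto
  also have "\<dots> = (if m = k then 1 else 0)"
    by (subst sum.delta) (auto simp: finite_permutations permutes_id)
  finally show ?thesis .
qed

text \<open>(r - 1, ..., 1, 0): the half sum of the positive roots, up to a constant shift that
  makes it integral and nonnegative.\<close>

definition rho :: "nat \<Rightarrow> nat \<Rightarrow> int" where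
  "rho r = (\<lambda>i. if i < r then int (r - 1 - i) else 0)"

lemma rho_expo: "rho r \<in> expo r"
  by (simp add: rho_def expo_def)

text \<open>Induction on the number of variables: row operations with the last variable x leave a
  single 1 in the last column and a factor t_j - x in every other column.\<close>

lemma altern_rho:
  "altern r (rho r) t = (\<Prod>(i, j)\<in>{(i, j). i < j \<and> j < r}. t i - t j)"
proof -
  define V where "V r = mat r r (\<lambda>(i, j). t j ^ (r - 1 - i))" for r
  have V: "altern r (rho r) t = det (V r)" for r
    unfolding det_eq_altern[symmetric] V_def
    by (rule arg_cong[of _ _ det], rule eq_matI) (simp_all add: rho_def power_int_of_nat del: of_nat_diff)
  have "det (V r) = (\<Prod>(i, j)\<in>{(i, j). i < j \<and> j < r}. t i - t j)"
  proof (induction r)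
    case 0
    have "{(i, j). i < j \<and> j < (0::nat)} = {}" by auto
    thus ?case by (simp add: V_def)
  next
    case (Suc r)
    define x where "x = t r"
    \<comment> \<open>Unipotent row operation: from each row, x times the next row is subtracted,
      which clears the last column above its bottom entry.\<close>
    define E where "E = mat (Suc r) (Suc r) (\<lambda>(i, j). if j = i then 1 else if j = Suc i then - x else 0)"
    define A where "A = mat r r (\<lambda>(i, j). t j ^ (r - 1 - i) * (t j - x))"
    define B where "B = four_block_mat A (0\<^sub>m r 1) (mat 1 r (\<lambda>_. 1)) (1\<^sub>m 1 :: complex mat)"
    have "det E = prod_list (diag_mat E)"
      by (rule det_upper_triangular) (auto simp: E_def)
    also have "diag_mat E = replicate (Suc r) 1"
      unfolding diag_mat_def by (rule nth_equalityI) (auto simp: E_def simp del: upt_Suc replicate_Suc)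
    finally have detE: "det E = 1" by simp
    have "E * V (Suc r) = B"
    proof (rule eq_matI)
      fix i j assume "i < dim_row B" "j < dim_col B"
      hence ij: "i < Suc r" "j < Suc r" by (auto simp: B_def A_def)
      have "(E * V (Suc r)) $$ (i, j) =
        (\<Sum>k<Suc r. (if k = i then 1 else if k = Suc i then - x else 0) * t j ^ (r - k))"
        using ij by (simp add: E_def V_def scalar_prod_def lessThan_atLeast0)
      also have "\<dots> = (\<Sum>k<Suc r. (if k = i then t j ^ (r - i) else 0) +
            (if k = Suc i then - x * t j ^ (r - Suc i) else 0))"
        by (rule sum.cong) auto
      also have "\<dots> = t j ^ (r - i) + (if Suc i < Suc r then - x * t j ^ (r - Suc i) else 0)"
        using ij by (subst sum.distrib, subst (1 2) sum.delta) auto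
      also have "\<dots> = B $$ (i, j)"
      proof (cases "i < r")
        case True
        hence "r - i = Suc (r - Suc i)" by simp
        thus ?thesis using ij True by (auto simp: B_def A_def x_def algebra_simps less_Suc_eq)
      next
        case False thus ?thesis using ij by (auto simp: B_def A_def less_Suc_eq)
      qed
      finally show "(E * V (Suc r)) $$ (i, j) = B $$ (i, j)" .
    qed (auto simp: E_def V_def B_def A_def)
    moreover have "det (E * V (Suc r)) = det E * det (V (Suc r))"
      by (rule det_mult[of _ "Suc r"]) (auto simp: E_def V_def)
    ultimately have "det (V (Suc r)) = det B" using detE by simp
    also have "\<dots> = det A"
      unfolding B_def by (subst det_four_block_mat_upper_right_zero[of _ r _ 1]) (auto simp: A_def)
    also have "\<dots> = det (V r) * (\<Prod>j<r. t j - x)"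
    proof -
      have "(\<Prod>i = 0..<r. t (p i) - x) = (\<Prod>j<r. t j - x)" if "p permutes {0..<r}" for p
        using prod.permute[OF that, of "\<lambda>j. t j - x"] by (simp add: o_def lessThan_atLeast0)
      thus ?thesis
        by (auto simp: Determinant.det_def A_def V_def sum_distrib_right prod.distrib permutes_in_image intro!: sum.cong)
    qed
    also have "\<dots> = (\<Prod>(i, j)\<in>{(i, j). i < j \<and> j < r}. t i - t j) * (\<Prod>(i, j)\<in>(\<lambda>i. (i, r)) ` {..<r}. t i - t j)"
      by (subst prod.reindex) (auto simp: Suc.IH x_def inj_on_def)
    also have "\<dots> = (\<Prod>(i, j)\<in>{(i, j). i < j \<and> j < Suc r}. t i - t j)"
    proof -
      have fin: "finite {(i, j). i < j \<and> j < (r::nat)}"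
        by (rule finite_subset[of _ "{..<r} \<times> {..<r}"]) auto
      have "{(i, j). i < j \<and> j < Suc r} = {(i, j). i < j \<and> j < r} \<union> (\<lambda>i. (i, r)) ` {..<r}"
        by (auto simp: less_Suc_eq)
      thus ?thesis using fin by (subst prod.union_disjoint[symmetric]) auto
    qed
    finally show ?case .
  qed
  thus ?thesis by (simp add: V)
qed

lemma altern_rho_nonzero:
  assumes "\<And>i j. i < j \<Longrightarrow> j < r \<Longrightarrow> t i \<noteq> t j"
  shows "altern r (rho r) t \<noteq> 0"
proof -
  have fin: "finite {(i, j). i < j \<and> j < (r::nat)}"
    by (rule finite_subset[of _ "{..<r} \<times> {..<r}"]) auto
  thus ?thesis unfolding altern_rho using assms by auto
qed

text \<open>The operator t_a d/dt_a is applied to the Vandermonde determinant, once to the sum of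
  monomials and once, logarithmically, to the product. This supplies the cross terms of the
  Laplacian in the character formula.\<close>

lemma altern_rho_euler:
  assumes t: "t \<in> torus r" and dist: "\<And>i j. i < r \<Longrightarrow> j < r \<Longrightarrow> i \<noteq> j \<Longrightarrow> t i \<noteq> t j" and a: "a < r"
  shows "(\<Sum>p | p permutes {..<r}. of_int (sign p) * of_int (rho r (p a)) * lmon r (rho r \<circ> p) t) =
         altern r (rho r) t * (\<Sum>b\<in>{..<r} - {a}. t a / (t a - t b))"
proof -
  let ?T = "\<lambda>s. t(a := s)"
  let ?P = "{(i, j). i < j \<and> j < r}"
  have fin: "finite ?P" by (rule finite_subset[of _ "{..<r} \<times> {..<r}"]) auto
  have ta: "t a \<noteq> 0" using t a by (simp add: torus_def)
  have lm: "((\<lambda>s. lmon r m (?T s)) has_field_derivative of_int (m a) * lmon r m t / t a) (at (t a))" for m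
  proof -
    define c where "c = (\<Prod>i\<in>{..<r} - {a}. t i powi m i)"
    have "lmon r m (?T s) = s powi m a * c" for s
      unfolding lmon_def c_def using a by (subst prod.remove[of _ a]) (auto intro!: prod.cong)
    moreover from this[of "t a"] have "lmon r m t = t a powi m a * c" by simp
    moreover have "((\<lambda>s. s powi m a * c) has_field_derivative of_int (m a) * (t a powi m a * c) / t a) (at (t a))"
      using ta by (auto intro!: derivative_eq_intros simp: power_int_diff)
    ultimately show ?thesis by simp
  qed
  \<comment> \<open>Termwise derivative of the alternating sum; \<open>D2\<close> differentiates the
    product form of the same function.\<close>
  have D1: "((\<lambda>s. altern r (rho r) (?T s)) has_field_derivative
      (\<Sum>p | p permutes {..<r}. of_int (sign p) * (of_int ((rho r \<circ> p) a) * lmon r (rho r \<circ> p) t / t a))) (at (t a))"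
    unfolding altern_def by (intro DERIV_sum DERIV_cmult lm)
  let ?d = "\<lambda>(i, j). (if i = a then 1 else 0) - (if j = a then 1 else 0) :: complex"
  have D2: "((\<lambda>s. altern r (rho r) (?T s)) has_field_derivative
      (\<Prod>(i, j)\<in>?P. t i - t j) * (\<Sum>ij\<in>?P. ?d ij / (case ij of (i, j) \<Rightarrow> t i - t j))) (at (t a))"
  proof -
    have "((\<lambda>s. \<Prod>ij\<in>?P. case ij of (i, j) \<Rightarrow> ?T s i - ?T s j) has_field_derivative
      (\<Prod>ij\<in>?P. case ij of (i, j) \<Rightarrow> ?T (t a) i - ?T (t a) j) *
      (\<Sum>ij\<in>?P. ?d ij / (case ij of (i, j) \<Rightarrow> ?T (t a) i - ?T (t a) j))) (at (t a))"
    proof (rule has_field_derivative_prod')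
      fix ij assume ij: "ij \<in> ?P"
      obtain i j where [simp]: "ij = (i, j)" by force
      show "(case ij of (i, j) \<Rightarrow> ?T (t a) i - ?T (t a) j) \<noteq> 0" using ij dist by auto
      show "((\<lambda>s. case ij of (i, j) \<Rightarrow> ?T s i - ?T s j) has_field_derivative ?d ij) (at (t a))"
        by (auto intro!: derivative_eq_intros)
    qed
    thus ?thesis unfolding altern_rho by simp
  qed
  \<comment> \<open>A pair contributes only if it contains a, and both orientations give 1 / (t_a -
    t_b).\<close>
  have "(\<Sum>ij\<in>?P. ?d ij / (case ij of (i, j) \<Rightarrow> t i - t j)) =
        (\<Sum>ij\<in>?P. (if fst ij = a then 1 / (t a - t (snd ij)) else 0) + (if snd ij = a then 1 / (t a - t (fst ij)) else 0))"
  proof (rule sum.cong[OF refl])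
    fix ij assume ij: "ij \<in> ?P"
    obtain i j where [simp]: "ij = (i, j)" by force
    have "i < j" using ij by auto
    moreover have "- 1 / (t i - t a) = 1 / (t a - t i)"
      by (metis minus_diff_eq minus_divide_divide minus_minus)
    ultimately show "?d ij / (case ij of (i, j) \<Rightarrow> t i - t j) =
      (if fst ij = a then 1 / (t a - t (snd ij)) else 0) + (if snd ij = a then 1 / (t a - t (fst ij)) else 0)"
      by auto
  qed
  also have "\<dots> = (\<Sum>ij\<in>?P \<inter> {ij. fst ij = a}. 1 / (t a - t (snd ij))) + (\<Sum>ij\<in>?P \<inter> {ij. snd ij = a}. 1 / (t a - t (fst ij)))"
    by (subst (1 2) sum.inter_restrict[OF fin]) (simp add: sum.distrib)
  also have "?P \<inter> {ij. fst ij = a} = (\<lambda>b. (a, b)) ` {b. a < b \<and> b < r}" by auto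
  also have "(\<Sum>ij\<in>\<dots>. 1 / (t a - t (snd ij))) = (\<Sum>b | a < b \<and> b < r. 1 / (t a - t b))"
    by (subst sum.reindex) (auto simp: inj_on_def)
  also have "?P \<inter> {ij. snd ij = a} = (\<lambda>b. (b, a)) ` {b. b < a}" using a by auto
  also have "(\<Sum>ij\<in>\<dots>. 1 / (t a - t (fst ij))) = (\<Sum>b | b < a. 1 / (t a - t b))"
    by (subst sum.reindex) (auto simp: inj_on_def)
  also have "(\<Sum>b | a < b \<and> b < r. 1 / (t a - t b)) + (\<Sum>b | b < a. 1 / (t a - t b)) = (\<Sum>b\<in>{..<r} - {a}. 1 / (t a - t b))"
    using a by (subst sum.union_disjoint[symmetric]) (auto intro!: sum.cong)
  finally have S: "(\<Sum>ij\<in>?P. ?d ij / (case ij of (i, j) \<Rightarrow> t i - t j)) = (\<Sum>b\<in>{..<r} - {a}. 1 / (t a - t b))" .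
  have "(\<Sum>p | p permutes {..<r}. of_int (sign p) * (of_int ((rho r \<circ> p) a) * lmon r (rho r \<circ> p) t / t a)) =
        altern r (rho r) t * (\<Sum>b\<in>{..<r} - {a}. 1 / (t a - t b))"
    using DERIV_unique[OF D1 D2] unfolding S altern_rho .
  hence "(\<Sum>p | p permutes {..<r}. of_int (sign p) * (of_int ((rho r \<circ> p) a) * lmon r (rho r \<circ> p) t / t a)) * t a =
        altern r (rho r) t * (\<Sum>b\<in>{..<r} - {a}. 1 / (t a - t b)) * t a" by simp
  thus ?thesis using ta by (simp add: sum_distrib_right sum_distrib_left mult.assoc)
qed

section \<open>Matrices and regular functions\<close>

lemma mult_entry:
  "A \<in> carrier_mat n m \<Longrightarrow> B \<in> carrier_mat m k \<Longrightarrow> i < n \<Longrightarrow> j < k \<Longrightarrow>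
   (A * B) $$ (i, j) = (\<Sum>l<m. A $$ (i, l) * B $$ (l, j))"
  by (auto simp: scalar_prod_def lessThan_atLeast0 intro!: sum.cong)

lemma mult_vec_entry:
  "A \<in> carrier_mat n m \<Longrightarrow> v \<in> carrier_vec m \<Longrightarrow> i < n \<Longrightarrow>
   (A *\<^sub>v v) $ i = (\<Sum>l<m. A $$ (i, l) * v $ l)"
  by (auto simp: scalar_prod_def lessThan_atLeast0 intro!: sum.cong)

lemma mult3_entry:
  assumes "A \<in> carrier_mat n m" "B \<in> carrier_mat m k" "C \<in> carrier_mat k l" "i < n" "j < l"
  shows "(A * B * C) $$ (i, j) = (\<Sum>b<k. \<Sum>a<m. A $$ (i, a) * B $$ (a, b) * C $$ (b, j))"
proof -
  have "(A * B * C) $$ (i, j) = (\<Sum>b<k. (A * B) $$ (i, b) * C $$ (b, j))"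
    using assms by (intro mult_entry[of _ n]) auto
  also have "\<dots> = (\<Sum>b<k. (\<Sum>a<m. A $$ (i, a) * B $$ (a, b)) * C $$ (b, j))"
    by (rule sum.cong[OF refl], subst mult_entry[OF assms(1,2)]) (use assms in auto)
  finally show ?thesis by (simp add: sum_distrib_right)
qed

lemma GL_iff: "A \<in> carrier (GL r) \<longleftrightarrow> A \<in> carrier_mat r r \<and> det A \<noteq> 0"
proof -
  have "carrier (GL r) = Units (ring_mat TYPE(complex) r ())"
    by (simp add: GL_def units_of_def)
  moreover have "A \<in> carrier_mat r r" if "A \<in> Units (ring_mat TYPE(complex) r ())"
    using that by (auto simp: Units_def ring_mat_simps)
  ultimately show ?thesis
    using det_non_zero_imp_unit[of A r "()"] unit_imp_det_non_zero[of A r "()"] by blast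
qed

lemma GL_mat: "A \<in> carrier (GL r) \<Longrightarrow> A \<in> carrier_mat r r"
  by (simp add: GL_iff)

lemma GL_mult_eq [simp]: "A \<otimes>\<^bsub>GL r\<^esub> B = A * B"
  by (simp add: GL_def units_of_def ring_mat_simps)

lemma GL_mult: "A \<in> carrier (GL r) \<Longrightarrow> B \<in> carrier (GL r) \<Longrightarrow> A * B \<in> carrier (GL r)"
  using det_mult[of A r B] by (auto simp: GL_iff)

lemma GL_one: "1\<^sub>m r \<in> carrier (GL r)"
  by (simp add: GL_iff)

lemma GL_inverse:
  assumes "A \<in> carrier (GL r)"
  obtains B where "B \<in> carrier (GL r)" "A * B = 1\<^sub>m r" "B * A = 1\<^sub>m r"
proof -
  have A: "A \<in> carrier_mat r r" using assms GL_iff by blast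
  have "A \<in> Units (ring_mat TYPE(complex) r ())" using assms by (simp add: GL_def units_of_def)
  then obtain B where B: "B \<in> carrier_mat r r" "A * B = 1\<^sub>m r" "B * A = 1\<^sub>m r"
    by (auto simp: Units_def ring_mat_simps)
  have "det A * det B = 1" using det_mult[OF A B(1)] B(2) by simp
  hence "det B \<noteq> 0" by auto
  thus ?thesis using that B by (simp add: GL_iff)
qed

lemma GL_I_right_inverse:
  assumes "A \<in> carrier_mat r r" "B \<in> carrier_mat r r" "A * B = 1\<^sub>m r"
  shows "A \<in> carrier (GL r)"
proof -
  have "det A * det B = 1" using det_mult[OF assms(1,2)] assms(3) by simp
  hence "det A \<noteq> 0" by auto
  thus ?thesis using assms by (simp add: GL_iff)
qed

lemma permutes_less: "p permutes {..<r} \<Longrightarrow> i < r \<Longrightarrow> p i < (r::nat)"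
  using permutes_in_image[of p "{..<r}" i] by simp

lemma smult_mat_mult_vec:
  "A \<in> carrier_mat n m \<Longrightarrow> v \<in> carrier_vec m \<Longrightarrow> (k \<cdot>\<^sub>m A) *\<^sub>v v = k \<cdot>\<^sub>v (A *\<^sub>v (v :: complex vec))"
  by (rule eq_vecI) auto

lemma mult_square_carrier:
  "A \<in> carrier_mat n n \<Longrightarrow> B \<in> carrier_mat n n \<Longrightarrow> A * B \<in> carrier_mat n n"
  by simp

lemma det_leibniz:
  "A \<in> carrier_mat r r \<Longrightarrow> det A = (\<Sum>p | p permutes {..<r}. of_int (sign p) * (\<Prod>i<r. A $$ (i, p i)))"
  by (simp add: Determinant.det_def lessThan_atLeast0)

text \<open>Convergence is entrywise along an arbitrary filter, so no topology on matrices is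
  involved.\<close>

lemma det_tendsto:
  fixes X :: "'a \<Rightarrow> complex mat"
  assumes X: "\<And>s. X s \<in> carrier_mat r r" and L: "L \<in> carrier_mat r r"
    and lim: "\<And>i j. i < r \<Longrightarrow> j < r \<Longrightarrow> ((\<lambda>s. X s $$ (i, j)) \<longlongrightarrow> L $$ (i, j)) F"
  shows "((\<lambda>s. det (X s)) \<longlongrightarrow> det L) F"
  unfolding det_leibniz[OF X] det_leibniz[OF L]
  by (intro tendsto_sum tendsto_mult tendsto_const tendsto_prod lim) (auto simp: permutes_less)

text \<open>Invertibility is asked of the limit: there the inverse of the determinant is continuous,
  and the values of a regular function off the group are harmless.\<close>

lemma regular_tendsto:
  fixes X :: "'a \<Rightarrow> complex mat"
  assumes f: "f \<in> regular_functions r"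
    and X: "\<And>s. X s \<in> carrier_mat r r" and L: "L \<in> carrier (GL r)"
    and lim: "\<And>i j. i < r \<Longrightarrow> j < r \<Longrightarrow> ((\<lambda>s. X s $$ (i, j)) \<longlongrightarrow> L $$ (i, j)) F"
  shows "((\<lambda>s. f (X s)) \<longlongrightarrow> f L) F"
  using f
proof induction
  case inverse_det
  show ?case using L
    by (intro tendsto_inverse det_tendsto[OF X] lim) (auto simp: GL_iff)
qed (auto intro: tendsto_intros lim)

section \<open>Diagonal matrices and the restriction of regular functions to the torus\<close>

definition dg :: "nat \<Rightarrow> (nat \<Rightarrow> complex) \<Rightarrow> complex mat" where
  "dg r t = mat r r (\<lambda>(i, j). if i = j then t i else 0)"

lemma dg_carrier [simp]: "dg r t \<in> carrier_mat r r"
  by (simp add: dg_def)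

lemma dg_entry: "i < r \<Longrightarrow> j < r \<Longrightarrow> dg r t $$ (i, j) = (if i = j then t i else 0)"
  by (simp add: dg_def)

lemma dg_upper: "upper_triangular (dg r t)"
  by (auto simp: dg_def)

lemma dg_mult_left:
  assumes "A \<in> carrier_mat r n" "i < r" "j < n"
  shows "(dg r t * A) $$ (i, j) = t i * A $$ (i, j)"
proof -
  have "(dg r t * A) $$ (i, j) = (\<Sum>l<r. dg r t $$ (i, l) * A $$ (l, j))"
    by (rule mult_entry[OF dg_carrier assms])
  also have "\<dots> = (\<Sum>l<r. if l = i then t i * A $$ (i, j) else 0)"
    by (rule sum.cong[OF refl]) (use assms in \<open>auto simp: dg_entry\<close>)
  finally have "(dg r t * A) $$ (i, j) = (\<Sum>l<r. if l = i then t i * A $$ (i, j) else 0)" .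
  thus ?thesis using assms by simp
qed

lemma dg_mult_right:
  assumes "A \<in> carrier_mat n r" "i < n" "j < r"
  shows "(A * dg r t) $$ (i, j) = A $$ (i, j) * t j"
proof -
  have "(A * dg r t) $$ (i, j) = (\<Sum>l<r. A $$ (i, l) * dg r t $$ (l, j))"
    by (rule mult_entry[OF assms(1) dg_carrier assms(2,3)])
  also have "\<dots> = (\<Sum>l<r. if l = j then A $$ (i, j) * t j else 0)"
    by (rule sum.cong[OF refl]) (use assms in \<open>auto simp: dg_entry\<close>)
  finally have "(A * dg r t) $$ (i, j) = (\<Sum>l<r. if l = j then A $$ (i, j) * t j else 0)" .
  thus ?thesis using assms by simp
qed

lemma dg_mult: "dg r t * dg r s = dg r (\<lambda>i. t i * s i)"
proof (rule eq_matI)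
  fix i j assume "i < dim_row (dg r (\<lambda>i. t i * s i))" "j < dim_col (dg r (\<lambda>i. t i * s i))"
  hence ij: "i < r" "j < r" by (auto simp: dg_def)
  show "(dg r t * dg r s) $$ (i, j) = dg r (\<lambda>i. t i * s i) $$ (i, j)"
    by (subst dg_mult_left[OF dg_carrier ij]) (use ij in \<open>auto simp: dg_entry\<close>)
qed (auto simp: dg_def)

lemma dg_one [simp]: "dg r (\<lambda>i. 1) = 1\<^sub>m r"
  by (rule eq_matI) (auto simp: dg_def)

lemma det_dg: "det (dg r t) = (\<Prod>i<r. t i)"
proof -
  have "det (dg r t) = prod_list (diag_mat (dg r t))"
    by (rule det_upper_triangular[OF dg_upper dg_carrier])
  also have "diag_mat (dg r t) = map t [0..<r]"
    unfolding diag_mat_def by (rule nth_equalityI) (auto simp: dg_def)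
  also have "prod_list (map t [0..<r]) = (\<Prod>i<r. t i)"
    by (simp add: prod.distinct_set_conv_list[symmetric] lessThan_atLeast0)
  finally show ?thesis .
qed

lemma dg_GL: "t \<in> torus r \<Longrightarrow> dg r t \<in> carrier (GL r)"
  by (simp add: GL_iff det_dg torus_def)

text \<open>The generators restrict to constants, coordinates, zero, or the monomial with all
  exponents -1, and Laurent polynomials are closed under sums and products.\<close>

lemma regular_laurent:
  assumes "f \<in> regular_functions r"
  shows "\<exists>b. laurent r (\<lambda>t. f (dg r t)) b"
  using assms
proof induction
  case (const c)
  have "laurent r (\<lambda>t. c * lmon r (\<lambda>i. 0) t) (\<lambda>m. c * (if m = (\<lambda>i. 0) then 1 else 0))"
    by (rule laurent_scale, rule laurent_lmon) (simp add: expo_def)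
  thus ?case by auto
next
  case (entry i j)
  show ?case
  proof (cases "i = j")
    case True
    have "laurent r (lmon r (\<lambda>x. if x = i then 1 else 0)) (\<lambda>m. if m = (\<lambda>x. if x = i then 1 else 0) then 1 else 0)"
      by (rule laurent_lmon) (use entry in \<open>auto simp: expo_def\<close>)
    hence "laurent r (\<lambda>t. dg r t $$ (i, j)) (\<lambda>m. if m = (\<lambda>x. if x = i then 1 else 0) then 1 else 0)"
      by (rule laurent_cong) (use entry True in \<open>simp add: dg_entry lmon_unit\<close>)
    thus ?thesis by blast
  next
    case False
    have "laurent r (\<lambda>t. dg r t $$ (i, j)) (\<lambda>m. 0)"
      by (rule laurent_cong[OF laurent_zero]) (use entry False in \<open>simp add: dg_entry\<close>)
    thus ?thesis by blast
  qed
next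
  case inverse_det
  let ?k = "\<lambda>i. if i < r then - 1 else 0 :: int"
  have L: "laurent r (lmon r ?k) (\<lambda>m. if m = ?k then 1 else 0)"
    by (rule laurent_lmon) (simp add: expo_def)
  have "lmon r ?k t = inverse (det (dg r t))" for t
  proof -
    have "lmon r ?k t = (\<Prod>i<r. inverse (t i))"
      unfolding lmon_def by (rule prod.cong) (auto simp: power_int_minus)
    thus ?thesis by (simp add: det_dg prod_inversef[unfolded o_def])
  qed
  hence "laurent r (\<lambda>t. inverse (det (dg r t))) (\<lambda>m. if m = ?k then 1 else 0)"
    by (rule laurent_cong[OF L])
  thus ?case by blast
next
  case (add f g)
  then obtain b c where "laurent r (\<lambda>t. f (dg r t)) b" "laurent r (\<lambda>t. g (dg r t)) c" by blast
  from laurent_add[OF this] show ?case by blast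
next
  case (mult f g)
  then obtain b c where "laurent r (\<lambda>t. f (dg r t)) b" "laurent r (\<lambda>t. g (dg r t)) c" by blast
  from laurent_mult[OF this] show ?case by blast
qed

section \<open>Weights\<close>

locale rational =
  fixes r d :: nat and R :: "complex mat \<Rightarrow> complex mat"
  assumes rational: "rational_rep r d R"
begin

lemma R_GL: "A \<in> carrier (GL r) \<Longrightarrow> R A \<in> carrier (GL d)"
  using rational by (auto simp: rational_rep_def hom_def)

lemma R_mat [intro]: "A \<in> carrier (GL r) \<Longrightarrow> R A \<in> carrier_mat d d"
  using R_GL GL_iff by blast

lemma R_mult: "A \<in> carrier (GL r) \<Longrightarrow> B \<in> carrier (GL r) \<Longrightarrow> R (A * B) = R A * R B"
  using rational by (auto simp: rational_rep_def hom_def)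

text \<open>Membership in \<open>hom\<close> gives multiplicativity only. The image of 1 is an
  invertible idempotent.\<close>

lemma R_one: "R (1\<^sub>m r) = 1\<^sub>m d"
proof -
  let ?X = "R (1\<^sub>m r)"
  have X: "?X \<in> carrier_mat d d" using GL_one by blast
  have XX: "?X * ?X = ?X" using R_mult[OF GL_one GL_one] by simp
  obtain Y where Y: "Y \<in> carrier (GL d)" "?X * Y = 1\<^sub>m d" using GL_inverse[OF R_GL[OF GL_one]] by metis
  have "?X = ?X * (?X * Y)" using X Y by simp
  also have "\<dots> = (?X * ?X) * Y" using X GL_mat[OF Y(1)] by (simp add: assoc_mult_mat[of _ d d _ d _ d])
  also have "\<dots> = 1\<^sub>m d" using XX Y by simp
  finally show ?thesis .
qed

lemma R_entry_regular:
  "i < d \<Longrightarrow> j < d \<Longrightarrow> \<exists>f\<in>regular_functions r. \<forall>A\<in>carrier (GL r). R A $$ (i, j) = f A"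
  using rational by (auto simp: rational_rep_def)

lemma R_tendsto:
  fixes X :: "'a \<Rightarrow> complex mat"
  assumes X: "\<And>s. X s \<in> carrier_mat r r" and L: "L \<in> carrier (GL r)"
    and GL: "eventually (\<lambda>s. X s \<in> carrier (GL r)) F"
    and lim: "\<And>i j. i < r \<Longrightarrow> j < r \<Longrightarrow> ((\<lambda>s. X s $$ (i, j)) \<longlongrightarrow> L $$ (i, j)) F"
    and ij: "i < d" "j < d"
  shows "((\<lambda>s. R (X s) $$ (i, j)) \<longlongrightarrow> R L $$ (i, j)) F"
proof -
  obtain f where f: "f \<in> regular_functions r" "\<And>A. A \<in> carrier (GL r) \<Longrightarrow> R A $$ (i, j) = f A"
    using R_entry_regular[OF ij] by blast
  have "((\<lambda>s. f (X s)) \<longlongrightarrow> f L) F" by (rule regular_tendsto[OF f(1) X L lim])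
  moreover have "eventually (\<lambda>s. f (X s) = R (X s) $$ (i, j)) F"
    using GL by eventually_elim (simp add: f(2))
  ultimately show ?thesis using f(2)[OF L] by (simp add: tendsto_cong)
qed

text \<open>Taken from the matrix entry itself: a regular function representing the entry is not
  unique, but its Laurent coefficients on the torus are.\<close>

definition wcoeff :: "nat \<Rightarrow> nat \<Rightarrow> (nat \<Rightarrow> int) \<Rightarrow> complex" where
  "wcoeff i j = (SOME b. laurent r (\<lambda>t. R (dg r t) $$ (i, j)) b)"

lemma wcoeff:
  assumes "i < d" "j < d"
  shows "laurent r (\<lambda>t. R (dg r t) $$ (i, j)) (wcoeff i j)"
proof -
  obtain f where f: "f \<in> regular_functions r" "\<And>A. A \<in> carrier (GL r) \<Longrightarrow> R A $$ (i, j) = f A"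
    using R_entry_regular[OF assms] by blast
  obtain b where b: "laurent r (\<lambda>t. f (dg r t)) b" using regular_laurent[OF f(1)] by blast
  have "laurent r (\<lambda>t. R (dg r t) $$ (i, j)) b"
    by (rule laurent_cong[OF b]) (simp add: f(2) dg_GL)
  thus ?thesis unfolding wcoeff_def by (rule someI[of "laurent r (\<lambda>t. R (dg r t) $$ (i, j))"])
qed

text \<open>The projection onto the weight space of weight m; \<open>R (dg r t)\<close> is the sum
  of \<open>lmon r m t\<close> times \<open>P m\<close>.\<close>

definition P :: "(nat \<Rightarrow> int) \<Rightarrow> complex mat" where
  "P m = mat d d (\<lambda>(i, j). wcoeff i j m)"

definition weights :: "(nat \<Rightarrow> int) set" where
  "weights = {m. P m \<noteq> 0\<^sub>m d d}"

lemma P_carrier [simp, intro]: "P m \<in> carrier_mat d d"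
  by (simp add: P_def)

lemma P_entry: "i < d \<Longrightarrow> j < d \<Longrightarrow> P m $$ (i, j) = wcoeff i j m"
  by (simp add: P_def)

lemma weights_iff: "m \<in> weights \<longleftrightarrow> (\<exists>i<d. \<exists>j<d. wcoeff i j m \<noteq> 0)"
proof
  assume "m \<in> weights"
  show "\<exists>i<d. \<exists>j<d. wcoeff i j m \<noteq> 0"
  proof (rule ccontr)
    assume "\<not> (\<exists>i<d. \<exists>j<d. wcoeff i j m \<noteq> 0)"
    hence "P m = 0\<^sub>m d d" by (intro eq_matI) (auto simp: P_def)
    thus False using \<open>m \<in> weights\<close> by (simp add: weights_def)
  qed
next
  assume "\<exists>i<d. \<exists>j<d. wcoeff i j m \<noteq> 0"
  then obtain i j where ij: "i < d" "j < d" "wcoeff i j m \<noteq> 0" by blast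
  hence "P m $$ (i, j) \<noteq> 0" by (simp add: P_entry)
  thus "m \<in> weights" using ij by (auto simp: weights_def)
qed

lemma finite_weights: "finite weights"
proof -
  have "weights = (\<Union>i<d. \<Union>j<d. {m. wcoeff i j m \<noteq> 0})" by (simp add: set_eq_iff weights_iff Bex_def)
  thus ?thesis using laurent_finite[OF wcoeff] by auto
qed

lemma weights_expo: "weights \<subseteq> expo r"
  using laurent_expo[OF wcoeff] by (auto simp: weights_iff)

lemma wcoeff_outside: "m \<notin> weights \<Longrightarrow> i < d \<Longrightarrow> j < d \<Longrightarrow> wcoeff i j m = 0"
  by (auto simp: weights_iff)

lemma R_dg_entry:
  assumes "i < d" "j < d" "t \<in> torus r"
  shows "R (dg r t) $$ (i, j) = (\<Sum>m\<in>weights. lmon r m t * P m $$ (i, j))"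
  by (subst laurentD[OF wcoeff[OF assms(1,2)] finite_weights _ assms(3)])
     (use assms weights_iff in \<open>auto simp: P_entry mult.commute\<close>)

text \<open>In R(t s) = R(t) R(s) = R(s) R(t) the point s is held fixed and the coefficients of the
  monomial m in t are compared.\<close>

lemma P_R_dg:
  assumes s: "s \<in> torus r"
  shows "P m * R (dg r s) = lmon r m s \<cdot>\<^sub>m P m" "R (dg r s) * P m = lmon r m s \<cdot>\<^sub>m P m"
proof -
  have Rs: "R (dg r s) \<in> carrier_mat d d" using dg_GL[OF s] by blast
  have both: "(\<Sum>k<d. wcoeff i k m * R (dg r s) $$ (k, j)) = lmon r m s * wcoeff i j m"
    "(\<Sum>k<d. R (dg r s) $$ (i, k) * wcoeff k j m) = lmon r m s * wcoeff i j m"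
    if ij: "i < d" "j < d" for i j
  proof -
    have L1: "laurent r (\<lambda>t. \<Sum>k<d. R (dg r s) $$ (k, j) * R (dg r t) $$ (i, k)) (\<lambda>m. \<Sum>k<d. R (dg r s) $$ (k, j) * wcoeff i k m)"
      by (rule laurent_sum, simp, rule laurent_scale, rule wcoeff) (use ij in auto)
    have L1': "laurent r (\<lambda>t. \<Sum>k<d. R (dg r s) $$ (i, k) * R (dg r t) $$ (k, j)) (\<lambda>m. \<Sum>k<d. R (dg r s) $$ (i, k) * wcoeff k j m)"
      by (rule laurent_sum, simp, rule laurent_scale, rule wcoeff) (use ij in auto)
    have L2: "laurent r (\<lambda>t. R (dg r (\<lambda>i. t i * s i)) $$ (i, j)) (\<lambda>m. lmon r m s * wcoeff i j m)"
    proof (rule laurentI)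
      show "finite weights" "weights \<subseteq> expo r" using finite_weights weights_expo .
      show "lmon r m s * wcoeff i j m = 0" if "m \<notin> weights" for m
        using wcoeff_outside[OF that ij] by simp
      show "R (dg r (\<lambda>i. t i * s i)) $$ (i, j) = (\<Sum>m\<in>weights. lmon r m s * wcoeff i j m * lmon r m t)"
        if "t \<in> torus r" for t
        using ij by (subst R_dg_entry[OF ij torus_mult[OF that s]])
          (auto simp: lmon_mult P_entry algebra_simps intro!: sum.cong)
    qed
    have "(\<lambda>m. \<Sum>k<d. R (dg r s) $$ (k, j) * wcoeff i k m) = (\<lambda>m. lmon r m s * wcoeff i j m)"
    proof (rule laurent_unique[OF L1 L2])
      fix t assume t: "t \<in> torus r"
      have "R (dg r (\<lambda>i. t i * s i)) $$ (i, j) = (R (dg r t) * R (dg r s)) $$ (i, j)"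
        by (simp add: dg_mult[symmetric] R_mult dg_GL t s)
      also have "\<dots> = (\<Sum>k<d. R (dg r s) $$ (k, j) * R (dg r t) $$ (i, k))"
        by (subst mult_entry[OF R_mat[OF dg_GL[OF t]] Rs]) (use ij in \<open>auto simp: mult.commute\<close>)
      finally show "(\<Sum>k<d. R (dg r s) $$ (k, j) * R (dg r t) $$ (i, k)) = R (dg r (\<lambda>i. t i * s i)) $$ (i, j)" by simp
    qed
    from fun_cong[OF this, of m]
    show "(\<Sum>k<d. wcoeff i k m * R (dg r s) $$ (k, j)) = lmon r m s * wcoeff i j m"
      by (simp add: mult.commute)
    have "(\<lambda>m. \<Sum>k<d. R (dg r s) $$ (i, k) * wcoeff k j m) = (\<lambda>m. lmon r m s * wcoeff i j m)"
    proof (rule laurent_unique[OF L1' L2])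
      fix t assume t: "t \<in> torus r"
      have "R (dg r (\<lambda>i. t i * s i)) = R (dg r (\<lambda>i. s i * t i))" by (simp add: mult.commute)
      hence "R (dg r (\<lambda>i. t i * s i)) $$ (i, j) = (R (dg r s) * R (dg r t)) $$ (i, j)"
        by (simp add: dg_mult[symmetric] R_mult dg_GL t s)
      also have "\<dots> = (\<Sum>k<d. R (dg r s) $$ (i, k) * R (dg r t) $$ (k, j))"
        by (subst mult_entry[OF Rs R_mat[OF dg_GL[OF t]]]) (use ij in auto)
      finally show "(\<Sum>k<d. R (dg r s) $$ (i, k) * R (dg r t) $$ (k, j)) = R (dg r (\<lambda>i. t i * s i)) $$ (i, j)" by simp
    qed
    from fun_cong[OF this, of m]
    show "(\<Sum>k<d. R (dg r s) $$ (i, k) * wcoeff k j m) = lmon r m s * wcoeff i j m" .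
  qed
  show "P m * R (dg r s) = lmon r m s \<cdot>\<^sub>m P m"
  proof (rule eq_matI)
    fix i j assume "i < dim_row (lmon r m s \<cdot>\<^sub>m P m)" "j < dim_col (lmon r m s \<cdot>\<^sub>m P m)"
    hence ij: "i < d" "j < d" by (auto simp: P_def)
    show "(P m * R (dg r s)) $$ (i, j) = (lmon r m s \<cdot>\<^sub>m P m) $$ (i, j)"
      using both(1)[OF ij] ij by (subst mult_entry[OF P_carrier Rs]) (auto simp: P_entry P_def)
  qed (use Rs in \<open>auto simp: P_def\<close>)
  show "R (dg r s) * P m = lmon r m s \<cdot>\<^sub>m P m"
  proof (rule eq_matI)
    fix i j assume "i < dim_row (lmon r m s \<cdot>\<^sub>m P m)" "j < dim_col (lmon r m s \<cdot>\<^sub>m P m)"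
    hence ij: "i < d" "j < d" by (auto simp: P_def)
    show "(R (dg r s) * P m) $$ (i, j) = (lmon r m s \<cdot>\<^sub>m P m) $$ (i, j)"
      using both(2)[OF ij] ij by (subst mult_entry[OF Rs P_carrier]) (auto simp: P_entry P_def)
  qed (use Rs in \<open>auto simp: P_def\<close>)
qed

text \<open>The coefficient of m' in P_m R(t) = t^m P_m shows that the projections are orthogonal
  idempotents.\<close>

lemma P_mult: "P m * P m' = (if m = m' then P m else 0\<^sub>m d d)"
proof (rule eq_matI)
  fix i j assume "i < dim_row (if m = m' then P m else 0\<^sub>m d d)" "j < dim_col (if m = m' then P m else 0\<^sub>m d d)"
  hence ij: "i < d" "j < d" by (auto simp: P_def split: if_splits)
  have L1: "laurent r (\<lambda>t. \<Sum>k<d. P m $$ (i, k) * R (dg r t) $$ (k, j)) (\<lambda>m'. \<Sum>k<d. P m $$ (i, k) * wcoeff k j m')"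
    by (rule laurent_sum, simp, rule laurent_scale, rule wcoeff) (use ij in auto)
  have L2: "laurent r (\<lambda>t. wcoeff i j m * lmon r m t) (\<lambda>m'. wcoeff i j m * (if m' = m then 1 else 0))"
  proof (cases "m \<in> expo r")
    case True thus ?thesis by (intro laurent_scale laurent_lmon)
  next
    case False
    hence "wcoeff i j m = 0" using weights_expo wcoeff_outside[OF _ ij] by blast
    thus ?thesis using laurent_zero by simp
  qed
  have "(\<lambda>m'. \<Sum>k<d. P m $$ (i, k) * wcoeff k j m') = (\<lambda>m'. wcoeff i j m * (if m' = m then 1 else 0))"
  proof (rule laurent_unique[OF L1 L2])
    fix t assume t: "t \<in> torus r"
    have "(P m * R (dg r t)) $$ (i, j) = (lmon r m t \<cdot>\<^sub>m P m) $$ (i, j)" by (simp add: P_R_dg[OF t])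
    thus "(\<Sum>k<d. P m $$ (i, k) * R (dg r t) $$ (k, j)) = wcoeff i j m * lmon r m t"
      using ij by (subst (asm) mult_entry[OF P_carrier R_mat[OF dg_GL[OF t]]]) (auto simp: P_def)
  qed
  from fun_cong[OF this, of m']
  show "(P m * P m') $$ (i, j) = (if m = m' then P m else 0\<^sub>m d d) $$ (i, j)"
    using ij by (subst mult_entry[OF P_carrier P_carrier]) (auto simp: P_entry)
qed (auto simp: P_def)

text \<open>Completeness of the weight decomposition is its value at t = 1.\<close>

lemma P_sum:
  assumes "i < d" "j < d"
  shows "(\<Sum>m\<in>weights. P m $$ (i, j)) = (if i = j then 1 else 0)"
  using R_dg_entry[OF assms, of "\<lambda>i. 1"] assms by (simp add: torus_def R_one)

lemma vec_weight_sum: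
  assumes x: "x \<in> carrier_vec d" and i: "i < d"
  shows "x $ i = (\<Sum>m\<in>weights. (P m *\<^sub>v x) $ i)"
proof -
  have "(\<Sum>m\<in>weights. (P m *\<^sub>v x) $ i) = (\<Sum>m\<in>weights. \<Sum>l<d. P m $$ (i, l) * x $ l)"
    by (simp add: mult_vec_entry[OF P_carrier x i])
  also have "\<dots> = (\<Sum>l<d. (\<Sum>m\<in>weights. P m $$ (i, l)) * x $ l)"
    by (subst sum.swap) (simp add: sum_distrib_right)
  also have "\<dots> = (\<Sum>l<d. if l = i then x $ l else 0)"
    using i by (intro sum.cong) (auto simp: P_sum)
  also have "\<dots> = x $ i" using i by simp
  finally show ?thesis by simp
qed

lemma R_dg_P_vec:
  assumes "x \<in> carrier_vec d" "t \<in> torus r"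
  shows "R (dg r t) *\<^sub>v (P m *\<^sub>v x) = lmon r m t \<cdot>\<^sub>v (P m *\<^sub>v x)"
proof -
  have "R (dg r t) *\<^sub>v (P m *\<^sub>v x) = (R (dg r t) * P m) *\<^sub>v x"
    using assms R_mat[OF dg_GL] by (simp add: assoc_mult_mat_vec[of _ d d _ d])
  thus ?thesis using assms by (simp add: P_R_dg smult_mat_mult_vec[OF P_carrier])
qed

text \<open>Again a comparison of coefficients in t, now in R(t) x = t^m x.\<close>

lemma weight_vector_P:
  assumes x: "x \<in> carrier_vec d" and m: "m \<in> expo r"
    and eig: "\<And>t. t \<in> torus r \<Longrightarrow> R (dg r t) *\<^sub>v x = lmon r m t \<cdot>\<^sub>v x"
  shows "P m' *\<^sub>v x = (if m' = m then x else 0\<^sub>v d)"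
proof (rule eq_vecI)
  fix i assume "i < dim_vec (if m' = m then x else 0\<^sub>v d)"
  hence i: "i < d" using x by (auto split: if_splits)
  have L1: "laurent r (\<lambda>t. \<Sum>k<d. x $ k * R (dg r t) $$ (i, k)) (\<lambda>m'. \<Sum>k<d. x $ k * wcoeff i k m')"
    by (rule laurent_sum, simp, rule laurent_scale, rule wcoeff) (use i in auto)
  have L2: "laurent r (\<lambda>t. x $ i * lmon r m t) (\<lambda>m'. x $ i * (if m' = m then 1 else 0))"
    using m by (intro laurent_scale laurent_lmon)
  have "(\<lambda>m'. \<Sum>k<d. x $ k * wcoeff i k m') = (\<lambda>m'. x $ i * (if m' = m then 1 else 0))"
  proof (rule laurent_unique[OF L1 L2])
    fix t assume t: "t \<in> torus r"
    have "(R (dg r t) *\<^sub>v x) $ i = (lmon r m t \<cdot>\<^sub>v x) $ i" by (simp add: eig[OF t])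
    thus "(\<Sum>k<d. x $ k * R (dg r t) $$ (i, k)) = x $ i * lmon r m t"
      using i x by (subst (asm) mult_vec_entry[OF R_mat[OF dg_GL[OF t]] x]) (auto simp: mult.commute)
  qed
  from fun_cong[OF this, of m']
  show "(P m' *\<^sub>v x) $ i = (if m' = m then x else 0\<^sub>v d) $ i"
    using i by (subst mult_vec_entry[OF P_carrier x]) (auto simp: P_entry mult.commute)
qed (use x in \<open>auto simp: P_def\<close>)

end

section \<open>Degeneration along one-parameter subgroups\<close>

definition pairing :: "nat \<Rightarrow> (nat \<Rightarrow> int) \<Rightarrow> (nat \<Rightarrow> int) \<Rightarrow> int" where
  "pairing r h m = (\<Sum>i<r. h i * m i)"

text \<open>The block diagonal part of B for the grading of the coordinates by h: the limit of tau^h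
  B tau^(-h) at tau = 0, if that limit exists.\<close>

definition level_part :: "nat \<Rightarrow> (nat \<Rightarrow> int) \<Rightarrow> complex mat \<Rightarrow> complex mat" where
  "level_part r h B = mat r r (\<lambda>(i, j). if h i = h j then B $$ (i, j) else 0)"

lemma power_int_sum: "x \<noteq> 0 \<Longrightarrow> x powi (\<Sum>i\<in>A. f i) = (\<Prod>i\<in>A. x powi f i)" for x :: complex
  by (induction A rule: infinite_finite_induct) (auto simp: power_int_add)

lemma lmon_one_parameter: "\<tau> \<noteq> 0 \<Longrightarrow> lmon r m (\<lambda>i. \<tau> powi h i) = \<tau> powi pairing r h m"
  by (simp add: lmon_def pairing_def power_int_sum power_int_mult)

lemma power_int_tendsto_0:
  assumes "k > 0" shows "((\<lambda>x::complex. x powi k) \<longlongrightarrow> 0) (at 0)"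
proof -
  have "((\<lambda>x::complex. x ^ nat k) \<longlongrightarrow> 0 ^ nat k) (at 0)"
    by (intro tendsto_intros)
  moreover have "(\<lambda>x::complex. x powi k) = (\<lambda>x. x ^ nat k)"
    using assms by (auto simp: power_int_def)
  ultimately show ?thesis using assms by (simp add: zero_power)
qed

text \<open>Conjugation multiplies entry (i, j) by tau^(h i - h j), and the assumption on B removes
  the negative powers. The determinant is constant along the curve, so the limit stays in the
  group.\<close>

lemma degeneration:
  fixes h :: "nat \<Rightarrow> int"
  assumes B: "B \<in> carrier (GL r)"
    and h: "\<And>i j. i < r \<Longrightarrow> j < r \<Longrightarrow> h i < h j \<Longrightarrow> B $$ (i, j) = 0"
  defines "T \<equiv> \<lambda>\<tau>. dg r (\<lambda>i. \<tau> powi h i)"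
  defines "X \<equiv> \<lambda>\<tau>. T \<tau> * B * T (inverse \<tau>)"
  shows "\<And>i j. i < r \<Longrightarrow> j < r \<Longrightarrow> ((\<lambda>\<tau>. X \<tau> $$ (i, j)) \<longlongrightarrow> level_part r h B $$ (i, j)) (at 0)"
    and "level_part r h B \<in> carrier (GL r)"
    and "det (level_part r h B) = det B"
proof -
  have Bc: "B \<in> carrier_mat r r" using B GL_iff by blast
  have Xc: "X \<tau> \<in> carrier_mat r r" for \<tau> unfolding X_def T_def by (intro mult_square_carrier dg_carrier Bc)
  have X: "X \<tau> $$ (i, j) = \<tau> powi (h i - h j) * B $$ (i, j)" if "i < r" "j < r" "\<tau> \<noteq> 0" for i j \<tau>
  proof -
    have TB: "dg r (\<lambda>i. \<tau> powi h i) * B \<in> carrier_mat r r" by (rule mult_square_carrier[OF dg_carrier Bc])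
    show ?thesis
    using that Bc unfolding X_def T_def
    by (subst dg_mult_right[OF TB that(1,2)], subst dg_mult_left[OF Bc that(1,2)])
       (auto simp: power_int_diff power_int_inverse divide_inverse)
  qed
  show lim: "((\<lambda>\<tau>. X \<tau> $$ (i, j)) \<longlongrightarrow> level_part r h B $$ (i, j)) (at 0)" if ij: "i < r" "j < r" for i j
  proof -
    have ev: "eventually (\<lambda>\<tau>. \<tau> powi (h i - h j) * B $$ (i, j) = X \<tau> $$ (i, j)) (at 0)"
      unfolding eventually_at_filter using X[OF ij] by simp
    have "((\<lambda>\<tau>. \<tau> powi (h i - h j) * B $$ (i, j)) \<longlongrightarrow> level_part r h B $$ (i, j)) (at 0)"
    proof -
      consider "h i < h j" | "h i = h j" | "h i > h j" by linarith
      thus ?thesis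
      proof cases
        case 1 thus ?thesis using h[OF ij] ij by (simp add: level_part_def)
      next
        case 2 thus ?thesis using ij by (simp add: level_part_def)
      next
        case 3
        hence "((\<lambda>\<tau>. \<tau> powi (h i - h j) * B $$ (i, j)) \<longlongrightarrow> 0 * B $$ (i, j)) (at 0)"
          by (intro tendsto_mult power_int_tendsto_0 tendsto_const) auto
        thus ?thesis using ij 3 by (simp add: level_part_def)
      qed
    qed
    thus ?thesis using ev by (simp add: tendsto_cong)
  qed
  have Lc: "level_part r h B \<in> carrier_mat r r" by (simp add: level_part_def)
  have "((\<lambda>\<tau>. det (X \<tau>)) \<longlongrightarrow> det (level_part r h B)) (at 0)"
    by (rule det_tendsto[OF Xc Lc lim])
  moreover have "eventually (\<lambda>\<tau>. det (X \<tau>) = det B) (at 0)"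
  proof -
    have "det (X \<tau>) = det B" if "\<tau> \<noteq> 0" for \<tau>
    proof -
      have TB: "dg r (\<lambda>i. \<tau> powi h i) * B \<in> carrier_mat r r" by (rule mult_square_carrier[OF dg_carrier Bc])
      have "det (X \<tau>) = det (dg r (\<lambda>i. \<tau> powi h i)) * det B * det (dg r (\<lambda>i. inverse \<tau> powi h i))"
        unfolding X_def T_def by (simp add: det_mult[OF TB dg_carrier] det_mult[OF dg_carrier Bc])
      also have "\<dots> = det B * (\<Prod>i<r. \<tau> powi h i * inverse \<tau> powi h i)"
        by (simp add: det_dg prod.distrib)
      also have "\<dots> = det B" using that by (simp flip: power_int_mult_distrib)
      finally show ?thesis .
    qed
    thus ?thesis unfolding eventually_at_filter by simp
  qed
  ultimately have "((\<lambda>\<tau>::complex. det B) \<longlongrightarrow> det (level_part r h B)) (at 0)"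
    using tendsto_cong by fastforce
  thus "det (level_part r h B) = det B" using LIM_unique tendsto_const by blast
  thus "level_part r h B \<in> carrier (GL r)" using Lc B by (simp add: GL_iff)
qed

context rational
begin

text \<open>Between two weight spaces the conjugated matrix acts as tau^q times the original block,
  where q = <h, m'> - <h, m>, and it converges at tau = 0. Negative q forces the block to vanish; q
  = 0 makes it equal to its limit.\<close>

lemma P_R_P_degenerate:
  fixes h :: "nat \<Rightarrow> int"
  assumes B: "B \<in> carrier (GL r)"
    and h: "\<And>i j. i < r \<Longrightarrow> j < r \<Longrightarrow> h i < h j \<Longrightarrow> B $$ (i, j) = 0"
  shows "pairing r h m' < pairing r h m \<Longrightarrow> P m' * R B * P m = 0\<^sub>m d d"
    and "pairing r h m' = pairing r h m \<Longrightarrow> P m' * R B * P m = P m' * R (level_part r h B) * P m"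
proof -
  define T where "T = (\<lambda>\<tau>. dg r (\<lambda>i. \<tau> powi h i))"
  define X where "X = (\<lambda>\<tau>. T \<tau> * B * T (inverse \<tau>))"
  define q where "q = pairing r h m' - pairing r h m"
  have deg1: "((\<lambda>\<tau>. X \<tau> $$ (i, j)) \<longlongrightarrow> level_part r h B $$ (i, j)) (at 0)" if "i < r" "j < r" for i j
    unfolding X_def T_def by (rule degeneration(1)[OF B h that])
  have deg2: "level_part r h B \<in> carrier (GL r)"
    by (rule degeneration(2)[OF B h])
  have Bc: "B \<in> carrier_mat r r" using B GL_iff by blast
  have RB: "R B \<in> carrier_mat d d" using B by blast
  have tor: "(\<lambda>i. \<tau> powi h i) \<in> torus r" if "\<tau> \<noteq> 0" for \<tau> using that by (simp add: torus_def)
  have T: "T \<tau> \<in> carrier (GL r)" if "\<tau> \<noteq> 0" for \<tau> unfolding T_def by (rule dg_GL[OF tor[OF that]])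
  have XGL: "X \<tau> \<in> carrier (GL r)" if "\<tau> \<noteq> 0" for \<tau>
    unfolding X_def by (intro GL_mult T B) (use that in auto)
  have PXP: "P m' * R (X \<tau>) * P m = \<tau> powi q \<cdot>\<^sub>m (P m' * R B * P m)" if \<tau>: "\<tau> \<noteq> 0" for \<tau>
  proof -
    have i\<tau>: "inverse \<tau> \<noteq> 0" using \<tau> by simp
    have "R (X \<tau>) = R (T \<tau>) * R B * R (T (inverse \<tau>))"
      unfolding X_def using T[OF \<tau>] T[OF i\<tau>] B by (simp add: R_mult GL_mult)
    hence "P m' * R (X \<tau>) * P m = (P m' * R (T \<tau>)) * R B * (R (T (inverse \<tau>)) * P m)"
      using R_mat[OF T[OF \<tau>]] R_mat[OF T[OF i\<tau>]] RB P_carrier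
      by (simp add: assoc_mult_mat[of _ d d _ d _ d])
    also have "P m' * R (T \<tau>) = \<tau> powi pairing r h m' \<cdot>\<^sub>m P m'"
      unfolding T_def by (simp add: P_R_dg[OF tor[OF \<tau>]] lmon_one_parameter[OF \<tau>])
    also have "R (T (inverse \<tau>)) * P m = inverse \<tau> powi pairing r h m \<cdot>\<^sub>m P m"
      unfolding T_def by (simp only: P_R_dg[OF tor[OF i\<tau>]] lmon_one_parameter[OF i\<tau>])
    also have "(\<tau> powi pairing r h m' \<cdot>\<^sub>m P m') * R B * (inverse \<tau> powi pairing r h m \<cdot>\<^sub>m P m)
       = (\<tau> powi pairing r h m' * inverse \<tau> powi pairing r h m) \<cdot>\<^sub>m (P m' * R B * P m)"
    proof -
      have 1: "(\<tau> powi pairing r h m' \<cdot>\<^sub>m P m') * R B = \<tau> powi pairing r h m' \<cdot>\<^sub>m (P m' * R B)"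
        by (rule mult_smult_assoc_mat[OF P_carrier RB])
      have c: "P m' * R B \<in> carrier_mat d d" using P_carrier RB by (rule mult_carrier_mat)
      show ?thesis unfolding 1
        by (subst mult_smult_assoc_mat[OF c smult_carrier_mat[OF P_carrier]], subst mult_smult_distrib[OF c P_carrier])
           (rule eq_matI, auto)
    qed
    also have "\<tau> powi pairing r h m' * inverse \<tau> powi pairing r h m = \<tau> powi q"
      using \<tau> by (simp add: q_def power_int_diff power_int_inverse divide_inverse)
    finally show ?thesis .
  qed
  have lim: "((\<lambda>\<tau>. (P m' * R (X \<tau>) * P m) $$ (i, j)) \<longlongrightarrow> (P m' * R (level_part r h B) * P m) $$ (i, j)) (at 0)"
    if ij: "i < d" "j < d" for i j
  proof -
    have RL: "((\<lambda>\<tau>. R (X \<tau>) $$ (a, b)) \<longlongrightarrow> R (level_part r h B) $$ (a, b)) (at 0)" if "a < d" "b < d" for a b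
    proof (rule R_tendsto)
      show "a < d" "b < d" "level_part r h B \<in> carrier (GL r)" by (fact that deg2)+
      show "((\<lambda>s. X s $$ (i, j)) \<longlongrightarrow> level_part r h B $$ (i, j)) (at 0)" if "i < r" "j < r" for i j
        by (rule deg1[OF that])
      show "X s \<in> carrier_mat r r" for s unfolding X_def T_def by (intro mult_square_carrier dg_carrier Bc)
      show "\<forall>\<^sub>F s in at 0. X s \<in> carrier (GL r)" unfolding eventually_at_filter using XGL by simp
    qed
    have "((\<lambda>\<tau>. \<Sum>b<d. \<Sum>a<d. P m' $$ (i, a) * R (X \<tau>) $$ (a, b) * P m $$ (b, j)) \<longlongrightarrow>
           (\<Sum>b<d. \<Sum>a<d. P m' $$ (i, a) * R (level_part r h B) $$ (a, b) * P m $$ (b, j))) (at 0)"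
      by (intro tendsto_sum tendsto_mult tendsto_const RL) auto
    also have "(\<Sum>b<d. \<Sum>a<d. P m' $$ (i, a) * R (level_part r h B) $$ (a, b) * P m $$ (b, j)) =
        (P m' * R (level_part r h B) * P m) $$ (i, j)"
      by (rule mult3_entry[symmetric]) (use deg2 ij in auto)
    finally show ?thesis
    proof (rule Lim_transform_eventually)
      show "\<forall>\<^sub>F \<tau> in at 0. (\<Sum>b<d. \<Sum>a<d. P m' $$ (i, a) * R (X \<tau>) $$ (a, b) * P m $$ (b, j)) = (P m' * R (X \<tau>) * P m) $$ (i, j)"
        unfolding eventually_at_filter
      proof (rule always_eventually, intro allI impI)
        fix \<tau> :: complex assume "\<tau> \<noteq> 0"
        show "(\<Sum>b<d. \<Sum>a<d. P m' $$ (i, a) * R (X \<tau>) $$ (a, b) * P m $$ (b, j)) = (P m' * R (X \<tau>) * P m) $$ (i, j)"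
          by (rule mult3_entry[symmetric]) (use XGL[OF \<open>\<tau> \<noteq> 0\<close>] ij in auto)
      qed
    qed
  qed
  have C: "P m' * R B * P m \<in> carrier_mat d d" using RB by (auto intro: mult_carrier_mat)
  let ?c = "\<lambda>i j. (P m' * R B * P m) $$ (i, j)"
  \<comment> \<open>The constant block is recovered from the convergent one by the factor tau^(-q),
    which tends to 0 in the first case.\<close>
  have ev: "eventually (\<lambda>\<tau>. \<tau> powi (- q) * (P m' * R (X \<tau>) * P m) $$ (i, j) = ?c i j) (at 0)"
    if ij: "i < d" "j < d" for i j
    unfolding eventually_at_filter
    by (rule always_eventually, intro allI impI)
       (use PXP carrier_matD[OF C] ij in \<open>simp add: power_int_minus del: index_mult_mat\<close>)
  {
    assume "pairing r h m' < pairing r h m"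
    hence q: "- q > 0" by (simp add: q_def)
    show "P m' * R B * P m = 0\<^sub>m d d"
    proof (rule eq_matI)
      fix i j assume "i < dim_row (0\<^sub>m d d :: complex mat)" "j < dim_col (0\<^sub>m d d :: complex mat)"
      hence ij: "i < d" "j < d" by auto
      have "((\<lambda>\<tau>. \<tau> powi (- q) * (P m' * R (X \<tau>) * P m) $$ (i, j)) \<longlongrightarrow> 0 * (P m' * R (level_part r h B) * P m) $$ (i, j)) (at 0)"
        by (intro tendsto_mult power_int_tendsto_0 q lim ij)
      hence "((\<lambda>\<tau>::complex. ?c i j) \<longlongrightarrow> 0 * (P m' * R (level_part r h B) * P m) $$ (i, j)) (at 0)"
        by (rule Lim_transform_eventually) (rule ev[OF ij])
      hence "?c i j = 0" using LIM_unique tendsto_const by fastforce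
      thus "?c i j = 0\<^sub>m d d $$ (i, j)" using ij by simp
    qed (use C in auto)
  }
  {
    assume "pairing r h m' = pairing r h m"
    hence q: "q = 0" by (simp add: q_def)
    have c: "P m' * R (level_part r h B) * P m \<in> carrier_mat d d" using deg2 by (auto intro: mult_carrier_mat)
    show "P m' * R B * P m = P m' * R (level_part r h B) * P m"
    proof (rule eq_matI)
      fix i j assume "i < dim_row (P m' * R (level_part r h B) * P m)" "j < dim_col (P m' * R (level_part r h B) * P m)"
      hence ij: "i < d" "j < d" using c by auto
      have "((\<lambda>\<tau>::complex. ?c i j) \<longlongrightarrow> (P m' * R (level_part r h B) * P m) $$ (i, j)) (at 0)"
        by (rule Lim_transform_eventually[OF lim[OF ij]]) (use ev[OF ij] q in simp)
      thus "?c i j = (P m' * R (level_part r h B) * P m) $$ (i, j)" using LIM_unique tendsto_const by blast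
    qed (use C c in auto)
  }
qed

end

lemma zero_mat_mult_vec: "x \<in> carrier_vec m \<Longrightarrow> 0\<^sub>m n m *\<^sub>v x = 0\<^sub>v n"
  by (rule eq_vecI) auto

lemma smult_zero_vec: "c \<cdot>\<^sub>v 0\<^sub>v n = (0\<^sub>v n :: complex vec)"
  by (rule eq_vecI) auto

lemma mult_unit_vec_entry:
  fixes A :: "complex mat"
  assumes "A \<in> carrier_mat n m" "i < n" "j < m"
  shows "(A *\<^sub>v unit_vec m j) $ i = A $$ (i, j)"
proof -
  have "(A *\<^sub>v unit_vec m j) $ i = (\<Sum>l<m. A $$ (i, l) * unit_vec m j $ l)"
    by (rule mult_vec_entry) (use assms in auto)
  also have "\<dots> = (\<Sum>l<m. if l = j then A $$ (i, j) else 0)"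
    by (rule sum.cong) (use assms in auto)
  finally show ?thesis using assms by simp
qed

text \<open>Entries of a rational representation are prescribed on invertible matrices only, hence
  regularity up to the values elsewhere.\<close>

definition reg_on :: "nat \<Rightarrow> (complex mat \<Rightarrow> complex) \<Rightarrow> bool" where
  "reg_on r F \<longleftrightarrow> (\<exists>f\<in>regular_functions r. \<forall>A\<in>carrier (GL r). F A = f A)"

lemma reg_on_const: "reg_on r (\<lambda>A. c)"
  unfolding reg_on_def by (rule bexI[OF _ regular_functions.const[of c]]) simp

lemma reg_on_add: "reg_on r F \<Longrightarrow> reg_on r G \<Longrightarrow> reg_on r (\<lambda>A. F A + G A)"
  unfolding reg_on_def
proof (elim bexE)
  fix f g assume "f \<in> regular_functions r" "g \<in> regular_functions r"
    "\<forall>A\<in>carrier (GL r). F A = f A" "\<forall>A\<in>carrier (GL r). G A = g A"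
  thus "\<exists>f\<in>regular_functions r. \<forall>A\<in>carrier (GL r). F A + G A = f A"
    by (intro bexI[OF _ regular_functions.add[of f r g]]) auto
qed

lemma reg_on_mult: "reg_on r F \<Longrightarrow> reg_on r G \<Longrightarrow> reg_on r (\<lambda>A. F A * G A)"
  unfolding reg_on_def
proof (elim bexE)
  fix f g assume "f \<in> regular_functions r" "g \<in> regular_functions r"
    "\<forall>A\<in>carrier (GL r). F A = f A" "\<forall>A\<in>carrier (GL r). G A = g A"
  thus "\<exists>f\<in>regular_functions r. \<forall>A\<in>carrier (GL r). F A * G A = f A"
    by (intro bexI[OF _ regular_functions.mult[of f r g]]) auto
qed

lemma reg_on_scale: "reg_on r F \<Longrightarrow> reg_on r (\<lambda>A. c * F A)"
  by (rule reg_on_mult[OF reg_on_const])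

lemma reg_on_diff: "reg_on r F \<Longrightarrow> reg_on r G \<Longrightarrow> reg_on r (\<lambda>A. F A - G A)"
  using reg_on_add[OF _ reg_on_scale[of r G "-1"], of F] by simp

lemma reg_on_sum: "finite S \<Longrightarrow> (\<And>x. x \<in> S \<Longrightarrow> reg_on r (F x)) \<Longrightarrow> reg_on r (\<lambda>A. \<Sum>x\<in>S. F x A)"
proof (induction S rule: finite_induct)
  case empty show ?case using reg_on_const[of r 0] by simp
next
  case (insert x S)
  have "reg_on r (\<lambda>A. F x A + (\<Sum>x\<in>S. F x A))"
    by (rule reg_on_add) (use insert in simp_all)
  thus ?case using insert by simp
qed

lemma reg_on_prod: "finite S \<Longrightarrow> (\<And>x. x \<in> S \<Longrightarrow> reg_on r (F x)) \<Longrightarrow> reg_on r (\<lambda>A. \<Prod>x\<in>S. F x A)"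
proof (induction S rule: finite_induct)
  case empty show ?case using reg_on_const[of r 1] by simp
next
  case (insert x S)
  have "reg_on r (\<lambda>A. F x A * (\<Prod>x\<in>S. F x A))"
    by (rule reg_on_mult) (use insert in simp_all)
  thus ?case using insert by simp
qed

lemma reg_on_entry: "i < r \<Longrightarrow> j < r \<Longrightarrow> reg_on r (\<lambda>A. A $$ (i, j))"
  unfolding reg_on_def by (rule bexI[OF _ regular_functions.entry[of i r j]]) simp_all

lemma reg_on_inverse_det: "reg_on r (\<lambda>A. inverse (det A))"
  unfolding reg_on_def by (rule bexI[OF _ regular_functions.inverse_det]) simp

lemma reg_on_cong: "reg_on r F \<Longrightarrow> (\<And>A. A \<in> carrier (GL r) \<Longrightarrow> F A = G A) \<Longrightarrow> reg_on r G"
  unfolding reg_on_def by (elim bexE, rule bexI) simp_all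

lemma rational_repI:
  assumes "\<And>A. A \<in> carrier (GL r) \<Longrightarrow> R A \<in> carrier (GL d)"
    and "\<And>A B. A \<in> carrier (GL r) \<Longrightarrow> B \<in> carrier (GL r) \<Longrightarrow> R (A * B) = R A * R B"
    and "\<And>i j. i < d \<Longrightarrow> j < d \<Longrightarrow> reg_on r (\<lambda>A. R A $$ (i, j))"
  shows "rational_rep r d R"
  using assms unfolding rational_rep_def reg_on_def hom_def by auto

lemma (in rational) R_reg_on: "i < d \<Longrightarrow> j < d \<Longrightarrow> reg_on r (\<lambda>A. R A $$ (i, j))"
  using R_entry_regular[of i j] by (simp add: reg_on_def)

section \<open>The big cell\<close>

definition lower_triangular :: "complex mat \<Rightarrow> bool" where
  "lower_triangular A \<longleftrightarrow> (\<forall>i < dim_row A. \<forall>j < dim_col A. i < j \<longrightarrow> A $$ (i, j) = 0)"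

definition lead :: "nat \<Rightarrow> complex mat \<Rightarrow> complex mat" where
  "lead k A = mat k k (\<lambda>ij. A $$ ij)"

text \<open>Induction with the last row and column split off: the factors of the leading block are
  inverted on the border, and the new corner is a Schur complement. Invertibility of the enlarged
  factors is read off from the determinant of A.\<close>

lemma LU_decomposition:
  assumes "A \<in> carrier_mat r r" "\<And>k. k \<le> r \<Longrightarrow> det (lead k A) \<noteq> 0"
  shows "\<exists>L U. L \<in> carrier (GL r) \<and> U \<in> carrier (GL r) \<and> lower_triangular L \<and> upper_triangular U \<and> A = L * U"
  using assms
proof (induction r arbitrary: A)
  case 0
  show ?case
    by (rule exI[of _ "1\<^sub>m 0"], rule exI[of _ "1\<^sub>m 0"])
       (use 0 in \<open>auto simp: GL_iff lower_triangular_def\<close>)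
next
  case (Suc r)
  define A1 where "A1 = lead r A"
  define A2 where "A2 = mat r 1 (\<lambda>(i, j). A $$ (i, r))"
  define A3 where "A3 = mat 1 r (\<lambda>(i, j). A $$ (r, j))"
  define A4 where "A4 = mat 1 1 (\<lambda>(i, j). A $$ (r, r))"
  have c: "A1 \<in> carrier_mat r r" "A2 \<in> carrier_mat r 1" "A3 \<in> carrier_mat 1 r" "A4 \<in> carrier_mat 1 1"
    by (auto simp: A1_def A2_def A3_def A4_def lead_def)
  have A: "A = four_block_mat A1 A2 A3 A4"
    using Suc.prems(1) by (intro eq_matI) (auto simp: A1_def A2_def A3_def A4_def lead_def less_Suc_eq)
  have "lead k A1 = lead k A" if "k \<le> r" for k
    using that by (intro eq_matI) (auto simp: A1_def lead_def)
  hence "\<And>k. k \<le> r \<Longrightarrow> det (lead k A1) \<noteq> 0" using Suc.prems(2) by simp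
  from Suc.IH[OF c(1) this] obtain L U where LU: "L \<in> carrier (GL r)" "U \<in> carrier (GL r)"
    "lower_triangular L" "upper_triangular U" "A1 = L * U" by blast
  obtain Li where Li: "Li \<in> carrier (GL r)" "L * Li = 1\<^sub>m r" using GL_inverse[OF LU(1)] by metis
  obtain Ui where Ui: "Ui \<in> carrier (GL r)" "Ui * U = 1\<^sub>m r" using GL_inverse[OF LU(2)] by metis
  note cc = GL_mat[OF LU(1)] GL_mat[OF LU(2)] GL_mat[OF Li(1)] GL_mat[OF Ui(1)]
  define L' where "L' = four_block_mat L (0\<^sub>m r 1) (A3 * Ui) (1\<^sub>m 1)"
  \<comment> \<open>\<open>Ui * Li\<close> is the inverse of \<open>A1\<close>, so this is the Schur
    complement of \<open>A1\<close> in A.\<close>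
  define S where "S = A4 - (A3 * Ui) * (Li * A2)"
  define U' where "U' = four_block_mat U (Li * A2) (0\<^sub>m 1 r) S"
  have c3: "A3 * Ui \<in> carrier_mat 1 r" "Li * A2 \<in> carrier_mat r 1" using c cc by auto
  have S: "S \<in> carrier_mat 1 1" unfolding S_def using c c3 by auto
  have L'c: "L' \<in> carrier_mat (Suc r) (Suc r)" and U'c: "U' \<in> carrier_mat (Suc r) (Suc r)"
    unfolding L'_def U'_def using cc S by auto
  have "L' * U' = four_block_mat (L * U + 0\<^sub>m r 1 * 0\<^sub>m 1 r) (L * (Li * A2) + 0\<^sub>m r 1 * S)
       ((A3 * Ui) * U + 1\<^sub>m 1 * 0\<^sub>m 1 r) ((A3 * Ui) * (Li * A2) + 1\<^sub>m 1 * S)"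
    unfolding L'_def U'_def by (rule mult_four_block_mat) (use cc c3 S in auto)
  also have "L * U + 0\<^sub>m r 1 * 0\<^sub>m 1 r = A1" using LU(5) c cc by auto
  also have "L * (Li * A2) + 0\<^sub>m r 1 * S = A2"
    using c cc S Li(2) by (simp add: assoc_mult_mat[of L r r Li r A2 1, symmetric])
  also have "(A3 * Ui) * U + 1\<^sub>m 1 * 0\<^sub>m 1 r = A3"
    using c cc Ui(2) by (simp add: assoc_mult_mat[of A3 1 r Ui r U r])
  also have "(A3 * Ui) * (Li * A2) + 1\<^sub>m 1 * S = A4"
  proof -
    have "(A3 * Ui) * (Li * A2) \<in> carrier_mat 1 1" using c3 by auto
    thus ?thesis using c S by (intro eq_matI) (auto simp: S_def)
  qed
  finally have prod: "A = L' * U'" using A by simp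
  have "lead (Suc r) A = A" using Suc.prems(1) by (intro eq_matI) (auto simp: lead_def)
  hence "det A \<noteq> 0" using Suc.prems(2)[of "Suc r"] by simp
  hence "det L' \<noteq> 0" "det U' \<noteq> 0" using det_mult[OF L'c U'c] prod by auto
  moreover have "lower_triangular L'"
    using LU(3) cc unfolding lower_triangular_def L'_def by (auto simp: less_Suc_eq)
  moreover have "upper_triangular U'"
    unfolding U'_def by (rule upper_triangular_four_block) (use cc S LU(4) in auto)
  ultimately show ?case using L'c U'c prod by (auto simp: GL_iff)
qed

lemma eventually_avoid_finite:
  assumes "finite (S :: complex set)"
  shows "eventually (\<lambda>s. s \<notin> S) (at 0)"
proof -
  have "\<forall>y\<in>S. eventually (\<lambda>s::complex. s \<noteq> y) (at 0)"
  proof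
    fix y :: complex assume "y \<in> S"
    show "eventually (\<lambda>s::complex. s \<noteq> y) (at 0)"
    proof (cases "y = 0")
      case True thus ?thesis by (simp add: eventually_at_filter)
    next
      case False
      have "((\<lambda>s::complex. s) \<longlongrightarrow> 0) (at 0)" by (rule tendsto_ident_at)
      thus ?thesis using False by (intro tendsto_imp_eventually_ne) auto
    qed
  qed
  hence "eventually (\<lambda>s::complex. \<forall>y\<in>S. s \<noteq> y) (at 0)"
    by (rule eventually_ball_finite[OF assms])
  thus ?thesis by (rule eventually_mono) auto
qed

text \<open>Along the line g - s the leading minors are, up to sign, characteristic polynomials of
  the leading blocks of g, so all but finitely many points of the line factor as L U. Letting s tend
  to 0 transfers the vanishing to g.\<close>

lemma big_cell_dense:
  assumes F: "reg_on r F"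
    and zero: "\<And>L U. L \<in> carrier (GL r) \<Longrightarrow> U \<in> carrier (GL r) \<Longrightarrow> lower_triangular L \<Longrightarrow>
      upper_triangular U \<Longrightarrow> F (L * U) = 0"
    and g: "g \<in> carrier (GL r)"
  shows "F g = 0"
proof -
  obtain f where f: "f \<in> regular_functions r" "\<And>A. A \<in> carrier (GL r) \<Longrightarrow> F A = f A"
    using F unfolding reg_on_def by blast
  define X where "X s = mat r r (\<lambda>(i, j). g $$ (i, j) - (if i = j then s else 0))" for s
  define S where "S = (\<Union>k\<in>{..r}. {s. poly (char_poly (lead k g)) s = 0})"
  have lc: "lead k A \<in> carrier_mat k k" for k A by (simp add: lead_def)
  have "finite {s. poly (char_poly (lead k g)) s = 0}" for k
  proof (rule poly_roots_finite)
    show "char_poly (lead k g) \<noteq> 0" using degree_monic_char_poly[OF lc, of k g] by auto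
  qed
  hence "finite S" by (simp add: S_def)
  hence ev: "eventually (\<lambda>s. s \<notin> S) (at 0)" by (rule eventually_avoid_finite)
  have det: "det (lead k (X s)) \<noteq> 0" if "s \<notin> S" "k \<le> r" for s k
  proof -
    have "lead k (X s) = char_matrix (lead k g) s"
      using that by (intro eq_matI) (auto simp: lead_def X_def char_matrix_def)
    moreover have "poly (char_poly (lead k g)) s \<noteq> 0" using that by (auto simp: S_def)
    ultimately show ?thesis
      using eigenvalue_det[OF lc, of k g s] eigenvalue_root_char_poly[OF lc, of k g s] by simp
  qed
  have zero': "f (X s) = 0" if s: "s \<notin> S" for s
  proof -
    have "X s \<in> carrier_mat r r" by (simp add: X_def)
    from LU_decomposition[OF this det[OF s]] obtain L U where
      "L \<in> carrier (GL r)" "U \<in> carrier (GL r)" "lower_triangular L" "upper_triangular U" "X s = L * U" by blast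
    thus ?thesis using zero f(2)[OF GL_mult] by metis
  qed
  have "((\<lambda>s. f (X s)) \<longlongrightarrow> f g) (at 0)"
  proof (rule regular_tendsto[OF f(1) _ g])
    show "X s \<in> carrier_mat r r" for s by (simp add: X_def)
    fix i j assume ij: "i < r" "j < r"
    have "((\<lambda>s. g $$ (i, j) - (if i = j then s else 0)) \<longlongrightarrow> g $$ (i, j) - (if i = j then 0 else 0)) (at 0)"
      by (cases "i = j") (auto intro!: tendsto_eq_intros)
    thus "((\<lambda>s. X s $$ (i, j)) \<longlongrightarrow> g $$ (i, j)) (at 0)" using ij by (simp add: X_def)
  qed
  moreover have "eventually (\<lambda>s. f (X s) = 0) (at 0)"
    using ev by (rule eventually_mono) (rule zero')
  ultimately have "((\<lambda>s::complex. 0) \<longlongrightarrow> f g) (at 0)" by (rule Lim_transform_eventually)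
  hence "f g = 0" using LIM_unique tendsto_const by metis
  thus ?thesis using f(2)[OF g] by simp
qed

section \<open>Highest weight vectors\<close>

definition tr :: "complex mat \<Rightarrow> complex" where
  "tr A = (\<Sum>i<dim_row A. A $$ (i, i))"

lemma tr_carrier: "A \<in> carrier_mat n m \<Longrightarrow> tr A = (\<Sum>i<n. A $$ (i, i))"
  by (auto simp: tr_def)

lemma tr_mult_comm:
  assumes "A \<in> carrier_mat n m" "B \<in> carrier_mat m n"
  shows "tr (A * B) = tr (B * A)"
proof -
  have "tr (A * B) = (\<Sum>i<n. \<Sum>l<m. A $$ (i, l) * B $$ (l, i))"
    using assms by (subst tr_carrier[of _ n n]) (auto simp: mult_entry[OF assms] intro!: sum.cong simp del: index_mult_mat)
  also have "\<dots> = (\<Sum>l<m. \<Sum>i<n. B $$ (l, i) * A $$ (i, l))"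
    by (subst sum.swap) (simp add: mult.commute)
  also have "\<dots> = tr (B * A)"
    using assms by (subst tr_carrier[of _ m m]) (auto simp: mult_entry[OF assms(2,1)] intro!: sum.cong simp del: index_mult_mat)
  finally show ?thesis .
qed

section \<open>Permutation matrices and the dominance order\<close>

definition perm_mat :: "nat \<Rightarrow> (nat \<Rightarrow> nat) \<Rightarrow> complex mat" where
  "perm_mat r p = mat r r (\<lambda>(i, j). if j = p i then 1 else 0)"

lemma perm_mat_carrier [simp]: "perm_mat r p \<in> carrier_mat r r"
  by (simp add: perm_mat_def)

lemma perm_mat_GL:
  assumes p: "p permutes {..<r}"
  shows "perm_mat r p \<in> carrier (GL r)"
proof (rule GL_I_right_inverse)
  let ?Q = "mat r r (\<lambda>(i, j). if i = p j then 1 else 0) :: complex mat"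
  show "perm_mat r p \<in> carrier_mat r r" "?Q \<in> carrier_mat r r" by auto
  show "perm_mat r p * ?Q = 1\<^sub>m r"
  proof (rule eq_matI)
    fix i j assume "i < dim_row (1\<^sub>m r :: complex mat)" "j < dim_col (1\<^sub>m r :: complex mat)"
    hence ij: "i < r" "j < r" by auto
    have "(perm_mat r p * ?Q) $$ (i, j) = (\<Sum>l<r. perm_mat r p $$ (i, l) * ?Q $$ (l, j))"
      by (rule mult_entry[OF _ _ ij]) auto
    also have "\<dots> = (\<Sum>l<r. if l = p i then (if p i = p j then 1 else 0) else 0)"
      by (rule sum.cong[OF refl]) (use ij in \<open>auto simp: perm_mat_def\<close>)
    also have "\<dots> = (if p i = p j then 1 else 0)" using permutes_less[OF p ij(1)] by simp
    also have "\<dots> = 1\<^sub>m r $$ (i, j)" using ij permutes_inj[OF p] by (auto simp: inj_def)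
    finally show "(perm_mat r p * ?Q) $$ (i, j) = 1\<^sub>m r $$ (i, j)" .
  qed (auto simp: perm_mat_def)
qed

lemma perm_mat_dg:
  assumes p: "p permutes {..<r}"
  shows "perm_mat r p * dg r t = dg r (t \<circ> p) * perm_mat r p"
proof (rule eq_matI)
  fix i j assume "i < dim_row (dg r (t \<circ> p) * perm_mat r p)" "j < dim_col (dg r (t \<circ> p) * perm_mat r p)"
  hence ij: "i < r" "j < r" by (auto simp: dg_def perm_mat_def)
  show "(perm_mat r p * dg r t) $$ (i, j) = (dg r (t \<circ> p) * perm_mat r p) $$ (i, j)"
    by (subst dg_mult_right[OF perm_mat_carrier ij], subst dg_mult_left[OF perm_mat_carrier ij])
       (use ij in \<open>auto simp: perm_mat_def\<close>)
qed (auto simp: dg_def perm_mat_def)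

definition dominant :: "nat \<Rightarrow> (nat \<Rightarrow> int) \<Rightarrow> bool" where
  "dominant r m \<longleftrightarrow> (\<forall>i j. i \<le> j \<longrightarrow> j < r \<longrightarrow> m j \<le> m i)"

text \<open>Dominance order: m - m' is a combination of the differences e_i - e_(i+1) whose
  coefficients, the partial sums, are nonnegative.\<close>

definition dom_le :: "nat \<Rightarrow> (nat \<Rightarrow> int) \<Rightarrow> (nat \<Rightarrow> int) \<Rightarrow> bool" where
  "dom_le r m' m \<longleftrightarrow> (\<forall>k\<le>r. (\<Sum>i<k. m' i) \<le> (\<Sum>i<k. m i)) \<and> (\<Sum>i<r. m' i) = (\<Sum>i<r. m i)"

text \<open>The gain from exchanging two entries; a weight maximising the pairing with rho therefore
  has no ascents.\<close>

lemma pairing_transpose: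
  assumes "i < j" "j < r"
  shows "pairing r h (m \<circ> Transposition.transpose i j) - pairing r h m = (h i - h j) * (m j - m i)"
proof -
  let ?p = "Transposition.transpose i j"
  have "pairing r h (m \<circ> ?p) - pairing r h m = (\<Sum>x<r. h x * (m (?p x) - m x))"
    by (simp add: pairing_def sum_subtractf right_diff_distrib)
  also have "\<dots> = (\<Sum>x\<in>{i, j}. h x * (m (?p x) - m x))"
    using assms by (intro sum.mono_neutral_right) (auto simp: Transposition.transpose_def)
  also have "\<dots> = (h i - h j) * (m j - m i)"
    using assms by (simp add: algebra_simps)
  finally show ?thesis .
qed

lemma level_part_rho: "upper_triangular B \<Longrightarrow> B \<in> carrier_mat r r \<Longrightarrow> level_part r (rho r) B = dg r (\<lambda>i. B $$ (i, i))"
  by (intro eq_matI) (auto simp: level_part_def rho_def dg_def)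

lemma level_part_uminus_rho: "B \<in> carrier_mat r r \<Longrightarrow> level_part r (\<lambda>i. - rho r i) B = dg r (\<lambda>i. B $$ (i, i))"
  by (intro eq_matI) (auto simp: level_part_def rho_def dg_def)

lemma GL_diag_torus:
  assumes "B \<in> carrier (GL r)" "upper_triangular B \<or> lower_triangular B"
  shows "(\<lambda>i. B $$ (i, i)) \<in> torus r"
proof -
  have B: "B \<in> carrier_mat r r" using assms GL_iff by blast
  have "det B = prod_list (diag_mat B)"
    using assms(2)
  proof
    assume "upper_triangular B" thus ?thesis using det_upper_triangular[OF _ B] by simp
  next
    assume "lower_triangular B" thus ?thesis
      using det_lower_triangular[OF _ B] B by (auto simp: lower_triangular_def)
  qed
  moreover have "det B \<noteq> 0" using assms GL_iff by blast
  ultimately have "0 \<notin> set (diag_mat B)" by auto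
  thus ?thesis using B by (auto simp: torus_def diag_mat_def image_iff)
qed

context rational
begin

definition hwv :: "(nat \<Rightarrow> int) \<Rightarrow> complex vec \<Rightarrow> bool" where
  "hwv m v \<longleftrightarrow> v \<in> carrier_vec d \<and> v \<noteq> 0\<^sub>v d \<and>
     (\<forall>B\<in>carrier (GL r). upper_triangular B \<longrightarrow> R B *\<^sub>v v = lmon r m (\<lambda>i. B $$ (i, i)) \<cdot>\<^sub>v v)"

lemma P_vec_carrier: "x \<in> carrier_vec d \<Longrightarrow> P m *\<^sub>v x \<in> carrier_vec d"
  by (rule mult_mat_vec_carrier[OF P_carrier])

lemma P_nonzero_vec:
  assumes "m \<in> weights"
  obtains x where "x \<in> carrier_vec d" "P m *\<^sub>v x \<noteq> 0\<^sub>v d"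
proof -
  obtain i j where ij: "i < d" "j < d" "wcoeff i j m \<noteq> 0" using assms weights_iff by blast
  have "(P m *\<^sub>v unit_vec d j) $ i = P m $$ (i, j)"
    by (rule mult_unit_vec_entry[OF P_carrier ij(1,2)])
  hence "P m *\<^sub>v unit_vec d j \<noteq> 0\<^sub>v d" using ij by (auto simp: P_entry)
  thus ?thesis by (rule that[OF unit_vec_carrier])
qed

lemma P_P_vec: "x \<in> carrier_vec d \<Longrightarrow> P m *\<^sub>v (P m' *\<^sub>v x) = (if m = m' then P m *\<^sub>v x else 0\<^sub>v d)"
  using assoc_mult_mat_vec[OF P_carrier P_carrier, of x m m'] by (auto simp: P_mult zero_mat_mult_vec)

lemma weight_in_weights:
  assumes "x \<in> carrier_vec d" "x \<noteq> 0\<^sub>v d" "P m *\<^sub>v x = x"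
  shows "m \<in> weights"
proof (rule ccontr)
  assume "m \<notin> weights"
  hence "P m = 0\<^sub>m d d" by (simp add: weights_def)
  thus False using assms by (simp add: zero_mat_mult_vec)
qed

text \<open>Conjugation by a permutation matrix permutes the torus coordinates, so this matrix
  carries weight vectors of m to weight vectors of m o p.\<close>

lemma weights_permute:
  assumes m: "m \<in> weights" and p: "p permutes {..<r}"
  shows "m \<circ> p \<in> weights"
proof -
  obtain x where x: "x \<in> carrier_vec d" "P m *\<^sub>v x \<noteq> 0\<^sub>v d" using P_nonzero_vec[OF m] .
  define y where "y = P m *\<^sub>v x"
  have y: "y \<in> carrier_vec d" "y \<noteq> 0\<^sub>v d" using x P_vec_carrier by (auto simp: y_def)
  let ?Q = "R (perm_mat r p)"
  have Q: "?Q \<in> carrier (GL d)" "?Q \<in> carrier_mat d d" using R_GL[OF perm_mat_GL[OF p]] GL_iff by auto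
  have Qy: "?Q *\<^sub>v y \<in> carrier_vec d" using Q y by auto
  have mexpo: "m \<circ> p \<in> expo r" using m weights_expo expo_permute[OF p] by blast
  have eig: "R (dg r s) *\<^sub>v (?Q *\<^sub>v y) = lmon r (m \<circ> p) s \<cdot>\<^sub>v (?Q *\<^sub>v y)" if s: "s \<in> torus r" for s
  proof -
    define t where "t = s \<circ> Hilbert_Choice.inv p"
    have ip: "Hilbert_Choice.inv p permutes {..<r}" by (rule permutes_inv[OF p])
    have t: "t \<in> torus r" using s permutes_less[OF ip] by (auto simp: t_def torus_def)
    have st: "s = t \<circ> p" using permutes_inverses(2)[OF p] by (simp add: t_def fun_eq_iff)
    have "R (dg r s) *\<^sub>v (?Q *\<^sub>v y) = (R (dg r s) * ?Q) *\<^sub>v y"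
      using Q y R_mat[OF dg_GL[OF s]] by (simp add: assoc_mult_mat_vec[of _ d d _ d])
    also have "R (dg r s) * ?Q = R (dg r s * perm_mat r p)"
      by (rule R_mult[symmetric]) (use dg_GL[OF s] perm_mat_GL[OF p] in auto)
    also have "dg r s * perm_mat r p = perm_mat r p * dg r t"
      using perm_mat_dg[OF p, of t] st by simp
    also have "R \<dots> = ?Q * R (dg r t)"
      by (rule R_mult) (use dg_GL[OF t] perm_mat_GL[OF p] in auto)
    also have "(?Q * R (dg r t)) *\<^sub>v y = ?Q *\<^sub>v (R (dg r t) *\<^sub>v y)"
      using Q y R_mat[OF dg_GL[OF t]] by (simp add: assoc_mult_mat_vec[of _ d d _ d])
    also have "R (dg r t) *\<^sub>v y = lmon r m t \<cdot>\<^sub>v y"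
      unfolding y_def by (rule R_dg_P_vec[OF x(1) t])
    also have "?Q *\<^sub>v (lmon r m t \<cdot>\<^sub>v y) = lmon r m t \<cdot>\<^sub>v (?Q *\<^sub>v y)"
      by (rule mult_mat_vec[OF Q(2) y(1)])
    also have "lmon r m t = lmon r (m \<circ> p) s" using lmon_permute[OF p, of m t] st by simp
    finally show ?thesis .
  qed
  have "?Q *\<^sub>v y \<noteq> 0\<^sub>v d"
  proof
    assume 0: "?Q *\<^sub>v y = 0\<^sub>v d"
    obtain Qi where Qi: "Qi \<in> carrier (GL d)" "Qi * ?Q = 1\<^sub>m d" using GL_inverse[OF Q(1)] by metis
    have "y = (Qi * ?Q) *\<^sub>v y" using Qi y by simp
    also have "\<dots> = Qi *\<^sub>v (?Q *\<^sub>v y)" using GL_mat[OF Qi(1)] Q y by (simp add: assoc_mult_mat_vec[of _ d d _ d])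
    also have "\<dots> = 0\<^sub>v d" using 0 GL_mat[OF Qi(1)] by auto
    finally show False using y by simp
  qed
  thus ?thesis
    using weight_in_weights[OF Qy] weight_vector_P[OF Qy mexpo eig, of "m \<circ> p"] by simp
qed

lemma char_permute:
  assumes p: "p permutes {..<r}" and t: "t \<in> torus r"
  shows "tr (R (dg r (t \<circ> p))) = tr (R (dg r t))"
proof -
  let ?Q = "R (perm_mat r p)"
  have tp: "t \<circ> p \<in> torus r" using t permutes_less[OF p] by (auto simp: torus_def)
  note G = perm_mat_GL[OF p] dg_GL[OF t] dg_GL[OF tp]
  have Q: "?Q \<in> carrier (GL d)" using R_GL[OF G(1)] .
  obtain Qi where Qi: "Qi \<in> carrier (GL d)" "?Q * Qi = 1\<^sub>m d" "Qi * ?Q = 1\<^sub>m d" using GL_inverse[OF Q] by metis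
  note c = GL_mat[OF Q] GL_mat[OF Qi(1)] R_mat[OF G(2)] R_mat[OF G(3)]
  have eq: "?Q * R (dg r t) = R (dg r (t \<circ> p)) * ?Q"
    using perm_mat_dg[OF p, of t] R_mult[OF G(1,2)] R_mult[OF G(3,1)] by simp
  have "R (dg r (t \<circ> p)) = R (dg r (t \<circ> p)) * (?Q * Qi)" using c Qi by simp
  also have "\<dots> = (?Q * R (dg r t)) * Qi" using c by (simp add: eq assoc_mult_mat[of _ d d _ d _ d])
  finally have "tr (R (dg r (t \<circ> p))) = tr ((?Q * R (dg r t)) * Qi)" by simp
  also have "\<dots> = tr (Qi * (?Q * R (dg r t)))" by (rule tr_mult_comm[of _ d d]) (use c in auto)
  also have "Qi * (?Q * R (dg r t)) = (Qi * ?Q) * R (dg r t)"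
    using c by (simp add: assoc_mult_mat[of _ d d _ d _ d])
  also have "\<dots> = R (dg r t)" using c Qi by simp
  finally show ?thesis .
qed

text \<open>The degeneration argument on vectors. When the level part is diagonal, equality of the
  pairings leaves just the torus action on the given weight space.\<close>

lemma triangular_P:
  assumes B: "B \<in> carrier (GL r)" and x: "x \<in> carrier_vec d"
    and h: "\<And>i j. i < r \<Longrightarrow> j < r \<Longrightarrow> h i < h j \<Longrightarrow> B $$ (i, j) = 0"
  shows "pairing r h m' < pairing r h m \<Longrightarrow> P m' *\<^sub>v (R B *\<^sub>v (P m *\<^sub>v x)) = 0\<^sub>v d"
    and "pairing r h m' = pairing r h m \<Longrightarrow> level_part r h B = dg r (\<lambda>i. B $$ (i, i)) \<Longrightarrow>
      (\<lambda>i. B $$ (i, i)) \<in> torus r \<Longrightarrow>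
      P m' *\<^sub>v (R B *\<^sub>v (P m *\<^sub>v x)) = (if m' = m then lmon r m (\<lambda>i. B $$ (i, i)) \<cdot>\<^sub>v (P m *\<^sub>v x) else 0\<^sub>v d)"
proof -
  have RB: "R B \<in> carrier_mat d d" using B by blast
  have eq: "P m' *\<^sub>v (A *\<^sub>v (P m *\<^sub>v x)) = (P m' * A * P m) *\<^sub>v x" if "A \<in> carrier_mat d d" for A
    by (simp only: assoc_mult_mat_vec[OF mult_square_carrier[OF P_carrier that] P_carrier x]
        assoc_mult_mat_vec[OF P_carrier that P_vec_carrier[OF x]])
  {
    assume "pairing r h m' < pairing r h m"
    from P_R_P_degenerate(1)[OF B h this] show "P m' *\<^sub>v (R B *\<^sub>v (P m *\<^sub>v x)) = 0\<^sub>v d"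
      using x by (simp add: eq[OF RB] zero_mat_mult_vec)
  }
  assume q: "pairing r h m' = pairing r h m" and lev: "level_part r h B = dg r (\<lambda>i. B $$ (i, i))"
    and tor: "(\<lambda>i. B $$ (i, i)) \<in> torus r"
  have "P m' *\<^sub>v (R B *\<^sub>v (P m *\<^sub>v x)) = (P m' * R (dg r (\<lambda>i. B $$ (i, i))) * P m) *\<^sub>v x"
    using P_R_P_degenerate(2)[OF B h q] by (simp add: eq[OF RB] lev)
  also have "\<dots> = P m' *\<^sub>v (R (dg r (\<lambda>i. B $$ (i, i))) *\<^sub>v (P m *\<^sub>v x))"
    by (rule eq[symmetric]) (rule R_mat[OF dg_GL[OF tor]])
  also have "\<dots> = P m' *\<^sub>v (lmon r m (\<lambda>i. B $$ (i, i)) \<cdot>\<^sub>v (P m *\<^sub>v x))"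
    by (simp add: R_dg_P_vec[OF x tor])
  also have "\<dots> = lmon r m (\<lambda>i. B $$ (i, i)) \<cdot>\<^sub>v (P m' *\<^sub>v (P m *\<^sub>v x))"
    by (rule mult_mat_vec[OF P_carrier P_vec_carrier[OF x]])
  finally show "P m' *\<^sub>v (R B *\<^sub>v (P m *\<^sub>v x)) = (if m' = m then lmon r m (\<lambda>i. B $$ (i, i)) \<cdot>\<^sub>v (P m *\<^sub>v x) else 0\<^sub>v d)"
    by (simp add: P_P_vec[OF x] smult_zero_vec)
qed

text \<open>A weight with the largest pairing with rho works: upper triangular matrices reach only
  weights of larger or equal pairing, and on equal pairing they act through their diagonal. It is
  dominant because exchanging an ascent would increase the pairing.\<close>

lemma hwv_exists:
  assumes d: "d > 0"
  obtains m v where "m \<in> weights" "dominant r m" "hwv m v"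
proof -
  have "weights \<noteq> {}"
  proof
    assume "weights = {}"
    thus False using P_sum[of 0 0] d by simp
  qed
  hence "Max (pairing r (rho r) ` weights) \<in> pairing r (rho r) ` weights"
    using finite_weights by (intro Max_in) auto
  then obtain m where m: "m \<in> weights" "pairing r (rho r) m = Max (pairing r (rho r) ` weights)"
    by (metis imageE)
  have m: "m \<in> weights" "\<And>m'. m' \<in> weights \<Longrightarrow> pairing r (rho r) m' \<le> pairing r (rho r) m"
    using m finite_weights by auto
  have "m j \<le> m i" if "i < j" "j < r" for i j
  proof (rule ccontr)
    assume "\<not> m j \<le> m i"
    let ?p = "Transposition.transpose i j"
    have "?p permutes {..<r}" using that by (simp add: permutes_swap_id)
    hence "m \<circ> ?p \<in> weights" by (rule weights_permute[OF m(1)])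
    hence "(rho r i - rho r j) * (m j - m i) \<le> 0"
      using m(2) pairing_transpose[OF that, of "rho r" m] by fastforce
    moreover have "rho r i - rho r j > 0" using that by (auto simp: rho_def)
    ultimately show False using \<open>\<not> m j \<le> m i\<close> by (simp add: mult_le_0_iff)
  qed
  hence dom: "dominant r m" unfolding dominant_def by (metis le_neq_implies_less order_refl)
  obtain x where x: "x \<in> carrier_vec d" "P m *\<^sub>v x \<noteq> 0\<^sub>v d" using P_nonzero_vec[OF m(1)] .
  have "R B *\<^sub>v (P m *\<^sub>v x) = lmon r m (\<lambda>i. B $$ (i, i)) \<cdot>\<^sub>v (P m *\<^sub>v x)"
    if B: "B \<in> carrier (GL r)" "upper_triangular B" for B
  proof (rule eq_vecI)
    let ?b = "\<lambda>i. B $$ (i, i)"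
    have Bc: "B \<in> carrier_mat r r" using B GL_iff by blast
    have h: "B $$ (i, j) = 0" if "i < r" "j < r" "rho r i < rho r j" for i j
      using that B(2) Bc by (auto simp: rho_def split: if_splits)
    fix i assume "i < dim_vec (lmon r m ?b \<cdot>\<^sub>v (P m *\<^sub>v x))"
    hence i: "i < d" by (simp add: P_def)
    have y: "R B *\<^sub>v (P m *\<^sub>v x) \<in> carrier_vec d"
      by (rule mult_mat_vec_carrier[OF R_mat[OF B(1)] P_vec_carrier[OF x(1)]])
    have "P m' *\<^sub>v (R B *\<^sub>v (P m *\<^sub>v x)) = (if m' = m then lmon r m ?b \<cdot>\<^sub>v (P m *\<^sub>v x) else 0\<^sub>v d)"
      if m': "m' \<in> weights" for m'
    proof (cases "pairing r (rho r) m' = pairing r (rho r) m")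
      case True
      show ?thesis
        by (rule triangular_P(2)[OF B(1) x(1) h True level_part_rho[OF B(2) Bc] GL_diag_torus[OF B(1)]])
           (use B in auto)
    next
      case False
      hence lt: "pairing r (rho r) m' < pairing r (rho r) m" using m(2)[OF m'] by simp
      show ?thesis using triangular_P(1)[OF B(1) x(1) h lt] lt by auto
    qed
    hence "(R B *\<^sub>v (P m *\<^sub>v x)) $ i = (\<Sum>m'\<in>weights. (if m' = m then lmon r m ?b \<cdot>\<^sub>v (P m *\<^sub>v x) else 0\<^sub>v d) $ i)"
      by (subst vec_weight_sum[OF y i]) (rule sum.cong, auto)
    also have "\<dots> = (\<Sum>m'\<in>weights. if m' = m then (lmon r m ?b \<cdot>\<^sub>v (P m *\<^sub>v x)) $ i else 0)"
      using i by (intro sum.cong) auto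
    also have "\<dots> = (lmon r m ?b \<cdot>\<^sub>v (P m *\<^sub>v x)) $ i" using m(1) finite_weights by simp
    finally show "(R B *\<^sub>v (P m *\<^sub>v x)) $ i = (lmon r m ?b \<cdot>\<^sub>v (P m *\<^sub>v x)) $ i" .
  qed (use R_mat[OF B(1)] in \<open>auto simp: P_def\<close>)
  hence "hwv m (P m *\<^sub>v x)" using x P_vec_carrier by (auto simp: hwv_def)
  thus ?thesis using that m dom by blast
qed

lemma hwv_P:
  assumes "hwv m v" "m \<in> expo r"
  shows "P m' *\<^sub>v v = (if m' = m then v else 0\<^sub>v d)"
proof (rule weight_vector_P)
  show "v \<in> carrier_vec d" "m \<in> expo r" using assms by (auto simp: hwv_def)
  fix t assume t: "t \<in> torus r"
  have "lmon r m (\<lambda>i. dg r t $$ (i, i)) = lmon r m t"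
    unfolding lmon_def by (rule prod.cong) (auto simp: dg_entry)
  thus "R (dg r t) *\<^sub>v v = lmon r m t \<cdot>\<^sub>v v"
    using assms dg_GL[OF t] dg_upper[of r t] by (simp add: hwv_def)
qed

text \<open>U acts on v by a scalar, and L can only lower weights in the dominance order. Each
  failing inequality of the order is detected by a one-parameter subgroup for which L satisfies the
  vanishing condition of the degeneration.\<close>

lemma hwv_big_cell:
  assumes v: "hwv m v" and m: "m \<in> expo r"
    and L: "L \<in> carrier (GL r)" "lower_triangular L" and U: "U \<in> carrier (GL r)" "upper_triangular U"
  shows "\<not> dom_le r m' m \<Longrightarrow> P m' *\<^sub>v (R (L * U) *\<^sub>v v) = 0\<^sub>v d"
    and "P m *\<^sub>v (R (L * U) *\<^sub>v v) = (lmon r m (\<lambda>i. U $$ (i, i)) * lmon r m (\<lambda>i. L $$ (i, i))) \<cdot>\<^sub>v v"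
proof -
  let ?u = "lmon r m (\<lambda>i. U $$ (i, i))"
  have vc: "v \<in> carrier_vec d" using v by (simp add: hwv_def)
  have Pv: "P m *\<^sub>v v = v" using hwv_P[OF v m] by simp
  have Lc: "L \<in> carrier_mat r r" using L GL_iff by blast
  have "R (L * U) *\<^sub>v v = R L *\<^sub>v (R U *\<^sub>v v)"
    using R_mult[OF L(1) U(1)] R_mat[OF L(1)] R_mat[OF U(1)] vc by (simp add: assoc_mult_mat_vec[of _ d d _ d])
  also have "R U *\<^sub>v v = ?u \<cdot>\<^sub>v v" using v U by (simp add: hwv_def)
  also have "R L *\<^sub>v (?u \<cdot>\<^sub>v v) = ?u \<cdot>\<^sub>v (R L *\<^sub>v v)" by (rule mult_mat_vec[OF R_mat[OF L(1)] vc])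
  finally have "P m' *\<^sub>v (R (L * U) *\<^sub>v v) = ?u \<cdot>\<^sub>v (P m' *\<^sub>v (R L *\<^sub>v v))" for m'
    using mult_mat_vec[OF P_carrier mult_mat_vec_carrier[OF R_mat[OF L(1)] vc]] by simp
  hence red: "P m' *\<^sub>v (R (L * U) *\<^sub>v v) = ?u \<cdot>\<^sub>v (P m' *\<^sub>v (R L *\<^sub>v (P m *\<^sub>v v)))" for m'
    by (simp add: Pv)
  have low: "L $$ (i, j) = 0" if "i < r" "j < r" "i < j" for i j
    using L(2) Lc that by (auto simp: lower_triangular_def)
  show "P m *\<^sub>v (R (L * U) *\<^sub>v v) = (?u * lmon r m (\<lambda>i. L $$ (i, i))) \<cdot>\<^sub>v v"
  proof -
    have h: "L $$ (i, j) = 0" if "i < r" "j < r" "- rho r i < - rho r j" for i j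
      using that by (intro low) (auto simp: rho_def)
    have "P m *\<^sub>v (R L *\<^sub>v (P m *\<^sub>v v)) = (if m = m then lmon r m (\<lambda>i. L $$ (i, i)) \<cdot>\<^sub>v (P m *\<^sub>v v) else 0\<^sub>v d)"
      by (rule triangular_P(2)[OF L(1) vc h refl level_part_uminus_rho[OF Lc] GL_diag_torus[OF L(1)]]) (use L in auto)
    thus ?thesis using red[of m] by (simp add: Pv smult_smult_assoc)
  qed
  assume "\<not> dom_le r m' m"
  then consider k where "k \<le> r" "(\<Sum>i<k. m i) < (\<Sum>i<k. m' i)" | "(\<Sum>i<r. m' i) < (\<Sum>i<r. m i)"
  proof (cases "\<exists>k\<le>r. (\<Sum>i<k. m i) < (\<Sum>i<k. m' i)")
    case True thus ?thesis using that by blast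
  next
    case False
    hence "\<forall>k\<le>r. (\<Sum>i<k. m' i) \<le> (\<Sum>i<k. m i)" by (simp add: not_less)
    moreover from this have "(\<Sum>i<r. m' i) \<le> (\<Sum>i<r. m i)" by simp
    ultimately show ?thesis using that(2) \<open>\<not> dom_le r m' m\<close> by (auto simp: dom_le_def)
  qed
  hence "P m' *\<^sub>v (R L *\<^sub>v (P m *\<^sub>v v)) = 0\<^sub>v d"
  proof cases
    case 1
    \<comment> \<open>Weight -1 on the first k coordinates turns an excess of the k-th partial sum
      of m' into a smaller pairing, and L has no entries in the forbidden block.\<close>
    have pair: "pairing r (\<lambda>i. if i < k then - 1 else 0) x = - (\<Sum>i<k. x i)" for x
    proof -
      have "pairing r (\<lambda>i. if i < k then - 1 else 0) x = (\<Sum>i<r. if i < k then - x i else 0)"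
        unfolding pairing_def by (rule sum.cong) auto
      also have "\<dots> = (\<Sum>i<k. - x i)"
        by (rule sum.mono_neutral_cong_right) (use 1 in auto)
      finally show ?thesis by (simp add: sum_negf)
    qed
    show ?thesis
      by (rule triangular_P(1)[OF L(1) vc, of "\<lambda>i. if i < k then - 1 else 0"])
         (use low 1 in \<open>auto simp: pair split: if_splits\<close>)
  next
    \<comment> \<open>Constant h means conjugation by scalars. A total above that of m is the
      previous case with k = r.\<close>
    case 2
    show ?thesis
      by (rule triangular_P(1)[OF L(1) vc, of "\<lambda>i. 1"]) (use 2 in \<open>auto simp: pairing_def\<close>)
  qed
  thus "P m' *\<^sub>v (R (L * U) *\<^sub>v v) = 0\<^sub>v d" using red[of m'] by (simp add: smult_zero_vec)
qed

lemma matrix_coeff_reg_on: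
  assumes "v \<in> carrier_vec d" "i < d"
  shows "reg_on r (\<lambda>A. (P m *\<^sub>v (R A *\<^sub>v v)) $ i)"
proof (rule reg_on_cong)
  show "reg_on r (\<lambda>A. \<Sum>l<d. P m $$ (i, l) * (\<Sum>k<d. v $ k * R A $$ (l, k)))"
    by (intro reg_on_sum reg_on_scale R_reg_on) auto
  fix A assume A: "A \<in> carrier (GL r)"
  have RA: "R A \<in> carrier_mat d d" using A by blast
  show "(\<Sum>l<d. P m $$ (i, l) * (\<Sum>k<d. v $ k * R A $$ (l, k))) = (P m *\<^sub>v (R A *\<^sub>v v)) $ i"
    by (subst mult_vec_entry[OF P_carrier mult_mat_vec_carrier[OF RA assms(1)] assms(2)],
        rule sum.cong[OF refl], subst mult_vec_entry[OF RA assms(1)]) (auto simp: mult.commute)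
qed

text \<open>Each coordinate of the projected orbit is regular in g and vanishes on the big
  cell.\<close>

lemma hwv_orbit_dom_le:
  assumes v: "hwv m v" "m \<in> expo r" and "\<not> dom_le r m' m" and g: "g \<in> carrier (GL r)"
  shows "P m' *\<^sub>v (R g *\<^sub>v v) = 0\<^sub>v d"
proof (rule eq_vecI)
  have vc: "v \<in> carrier_vec d" using v by (simp add: hwv_def)
  fix i assume "i < dim_vec (0\<^sub>v d :: complex vec)"
  hence i: "i < d" by simp
  have "(P m' *\<^sub>v (R g *\<^sub>v v)) $ i = 0"
    by (rule big_cell_dense[OF matrix_coeff_reg_on[OF vc i] _ g])
       (use hwv_big_cell(1)[OF v _ _ _ _ assms(3)] i in auto)
  thus "(P m' *\<^sub>v (R g *\<^sub>v v)) $ i = 0\<^sub>v d $ i" using i by simp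
qed (simp add: P_def)

text \<open>Proportionality to v is the vanishing of the minors y_i v_k - y_k v_i for one k with v_k
  nonzero. These are regular in g, so the big cell decides.\<close>

lemma hwv_orbit_line:
  assumes v: "hwv m v" "m \<in> expo r" and g: "g \<in> carrier (GL r)"
  shows "\<exists>c. P m *\<^sub>v (R g *\<^sub>v v) = c \<cdot>\<^sub>v v"
proof -
  have vc: "v \<in> carrier_vec d" using v by (simp add: hwv_def)
  have "\<exists>k<d. v $ k \<noteq> 0"
  proof (rule ccontr)
    assume "\<not> (\<exists>k<d. v $ k \<noteq> 0)"
    hence "v = 0\<^sub>v d" using vc by (intro eq_vecI) auto
    thus False using v by (simp add: hwv_def)
  qed
  then obtain k where k: "k < d" "v $ k \<noteq> 0" by blast
  let ?y = "P m *\<^sub>v (R g *\<^sub>v v)"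
  have eq: "?y $ i * v $ k - ?y $ k * v $ i = 0" if i: "i < d" for i
  proof (rule big_cell_dense[OF _ _ g])
    have "reg_on r (\<lambda>A. v $ k * (P m *\<^sub>v (R A *\<^sub>v v)) $ i - v $ i * (P m *\<^sub>v (R A *\<^sub>v v)) $ k)"
      by (intro reg_on_diff reg_on_scale matrix_coeff_reg_on vc i k)
    thus "reg_on r (\<lambda>A. (P m *\<^sub>v (R A *\<^sub>v v)) $ i * v $ k - (P m *\<^sub>v (R A *\<^sub>v v)) $ k * v $ i)"
      by (rule reg_on_cong) (simp add: mult.commute)
    fix L U assume LU: "L \<in> carrier (GL r)" "U \<in> carrier (GL r)" "lower_triangular L" "upper_triangular U"
    show "(P m *\<^sub>v (R (L * U) *\<^sub>v v)) $ i * v $ k - (P m *\<^sub>v (R (L * U) *\<^sub>v v)) $ k * v $ i = 0"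
      unfolding hwv_big_cell(2)[OF v LU(1,3,2,4)] using i k vc by simp
  qed
  have "?y = (?y $ k / v $ k) \<cdot>\<^sub>v v"
  proof (rule eq_vecI)
    fix i assume "i < dim_vec ((?y $ k / v $ k) \<cdot>\<^sub>v v)"
    hence i: "i < d" using vc by simp
    thus "?y $ i = ((?y $ k / v $ k) \<cdot>\<^sub>v v) $ i" using eq[OF i] k vc by (simp add: field_simps del: index_mult_mat_vec)
  qed (use vc in \<open>simp add: P_def\<close>)
  thus ?thesis by blast
qed

end

section \<open>Irreducible representations and their highest weight space\<close>

lemma subspaceI:
  assumes "W \<subseteq> carrier_vec n" "0\<^sub>v n \<in> W" "\<And>x y. x \<in> W \<Longrightarrow> y \<in> W \<Longrightarrow> x + y \<in> W"
    "\<And>c x. x \<in> W \<Longrightarrow> c \<cdot>\<^sub>v x \<in> W"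
  shows "VectorSpace.subspace class_ring W (module_vec TYPE(complex) n)"
  unfolding VectorSpace.subspace_def submodule_def
  using vec_vs[where 'a = complex and n = n] vec_module[where 'a = complex and n = n] assms by (auto simp: module_vec_simps)

lemma subspaceD:
  assumes "VectorSpace.subspace class_ring W (module_vec TYPE(complex) n)"
  shows "W \<subseteq> carrier_vec n" "0\<^sub>v n \<in> W" "\<And>x y. x \<in> W \<Longrightarrow> y \<in> W \<Longrightarrow> x + y \<in> W"
    "\<And>c x. x \<in> W \<Longrightarrow> c \<cdot>\<^sub>v x \<in> W"
  using assms unfolding VectorSpace.subspace_def submodule_def
  by (auto simp: module_vec_simps class_ring_simps)

lemma irreducible_invariant:
  assumes irr: "irreducible_rep r d R"
    and W: "W \<subseteq> carrier_vec d" "0\<^sub>v d \<in> W" "\<And>x y. x \<in> W \<Longrightarrow> y \<in> W \<Longrightarrow> x + y \<in> W"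
    "\<And>c x. x \<in> W \<Longrightarrow> c \<cdot>\<^sub>v x \<in> W"
    and inv: "\<And>A x. A \<in> carrier (GL r) \<Longrightarrow> x \<in> W \<Longrightarrow> R A *\<^sub>v x \<in> W"
    and v: "v \<in> W" "v \<noteq> 0\<^sub>v d"
  shows "W = carrier_vec d"
proof -
  have "W = {0\<^sub>v d} \<or> W = carrier_vec d"
    using irr subspaceI[OF W] inv unfolding irreducible_rep_def by blast
  thus ?thesis using v by blast
qed

locale irreducible = rational +
  fixes m :: "nat \<Rightarrow> int" and v :: "complex vec"
  assumes irred: "irreducible_rep r d R" and hw: "hwv m v" and m_expo: "m \<in> expo r"
begin

lemma v_carrier: "v \<in> carrier_vec d" and v_nonzero: "v \<noteq> 0\<^sub>v d"
  using hw by (auto simp: hwv_def)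

lemma R_comp: "A \<in> carrier (GL r) \<Longrightarrow> B \<in> carrier (GL r) \<Longrightarrow> x \<in> carrier_vec d \<Longrightarrow>
    R A *\<^sub>v (R B *\<^sub>v x) = R (A * B) *\<^sub>v x"
  using R_mult[of A B] R_mat[of A] R_mat[of B] by (simp add: assoc_mult_mat_vec[of _ d d _ d])

lemma R_vec: "A \<in> carrier (GL r) \<Longrightarrow> x \<in> carrier_vec d \<Longrightarrow> R A *\<^sub>v x \<in> carrier_vec d"
  using R_mat[of A] by auto

lemma R_add: "A \<in> carrier (GL r) \<Longrightarrow> x \<in> carrier_vec d \<Longrightarrow> y \<in> carrier_vec d \<Longrightarrow>
    R A *\<^sub>v (x + y) = R A *\<^sub>v x + R A *\<^sub>v y"
  using R_mat[of A] by (simp add: mult_add_distrib_mat_vec[of _ d d])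

lemma R_smult: "A \<in> carrier (GL r) \<Longrightarrow> x \<in> carrier_vec d \<Longrightarrow> R A *\<^sub>v (c \<cdot>\<^sub>v x) = c \<cdot>\<^sub>v (R A *\<^sub>v x)"
  using R_mat[of A] by (simp add: mult_mat_vec[of _ d d])

lemma R_zero: "A \<in> carrier (GL r) \<Longrightarrow> R A *\<^sub>v 0\<^sub>v d = 0\<^sub>v d"
  using R_mat[of A] by auto

lemma P_add: "x \<in> carrier_vec d \<Longrightarrow> y \<in> carrier_vec d \<Longrightarrow> P k *\<^sub>v (x + y) = P k *\<^sub>v x + P k *\<^sub>v y"
  by (rule mult_add_distrib_mat_vec[OF P_carrier])

lemma P_smult: "x \<in> carrier_vec d \<Longrightarrow> P k *\<^sub>v (c \<cdot>\<^sub>v x) = c \<cdot>\<^sub>v (P k *\<^sub>v x)"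
  by (rule mult_mat_vec[OF P_carrier])

lemma P_zero: "P k *\<^sub>v 0\<^sub>v d = 0\<^sub>v d"
  by (auto simp: P_def)

lemma P_v: "P m *\<^sub>v v = v"
  using hwv_P[OF hw m_expo] by simp

lemma m_weight: "m \<in> weights"
  by (rule weight_in_weights[OF v_carrier v_nonzero P_v])

text \<open>Vectors whose whole orbit has no component of weight m' form an invariant subspace. It
  contains v, hence is everything.\<close>

lemma weights_dom_le:
  assumes m': "m' \<in> weights"
  shows "dom_le r m' m"
proof (rule ccontr)
  assume nd: "\<not> dom_le r m' m"
  define W where "W = {x\<in>carrier_vec d. \<forall>h\<in>carrier (GL r). P m' *\<^sub>v (R h *\<^sub>v x) = 0\<^sub>v d}"
  have "W = carrier_vec d"
  proof (rule irreducible_invariant[OF irred])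
    show "v \<in> W" using hwv_orbit_dom_le[OF hw m_expo nd] v_carrier by (auto simp: W_def)
    show "v \<noteq> 0\<^sub>v d" by (rule v_nonzero)
    show "R A *\<^sub>v x \<in> W" if "A \<in> carrier (GL r)" "x \<in> W" for A x
      using that by (auto simp: W_def R_comp GL_mult R_vec)
  qed (auto simp: W_def R_add R_smult R_zero P_add P_smult P_zero R_vec)
  moreover obtain x where x: "x \<in> carrier_vec d" "P m' *\<^sub>v x \<noteq> 0\<^sub>v d" using P_nonzero_vec[OF m'] .
  ultimately have "P m' *\<^sub>v (R (1\<^sub>m r) *\<^sub>v x) = 0\<^sub>v d" using GL_one by (auto simp: W_def)
  thus False using x by (simp add: R_one)
qed

text \<open>The vectors whose orbit projects into the line of v are an invariant subspace containing
  v. So the highest weight space is one-dimensional.\<close>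

lemma P_line:
  assumes x: "x \<in> carrier_vec d"
  shows "\<exists>c. P m *\<^sub>v x = c \<cdot>\<^sub>v v"
proof -
  define W where "W = {x\<in>carrier_vec d. \<forall>h\<in>carrier (GL r). \<exists>c. P m *\<^sub>v (R h *\<^sub>v x) = c \<cdot>\<^sub>v v}"
  have "W = carrier_vec d"
  proof (rule irreducible_invariant[OF irred])
    show "v \<in> W" using hwv_orbit_line[OF hw m_expo] v_carrier by (auto simp: W_def)
    show "v \<noteq> 0\<^sub>v d" by (rule v_nonzero)
    show "R A *\<^sub>v x \<in> W" if "A \<in> carrier (GL r)" "x \<in> W" for A x
      using that by (auto simp: W_def R_comp GL_mult R_vec)
    show "W \<subseteq> carrier_vec d" by (auto simp: W_def)
    have "P m *\<^sub>v (R h *\<^sub>v 0\<^sub>v d) = 0 \<cdot>\<^sub>v v" if "h \<in> carrier (GL r)" for h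
      using v_carrier that by (auto simp: R_zero P_zero)
    hence "\<forall>h\<in>carrier (GL r). \<exists>c. P m *\<^sub>v (R h *\<^sub>v 0\<^sub>v d) = c \<cdot>\<^sub>v v" by metis
    thus "0\<^sub>v d \<in> W" unfolding W_def by simp
    show "x + y \<in> W" if xy: "x \<in> W" "y \<in> W" for x y
    proof -
      have "\<exists>c. P m *\<^sub>v (R h *\<^sub>v (x + y)) = c \<cdot>\<^sub>v v" if h: "h \<in> carrier (GL r)" for h
      proof -
        obtain a where a: "P m *\<^sub>v (R h *\<^sub>v x) = a \<cdot>\<^sub>v v"
          using xy(1) h unfolding W_def by blast
        obtain b where b: "P m *\<^sub>v (R h *\<^sub>v y) = b \<cdot>\<^sub>v v"
          using xy(2) h unfolding W_def by blast
        from a b have "P m *\<^sub>v (R h *\<^sub>v (x + y)) = (a + b) \<cdot>\<^sub>v v"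
          using xy h by (simp add: W_def R_add P_add R_vec add_smult_distrib_vec)
        thus ?thesis by blast
      qed
      thus ?thesis using xy by (auto simp: W_def)
    qed
    show "c \<cdot>\<^sub>v x \<in> W" if x: "x \<in> W" for c x
    proof -
      have "\<exists>b. P m *\<^sub>v (R h *\<^sub>v (c \<cdot>\<^sub>v x)) = b \<cdot>\<^sub>v v" if h: "h \<in> carrier (GL r)" for h
      proof -
        obtain a where "P m *\<^sub>v (R h *\<^sub>v x) = a \<cdot>\<^sub>v v" using x h unfolding W_def by blast
        hence "P m *\<^sub>v (R h *\<^sub>v (c \<cdot>\<^sub>v x)) = (c * a) \<cdot>\<^sub>v v"
          using x h by (simp add: W_def R_smult P_smult R_vec smult_smult_assoc)
        thus ?thesis by blast
      qed
      thus ?thesis using x by (auto simp: W_def)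
    qed
  qed
  hence "\<exists>c. P m *\<^sub>v (R (1\<^sub>m r) *\<^sub>v x) = c \<cdot>\<^sub>v v" using x GL_one by (auto simp: W_def)
  thus ?thesis using x by (simp add: R_one)
qed

text \<open>\<open>P m\<close> has rank one, with entries c_j v_i; since it fixes v, the sum of the
  c_l v_l, which is the trace, is 1.\<close>

lemma tr_P_highest: "tr (P m) = 1"
proof -
  have "\<forall>j. \<exists>c. j < d \<longrightarrow> P m *\<^sub>v unit_vec d j = c \<cdot>\<^sub>v v"
    using P_line by (metis unit_vec_carrier)
  then obtain c where c: "\<And>j. j < d \<Longrightarrow> P m *\<^sub>v unit_vec d j = c j \<cdot>\<^sub>v v" by metis
  have e: "P m $$ (i, j) = c j * v $ i" if "i < d" "j < d" for i j
  proof -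
    have "(P m *\<^sub>v unit_vec d j) $ i = P m $$ (i, j)"
      by (rule mult_unit_vec_entry[OF P_carrier that])
    thus ?thesis using c[OF that(2)] that v_carrier by simp
  qed
  obtain k where k: "k < d" "v $ k \<noteq> 0"
  proof -
    have "\<exists>k<d. v $ k \<noteq> 0"
    proof (rule ccontr)
      assume "\<not> (\<exists>k<d. v $ k \<noteq> 0)"
      hence "v = 0\<^sub>v d" using v_carrier by (intro eq_vecI) auto
      thus False using v_nonzero by simp
    qed
    thus ?thesis using that by blast
  qed
  have "v $ k = (\<Sum>l<d. P m $$ (k, l) * v $ l)"
    using mult_vec_entry[OF P_carrier v_carrier k(1), of m] by (simp add: P_v)
  also have "\<dots> = v $ k * (\<Sum>l<d. c l * v $ l)"
    using k by (simp add: e sum_distrib_left mult_ac)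
  finally have "(\<Sum>l<d. c l * v $ l) = 1" using k by simp
  thus ?thesis by (simp add: tr_carrier[OF P_carrier] e)
qed

end

section \<open>Uniqueness of irreducible representations\<close>

definition rep_equiv :: "nat \<Rightarrow> nat \<Rightarrow> (complex mat \<Rightarrow> complex mat) \<Rightarrow> (complex mat \<Rightarrow> complex mat) \<Rightarrow> bool" where
  "rep_equiv r d R R' \<longleftrightarrow> (\<exists>T\<in>carrier (GL d). \<forall>A\<in>carrier (GL r). T * R A = R' A * T)"

text \<open>The graph of the isomorphism that sends v to v'.\<close>

definition linked where
  "linked r m d R v d' R' v' x x' \<longleftrightarrow> x \<in> carrier_vec d \<and> x' \<in> carrier_vec d' \<and>
     (\<forall>h\<in>carrier (GL r). \<exists>c. rational.P r d R m *\<^sub>v (R h *\<^sub>v x) = c \<cdot>\<^sub>v v \<and>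
        rational.P r d' R' m *\<^sub>v (R' h *\<^sub>v x') = c \<cdot>\<^sub>v v')"

lemma linked_swap: "linked r m d R v d' R' v' x x' \<longleftrightarrow> linked r m d' R' v' d R v x' x"
  unfolding linked_def by (simp add: conj_commute) blast

lemma mat_eq_by_vec:
  fixes A B :: "complex mat"
  assumes "A \<in> carrier_mat n m" "B \<in> carrier_mat n m" "\<And>x. x \<in> carrier_vec m \<Longrightarrow> A *\<^sub>v x = B *\<^sub>v x"
  shows "A = B"
proof (rule eq_matI)
  fix i j assume "i < dim_row B" "j < dim_col B"
  hence ij: "i < n" "j < m" using assms by auto
  show "A $$ (i, j) = B $$ (i, j)"
    using assms(3)[OF unit_vec_carrier, of j] mult_unit_vec_entry[OF assms(1) ij] mult_unit_vec_entry[OF assms(2) ij]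
    by simp
qed (use assms in auto)

lemma nonzero_vec_entry:
  assumes "v \<in> carrier_vec d" "v \<noteq> 0\<^sub>v d"
  obtains k where "k < d" "(v :: complex vec) $ k \<noteq> 0"
proof -
  have "\<exists>k<d. v $ k \<noteq> 0"
  proof (rule ccontr)
    assume "\<not> (\<exists>k<d. v $ k \<noteq> 0)"
    hence "v = 0\<^sub>v d" using assms(1) by (intro eq_vecI) auto
    thus False using assms by simp
  qed
  thus ?thesis using that by blast
qed

locale irreducible_pair = V: irreducible r d R m v + V': irreducible r d' R' m v'
  for r d d' :: nat and R R' :: "complex mat \<Rightarrow> complex mat" and m :: "nat \<Rightarrow> int" and v v' :: "complex vec"
begin

abbreviation \<Gamma> where "\<Gamma> \<equiv> linked r m d R v d' R' v'"

lemma link_carrier: "\<Gamma> x x' \<Longrightarrow> x \<in> carrier_vec d" "\<Gamma> x x' \<Longrightarrow> x' \<in> carrier_vec d'"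
  by (auto simp: linked_def)

lemma link_add:
  assumes "\<Gamma> x x'" "\<Gamma> y y'" shows "\<Gamma> (x + y) (x' + y')"
proof -
  note c = link_carrier[OF assms(1)] link_carrier[OF assms(2)]
  have "\<exists>c. V.P m *\<^sub>v (R h *\<^sub>v (x + y)) = c \<cdot>\<^sub>v v \<and> V'.P m *\<^sub>v (R' h *\<^sub>v (x' + y')) = c \<cdot>\<^sub>v v'"
    if h: "h \<in> carrier (GL r)" for h
  proof -
    obtain a where a: "V.P m *\<^sub>v (R h *\<^sub>v x) = a \<cdot>\<^sub>v v" "V'.P m *\<^sub>v (R' h *\<^sub>v x') = a \<cdot>\<^sub>v v'"
      using assms(1) h unfolding linked_def by blast
    obtain b where b: "V.P m *\<^sub>v (R h *\<^sub>v y) = b \<cdot>\<^sub>v v" "V'.P m *\<^sub>v (R' h *\<^sub>v y') = b \<cdot>\<^sub>v v'"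
      using assms(2) h unfolding linked_def by blast
    have "V.P m *\<^sub>v (R h *\<^sub>v (x + y)) = (a + b) \<cdot>\<^sub>v v"
      using a b c h by (simp add: V.R_add V.P_add V.R_vec add_smult_distrib_vec)
    moreover have "V'.P m *\<^sub>v (R' h *\<^sub>v (x' + y')) = (a + b) \<cdot>\<^sub>v v'"
      using a b c h by (simp add: V'.R_add V'.P_add V'.R_vec add_smult_distrib_vec)
    ultimately show ?thesis by blast
  qed
  thus ?thesis using c unfolding linked_def by simp
qed

lemma link_smult:
  assumes "\<Gamma> x x'" shows "\<Gamma> (c \<cdot>\<^sub>v x) (c \<cdot>\<^sub>v x')"
proof -
  note cc = link_carrier[OF assms(1)]
  have "\<exists>b. V.P m *\<^sub>v (R h *\<^sub>v (c \<cdot>\<^sub>v x)) = b \<cdot>\<^sub>v v \<and> V'.P m *\<^sub>v (R' h *\<^sub>v (c \<cdot>\<^sub>v x')) = b \<cdot>\<^sub>v v'"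
    if h: "h \<in> carrier (GL r)" for h
  proof -
    obtain a where a: "V.P m *\<^sub>v (R h *\<^sub>v x) = a \<cdot>\<^sub>v v" "V'.P m *\<^sub>v (R' h *\<^sub>v x') = a \<cdot>\<^sub>v v'"
      using assms(1) h unfolding linked_def by blast
    have "V.P m *\<^sub>v (R h *\<^sub>v (c \<cdot>\<^sub>v x)) = (c * a) \<cdot>\<^sub>v v"
      using a cc h by (simp add: V.R_smult V.P_smult V.R_vec smult_smult_assoc)
    moreover have "V'.P m *\<^sub>v (R' h *\<^sub>v (c \<cdot>\<^sub>v x')) = (c * a) \<cdot>\<^sub>v v'"
      using a cc h by (simp add: V'.R_smult V'.P_smult V'.R_vec smult_smult_assoc)
    ultimately show ?thesis by blast
  qed
  thus ?thesis using cc unfolding linked_def by simp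
qed

lemma link_zero: "\<Gamma> (0\<^sub>v d) (0\<^sub>v d')"
proof -
  have "V.P m *\<^sub>v (R h *\<^sub>v 0\<^sub>v d) = 0 \<cdot>\<^sub>v v \<and> V'.P m *\<^sub>v (R' h *\<^sub>v 0\<^sub>v d') = 0 \<cdot>\<^sub>v v'"
    if "h \<in> carrier (GL r)" for h
    using that V.v_carrier V'.v_carrier by (auto simp: V.R_zero V'.R_zero V.P_zero V'.P_zero)
  thus ?thesis unfolding linked_def by (metis zero_carrier_vec)
qed

lemma link_act:
  assumes "\<Gamma> x x'" "g \<in> carrier (GL r)" shows "\<Gamma> (R g *\<^sub>v x) (R' g *\<^sub>v x')"
proof -
  note cc = link_carrier[OF assms(1)]
  have "\<exists>b. V.P m *\<^sub>v (R h *\<^sub>v (R g *\<^sub>v x)) = b \<cdot>\<^sub>v v \<and> V'.P m *\<^sub>v (R' h *\<^sub>v (R' g *\<^sub>v x')) = b \<cdot>\<^sub>v v'"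
    if h: "h \<in> carrier (GL r)" for h
    using assms GL_mult[OF h assms(2)] cc h unfolding linked_def by (simp add: V.R_comp V'.R_comp)
  thus ?thesis using cc assms(2) unfolding linked_def by (simp add: V.R_vec V'.R_vec)
qed

text \<open>On the big cell both scalars are the same product of monomials in the diagonals of L and
  U; density extends their equality to the group.\<close>

lemma link_hwv: "\<Gamma> v v'"
proof -
  obtain k where k: "k < d" "v $ k \<noteq> 0" using nonzero_vec_entry[OF V.v_carrier V.v_nonzero] .
  obtain k' where k': "k' < d'" "v' $ k' \<noteq> 0" using nonzero_vec_entry[OF V'.v_carrier V'.v_nonzero] .
  have "\<exists>c. V.P m *\<^sub>v (R h *\<^sub>v v) = c \<cdot>\<^sub>v v \<and> V'.P m *\<^sub>v (R' h *\<^sub>v v') = c \<cdot>\<^sub>v v'"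
    if h: "h \<in> carrier (GL r)" for h
  proof -
    obtain c where c: "V.P m *\<^sub>v (R h *\<^sub>v v) = c \<cdot>\<^sub>v v" using V.hwv_orbit_line[OF V.hw V.m_expo h] by blast
    obtain c' where c': "V'.P m *\<^sub>v (R' h *\<^sub>v v') = c' \<cdot>\<^sub>v v'" using V'.hwv_orbit_line[OF V'.hw V'.m_expo h] by blast
    have "v' $ k' * (V.P m *\<^sub>v (R h *\<^sub>v v)) $ k - v $ k * (V'.P m *\<^sub>v (R' h *\<^sub>v v')) $ k' = 0"
    proof (rule big_cell_dense[OF _ _ h])
      show "reg_on r (\<lambda>A. v' $ k' * (V.P m *\<^sub>v (R A *\<^sub>v v)) $ k - v $ k * (V'.P m *\<^sub>v (R' A *\<^sub>v v')) $ k')"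
        by (intro reg_on_diff reg_on_scale V.matrix_coeff_reg_on V'.matrix_coeff_reg_on V.v_carrier V'.v_carrier k k')
      fix L U assume LU: "L \<in> carrier (GL r)" "U \<in> carrier (GL r)" "lower_triangular L" "upper_triangular U"
      show "v' $ k' * (V.P m *\<^sub>v (R (L * U) *\<^sub>v v)) $ k - v $ k * (V'.P m *\<^sub>v (R' (L * U) *\<^sub>v v')) $ k' = 0"
        unfolding V.hwv_big_cell(2)[OF V.hw V.m_expo LU(1,3,2,4)] V'.hwv_big_cell(2)[OF V'.hw V'.m_expo LU(1,3,2,4)]
        using k k' V.v_carrier V'.v_carrier by simp
    qed
    hence "c = c'" unfolding c c' using k k' V.v_carrier V'.v_carrier by simp
    thus ?thesis using c c' by blast
  qed
  thus ?thesis using V.v_carrier V'.v_carrier unfolding linked_def by simp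
qed

text \<open>The partners of 0 form an invariant subspace. If it were the whole module, 0 would be
  linked to v', and comparison at the identity would give v' = 0.\<close>

lemma link_zero_left:
  assumes "\<Gamma> (0\<^sub>v d) x'" shows "x' = 0\<^sub>v d'"
proof (rule ccontr)
  assume nz: "x' \<noteq> 0\<^sub>v d'"
  define W where "W = {y. \<Gamma> (0\<^sub>v d) y}"
  have "W = carrier_vec d'"
  proof (rule irreducible_invariant[OF V'.irred])
    show "W \<subseteq> carrier_vec d'" using link_carrier by (auto simp: W_def)
    show "0\<^sub>v d' \<in> W" using link_zero by (simp add: W_def)
    show "x + y \<in> W" if "x \<in> W" "y \<in> W" for x y using link_add[of "0\<^sub>v d" x "0\<^sub>v d" y] that by (simp add: W_def)
    show "c \<cdot>\<^sub>v x \<in> W" if "x \<in> W" for c x using link_smult[of "0\<^sub>v d" x c] that by (simp add: W_def smult_zero_vec)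
    show "R' A *\<^sub>v x \<in> W" if "A \<in> carrier (GL r)" "x \<in> W" for A x
      using link_act[of "0\<^sub>v d" x A] that by (simp add: W_def V.R_zero)
    show "x' \<in> W" using assms by (simp add: W_def)
  qed (rule nz)
  hence "\<Gamma> (0\<^sub>v d) v'" using V'.v_carrier by (auto simp: W_def)
  then obtain c where c: "V.P m *\<^sub>v (R (1\<^sub>m r) *\<^sub>v 0\<^sub>v d) = c \<cdot>\<^sub>v v" "V'.P m *\<^sub>v (R' (1\<^sub>m r) *\<^sub>v v') = c \<cdot>\<^sub>v v'"
    using GL_one unfolding linked_def by blast
  have z: "c \<cdot>\<^sub>v v = 0\<^sub>v d" using c(1) by (simp add: V.R_zero[OF GL_one] V.P_zero)
  obtain k where k: "k < d" "v $ k \<noteq> 0" using nonzero_vec_entry[OF V.v_carrier V.v_nonzero] .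
  have "(c \<cdot>\<^sub>v v) $ k = 0" using z k by simp
  hence "c = 0" using k V.v_carrier by simp
  hence "v' = 0 \<cdot>\<^sub>v v'" using c(2) V'.v_carrier by (simp add: V'.R_one V'.P_v)
  also have "\<dots> = 0\<^sub>v d'" by (rule eq_vecI) (use V'.v_carrier in auto)
  finally show False using V'.v_nonzero by simp
qed

text \<open>The domain of the relation is invariant and contains v.\<close>

lemma link_total:
  assumes "x \<in> carrier_vec d" shows "\<exists>x'. \<Gamma> x x'"
proof -
  define W where "W = {x. \<exists>x'. \<Gamma> x x'}"
  have "W = carrier_vec d"
  proof (rule irreducible_invariant[OF V.irred])
    show "W \<subseteq> carrier_vec d" using link_carrier by (auto simp: W_def)
    show "0\<^sub>v d \<in> W" using link_zero by (auto simp: W_def)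
    show "x + y \<in> W" if "x \<in> W" "y \<in> W" for x y using link_add that unfolding W_def by blast
    show "c \<cdot>\<^sub>v x \<in> W" if "x \<in> W" for c x using link_smult that unfolding W_def by blast
    show "R A *\<^sub>v x \<in> W" if "A \<in> carrier (GL r)" "x \<in> W" for A x using link_act that unfolding W_def by blast
    show "v \<in> W" using link_hwv by (auto simp: W_def)
  qed (rule V.v_nonzero)
  thus ?thesis using assms by (auto simp: W_def)
qed

text \<open>Partners of the unit vectors serve as columns; the coordinates of x are then added one
  at a time, since the relation is closed under sums and multiples.\<close>

lemma link_matrix: "\<exists>T\<in>carrier_mat d' d. \<forall>x\<in>carrier_vec d. \<Gamma> x (T *\<^sub>v x)"
proof -
  have "\<forall>j. \<exists>y. \<Gamma> (unit_vec d j) y" using link_total by simp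
  then obtain \<tau> where \<tau>: "\<And>j. \<Gamma> (unit_vec d j) (\<tau> j)" by metis
  define T where "T = mat d' d (\<lambda>(i, j). \<tau> j $ i)"
  have T: "T \<in> carrier_mat d' d" by (simp add: T_def)
  have Te: "T *\<^sub>v unit_vec d j = \<tau> j" if j: "j < d" for j
  proof (rule eq_vecI)
    have "\<tau> j \<in> carrier_vec d'" using link_carrier(2)[OF \<tau>] .
    thus "dim_vec (T *\<^sub>v unit_vec d j) = dim_vec (\<tau> j)" by (simp add: T_def)
    fix i assume "i < dim_vec (\<tau> j)"
    hence i: "i < d'" using \<open>\<tau> j \<in> carrier_vec d'\<close> by simp
    show "(T *\<^sub>v unit_vec d j) $ i = \<tau> j $ i"
      using mult_unit_vec_entry[OF T i j] i j by (simp add: T_def)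
  qed
  have "\<Gamma> x (T *\<^sub>v x)" if x: "x \<in> carrier_vec d" for x
  proof -
    define y where "y k = vec d (\<lambda>i. if i < k then x $ i else 0)" for k
    have "k \<le> d \<Longrightarrow> \<Gamma> (y k) (T *\<^sub>v y k)" for k
    proof (induction k)
      case 0
      have "y 0 = 0\<^sub>v d" by (rule eq_vecI) (auto simp: y_def)
      moreover have "T *\<^sub>v 0\<^sub>v d = 0\<^sub>v d'" using T by auto
      ultimately show ?case using link_zero by simp
    next
      case (Suc k)
      have yS: "y (Suc k) = y k + x $ k \<cdot>\<^sub>v unit_vec d k"
        using Suc by (intro eq_vecI) (auto simp: y_def less_Suc_eq)
      have yc: "y k \<in> carrier_vec d" by (simp add: y_def)
      have "T *\<^sub>v y (Suc k) = T *\<^sub>v y k + x $ k \<cdot>\<^sub>v \<tau> k"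
        unfolding yS using T yc Suc.prems
        by (simp add: mult_add_distrib_mat_vec[of _ d' d] mult_mat_vec[of _ d' d] Te)
      thus ?case using link_add[OF Suc.IH link_smult[OF \<tau>[of k], of "x $ k"]] Suc.prems yS by simp
    qed
    from this[of d] have "\<Gamma> (y d) (T *\<^sub>v y d)" by simp
    moreover have "y d = x" using x by (intro eq_vecI) (auto simp: y_def)
    ultimately show ?thesis by simp
  qed
  thus ?thesis using T by blast
qed

lemma link_functional:
  assumes "\<Gamma> x y" "\<Gamma> x z" shows "y = z"
proof -
  note c = link_carrier[OF assms(1)] link_carrier[OF assms(2)]
  have "\<Gamma> (x + (-1) \<cdot>\<^sub>v x) (y + (-1) \<cdot>\<^sub>v z)" by (rule link_add[OF assms(1) link_smult[OF assms(2)]])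
  moreover have "x + (-1) \<cdot>\<^sub>v x = 0\<^sub>v d" using c by (intro eq_vecI) auto
  ultimately have 0: "y + (-1) \<cdot>\<^sub>v z = 0\<^sub>v d'" using link_zero_left by simp
  show ?thesis
  proof (rule eq_vecI)
    fix i assume "i < dim_vec z"
    hence i: "i < d'" using c by auto
    have "(y + (-1) \<cdot>\<^sub>v z) $ i = 0" using 0 i by simp
    thus "y $ i = z $ i" using i c by simp
  qed (use c in auto)
qed

end

text \<open>Both directions of the relation are given by matrices, and functionality makes them
  mutually inverse. Cyclicity of the trace then equates the dimensions.\<close>

theorem irreducible_unique:
  assumes "irreducible r d R m v" "irreducible r d' R' m v'"
  shows "d = d'" "rep_equiv r d R R'"
proof -
  interpret X: irreducible_pair r d d' R R' m v v' using assms by (simp add: irreducible_pair_def)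
  interpret Y: irreducible_pair r d' d R' R m v' v using assms by (simp add: irreducible_pair_def)
  have sw: "linked r m d R v d' R' v' x x' \<longleftrightarrow> linked r m d' R' v' d R v x' x" for x x' by (rule linked_swap)
  obtain T where T: "T \<in> carrier_mat d' d" "\<And>x. x \<in> carrier_vec d \<Longrightarrow> linked r m d R v d' R' v' x (T *\<^sub>v x)"
    using X.link_matrix by blast
  obtain T' where T': "T' \<in> carrier_mat d d'" "\<And>x. x \<in> carrier_vec d' \<Longrightarrow> linked r m d' R' v' d R v x (T' *\<^sub>v x)"
    using Y.link_matrix by blast
  have 1: "T' * T = 1\<^sub>m d"
  proof (rule mat_eq_by_vec[of _ d d])
    fix x :: "complex vec" assume x: "x \<in> carrier_vec d"
    have Tx: "T *\<^sub>v x \<in> carrier_vec d'" using T x by auto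
    have "linked r m d' R' v' d R v (T *\<^sub>v x) x" using T(2)[OF x] sw by simp
    hence "T' *\<^sub>v (T *\<^sub>v x) = x" using Y.link_functional T'(2)[OF Tx] by blast
    thus "(T' * T) *\<^sub>v x = 1\<^sub>m d *\<^sub>v x" using T(1) T'(1) x by (simp add: assoc_mult_mat_vec[of _ d d' _ d])
  qed (use T T' in auto)
  have 2: "T * T' = 1\<^sub>m d'"
  proof (rule mat_eq_by_vec[of _ d' d'])
    fix x :: "complex vec" assume x: "x \<in> carrier_vec d'"
    have Tx: "T' *\<^sub>v x \<in> carrier_vec d" using T' x by auto
    have "linked r m d R v d' R' v' (T' *\<^sub>v x) x" using T'(2)[OF x] sw by simp
    hence "T *\<^sub>v (T' *\<^sub>v x) = x" using X.link_functional T(2)[OF Tx] by blast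
    thus "(T * T') *\<^sub>v x = 1\<^sub>m d' *\<^sub>v x" using T(1) T'(1) x by (simp add: assoc_mult_mat_vec[of _ d' d _ d'])
  qed (use T T' in auto)
  have "(of_nat d :: complex) = tr (T' * T)" unfolding 1 by (simp add: tr_def)
  also have "\<dots> = tr (T * T')" by (rule tr_mult_comm[OF T'(1) T(1)])
  also have "\<dots> = of_nat d'" unfolding 2 by (simp add: tr_def)
  finally show d: "d = d'" by simp
  have "T \<in> carrier (GL d)" by (rule GL_I_right_inverse[of T d T']) (use T T' 2 d in auto)
  moreover have "T * R A = R' A * T" if A: "A \<in> carrier (GL r)" for A
  proof (rule mat_eq_by_vec[of _ d d])
    note RA = X.V.R_mat[OF A] X.V'.R_mat[OF A]
    show "T * R A \<in> carrier_mat d d" "R' A * T \<in> carrier_mat d d" using T RA d by auto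
    fix x :: "complex vec" assume x: "x \<in> carrier_vec d"
    have Rx: "R A *\<^sub>v x \<in> carrier_vec d" using RA x by auto
    have "R' A *\<^sub>v (T *\<^sub>v x) = T *\<^sub>v (R A *\<^sub>v x)"
      using X.link_functional[OF X.link_act[OF T(2)[OF x] A] T(2)[OF Rx]] .
    thus "(T * R A) *\<^sub>v x = (R' A * T) *\<^sub>v x" using T(1) RA x d
      by (simp add: assoc_mult_mat_vec[of _ d d _ d])
  qed
  ultimately show "rep_equiv r d R R'" unfolding rep_equiv_def by blast
qed

section \<open>The differential of a representation\<close>

text \<open>Regular functions need only be differentiated along curves, which avoids a norm on matrices.\<close>

definition has_gradient :: "nat \<Rightarrow> complex mat \<Rightarrow> (complex mat \<Rightarrow> complex) \<Rightarrow> (nat \<Rightarrow> nat \<Rightarrow> complex) \<Rightarrow> bool" where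
  "has_gradient r A F D \<longleftrightarrow> (\<forall>\<gamma> Y. (\<forall>s. \<gamma> s \<in> carrier_mat r r) \<longrightarrow> \<gamma> 0 = A \<longrightarrow>
     (\<forall>i<r. \<forall>j<r. ((\<lambda>s. \<gamma> s $$ (i, j)) has_field_derivative Y i j) (at (0::complex))) \<longrightarrow>
     ((\<lambda>s. F (\<gamma> s)) has_field_derivative (\<Sum>i<r. \<Sum>j<r. D i j * Y i j)) (at 0))"

lemma has_gradientD:
  assumes "has_gradient r A F D" "\<And>s. \<gamma> s \<in> carrier_mat r r" "\<gamma> 0 = A"
    "\<And>i j. i < r \<Longrightarrow> j < r \<Longrightarrow> ((\<lambda>s. \<gamma> s $$ (i, j)) has_field_derivative Y i j) (at 0)"
  shows "((\<lambda>s. F (\<gamma> s)) has_field_derivative (\<Sum>i<r. \<Sum>j<r. D i j * Y i j)) (at 0)"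
  using assms unfolding has_gradient_def by blast

lemma has_gradient_const: "has_gradient r A (\<lambda>A. c) (\<lambda>i j. 0)"
  unfolding has_gradient_def by simp

lemma has_gradient_entry:
  assumes "a < r" "b < r"
  shows "has_gradient r A (\<lambda>A. A $$ (a, b)) (\<lambda>i j. if i = a \<and> j = b then 1 else 0)"
proof -
  have "(\<Sum>i<r. \<Sum>j<r. (if i = a \<and> j = b then 1 else 0) * Y i j) = Y a b" for Y :: "nat \<Rightarrow> nat \<Rightarrow> complex"
  proof -
    have "(\<Sum>i<r. \<Sum>j<r. (if i = a \<and> j = b then 1 else 0) * Y i j) = (\<Sum>i<r. if i = a then Y a b else 0)"
    proof (rule sum.cong[OF refl])
      fix i
      have "(\<Sum>j<r. (if i = a \<and> j = b then 1 else 0) * Y i j) = (\<Sum>j<r. if j = b then (if i = a then Y a b else 0) else 0)"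
        by (rule sum.cong) auto
      thus "(\<Sum>j<r. (if i = a \<and> j = b then 1 else 0) * Y i j) = (if i = a then Y a b else 0)" using assms by simp
    qed
    thus ?thesis using assms by simp
  qed
  thus ?thesis using assms unfolding has_gradient_def by simp
qed

lemma has_gradient_add:
  assumes "has_gradient r A F D" "has_gradient r A G E"
  shows "has_gradient r A (\<lambda>A. F A + G A) (\<lambda>i j. D i j + E i j)"
  unfolding has_gradient_def
proof (intro allI impI)
  fix \<gamma> Y assume "\<forall>s. \<gamma> s \<in> carrier_mat r r" "\<gamma> 0 = A"
    "\<forall>i<r. \<forall>j<r. ((\<lambda>s. \<gamma> s $$ (i, j)) has_field_derivative Y i j) (at (0::complex))"
  hence "((\<lambda>s. F (\<gamma> s)) has_field_derivative (\<Sum>i<r. \<Sum>j<r. D i j * Y i j)) (at 0)"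
    "((\<lambda>s. G (\<gamma> s)) has_field_derivative (\<Sum>i<r. \<Sum>j<r. E i j * Y i j)) (at 0)"
    using assms unfolding has_gradient_def by auto
  from DERIV_add[OF this]
  show "((\<lambda>s. F (\<gamma> s) + G (\<gamma> s)) has_field_derivative (\<Sum>i<r. \<Sum>j<r. (D i j + E i j) * Y i j)) (at 0)"
    by (simp add: distrib_right sum.distrib)
qed

lemma has_gradient_mult:
  assumes "has_gradient r A F D" "has_gradient r A G E"
  shows "has_gradient r A (\<lambda>A. F A * G A) (\<lambda>i j. D i j * G A + E i j * F A)"
  unfolding has_gradient_def
proof (intro allI impI)
  fix \<gamma> Y assume \<gamma>: "\<forall>s. \<gamma> s \<in> carrier_mat r r" "\<gamma> 0 = A"
    "\<forall>i<r. \<forall>j<r. ((\<lambda>s. \<gamma> s $$ (i, j)) has_field_derivative Y i j) (at (0::complex))"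
  hence "((\<lambda>s. F (\<gamma> s)) has_field_derivative (\<Sum>i<r. \<Sum>j<r. D i j * Y i j)) (at 0)"
    "((\<lambda>s. G (\<gamma> s)) has_field_derivative (\<Sum>i<r. \<Sum>j<r. E i j * Y i j)) (at 0)"
    using assms unfolding has_gradient_def by auto
  from DERIV_mult[OF this]
  have "((\<lambda>s. F (\<gamma> s) * G (\<gamma> s)) has_field_derivative
     (\<Sum>i<r. \<Sum>j<r. D i j * Y i j) * G A + (\<Sum>i<r. \<Sum>j<r. E i j * Y i j) * F A) (at 0)"
    by (simp add: \<gamma>(2))
  also have "(\<Sum>i<r. \<Sum>j<r. D i j * Y i j) * G A + (\<Sum>i<r. \<Sum>j<r. E i j * Y i j) * F A =
     (\<Sum>i<r. \<Sum>j<r. (D i j * G A + E i j * F A) * Y i j)"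
    by (simp add: sum_distrib_right sum_distrib_left sum.distrib algebra_simps)
  finally show "((\<lambda>s. F (\<gamma> s) * G (\<gamma> s)) has_field_derivative (\<Sum>i<r. \<Sum>j<r. (D i j * G A + E i j * F A) * Y i j)) (at 0)" .
qed

lemma has_gradient_sum_ex:
  "finite S \<Longrightarrow> (\<And>x. x \<in> S \<Longrightarrow> \<exists>D. has_gradient r A (F x) D) \<Longrightarrow> \<exists>D. has_gradient r A (\<lambda>A. \<Sum>x\<in>S. F x A) D"
proof (induction S rule: finite_induct)
  case empty
  show ?case by (rule exI[of _ "\<lambda>i j. 0"]) (use has_gradient_const[of r A 0] in simp)
next
  case (insert x S)
  then obtain D E where "has_gradient r A (F x) D" "has_gradient r A (\<lambda>A. \<Sum>x\<in>S. F x A) E" by (meson insertCI)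
  from has_gradient_add[OF this] show ?case unfolding sum.insert[OF insert(1,2)] by (rule exI[where P = "has_gradient r A _"])
qed

lemma has_gradient_prod_ex:
  "finite S \<Longrightarrow> (\<And>x. x \<in> S \<Longrightarrow> \<exists>D. has_gradient r A (F x) D) \<Longrightarrow> \<exists>D. has_gradient r A (\<lambda>A. \<Prod>x\<in>S. F x A) D"
proof (induction S rule: finite_induct)
  case empty
  show ?case by (rule exI[of _ "\<lambda>i j. 0"]) (use has_gradient_const[of r A 1] in simp)
next
  case (insert x S)
  then obtain D E where "has_gradient r A (F x) D" "has_gradient r A (\<lambda>A. \<Prod>x\<in>S. F x A) E" by (meson insertCI)
  from has_gradient_mult[OF this] show ?case unfolding prod.insert[OF insert(1,2)] by (rule exI[where P = "has_gradient r A _"])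
qed

lemma has_gradient_cong:
  assumes "has_gradient r A F D" "\<And>A. A \<in> carrier_mat r r \<Longrightarrow> F A = G A"
  shows "has_gradient r A G D"
  using assms unfolding has_gradient_def by simp

lemma has_gradient_det_ex: "\<exists>D. has_gradient r A det D"
proof -
  have "\<exists>D. has_gradient r A (\<lambda>A. \<Sum>p | p permutes {..<r}. of_int (sign p) * (\<Prod>i<r. A $$ (i, p i))) D"
  proof (rule has_gradient_sum_ex)
    show "finite {p. p permutes {..<r}}" by (simp add: finite_permutations)
    fix p assume "p \<in> {p. p permutes {..<r}}"
    hence p: "p permutes {..<r}" by simp
    have "\<exists>D. has_gradient r A (\<lambda>A. \<Prod>i<r. A $$ (i, p i)) D"
    proof (rule has_gradient_prod_ex)
      show "\<exists>D. has_gradient r A (\<lambda>A. A $$ (i, p i)) D" if "i \<in> {..<r}" for i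
        using has_gradient_entry[of i r "p i" A] permutes_less[OF p] that by blast
    qed simp
    thus "\<exists>D. has_gradient r A (\<lambda>A. of_int (sign p) * (\<Prod>i<r. A $$ (i, p i))) D"
      using has_gradient_mult[OF has_gradient_const] by blast
  qed
  then obtain D where "has_gradient r A (\<lambda>A. \<Sum>p | p permutes {..<r}. of_int (sign p) * (\<Prod>i<r. A $$ (i, p i))) D" ..
  hence "has_gradient r A det D" by (rule has_gradient_cong) (simp add: det_leibniz)
  thus ?thesis by blast
qed

lemma regular_gradient:
  assumes "f \<in> regular_functions r" "A \<in> carrier (GL r)"
  shows "\<exists>D. has_gradient r A f D"
  using assms(1)
proof induction
  case (const c) thus ?case using has_gradient_const by blast
next
  case (entry i j) thus ?case using has_gradient_entry by blast
next
  case inverse_det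
  obtain D where D: "has_gradient r A det D" using has_gradient_det_ex by blast
  have "has_gradient r A (\<lambda>A. inverse (det A)) (\<lambda>i j. - (inverse (det A) * inverse (det A)) * D i j)"
    unfolding has_gradient_def
  proof (intro allI impI)
    fix \<gamma> Y assume \<gamma>: "\<forall>s. \<gamma> s \<in> carrier_mat r r" "\<gamma> 0 = A"
      "\<forall>i<r. \<forall>j<r. ((\<lambda>s. \<gamma> s $$ (i, j)) has_field_derivative Y i j) (at (0::complex))"
    hence d: "((\<lambda>s. det (\<gamma> s)) has_field_derivative (\<Sum>i<r. \<Sum>j<r. D i j * Y i j)) (at 0)"
      using D unfolding has_gradient_def by auto
    have "det (\<gamma> 0) \<noteq> 0" using assms(2) \<gamma>(2) GL_iff by auto
    from DERIV_inverse_fun[OF d this]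
    show "((\<lambda>s. inverse (det (\<gamma> s))) has_field_derivative
        (\<Sum>i<r. \<Sum>j<r. - (inverse (det A) * inverse (det A)) * D i j * Y i j)) (at 0)"
      by (simp add: \<gamma>(2) sum_distrib_left sum_distrib_right sum_negf mult_ac)
  qed
  thus ?case by blast
next
  case (add f g) thus ?case using has_gradient_add by blast
next
  case (mult f g) thus ?case using has_gradient_mult by blast
qed

section \<open>Elementary matrices and contraction of invariant tensors\<close>

lemma zero_smult_vec: "x \<in> carrier_vec n \<Longrightarrow> 0 \<cdot>\<^sub>v x = (0\<^sub>v n :: complex vec)"
  by (rule eq_vecI) auto

lemma smult_smult_mat: "a \<cdot>\<^sub>m (b \<cdot>\<^sub>m A) = (a * b) \<cdot>\<^sub>m (A :: complex mat)"
  by (rule eq_matI) auto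

text \<open>The curve 1 + s E_ab. For distinct a, b it is a one-parameter subgroup; for a = b it is
  diagonal and leaves the group at s = -1.\<close>

definition elem :: "nat \<Rightarrow> nat \<Rightarrow> nat \<Rightarrow> complex \<Rightarrow> complex mat" where
  "elem r a b s = mat r r (\<lambda>(i, j). (if i = j then 1 else 0) + (if i = a \<and> j = b then s else 0))"

lemma elem_carrier [simp]: "elem r a b s \<in> carrier_mat r r"
  by (simp add: elem_def)

lemma elem_entry: "i < r \<Longrightarrow> j < r \<Longrightarrow>
    elem r a b s $$ (i, j) = (if i = j then 1 else 0) + (if i = a \<and> j = b then s else 0)"
  by (simp add: elem_def)

lemma elem_zero [simp]: "elem r a b 0 = 1\<^sub>m r"
  by (rule eq_matI) (auto simp: elem_def)

lemma elem_inverse: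
  assumes "a \<noteq> b" "a < r" "b < r"
  shows "elem r a b s * elem r a b (- s) = 1\<^sub>m r"
proof (rule eq_matI)
  fix i j assume "i < dim_row (1\<^sub>m r :: complex mat)" "j < dim_col (1\<^sub>m r :: complex mat)"
  hence ij: "i < r" "j < r" by auto
  have "(elem r a b s * elem r a b (- s)) $$ (i, j) = (\<Sum>l<r. elem r a b s $$ (i, l) * elem r a b (- s) $$ (l, j))"
    by (rule mult_entry[OF _ _ ij]) auto
  also have "\<dots> = (\<Sum>l<r. (if l = i then elem r a b (- s) $$ (i, j) else 0) + (if l = b then (if i = a \<and> j = b then s else 0) else 0))"
    by (rule sum.cong[OF refl]) (use ij assms in \<open>auto simp: elem_entry\<close>)
  also have "\<dots> = elem r a b (- s) $$ (i, j) + (if i = a \<and> j = b then s else 0)"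
    using ij assms by (simp add: sum.distrib)
  also have "\<dots> = 1\<^sub>m r $$ (i, j)" using ij by (auto simp: elem_entry)
  finally show "(elem r a b s * elem r a b (- s)) $$ (i, j) = 1\<^sub>m r $$ (i, j)" .
qed (auto simp: elem_def)

lemma elem_diag: "elem r a a s = dg r (\<lambda>i. if i = a then 1 + s else 1)"
  by (rule eq_matI) (auto simp: elem_def dg_def)

lemma elem_GL: "a \<noteq> b \<Longrightarrow> a < r \<Longrightarrow> b < r \<Longrightarrow> elem r a b s \<in> carrier (GL r)"
  by (rule GL_I_right_inverse[OF _ _ elem_inverse]) auto

lemma sum_single2:
  fixes f :: "nat \<Rightarrow> nat \<Rightarrow> complex"
  assumes "a < r" "b < r"
  shows "(\<Sum>i<r. \<Sum>j<r. if i = a \<and> j = b then f i j else 0) = f a b"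
proof -
  have "(\<Sum>i<r. \<Sum>j<r. if i = a \<and> j = b then f i j else 0) = (\<Sum>i<r. if i = a then f a b else 0)"
  proof (rule sum.cong[OF refl])
    fix i
    have "(\<Sum>j<r. if i = a \<and> j = b then f i j else 0) = (\<Sum>j<r. if j = b then (if i = a then f a b else 0) else 0)"
      by (rule sum.cong) auto
    thus "(\<Sum>j<r. if i = a \<and> j = b then f i j else 0) = (if i = a then f a b else 0)" using assms by simp
  qed
  thus ?thesis using assms by simp
qed

lemma sum_rotate: "(\<Sum>x\<in>A. \<Sum>a\<in>B. \<Sum>b\<in>C. f x a b) = (\<Sum>a\<in>B. \<Sum>b\<in>C. \<Sum>x\<in>A. f x a b)"
  for f :: "_ \<Rightarrow> _ \<Rightarrow> _ \<Rightarrow> complex"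
  by (subst sum.swap) (rule sum.cong[OF refl], rule sum.swap)

lemma contraction:
  fixes g h :: "nat \<Rightarrow> nat \<Rightarrow> complex"
  assumes "\<And>c q. c < r \<Longrightarrow> q < r \<Longrightarrow> (\<Sum>a<r. g c a * h a q) = (if c = q then 1 else 0)"
  shows "(\<Sum>a<r. (\<Sum>c<r. g c a * y c) * (\<Sum>q<r. h a q * z q)) = (\<Sum>c<r. y c * z c)"
proof -
  have "(\<Sum>a<r. (\<Sum>c<r. g c a * y c) * (\<Sum>q<r. h a q * z q)) = (\<Sum>a<r. \<Sum>c<r. \<Sum>q<r. y c * z q * (g c a * h a q))"
    by (simp add: sum_product mult_ac)
  also have "\<dots> = (\<Sum>c<r. \<Sum>a<r. \<Sum>q<r. y c * z q * (g c a * h a q))"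
    by (rule sum.swap)
  also have "\<dots> = (\<Sum>c<r. \<Sum>q<r. \<Sum>a<r. y c * z q * (g c a * h a q))"
    by (rule sum.cong[OF refl], rule sum.swap)
  also have "\<dots> = (\<Sum>c<r. \<Sum>q<r. y c * z q * (\<Sum>a<r. g c a * h a q))"
    by (simp add: sum_distrib_left)
  also have "\<dots> = (\<Sum>c<r. \<Sum>q<r. if q = c then y c * z c else 0)"
    by (intro sum.cong refl) (auto simp: assms)
  also have "\<dots> = (\<Sum>c<r. y c * z c)" by simp
  finally show ?thesis .
qed

text \<open>Coordinate form of the invariance of the sum of E_ab tensor E_ba under conjugation by g
  with inverse h. This is why the Casimir element commutes with the group.\<close>

lemma triple_contraction:
  fixes g h :: "nat \<Rightarrow> nat \<Rightarrow> complex"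
  assumes "\<And>c q. c < r \<Longrightarrow> q < r \<Longrightarrow> (\<Sum>a<r. g c a * h a q) = (if c = q then 1 else 0)"
  shows "(\<Sum>a<r. \<Sum>b<r. (\<Sum>c<r. \<Sum>e<r. g c a * h b e * E c e) * (\<Sum>p<r. \<Sum>q<r. g p b * h a q * F p q)) =
         (\<Sum>c<r. \<Sum>e<r. E c e * F e c)"
proof -
  define Y where "Y c b = (\<Sum>e<r. h b e * E c e)" for c b
  define Z where "Z b q = (\<Sum>p<r. g p b * F p q)" for b q
  have X1: "(\<Sum>c<r. \<Sum>e<r. g c a * h b e * E c e) = (\<Sum>c<r. g c a * Y c b)" for a b
    by (simp add: Y_def sum_distrib_left mult_ac)
  have X2: "(\<Sum>p<r. \<Sum>q<r. g p b * h a q * F p q) = (\<Sum>q<r. h a q * Z b q)" for a b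
    by (subst sum.swap) (simp add: Z_def sum_distrib_left mult_ac)
  have "(\<Sum>a<r. \<Sum>b<r. (\<Sum>c<r. g c a * Y c b) * (\<Sum>q<r. h a q * Z b q)) =
        (\<Sum>b<r. \<Sum>a<r. (\<Sum>c<r. g c a * Y c b) * (\<Sum>q<r. h a q * Z b q))"
    by (rule sum.swap)
  also have "\<dots> = (\<Sum>b<r. \<Sum>c<r. Y c b * Z b c)"
    by (rule sum.cong[OF refl], rule contraction[OF assms])
  also have "\<dots> = (\<Sum>c<r. \<Sum>b<r. (\<Sum>p<r. g p b * F p c) * (\<Sum>e<r. h b e * E c e))"
    by (subst sum.swap) (simp add: Y_def Z_def mult.commute)
  also have "\<dots> = (\<Sum>c<r. \<Sum>e<r. F e c * E c e)"
    by (rule sum.cong[OF refl], rule contraction[OF assms])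
  also have "\<dots> = (\<Sum>c<r. \<Sum>e<r. E c e * F e c)" by (simp only: mult.commute)
  finally show ?thesis unfolding X1 X2 .
qed

section \<open>The Lie algebra action and its Casimir element\<close>

context rational
begin

text \<open>Belongs to one regular representative of the entry; derivatives along curves inside the
  group do not depend on that choice.\<close>

definition grad :: "nat \<Rightarrow> nat \<Rightarrow> nat \<Rightarrow> nat \<Rightarrow> complex" where
  "grad i j = (SOME D. \<exists>f\<in>regular_functions r. (\<forall>A\<in>carrier (GL r). R A $$ (i, j) = f A) \<and> has_gradient r (1\<^sub>m r) f D)"

text \<open>The image of the matrix unit E_ab under the differential of R at the identity.\<close>

definition E :: "nat \<Rightarrow> nat \<Rightarrow> complex mat" where
  "E a b = mat d d (\<lambda>(i, j). grad i j a b)"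

lemma E_carrier [simp, intro]: "E a b \<in> carrier_mat d d"
  by (simp add: E_def)

text \<open>The determinant is continuous along the curve, so the curve stays in the group near 0,
  where R agrees with its differentiable representative.\<close>

lemma R_derivative:
  assumes \<gamma>: "\<And>s. \<gamma> s \<in> carrier_mat r r" "\<gamma> 0 = 1\<^sub>m r"
    "\<And>a b. a < r \<Longrightarrow> b < r \<Longrightarrow> ((\<lambda>s. \<gamma> s $$ (a, b)) has_field_derivative Y a b) (at (0::complex))"
    and ij: "i < d" "j < d"
  shows "((\<lambda>s. R (\<gamma> s) $$ (i, j)) has_field_derivative (\<Sum>a<r. \<Sum>b<r. E a b $$ (i, j) * Y a b)) (at 0)"
proof -
  have "\<exists>D. \<exists>f\<in>regular_functions r. (\<forall>A\<in>carrier (GL r). R A $$ (i, j) = f A) \<and> has_gradient r (1\<^sub>m r) f D"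
    using R_entry_regular[OF ij] regular_gradient[OF _ GL_one] by meson
  from someI_ex[OF this] obtain f where f: "f \<in> regular_functions r" "\<And>A. A \<in> carrier (GL r) \<Longrightarrow> R A $$ (i, j) = f A"
    "has_gradient r (1\<^sub>m r) f (grad i j)" unfolding grad_def by blast
  have df: "((\<lambda>s. f (\<gamma> s)) has_field_derivative (\<Sum>a<r. \<Sum>b<r. grad i j a b * Y a b)) (at 0)"
    by (rule has_gradientD[OF f(3) \<gamma>])
  have "((\<lambda>s. det (\<gamma> s)) \<longlongrightarrow> det (1\<^sub>m r)) (at 0)"
  proof (rule det_tendsto[OF \<gamma>(1)])
    fix a b assume "a < r" "b < r"
    from DERIV_isCont[OF \<gamma>(3)[OF this]] show "((\<lambda>s. \<gamma> s $$ (a, b)) \<longlongrightarrow> 1\<^sub>m r $$ (a, b)) (at 0)"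
      by (simp add: isCont_def \<gamma>(2))
  qed simp
  hence "eventually (\<lambda>s. det (\<gamma> s) \<noteq> 0) (at 0)" by (rule tendsto_imp_eventually_ne) simp
  hence "eventually (\<lambda>s. det (\<gamma> s) \<noteq> 0) (nhds 0)" by (simp add: eventually_nhds_conv_at \<gamma>(2))
  hence "eventually (\<lambda>s. f (\<gamma> s) = R (\<gamma> s) $$ (i, j)) (nhds 0)"
    by (rule eventually_mono) (simp add: f(2) GL_iff \<gamma>(1))
  from DERIV_cong_ev[OF refl this refl] df
  have "((\<lambda>s. R (\<gamma> s) $$ (i, j)) has_field_derivative (\<Sum>a<r. \<Sum>b<r. grad i j a b * Y a b)) (at 0)" by simp
  thus ?thesis using ij by (simp add: E_def)
qed

lemma R_elem_derivative:
  assumes ab: "a < r" "b < r" and ij: "i < d" "j < d"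
  shows "((\<lambda>s. R (elem r a b (c * s)) $$ (i, j)) has_field_derivative c * E a b $$ (i, j)) (at 0)"
proof -
  have "((\<lambda>s. R (elem r a b (c * s)) $$ (i, j)) has_field_derivative
     (\<Sum>x<r. \<Sum>y<r. E x y $$ (i, j) * (if x = a \<and> y = b then c else 0))) (at 0)"
  proof (rule R_derivative[OF _ _ _ ij])
    fix x y assume "x < r" "y < r"
    thus "((\<lambda>s. elem r a b (c * s) $$ (x, y)) has_field_derivative (if x = a \<and> y = b then c else 0)) (at 0)"
      by (cases "x = a \<and> y = b") (auto simp: elem_entry intro!: derivative_eq_intros)
  qed auto
  also have "(\<Sum>x<r. \<Sum>y<r. E x y $$ (i, j) * (if x = a \<and> y = b then c else 0)) =
     (\<Sum>x<r. \<Sum>y<r. if x = a \<and> y = b then c * E x y $$ (i, j) else 0)"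
    by (intro sum.cong) auto
  also have "\<dots> = c * E a b $$ (i, j)" by (rule sum_single2[OF ab])
  finally show ?thesis .
qed

lemma mult3_derivative:
  assumes A: "\<And>s. A s \<in> carrier_mat d d" and B: "B \<in> carrier_mat d d" and C: "\<And>s. C s \<in> carrier_mat d d"
    and dA: "\<And>i j. i < d \<Longrightarrow> j < d \<Longrightarrow> ((\<lambda>s. A s $$ (i, j)) has_field_derivative A' $$ (i, j)) (at (0::complex))"
    and dC: "\<And>i j. i < d \<Longrightarrow> j < d \<Longrightarrow> ((\<lambda>s. C s $$ (i, j)) has_field_derivative C' $$ (i, j)) (at (0::complex))"
    and A': "A' \<in> carrier_mat d d" and C': "C' \<in> carrier_mat d d" and ij: "i < d" "j < d"
  shows "((\<lambda>s. (A s * B * C s) $$ (i, j)) has_field_derivative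
           (A' * B * C 0) $$ (i, j) + (A 0 * B * C') $$ (i, j)) (at 0)"
proof -
  have "((\<lambda>s. \<Sum>b<d. \<Sum>a<d. A s $$ (i, a) * B $$ (a, b) * C s $$ (b, j)) has_field_derivative
     (\<Sum>b<d. \<Sum>a<d. A' $$ (i, a) * B $$ (a, b) * C 0 $$ (b, j) + C' $$ (b, j) * (A 0 $$ (i, a) * B $$ (a, b)))) (at 0)"
    by (intro DERIV_sum DERIV_mult DERIV_cmult_right dA dC) (use ij in auto)
  also have "(\<Sum>b<d. \<Sum>a<d. A' $$ (i, a) * B $$ (a, b) * C 0 $$ (b, j) + C' $$ (b, j) * (A 0 $$ (i, a) * B $$ (a, b)))
     = (A' * B * C 0) $$ (i, j) + (A 0 * B * C') $$ (i, j)"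
    unfolding mult3_entry[OF A' B C ij] mult3_entry[OF A B C' ij] by (simp add: sum.distrib mult_ac)
  finally show ?thesis unfolding mult3_entry[OF A B C ij] .
qed

text \<open>The curve g (1 + s E_ab) h is affine in s with slope g E_ab h. Differentiating R along
  it, once directly and once as a product of three factors, gives the two sides.\<close>

lemma Ad:
  assumes g: "g \<in> carrier (GL r)" "h \<in> carrier (GL r)" "g * h = 1\<^sub>m r"
    and ab: "a < r" "b < r" and ij: "i < d" "j < d"
  shows "(R g * E a b * R h) $$ (i, j) = (\<Sum>c<r. \<Sum>e<r. g $$ (c, a) * h $$ (b, e) * E c e $$ (i, j))"
proof -
  define \<gamma> where "\<gamma> s = g * elem r a b s * h" for s
  note gc = GL_mat[OF g(1)] GL_mat[OF g(2)]
  note Rg = R_mat[OF g(1)] R_mat[OF g(2)]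
  have \<gamma>c: "\<gamma> s \<in> carrier_mat r r" for s unfolding \<gamma>_def using gc by (intro mult_square_carrier) auto
  have \<gamma>0: "\<gamma> 0 = 1\<^sub>m r" using gc g(3) by (simp add: \<gamma>_def)
  have \<gamma>e: "\<gamma> s $$ (c, e) = 1\<^sub>m r $$ (c, e) + s * (g $$ (c, a) * h $$ (b, e))" if ce: "c < r" "e < r" for s c e
  proof -
    have "\<gamma> s $$ (c, e) = (\<Sum>y<r. \<Sum>x<r. g $$ (c, x) * elem r a b s $$ (x, y) * h $$ (y, e))"
      unfolding \<gamma>_def by (rule mult3_entry) (use gc ce in auto)
    also have "\<dots> = (\<Sum>y<r. \<Sum>x<r. (if x = y then g $$ (c, y) * h $$ (y, e) else 0) + (if y = b \<and> x = a then g $$ (c, x) * s * h $$ (y, e) else 0))"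
      by (intro sum.cong refl) (auto simp: elem_entry algebra_simps)
    also have "\<dots> = (\<Sum>y<r. g $$ (c, y) * h $$ (y, e)) + g $$ (c, a) * s * h $$ (b, e)"
      by (simp only: sum.distrib sum_single2[OF ab(2,1), of "\<lambda>y x. g $$ (c, x) * s * h $$ (y, e)"]) simp
    also have "(\<Sum>y<r. g $$ (c, y) * h $$ (y, e)) = (g * h) $$ (c, e)"
      by (rule mult_entry[symmetric]) (use gc ce in auto)
    finally show ?thesis using g(3) by (simp add: mult_ac)
  qed
  have d1: "((\<lambda>s. R (\<gamma> s) $$ (i, j)) has_field_derivative (\<Sum>c<r. \<Sum>e<r. E c e $$ (i, j) * (g $$ (c, a) * h $$ (b, e)))) (at 0)"
  proof (rule R_derivative[of \<gamma>])
    show "\<And>s. \<gamma> s \<in> carrier_mat r r" "\<gamma> 0 = 1\<^sub>m r" "i < d" "j < d" by (rule \<gamma>c \<gamma>0 ij)+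
    fix c e assume ce: "c < r" "e < r"
    show "((\<lambda>s. \<gamma> s $$ (c, e)) has_field_derivative g $$ (c, a) * h $$ (b, e)) (at 0)"
      unfolding \<gamma>e[OF ce] by (auto intro!: derivative_eq_intros)
  qed
  have d2: "((\<lambda>s. \<Sum>y<d. \<Sum>x<d. R g $$ (i, x) * R (elem r a b (1 * s)) $$ (x, y) * R h $$ (y, j)) has_field_derivative
     (\<Sum>y<d. \<Sum>x<d. R g $$ (i, x) * (1 * E a b $$ (x, y)) * R h $$ (y, j))) (at 0)"
    by (intro DERIV_sum DERIV_cmult_right DERIV_cmult R_elem_derivative ab) auto
  \<comment> \<open>Also for a = b the curve stays in the group near 0, so R splits into three
    factors there.\<close>
  have "((\<lambda>s. det (elem r a b s)) \<longlongrightarrow> det (elem r a b 0)) (at 0)"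
  proof (rule det_tendsto)
    fix i j assume ij: "i < r" "j < r"
    have lim: "((\<lambda>s. (if i = j then 1 else 0) + (if i = a \<and> j = b then 1 else 0) * s) \<longlongrightarrow>
        (if i = j then 1 else 0) + (if i = a \<and> j = b then 1 else 0) * (0 :: complex)) (at 0)"
      by (intro tendsto_intros)
    have e: "elem r a b s $$ (i, j) = (if i = j then 1 else 0) + (if i = a \<and> j = b then 1 else 0) * s" for s
      using ij by (auto simp: elem_entry)
    show "((\<lambda>s. elem r a b s $$ (i, j)) \<longlongrightarrow> elem r a b 0 $$ (i, j)) (at 0)" unfolding e by (rule lim)
  qed (rule elem_carrier)+
  hence "eventually (\<lambda>s. det (elem r a b s) \<noteq> 0) (at 0)" by (rule tendsto_imp_eventually_ne) simp
  hence "eventually (\<lambda>s. det (elem r a b s) \<noteq> 0) (nhds 0)" by (simp add: eventually_nhds_conv_at)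
  hence ev: "eventually (\<lambda>s. (\<Sum>y<d. \<Sum>x<d. R g $$ (i, x) * R (elem r a b (1 * s)) $$ (x, y) * R h $$ (y, j)) = R (\<gamma> s) $$ (i, j)) (nhds 0)"
  proof (rule eventually_mono)
    fix s assume "det (elem r a b s) \<noteq> 0"
    hence e: "elem r a b s \<in> carrier (GL r)" by (simp add: GL_iff)
    have "R (\<gamma> s) = R g * R (elem r a b s) * R h"
      unfolding \<gamma>_def using g e by (simp add: R_mult GL_mult)
    thus "(\<Sum>y<d. \<Sum>x<d. R g $$ (i, x) * R (elem r a b (1 * s)) $$ (x, y) * R h $$ (y, j)) = R (\<gamma> s) $$ (i, j)"
      using mult3_entry[OF Rg(1) R_mat[OF e] Rg(2) ij] by simp
  qed
  have "((\<lambda>s. R (\<gamma> s) $$ (i, j)) has_field_derivative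
     (\<Sum>y<d. \<Sum>x<d. R g $$ (i, x) * (1 * E a b $$ (x, y)) * R h $$ (y, j))) (at 0)"
    using DERIV_cong_ev[OF refl ev refl] d2 by blast
  from DERIV_unique[OF this d1] show ?thesis
    using mult3_entry[OF Rg(1) E_carrier Rg(2) ij, of a b] by (simp add: mult_ac)
qed

text \<open>\<open>Ad\<close> for a diagonal matrix: E_ab has weight e_a - e_b.\<close>

lemma R_dg_E:
  assumes t: "t \<in> torus r" and ab: "a < r" "b < r"
  shows "R (dg r t) * E a b = (t a / t b) \<cdot>\<^sub>m (E a b * R (dg r t))"
proof -
  let ?s = "\<lambda>i. inverse (t i)"
  have s: "?s \<in> torus r" using t by (simp add: torus_def)
  have ts: "dg r t * dg r ?s = 1\<^sub>m r"
    by (rule eq_matI) (use t in \<open>auto simp: dg_mult dg_entry torus_def simp del: dg_one, simp_all add: dg_def\<close>)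
  have st: "dg r ?s * dg r t = 1\<^sub>m r"
    by (rule eq_matI) (use t in \<open>auto simp: dg_mult dg_entry torus_def simp del: dg_one, simp_all add: dg_def\<close>)
  note c = R_mat[OF dg_GL[OF t]] R_mat[OF dg_GL[OF s]]
  have "R (dg r t) * E a b * R (dg r ?s) = (t a / t b) \<cdot>\<^sub>m E a b"
  proof (rule eq_matI)
    fix i j assume "i < dim_row ((t a / t b) \<cdot>\<^sub>m E a b)" "j < dim_col ((t a / t b) \<cdot>\<^sub>m E a b)"
    hence ij: "i < d" "j < d" by (auto simp: E_def)
    have "(R (dg r t) * E a b * R (dg r ?s)) $$ (i, j) = (\<Sum>x<r. \<Sum>y<r. dg r t $$ (x, a) * dg r ?s $$ (b, y) * E x y $$ (i, j))"
      by (rule Ad[OF dg_GL[OF t] dg_GL[OF s] ts ab ij])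
    also have "\<dots> = (\<Sum>x<r. \<Sum>y<r. if x = a \<and> y = b then t x * ?s y * E x y $$ (i, j) else 0)"
      by (intro sum.cong refl) (use ab in \<open>auto simp: dg_entry\<close>)
    also have "\<dots> = t a * ?s b * E a b $$ (i, j)" by (rule sum_single2[OF ab])
    finally show "(R (dg r t) * E a b * R (dg r ?s)) $$ (i, j) = ((t a / t b) \<cdot>\<^sub>m E a b) $$ (i, j)"
      using ij by (simp add: E_def divide_inverse)
  qed (use c in \<open>auto simp: E_def\<close>)
  hence "R (dg r t) * E a b * R (dg r ?s) * R (dg r t) = ((t a / t b) \<cdot>\<^sub>m E a b) * R (dg r t)" by simp
  also have "R (dg r t) * E a b * R (dg r ?s) * R (dg r t) = R (dg r t) * E a b * (R (dg r ?s) * R (dg r t))"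
    by (rule assoc_mult_mat[of _ d d _ d _ d]) (use c in \<open>auto intro: mult_square_carrier\<close>)
  also have "R (dg r ?s) * R (dg r t) = 1\<^sub>m d"
    using R_mult[OF dg_GL[OF s] dg_GL[OF t]] st R_one by simp
  also have "R (dg r t) * E a b * 1\<^sub>m d = R (dg r t) * E a b"
    by (rule right_mult_one_mat[of _ d]) (use c in \<open>auto intro: mult_square_carrier\<close>)
  finally show ?thesis by (simp add: mult_smult_assoc_mat[OF E_carrier c(1)])
qed

text \<open>Derivative at 0 of R(1 + u E_ab) E_ba R(1 - u E_ab): the product rule gives the
  commutator, and \<open>Ad\<close> gives a quadratic polynomial in u with linear coefficient E_aa -
  E_bb.\<close>

lemma E_commutator:
  assumes ab: "a < r" "b < r" "a \<noteq> b"
  shows "E a b * E b a = E b a * E a b + E a a - E b b"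
proof (rule eq_matI)
  fix i j assume "i < dim_row (E b a * E a b + E a a - E b b)" "j < dim_col (E b a * E a b + E a a - E b b)"
  hence ij: "i < d" "j < d" by (auto simp: E_def)
  have Re: "R (elem r a b s) \<in> carrier_mat d d" for s by (rule R_mat[OF elem_GL]) (use ab in auto)
  have d1: "((\<lambda>u. (R (elem r a b (1 * u)) * E b a * R (elem r a b (- 1 * u))) $$ (i, j)) has_field_derivative
      (E a b * E b a * R (elem r a b (- 1 * 0))) $$ (i, j) + (R (elem r a b (1 * 0)) * E b a * (- 1 \<cdot>\<^sub>m E a b)) $$ (i, j)) (at 0)"
  proof (rule mult3_derivative[OF Re E_carrier Re _ _ E_carrier _ ij])
    show "((\<lambda>s. R (elem r a b (1 * s)) $$ (i, j)) has_field_derivative E a b $$ (i, j)) (at 0)" if "i < d" "j < d" for i j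
      using R_elem_derivative[OF ab(1,2) that, of 1] by simp
    show "((\<lambda>s. R (elem r a b (- 1 * s)) $$ (i, j)) has_field_derivative (- 1 \<cdot>\<^sub>m E a b) $$ (i, j)) (at 0)" if "i < d" "j < d" for i j
      using R_elem_derivative[OF ab(1,2) that, of "- 1"] that by (simp add: E_def)
  qed (simp add: smult_carrier_mat)
  have ad: "(R (elem r a b (1 * u)) * E b a * R (elem r a b (- 1 * u))) $$ (i, j) =
      E b a $$ (i, j) + u * E a a $$ (i, j) - u * E b b $$ (i, j) - u * u * E a b $$ (i, j)" for u
  proof -
    have "(R (elem r a b u) * E b a * R (elem r a b (- u))) $$ (i, j) =
        (\<Sum>x<r. \<Sum>y<r. elem r a b u $$ (x, b) * elem r a b (- u) $$ (a, y) * E x y $$ (i, j))"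
      by (rule Ad[OF elem_GL elem_GL elem_inverse ab(2,1) ij]) (use ab in auto)
    also have "\<dots> = (\<Sum>x<r. \<Sum>y<r. (if x = b \<and> y = a then E x y $$ (i, j) else 0) + (if x = a \<and> y = a then u * E x y $$ (i, j) else 0)
        + (if x = b \<and> y = b then - u * E x y $$ (i, j) else 0) + (if x = a \<and> y = b then - u * u * E x y $$ (i, j) else 0))"
      by (intro sum.cong refl) (use ab in \<open>auto simp: elem_entry\<close>)
    also have "\<dots> = E b a $$ (i, j) + u * E a a $$ (i, j) + - u * E b b $$ (i, j) + - u * u * E a b $$ (i, j)"
      by (simp only: sum.distrib sum_single2[OF ab(2,1)] sum_single2[OF ab(1,1)] sum_single2[OF ab(2,2)] sum_single2[OF ab(1,2)])
    finally show ?thesis by simp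
  qed
  have d2: "((\<lambda>u. (R (elem r a b (1 * u)) * E b a * R (elem r a b (- 1 * u))) $$ (i, j)) has_field_derivative
      E a a $$ (i, j) - E b b $$ (i, j)) (at 0)"
    unfolding ad by (auto intro!: derivative_eq_intros)
  have "(E a b * E b a * R (elem r a b (- 1 * 0))) $$ (i, j) + (R (elem r a b (1 * 0)) * E b a * (- 1 \<cdot>\<^sub>m E a b)) $$ (i, j)
      = E a a $$ (i, j) - E b b $$ (i, j)" by (rule DERIV_unique[OF d1 d2])
  moreover have "E a b * E b a * R (elem r a b (- 1 * 0)) = E a b * E b a"
    using right_mult_one_mat[OF mult_square_carrier[OF E_carrier E_carrier], of a b b a] by (simp add: R_one)
  moreover have "R (elem r a b (1 * 0)) * E b a * (- 1 \<cdot>\<^sub>m E a b) = - 1 \<cdot>\<^sub>m (E b a * E a b)"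
    by (simp add: R_one left_mult_one_mat[OF E_carrier] mult_smult_distrib[OF E_carrier E_carrier])
  ultimately have "(E a b * E b a) $$ (i, j) + (- 1 \<cdot>\<^sub>m (E b a * E a b)) $$ (i, j) = E a a $$ (i, j) - E b b $$ (i, j)" by simp
  moreover have "(- 1 \<cdot>\<^sub>m (E b a * E a b)) $$ (i, j) = - ((E b a * E a b) $$ (i, j))"
    using ij carrier_matD[OF mult_square_carrier[OF E_carrier E_carrier, of b a a b]] by (simp del: index_mult_mat)
  ultimately show "(E a b * E b a) $$ (i, j) = (E b a * E a b + E a a - E b b) $$ (i, j)"
    using ij carrier_matD[OF E_carrier] carrier_matD[OF mult_square_carrier[OF E_carrier E_carrier, of b a a b]]
    by (simp del: index_mult_mat add: algebra_simps)
qed (auto simp: E_def)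

text \<open>The quadratic Casimir element, written entrywise so that no sum of matrices is
  formed.\<close>

definition casimir :: "complex mat" where
  "casimir = mat d d (\<lambda>(i, j). \<Sum>a<r. \<Sum>b<r. (E a b * E b a) $$ (i, j))"

lemma casimir_carrier [simp, intro]: "casimir \<in> carrier_mat d d"
  by (simp add: casimir_def)

text \<open>Conjugation replaces each factor by the combination from \<open>Ad\<close>, and the
  contraction of g with its inverse restores the original sum.\<close>

lemma casimir_commutes:
  assumes g: "g \<in> carrier (GL r)"
  shows "R g * casimir = casimir * R g"
proof -
  obtain h where h: "h \<in> carrier (GL r)" "g * h = 1\<^sub>m r" "h * g = 1\<^sub>m r" using GL_inverse[OF g] by metis
  note gc = GL_mat[OF g] GL_mat[OF h(1)]
  note c = R_mat[OF g] R_mat[OF h(1)]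
  have hg: "R h * R g = 1\<^sub>m d" using R_mult[OF h(1) g] h(3) R_one by simp
  have gh: "(\<Sum>a<r. g $$ (x, a) * h $$ (a, y)) = (if x = y then 1 else 0)" if "x < r" "y < r" for x y
    using mult_entry[OF gc that] that h(2) by simp
  have conj: "R g * casimir * R h = casimir"
  proof (rule eq_matI)
    fix i j assume "i < dim_row casimir" "j < dim_col casimir"
    hence ij: "i < d" "j < d" by (auto simp: casimir_def)
    define X where "X a b = R g * E a b * R h" for a b
    have Xc: "X a b \<in> carrier_mat d d" for a b unfolding X_def using c by (intro mult_square_carrier) auto
    have XX: "X a b * X b a = R g * (E a b * E b a) * R h" for a b
    proof -
      have "X a b * X b a = (R g * E a b) * (R h * (R g * E b a * R h))"
        unfolding X_def by (rule assoc_mult_mat[of _ d d _ d _ d]) (use c in \<open>auto intro!: mult_square_carrier\<close>)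
      also have "R h * (R g * E b a * R h) = (R h * R g) * E b a * R h"
        using c E_carrier[of b a] by (simp add: assoc_mult_mat[of _ d d _ d _ d] mult_square_carrier)
      also have "(R h * R g) * E b a = E b a" unfolding hg by (rule left_mult_one_mat[OF E_carrier])
      also have "(R g * E a b) * (E b a * R h) = R g * (E a b * E b a) * R h"
        using c E_carrier[of b a] E_carrier[of a b] by (simp add: assoc_mult_mat[of _ d d _ d _ d] mult_square_carrier)
      finally show ?thesis .
    qed
    have "(R g * casimir * R h) $$ (i, j) = (\<Sum>y<d. \<Sum>x<d. R g $$ (i, x) * casimir $$ (x, y) * R h $$ (y, j))"
      by (rule mult3_entry) (use c ij in auto)
    also have "\<dots> = (\<Sum>y<d. \<Sum>x<d. \<Sum>a<r. \<Sum>b<r. R g $$ (i, x) * (E a b * E b a) $$ (x, y) * R h $$ (y, j))"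
      by (intro sum.cong refl) (simp add: casimir_def sum_distrib_left sum_distrib_right del: index_mult_mat)
    also have "\<dots> = (\<Sum>y<d. \<Sum>a<r. \<Sum>b<r. \<Sum>x<d. R g $$ (i, x) * (E a b * E b a) $$ (x, y) * R h $$ (y, j))"
      by (rule sum.cong[OF refl], rule sum_rotate)
    also have "\<dots> = (\<Sum>a<r. \<Sum>b<r. \<Sum>y<d. \<Sum>x<d. R g $$ (i, x) * (E a b * E b a) $$ (x, y) * R h $$ (y, j))"
      by (rule sum_rotate)
    also have "\<dots> = (\<Sum>a<r. \<Sum>b<r. (R g * (E a b * E b a) * R h) $$ (i, j))"
      by (intro sum.cong refl, rule mult3_entry[symmetric]) (use c ij in \<open>auto intro: mult_square_carrier\<close>)
    also have "\<dots> = (\<Sum>a<r. \<Sum>b<r. \<Sum>k<d. X a b $$ (i, k) * X b a $$ (k, j))"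
      by (simp add: XX[symmetric] mult_entry[OF Xc Xc ij] del: index_mult_mat)
    also have "\<dots> = (\<Sum>k<d. \<Sum>a<r. \<Sum>b<r. X a b $$ (i, k) * X b a $$ (k, j))"
      by (rule sum_rotate[symmetric])
    also have "\<dots> = (\<Sum>k<d. \<Sum>a<r. \<Sum>b<r. (\<Sum>c<r. \<Sum>e<r. g $$ (c, a) * h $$ (b, e) * E c e $$ (i, k)) *
        (\<Sum>c<r. \<Sum>e<r. g $$ (c, b) * h $$ (a, e) * E c e $$ (k, j)))"
      unfolding X_def by (intro sum.cong refl arg_cong2[where f = "(*)"] Ad g h) (use ij in auto)
    also have "\<dots> = (\<Sum>k<d. \<Sum>a<r. \<Sum>b<r. E a b $$ (i, k) * E b a $$ (k, j))"
      by (intro sum.cong refl triple_contraction gh)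
    also have "\<dots> = (\<Sum>a<r. \<Sum>b<r. \<Sum>k<d. E a b $$ (i, k) * E b a $$ (k, j))"
      by (rule sum_rotate)
    also have "\<dots> = casimir $$ (i, j)"
      using ij by (simp add: casimir_def mult_entry[OF E_carrier E_carrier] del: index_mult_mat)
    finally show "(R g * casimir * R h) $$ (i, j) = casimir $$ (i, j)" .
  qed (use c in \<open>auto simp: casimir_def\<close>)
  have "casimir * R g = R g * casimir * R h * R g" by (simp only: conj)
  also have "\<dots> = R g * casimir * (R h * R g)"
    by (rule assoc_mult_mat[of _ d d _ d _ d]) (use c in \<open>auto intro!: mult_square_carrier\<close>)
  also have "\<dots> = R g * casimir" unfolding hg
    by (rule right_mult_one_mat[of _ d]) (use c in \<open>auto intro!: mult_square_carrier\<close>)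
  finally show ?thesis ..
qed

text \<open>Derivative at 0 of R(1 + s E_aa) P_m = (1 + s)^(m a) P_m, an identity that holds near 0,
  away from s = -1.\<close>

lemma E_P:
  assumes a: "a < r"
  shows "E a a * P m = of_int (m a) \<cdot>\<^sub>m P m"
proof (rule eq_matI)
  fix i j assume "i < dim_row (of_int (m a) \<cdot>\<^sub>m P m)" "j < dim_col (of_int (m a) \<cdot>\<^sub>m P m)"
  hence ij: "i < d" "j < d" by (auto simp: P_def)
  let ?t = "\<lambda>s i. if i = a then 1 + s else 1 :: complex"
  have d1: "((\<lambda>s. \<Sum>k<d. R (elem r a a (1 * s)) $$ (i, k) * P m $$ (k, j)) has_field_derivative
      (\<Sum>k<d. 1 * E a a $$ (i, k) * P m $$ (k, j))) (at 0)"
    by (intro DERIV_sum DERIV_cmult_right R_elem_derivative a ij) auto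
  have lm: "lmon r m (?t s) = (1 + s) powi m a" for s
  proof -
    have "lmon r m (?t s) = (\<Prod>i<r. if i = a then (1 + s) powi m a else 1)"
      unfolding lmon_def by (rule prod.cong) auto
    thus ?thesis using a by simp
  qed
  have d2: "((\<lambda>s. (1 + s) powi m a * P m $$ (i, j)) has_field_derivative of_int (m a) * P m $$ (i, j)) (at (0::complex))"
    by (auto intro!: derivative_eq_intros)
  have "eventually (\<lambda>s::complex. s \<noteq> -1) (nhds 0)"
    by (rule t1_space_nhds) simp
  hence ev: "eventually (\<lambda>s. (\<Sum>k<d. R (elem r a a (1 * s)) $$ (i, k) * P m $$ (k, j)) = (1 + s) powi m a * P m $$ (i, j)) (nhds 0)"
  proof (rule eventually_mono)
    fix s :: complex assume "s \<noteq> -1"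
    hence t: "?t s \<in> torus r" by (auto simp: torus_def add_eq_0_iff)
    have "(\<Sum>k<d. R (dg r (?t s)) $$ (i, k) * P m $$ (k, j)) = (R (dg r (?t s)) * P m) $$ (i, j)"
      by (rule mult_entry[symmetric, OF R_mat[OF dg_GL[OF t]] P_carrier ij])
    also have "\<dots> = (1 + s) powi m a * P m $$ (i, j)"
      unfolding P_R_dg(2)[OF t] lm using ij by (simp add: P_def)
    finally show "(\<Sum>k<d. R (elem r a a (1 * s)) $$ (i, k) * P m $$ (k, j)) = (1 + s) powi m a * P m $$ (i, j)"
      by (simp add: elem_diag)
  qed
  have "(\<Sum>k<d. 1 * E a a $$ (i, k) * P m $$ (k, j)) = of_int (m a) * P m $$ (i, j)"
    using DERIV_cong_ev[OF refl ev refl] d1 d2 DERIV_unique by blast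
  thus "(E a a * P m) $$ (i, j) = (of_int (m a) \<cdot>\<^sub>m P m) $$ (i, j)"
    using mult_entry[OF E_carrier P_carrier ij, of a a m] ij by (simp add: P_def)
qed (auto simp: E_def P_def)

text \<open>For a < b the curve 1 + s E_ab is unipotent upper triangular and fixes v.\<close>

lemma E_hwv_raise:
  assumes v: "hwv m v" and ab: "a < b" "b < r"
  shows "E a b *\<^sub>v v = 0\<^sub>v d"
proof (rule eq_vecI)
  have vc: "v \<in> carrier_vec d" using v by (simp add: hwv_def)
  fix i assume "i < dim_vec (0\<^sub>v d :: complex vec)"
  hence i: "i < d" by simp
  have ar: "a < r" using ab by simp
  have d1: "((\<lambda>s. \<Sum>k<d. R (elem r a b (1 * s)) $$ (i, k) * v $ k) has_field_derivative
      (\<Sum>k<d. 1 * E a b $$ (i, k) * v $ k)) (at 0)"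
    by (intro DERIV_sum DERIV_cmult_right R_elem_derivative ar ab i) auto
  have "(\<Sum>k<d. R (elem r a b s) $$ (i, k) * v $ k) = v $ i" for s
  proof -
    have e: "elem r a b s \<in> carrier (GL r)" by (rule elem_GL) (use ab in auto)
    have ut: "upper_triangular (elem r a b s)" using ab by (intro upper_triangularI) (auto simp: elem_def)
    have "lmon r m (\<lambda>i. elem r a b s $$ (i, i)) = 1"
      unfolding lmon_def by (rule prod.neutral) (use ab in \<open>auto simp: elem_entry\<close>)
    hence "R (elem r a b s) *\<^sub>v v = v" using v e ut by (simp add: hwv_def)
    thus ?thesis using mult_vec_entry[OF R_mat[OF e] vc i] by simp
  qed
  hence "((\<lambda>s. \<Sum>k<d. R (elem r a b (1 * s)) $$ (i, k) * v $ k) has_field_derivative 0) (at 0)" by simp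
  from DERIV_unique[OF d1 this] show "(E a b *\<^sub>v v) $ i = 0\<^sub>v d $ i"
    using mult_vec_entry[OF E_carrier vc i, of a b] i by simp
qed (simp add: E_def)

end

context rational
begin

lemma E_weight_vec:
  assumes a: "a < r" and x: "x \<in> carrier_vec d" "P m *\<^sub>v x = x"
  shows "E a a *\<^sub>v x = of_int (m a) \<cdot>\<^sub>v x"
proof -
  have "E a a *\<^sub>v (P m *\<^sub>v x) = (E a a * P m) *\<^sub>v x"
    by (rule assoc_mult_mat_vec[symmetric, OF E_carrier P_carrier x(1)])
  also have "\<dots> = of_int (m a) \<cdot>\<^sub>v (P m *\<^sub>v x)"
    by (simp add: E_P[OF a] smult_mat_mult_vec[OF P_carrier x(1)])
  finally show ?thesis using x by simp
qed

text \<open>Products whose right factor is a raising operator kill v; the opposite order is reduced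
  to this one by the commutator, at the cost of diagonal scalars. The eigenvalue stays implicit: the
  resulting constant is identified later at the leading exponent.\<close>

lemma casimir_hwv:
  assumes v: "hwv m v" and m: "m \<in> expo r"
  shows "\<exists>c. casimir *\<^sub>v v = c \<cdot>\<^sub>v v"
proof -
  have vc: "v \<in> carrier_vec d" using v by (simp add: hwv_def)
  have wv: "E a a *\<^sub>v v = of_int (m a) \<cdot>\<^sub>v v" if "a < r" for a
    by (rule E_weight_vec[OF that vc]) (use hwv_P[OF v m, of m] in simp)
  have assoc: "(E a b * E a' b') *\<^sub>v v = E a b *\<^sub>v (E a' b' *\<^sub>v v)" for a b a' b'
    by (rule assoc_mult_mat_vec[OF E_carrier E_carrier vc])
  have zero: "E a b *\<^sub>v 0\<^sub>v d = 0\<^sub>v d" for a b by (auto simp: E_def)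
  have "\<exists>c. (E a b * E b a) *\<^sub>v v = c \<cdot>\<^sub>v v" if ab: "a < r" "b < r" for a b
  proof -
    consider "a = b" | "b < a" | "a < b" by linarith
    thus ?thesis
    proof cases
      case 1
      have "(E a b * E b a) *\<^sub>v v = of_int (m a) \<cdot>\<^sub>v (of_int (m a) \<cdot>\<^sub>v v)"
        using 1 wv[OF ab(1)] mult_mat_vec[OF E_carrier vc] by (simp add: assoc)
      thus ?thesis by (auto simp: smult_smult_assoc)
    next
      case 2
      have "(E a b * E b a) *\<^sub>v v = 0 \<cdot>\<^sub>v v"
        using E_hwv_raise[OF v 2 ab(1)] vc by (simp add: assoc zero zero_smult_vec)
      thus ?thesis by blast
    next
      case 3
      have c: "E b a * E a b \<in> carrier_mat d d" by (rule mult_square_carrier[OF E_carrier E_carrier])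
      have "(E a b * E b a) *\<^sub>v v = (E b a * E a b + E a a - E b b) *\<^sub>v v"
        using E_commutator[of a b] ab 3 by simp
      also have "\<dots> = (E b a * E a b) *\<^sub>v v + E a a *\<^sub>v v - E b b *\<^sub>v v"
        using c vc by (simp add: minus_mult_distrib_mat_vec[of _ d d] add_mult_distrib_mat_vec[of _ d d])
      also have "\<dots> = (of_int (m a) - of_int (m b)) \<cdot>\<^sub>v v"
        using E_hwv_raise[OF v 3 ab(2)] wv[OF ab(1)] wv[OF ab(2)] vc
        by (intro eq_vecI) (auto simp: assoc zero algebra_simps)
      finally show ?thesis by blast
    qed
  qed
  then obtain c where c: "\<And>a b. a < r \<Longrightarrow> b < r \<Longrightarrow> (E a b * E b a) *\<^sub>v v = c a b \<cdot>\<^sub>v v" by metis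
  have "casimir *\<^sub>v v = (\<Sum>a<r. \<Sum>b<r. c a b) \<cdot>\<^sub>v v"
  proof (rule eq_vecI)
    fix i assume "i < dim_vec ((\<Sum>a<r. \<Sum>b<r. c a b) \<cdot>\<^sub>v v)"
    hence i: "i < d" using vc by simp
    have "(casimir *\<^sub>v v) $ i = (\<Sum>k<d. \<Sum>a<r. \<Sum>b<r. (E a b * E b a) $$ (i, k) * v $ k)"
      using i by (subst mult_vec_entry[OF casimir_carrier vc i]) (simp add: casimir_def sum_distrib_right del: index_mult_mat)
    also have "\<dots> = (\<Sum>a<r. \<Sum>b<r. \<Sum>k<d. (E a b * E b a) $$ (i, k) * v $ k)" by (rule sum_rotate)
    also have "\<dots> = (\<Sum>a<r. \<Sum>b<r. ((E a b * E b a) *\<^sub>v v) $ i)"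
      by (intro sum.cong refl, rule mult_vec_entry[symmetric, OF mult_square_carrier[OF E_carrier E_carrier] vc i])
    also have "\<dots> = (\<Sum>a<r. \<Sum>b<r. c a b * v $ i)" using c i vc by (intro sum.cong refl) simp
    finally show "(casimir *\<^sub>v v) $ i = ((\<Sum>a<r. \<Sum>b<r. c a b) \<cdot>\<^sub>v v) $ i"
      using i vc by (simp add: sum_distrib_right)
  qed (use vc in \<open>simp add: casimir_def\<close>)
  thus ?thesis by blast
qed

section \<open>Traces against torus elements\<close>

definition character :: "(nat \<Rightarrow> complex) \<Rightarrow> complex" where
  "character t = tr (R (dg r t))"

text \<open>The character with the weight m counted with the additional factor F(m): F(m) = m_a
  amounts to the Euler operator in t_a.\<close>

definition dchar :: "((nat \<Rightarrow> int) \<Rightarrow> complex) \<Rightarrow> (nat \<Rightarrow> complex) \<Rightarrow> complex" where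
  "dchar F t = (\<Sum>m\<in>weights. F m * (tr (P m) * lmon r m t))"

lemma tr_mult_R:
  assumes A: "A \<in> carrier_mat d d" and t: "t \<in> torus r"
  shows "tr (A * R (dg r t)) = (\<Sum>m\<in>weights. lmon r m t * tr (A * P m))"
proof -
  note Rt = R_mat[OF dg_GL[OF t]]
  have "tr (A * R (dg r t)) = (\<Sum>i<d. \<Sum>k<d. A $$ (i, k) * R (dg r t) $$ (k, i))"
    using mult_entry[OF A Rt] by (simp add: tr_carrier[OF mult_square_carrier[OF A Rt]] del: index_mult_mat)
  also have "\<dots> = (\<Sum>i<d. \<Sum>k<d. \<Sum>m\<in>weights. lmon r m t * (A $$ (i, k) * P m $$ (k, i)))"
    by (intro sum.cong refl) (simp add: R_dg_entry[OF _ _ t] sum_distrib_left mult_ac)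
  also have "\<dots> = (\<Sum>m\<in>weights. \<Sum>i<d. \<Sum>k<d. lmon r m t * (A $$ (i, k) * P m $$ (k, i)))"
    by (rule sum_rotate[symmetric])
  also have "\<dots> = (\<Sum>m\<in>weights. lmon r m t * tr (A * P m))"
    using mult_entry[OF A P_carrier]
    by (simp add: tr_carrier[OF mult_square_carrier[OF A P_carrier]] sum_distrib_left del: index_mult_mat)
  finally show ?thesis .
qed

lemma character_sum: "t \<in> torus r \<Longrightarrow> character t = dchar (\<lambda>m. 1) t"
  unfolding character_def dchar_def
  using tr_mult_R[of "1\<^sub>m d" t] R_mat[OF dg_GL, of t] left_mult_one_mat[OF P_carrier]
  by (simp add: mult.commute)

lemma tr_smult: "A \<in> carrier_mat n n \<Longrightarrow> tr (c \<cdot>\<^sub>m A) = c * tr A"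
  by (simp add: tr_def sum_distrib_left)

lemma tr_E: "a < r \<Longrightarrow> t \<in> torus r \<Longrightarrow> tr (E a a * R (dg r t)) = dchar (\<lambda>m. of_int (m a)) t"
  by (subst tr_mult_R[OF E_carrier]) (simp_all add: E_P tr_smult[OF P_carrier] dchar_def mult_ac)

lemma tr_EE_diag: "a < r \<Longrightarrow> t \<in> torus r \<Longrightarrow> tr (E a a * E a a * R (dg r t)) = dchar (\<lambda>m. of_int (m a) * of_int (m a)) t"
proof -
  assume a: "a < r" and t: "t \<in> torus r"
  have "E a a * E a a * P m = (of_int (m a) * of_int (m a)) \<cdot>\<^sub>m P m" for m
  proof -
    have "E a a * E a a * P m = E a a * (E a a * P m)" by (rule assoc_mult_mat[OF E_carrier E_carrier P_carrier])
    also have "\<dots> = of_int (m a) \<cdot>\<^sub>m (of_int (m a) \<cdot>\<^sub>m P m)"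
      unfolding E_P[OF a] mult_smult_distrib[OF E_carrier P_carrier] ..
    finally show ?thesis by (simp add: smult_smult_mat)
  qed
  thus ?thesis using t
    by (subst tr_mult_R[OF mult_square_carrier[OF E_carrier E_carrier]]) (simp_all add: tr_smult[OF P_carrier] dchar_def mult_ac)
qed

text \<open>By cyclicity, moving E b a around the trace past R (dg r t) multiplies the trace by t a / t b;
  together with the commutator of E a b and E b a this determines it.\<close>

lemma tr_EE_off:
  assumes ab: "a < r" "b < r" "a \<noteq> b" and t: "t \<in> torus r" "t a \<noteq> t b"
  shows "tr (E a b * E b a * R (dg r t)) =
    t a / (t a - t b) * (dchar (\<lambda>m. of_int (m a)) t - dchar (\<lambda>m. of_int (m b)) t)"
proof -
  note Rt = R_mat[OF dg_GL[OF t(1)]]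
  note EE = mult_square_carrier[OF E_carrier E_carrier]
  define S where "S = tr (E a b * E b a * R (dg r t))"
  define T where "T = tr (E b a * E a b * R (dg r t))"
  have nz: "t a \<noteq> 0" "t b \<noteq> 0" using t ab by (auto simp: torus_def)
  have "S = tr (E a b * (E b a * R (dg r t)))"
    unfolding S_def by (simp only: assoc_mult_mat[OF E_carrier E_carrier Rt])
  also have "\<dots> = tr ((E b a * R (dg r t)) * E a b)"
    by (rule tr_mult_comm[OF E_carrier mult_square_carrier[OF E_carrier Rt]])
  also have "(E b a * R (dg r t)) * E a b = E b a * (R (dg r t) * E a b)"
    by (rule assoc_mult_mat[OF E_carrier Rt E_carrier])
  also have "\<dots> = (t a / t b) \<cdot>\<^sub>m (E b a * E a b * R (dg r t))"
    unfolding R_dg_E[OF t(1) ab(1,2)] mult_smult_distrib[OF E_carrier mult_square_carrier[OF E_carrier Rt]]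
    by (simp only: assoc_mult_mat[OF E_carrier E_carrier Rt])
  finally have 1: "S = t a / t b * T" by (simp only: T_def tr_smult[OF mult_square_carrier[OF EE Rt]])
  have "E a b * E b a * R (dg r t) = (E b a * E a b + E a a - E b b) * R (dg r t)"
    by (simp only: E_commutator[OF ab])
  also have "\<dots> = E b a * E a b * R (dg r t) + E a a * R (dg r t) - E b b * R (dg r t)"
    using EE[of b a a b] E_carrier[of a a] E_carrier[of b b] Rt
    by (simp add: minus_mult_distrib_mat[of _ d d] add_mult_distrib_mat[of _ d d])
  finally have 2: "S = T + dchar (\<lambda>m. of_int (m a)) t - dchar (\<lambda>m. of_int (m b)) t"
    using mult_square_carrier[OF EE Rt, of b a a b] mult_square_carrier[OF E_carrier Rt, of a a] mult_square_carrier[OF E_carrier Rt, of b b]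
    by (simp add: S_def T_def tr_E[OF ab(1) t(1), symmetric] tr_E[OF ab(2) t(1), symmetric] tr_def sum.distrib sum_subtractf del: index_mult_mat)
  have "S * t b = t a * T" using 1 nz by (simp add: field_simps)
  also have "T = S - dchar (\<lambda>m. of_int (m a)) t + dchar (\<lambda>m. of_int (m b)) t" using 2 by simp
  finally have "S * (t a - t b) = t a * (dchar (\<lambda>m. of_int (m a)) t - dchar (\<lambda>m. of_int (m b)) t)"
    by (simp add: algebra_simps)
  thus ?thesis unfolding S_def[symmetric] using t(2) by (simp add: eq_divide_eq)
qed

lemma tr_casimir:
  assumes t: "t \<in> torus r" and dist: "\<And>i j. i < r \<Longrightarrow> j < r \<Longrightarrow> i \<noteq> j \<Longrightarrow> t i \<noteq> t j"
  shows "tr (casimir * R (dg r t)) = (\<Sum>a<r. dchar (\<lambda>m. of_int (m a) * of_int (m a)) t) +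
    (\<Sum>a<r. \<Sum>b\<in>{..<r} - {a}. t a / (t a - t b) * (dchar (\<lambda>m. of_int (m a)) t - dchar (\<lambda>m. of_int (m b)) t))"
proof -
  note Rt = R_mat[OF dg_GL[OF t]]
  note EE = mult_square_carrier[OF E_carrier E_carrier]
  have "tr (casimir * R (dg r t)) = (\<Sum>i<d. \<Sum>k<d. casimir $$ (i, k) * R (dg r t) $$ (k, i))"
    using mult_entry[OF casimir_carrier Rt]
    by (simp add: tr_carrier[OF mult_square_carrier[OF casimir_carrier Rt]] del: index_mult_mat)
  also have "\<dots> = (\<Sum>i<d. \<Sum>k<d. \<Sum>a<r. \<Sum>b<r. (E a b * E b a) $$ (i, k) * R (dg r t) $$ (k, i))"
    by (intro sum.cong refl) (simp add: casimir_def sum_distrib_right del: index_mult_mat)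
  also have "\<dots> = (\<Sum>i<d. \<Sum>a<r. \<Sum>b<r. \<Sum>k<d. (E a b * E b a) $$ (i, k) * R (dg r t) $$ (k, i))"
    by (rule sum.cong[OF refl], rule sum_rotate)
  also have "\<dots> = (\<Sum>a<r. \<Sum>b<r. \<Sum>i<d. \<Sum>k<d. (E a b * E b a) $$ (i, k) * R (dg r t) $$ (k, i))"
    by (rule sum_rotate)
  also have "\<dots> = (\<Sum>a<r. \<Sum>b<r. tr (E a b * E b a * R (dg r t)))"
    using mult_entry[OF EE Rt] by (simp add: tr_carrier[OF mult_square_carrier[OF EE Rt]] del: index_mult_mat)
  also have "\<dots> = (\<Sum>a<r. tr (E a a * E a a * R (dg r t)) + (\<Sum>b\<in>{..<r} - {a}. tr (E a b * E b a * R (dg r t))))"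
    by (rule sum.cong[OF refl], rule sum.remove) auto
  also have "\<dots> = (\<Sum>a<r. dchar (\<lambda>m. of_int (m a) * of_int (m a)) t + (\<Sum>b\<in>{..<r} - {a}.
      t a / (t a - t b) * (dchar (\<lambda>m. of_int (m a)) t - dchar (\<lambda>m. of_int (m b)) t)))"
    by (intro sum.cong refl arg_cong2[where f = "(+)"] tr_EE_diag tr_EE_off t dist) auto
  finally show ?thesis by (simp add: sum.distrib)
qed

end

context irreducible
begin

text \<open>Schur's lemma with an eigenvector already at hand: the eigenspace to the eigenvalue on v
  is invariant.\<close>

lemma casimir_scalar: "\<exists>c. \<forall>t\<in>torus r. tr (casimir * R (dg r t)) = c * character t"
proof -
  obtain c where c: "casimir *\<^sub>v v = c \<cdot>\<^sub>v v" using casimir_hwv[OF hw m_expo] by blast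
  define W where "W = {x\<in>carrier_vec d. casimir *\<^sub>v x = c \<cdot>\<^sub>v x}"
  have "W = carrier_vec d"
  proof (rule irreducible_invariant[OF irred])
    show "v \<in> W" using c v_carrier by (simp add: W_def)
    show "v \<noteq> 0\<^sub>v d" by (rule v_nonzero)
    show "R A *\<^sub>v x \<in> W" if A: "A \<in> carrier (GL r)" and x: "x \<in> W" for A x
    proof -
      have xc: "x \<in> carrier_vec d" and cx: "casimir *\<^sub>v x = c \<cdot>\<^sub>v x" using x by (auto simp: W_def)
      have "casimir *\<^sub>v (R A *\<^sub>v x) = (casimir * R A) *\<^sub>v x"
        by (rule assoc_mult_mat_vec[symmetric, OF casimir_carrier R_mat[OF A] xc])
      also have "\<dots> = R A *\<^sub>v (casimir *\<^sub>v x)"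
        unfolding casimir_commutes[OF A, symmetric] by (rule assoc_mult_mat_vec[OF R_mat[OF A] casimir_carrier xc])
      also have "\<dots> = c \<cdot>\<^sub>v (R A *\<^sub>v x)" unfolding cx by (rule R_smult[OF A xc])
      finally show ?thesis using R_vec[OF A xc] by (simp add: W_def)
    qed
    show "0\<^sub>v d \<in> W" using casimir_carrier by (auto simp: W_def smult_zero_vec casimir_def)
    show "x + y \<in> W" if "x \<in> W" "y \<in> W" for x y
      using that by (simp add: W_def mult_add_distrib_mat_vec[OF casimir_carrier] smult_add_distrib_vec[of _ d])
    show "b \<cdot>\<^sub>v x \<in> W" if "x \<in> W" for b x
      using that by (simp add: W_def mult_mat_vec[OF casimir_carrier] smult_smult_assoc mult.commute)
  qed (auto simp: W_def)
  hence "casimir *\<^sub>v x = (c \<cdot>\<^sub>m 1\<^sub>m d) *\<^sub>v x" if "x \<in> carrier_vec d" for x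
    using that smult_mat_mult_vec[OF one_carrier_mat that] by (auto simp: W_def)
  hence C: "casimir = c \<cdot>\<^sub>m 1\<^sub>m d"
    by (intro mat_eq_by_vec[OF casimir_carrier]) auto
  have "tr (casimir * R (dg r t)) = c * character t" if t: "t \<in> torus r" for t
    unfolding C character_def
    using R_mat[OF dg_GL[OF t]] by (simp add: mult_smult_assoc_mat[of _ d d] tr_smult)
  thus ?thesis by blast
qed

end

section \<open>The Weyl character formula\<close>

lemma dominant_shift_strict:
  "dominant r m \<Longrightarrow> i < j \<Longrightarrow> j < r \<Longrightarrow> m j + rho r j < m i + rho r i"
proof -
  assume "dominant r m" "i < j" "j < r"
  hence "m j \<le> m i" "rho r j < rho r i" by (simp_all add: dominant_def rho_def)
  thus ?thesis by simp
qed

lemma dominant_shift_mono: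
  "dominant r m \<Longrightarrow> i \<le> j \<Longrightarrow> j < r \<Longrightarrow> m j + rho r j \<le> m i + rho r i"
  using dominant_shift_strict[of r m i j] by (cases "i = j") auto

lemma laurent_permute:
  assumes F: "laurent r F b" and q: "q permutes {..<r}"
  shows "laurent r (\<lambda>t. F (t \<circ> q)) (\<lambda>k. b (k \<circ> q))"
proof (rule laurentI)
  let ?S = "{k. b k \<noteq> 0}" and ?i = "Hilbert_Choice.inv q"
  note iq = permutes_inv[OF q]
  have inv: "k \<circ> ?i \<circ> q = k" "k \<circ> q \<circ> ?i = k" for k :: "nat \<Rightarrow> int"
    using permutes_inverses[OF q] by (auto simp: fun_eq_iff)
  show "finite ((\<lambda>k. k \<circ> ?i) ` ?S)" using laurent_finite[OF F] by simp
  show "(\<lambda>k. k \<circ> ?i) ` ?S \<subseteq> expo r" using laurent_expo[OF F] expo_permute[OF iq] by auto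
  show "b (k \<circ> q) = 0" if "k \<notin> (\<lambda>k. k \<circ> ?i) ` ?S" for k
    using that inv(2)[of k] by (metis (mono_tags, lifting) image_eqI mem_Collect_eq)
  fix t assume t: "t \<in> torus r"
  hence tq: "t \<circ> q \<in> torus r" using permutes_less[OF q] by (auto simp: torus_def)
  have inj: "inj_on (\<lambda>k. k \<circ> ?i) ?S"
    by (rule inj_onI) (metis inv(1))
  have "F (t \<circ> q) = (\<Sum>k\<in>?S. b k * lmon r k (t \<circ> q))"
    by (rule laurentD[OF F laurent_finite[OF F] _ tq]) simp
  also have "\<dots> = (\<Sum>k\<in>?S. b k * lmon r (k \<circ> ?i) t)"
    using lmon_permute[OF q] inv(1) by (intro sum.cong refl) metis
  also have "\<dots> = (\<Sum>k\<in>(\<lambda>k. k \<circ> ?i) ` ?S. b (k \<circ> q) * lmon r k t)"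
    by (subst sum.reindex[OF inj]) (simp add: inv(1))
  finally show "F (t \<circ> q) = (\<Sum>k\<in>(\<lambda>k. k \<circ> ?i) ` ?S. b (k \<circ> q) * lmon r k t)" .
qed

text \<open>The Casimir trace divides by t_a - t_b, so its identity is available only for distinct
  coordinates. The points t_i + s i avoid coincidences and zeros for all but finitely many s and
  tend to t.\<close>

lemma laurent_unique_distinct:
  assumes F: "laurent r F b" and G: "laurent r G c"
    and eq: "\<And>t. t \<in> torus r \<Longrightarrow> (\<And>i j. i < r \<Longrightarrow> j < r \<Longrightarrow> i \<noteq> j \<Longrightarrow> t i \<noteq> t j) \<Longrightarrow> F t = G t"
  shows "b = c"
proof (rule laurent_unique[OF F G])
  fix t assume t: "t \<in> torus r"
  define T where "T s i = t i + s * of_nat i" for s i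
  define S where "S = (\<Union>i<r. {s. t i + s * of_nat i = 0}) \<union>
      (\<Union>i<r. \<Union>j<r. {s. i \<noteq> j \<and> t i + s * of_nat i = t j + s * of_nat j})"
  have "finite {s. t i + s * of_nat i = 0}" if "i < r" for i
  proof (rule finite_subset)
    show "{s. t i + s * of_nat i = 0} \<subseteq> {- t i / of_nat i}"
      using torusD[OF t that] by (cases "i = 0") (auto simp: field_simps eq_neg_iff_add_eq_0)
  qed simp
  moreover have "finite {s. i \<noteq> j \<and> t i + s * of_nat i = t j + s * of_nat j}" for i j
  proof (rule finite_subset)
    show "{s. i \<noteq> j \<and> t i + s * of_nat i = t j + s * of_nat j} \<subseteq> {(t j - t i) / (of_nat i - of_nat j)}"
      by (auto simp: field_simps)
  qed simp
  ultimately have "finite S" by (auto simp: S_def)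
  from eventually_avoid_finite[OF this] have ev: "eventually (\<lambda>s. F (T s) = G (T s)) (at 0)"
  proof (rule eventually_mono)
    fix s assume "s \<notin> S"
    thus "F (T s) = G (T s)" by (intro eq) (auto simp: T_def S_def torus_def)
  qed
  have evt: "eventually (\<lambda>s. T s \<in> torus r) (at 0)"
    using eventually_avoid_finite[OF \<open>finite S\<close>]
    by (rule eventually_mono) (auto simp: T_def S_def torus_def)
  have lim: "((\<lambda>s. H (T s)) \<longlongrightarrow> H t) (at 0)" if H: "laurent r H h" for H h
  proof -
    let ?f = "\<lambda>t. \<Sum>k | h k \<noteq> 0. h k * lmon r k t"
    have "((\<lambda>s. T s i) \<longlongrightarrow> t i) (at 0)" for i
      unfolding T_def by (auto intro!: tendsto_eq_intros)
    hence "((\<lambda>s. ?f (T s)) \<longlongrightarrow> ?f t) (at 0)"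
      unfolding lmon_def using torusD[OF t] by (intro tendsto_intros) auto
    moreover have "eventually (\<lambda>s. ?f (T s) = H (T s)) (at 0)"
      using evt by (rule eventually_mono) (use H in \<open>simp add: laurent_def\<close>)
    ultimately have "((\<lambda>s. H (T s)) \<longlongrightarrow> ?f t) (at 0)" by (rule Lim_transform_eventually)
    thus ?thesis using H t by (simp add: laurent_def)
  qed
  have "((\<lambda>s. G (T s)) \<longlongrightarrow> F t) (at 0)" by (rule Lim_transform_eventually[OF lim[OF F] ev])
  with lim[OF G] show "F t = G t" using LIM_unique by blast
qed

text \<open>Let B be the first n indices and A their image. A - B and B - A have equal size, and k(n
  - 1) separates the values of k on them.\<close>

lemma sum_permute_initial_le:
  fixes k :: "nat \<Rightarrow> int"
  assumes p: "p permutes {..<r}" and k: "\<And>i j. i \<le> j \<Longrightarrow> j < r \<Longrightarrow> k j \<le> k i" and n: "n \<le> r"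
  shows "(\<Sum>i<n. k (p i)) \<le> (\<Sum>i<n. k i)"
proof (cases "n = 0")
  case False
  define A where "A = p ` {..<n}"
  define B where "B = {..<n}"
  have inj: "inj_on p {..<n}" using permutes_inj[OF p] by (simp add: inj_on_def inj_def)
  have fin: "finite A" "finite B" by (auto simp: A_def B_def)
  have card: "card A = card B" using inj by (simp add: A_def B_def card_image)
  have cAB: "card (A - B) = card (B - A)"
    using card_Diff_subset_Int[of A B] card_Diff_subset_Int[of B A] fin card by (simp add: Int_commute)
  have Ar: "A \<subseteq> {..<r}" using permutes_less[OF p] n by (auto simp: A_def)
  have "(\<Sum>i<n. k (p i)) = sum k A" unfolding A_def by (simp add: sum.reindex[OF inj])
  also have "\<dots> = sum k (A \<inter> B) + sum k (A - B)" using fin by (simp add: sum.Int_Diff)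
  also have "sum k (A - B) \<le> of_nat (card (A - B)) * k (n - 1)"
    by (rule sum_bounded_above) (use Ar False in \<open>auto simp: B_def intro!: k\<close>)
  also have "of_nat (card (A - B)) * k (n - 1) = of_nat (card (B - A)) * k (n - 1)" by (simp add: cAB)
  also have "\<dots> \<le> sum k (B - A)"
    by (rule sum_bounded_below) (use n False in \<open>auto simp: B_def intro!: k\<close>)
  also have "sum k (A \<inter> B) + sum k (B - A) = sum k B"
    using fin sum.Int_Diff[of B k A] by (simp add: Int_commute)
  finally show ?thesis by (simp add: B_def)
qed simp

lemma abel_summation:
  fixes x s :: "nat \<Rightarrow> int"
  shows "(\<Sum>i<Suc n. x i * s i) = (\<Sum>i<n. (\<Sum>j<Suc i. x j) * (s i - s (Suc i))) + (\<Sum>j<Suc n. x j) * s n"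
  by (induction n) (simp_all add: algebra_simps)

text \<open>With x = l - k and s = l + k, the difference of the squared norms is the sum of x_i s_i.
  Abel summation writes it as nonnegative partial sums of x times the positive drops of s, so all
  partial sums vanish.\<close>

lemma dom_le_norm_eq:
  fixes k l :: "nat \<Rightarrow> int"
  assumes dom: "dom_le r k l" and nrm: "(\<Sum>i<r. k i * k i) = (\<Sum>i<r. l i * l i)"
    and k: "\<And>i j. i < j \<Longrightarrow> j < r \<Longrightarrow> k j < k i" and l: "\<And>i j. i < j \<Longrightarrow> j < r \<Longrightarrow> l j < l i"
    and i: "i < r"
  shows "k i = l i"
proof -
  obtain n where n: "r = Suc n" using i by (cases r) auto
  define x where "x i = l i - k i" for i
  define s where "s i = l i + k i" for i
  have part: "(\<Sum>j<Suc i. x j) \<ge> 0" if "i < r" for i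
  proof -
    have "Suc i \<le> r" using that by simp
    hence "(\<Sum>j<Suc i. k j) \<le> (\<Sum>j<Suc i. l j)" using dom unfolding dom_le_def by blast
    thus ?thesis by (simp add: x_def sum_subtractf del: sum.lessThan_Suc)
  qed
  have tot: "(\<Sum>j<Suc n. x j) = 0" using dom n by (simp add: dom_le_def x_def sum_subtractf del: sum.lessThan_Suc)
  have "0 = (\<Sum>i<r. l i * l i) - (\<Sum>i<r. k i * k i)" using nrm by simp
  also have "\<dots> = (\<Sum>i<Suc n. x i * s i)"
    unfolding n by (simp add: x_def s_def algebra_simps sum.distrib sum_subtractf del: sum.lessThan_Suc)
  also have "\<dots> = (\<Sum>i<n. (\<Sum>j<Suc i. x j) * (s i - s (Suc i)))"
    unfolding abel_summation tot by simp
  finally have 0: "(\<Sum>i<n. (\<Sum>j<Suc i. x j) * (s i - s (Suc i))) = 0" by simp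
  have pos: "s i - s (Suc i) > 0" if "i < n" for i
    using k[of i "Suc i"] l[of i "Suc i"] that n by (simp add: s_def)
  have z: "(\<Sum>j<Suc i. x j) = 0" if "i < n" for i
  proof -
    have "(\<Sum>j<Suc i. x j) * (s i - s (Suc i)) = 0"
    proof (rule sum_nonneg_0[OF _ _ 0])
      show "0 \<le> (\<Sum>j<Suc i. x j) * (s i - s (Suc i))" if "i \<in> {..<n}" for i
        using part[of i] pos[of i] that n by (intro mult_nonneg_nonneg) (auto simp del: sum.lessThan_Suc)
    qed (use that in auto)
    thus ?thesis using pos[OF that] by (simp del: sum.lessThan_Suc)
  qed
  have z': "(\<Sum>j<i. x j) = 0" if "i \<le> r" for i
    using that z[of "i - 1"] tot n by (cases i) (auto simp: le_Suc_eq less_Suc_eq_le simp del: sum.lessThan_Suc)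
  have "x i = (\<Sum>j<Suc i. x j) - (\<Sum>j<i. x j)" by simp
  also have "\<dots> = 0" using z'[of "Suc i"] z'[of i] i by (simp del: sum.lessThan_Suc)
  finally show ?thesis by (simp add: x_def)
qed

text \<open>Pairing (a, b) with (b, a), since t_a / (t_a - t_b) + t_b / (t_b - t_a) = 1.\<close>

lemma sum_symmetrize:
  fixes t D :: "nat \<Rightarrow> complex"
  assumes dist: "\<And>i j. i < r \<Longrightarrow> j < r \<Longrightarrow> i \<noteq> j \<Longrightarrow> t i \<noteq> t j"
  shows "(\<Sum>a<r. \<Sum>b\<in>{..<r} - {a}. t a / (t a - t b) * (D a + D b)) = (of_nat r - 1) * (\<Sum>a<r. D a)"
proof -
  define f where "f a b = (if a = b then 0 else t a / (t a - t b) * (D a + D b))" for a b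
  define S where "S = (\<Sum>a<r. \<Sum>b<r. f a b)"
  have "(\<Sum>a<r. \<Sum>b\<in>{..<r} - {a}. t a / (t a - t b) * (D a + D b)) = S"
    unfolding S_def
  proof (rule sum.cong[OF refl])
    fix a assume "a \<in> {..<r}"
    hence "(\<Sum>b<r. f a b) = f a a + (\<Sum>b\<in>{..<r} - {a}. f a b)" by (intro sum.remove) auto
    also have "\<dots> = (\<Sum>b\<in>{..<r} - {a}. t a / (t a - t b) * (D a + D b))"
      by (auto simp: f_def intro!: sum.cong)
    finally show "(\<Sum>b\<in>{..<r} - {a}. t a / (t a - t b) * (D a + D b)) = (\<Sum>b<r. f a b)" ..
  qed
  moreover have "S + S = 2 * ((of_nat r - 1) * (\<Sum>a<r. D a))"
  proof -
    have "S + S = (\<Sum>a<r. \<Sum>b<r. f a b) + (\<Sum>a<r. \<Sum>b<r. f b a)"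
      unfolding S_def by (subst (2) sum.swap) simp
    also have "\<dots> = (\<Sum>a<r. \<Sum>b<r. f a b + f b a)" by (simp add: sum.distrib)
    also have "\<dots> = (\<Sum>a<r. \<Sum>b<r. D a + D b - (if b = a then 2 * D a else 0))"
    proof (intro sum.cong refl)
      fix a b assume ab: "a \<in> {..<r}" "b \<in> {..<r}"
      show "f a b + f b a = D a + D b - (if b = a then 2 * D a else 0)"
      proof (cases "a = b")
        case False
        have "t b / (t b - t a) = - (t b / (t a - t b))"
          by (metis minus_diff_eq minus_divide_right)
        hence "f a b + f b a = (t a / (t a - t b) - t b / (t a - t b)) * (D a + D b)"
          using False by (simp add: f_def left_diff_distrib add.commute)
        also have "\<dots> = (t a - t b) / (t a - t b) * (D a + D b)" by (simp only: diff_divide_distrib)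
        finally show ?thesis using False dist[of a b] ab by simp
      qed (simp add: f_def)
    qed
    also have "\<dots> = (\<Sum>a<r. (of_nat r * D a + (\<Sum>b<r. D b)) - 2 * D a)"
      by (intro sum.cong refl) (simp add: sum.distrib sum_subtractf)
    also have "\<dots> = 2 * ((of_nat r - 1) * (\<Sum>a<r. D a))"
      by (simp add: sum.distrib sum_subtractf sum_distrib_left sum_distrib_right algebra_simps)
    finally show ?thesis .
  qed
  ultimately show ?thesis by simp
qed

context irreducible
begin

text \<open>Coefficients of the Vandermonde determinant times the character; \<open>tr (P w)\<close>
  is the multiplicity of w.\<close>

definition num_coeff :: "(nat \<Rightarrow> int) \<Rightarrow> complex" where
  "num_coeff k = (\<Sum>p | p permutes {..<r}. \<Sum>w\<in>weights. of_int (sign p) * tr (P w) *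
     (if k = (\<lambda>i. w i + rho r (p i)) then 1 else 0))"

lemma shifted_expo: "p permutes {..<r} \<Longrightarrow> w \<in> weights \<Longrightarrow> (\<lambda>i. w i + rho r (p i)) \<in> expo r"
  using weights_expo expo_permute[OF _ rho_expo, of p] by (auto intro!: expo_add simp: o_def)

text \<open>f = 1 gives the numerator of the character formula; taking for f the squared norm of the
  exponent gives its Laplacian.\<close>

lemma laurent_weighted:
  "laurent r (\<lambda>t. \<Sum>p | p permutes {..<r}. \<Sum>w\<in>weights. of_int (sign p) * tr (P w) * f (\<lambda>i. w i + rho r (p i)) *
      lmon r (\<lambda>i. w i + rho r (p i)) t) (\<lambda>k. f k * num_coeff k)"
proof -
  have "laurent r (\<lambda>t. \<Sum>p | p permutes {..<r}. \<Sum>w\<in>weights. of_int (sign p) * tr (P w) * f (\<lambda>i. w i + rho r (p i)) *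
      lmon r (\<lambda>i. w i + rho r (p i)) t)
    (\<lambda>k. \<Sum>p | p permutes {..<r}. \<Sum>w\<in>weights. of_int (sign p) * tr (P w) * f (\<lambda>i. w i + rho r (p i)) *
      (if k = (\<lambda>i. w i + rho r (p i)) then 1 else 0))"
    by (rule laurent_sum, simp add: finite_permutations, rule laurent_sum[OF finite_weights], rule laurent_scale,
        rule laurent_lmon, rule shifted_expo) auto
  also have "(\<lambda>k. \<Sum>p | p permutes {..<r}. \<Sum>w\<in>weights. of_int (sign p) * tr (P w) * f (\<lambda>i. w i + rho r (p i)) *
      (if k = (\<lambda>i. w i + rho r (p i)) then 1 else 0)) = (\<lambda>k. f k * num_coeff k)"
    unfolding num_coeff_def sum_distrib_left by (intro ext sum.cong refl) auto
  finally show ?thesis .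
qed

lemma numerator_expand:
  assumes t: "t \<in> torus r"
  shows "altern r (rho r) t * character t = (\<Sum>p | p permutes {..<r}. \<Sum>w\<in>weights. of_int (sign p) * tr (P w) * 1 *
      lmon r (\<lambda>i. w i + rho r (p i)) t)"
  unfolding altern_def character_sum[OF t] dchar_def sum_product
  by (intro sum.cong refl) (simp add: lmon_add[OF t] o_def mult_ac)

lemma laurent_numerator: "laurent r (\<lambda>t. altern r (rho r) t * character t) num_coeff"
  using laurent_cong[OF laurent_weighted[of "\<lambda>k. 1"]] numerator_expand by simp

lemma sum_weights: "w \<in> weights \<Longrightarrow> (\<Sum>i<r. w i) = (\<Sum>i<r. m i)"
  using weights_dom_le by (simp add: dom_le_def)

text \<open>The left-hand side is the Laplacian of the torus applied to the numerator. The identity comes from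
  the trace of the Casimir element; the cross terms of the Laplacian of the product match the
  off-diagonal terms of that trace by the Vandermonde formula.\<close>

lemma laplace_numerator:
  "\<exists>c. \<forall>t\<in>torus r. (\<forall>i<r. \<forall>j<r. i \<noteq> j \<longrightarrow> t i \<noteq> t j) \<longrightarrow>
     (\<Sum>p | p permutes {..<r}. \<Sum>w\<in>weights. of_int (sign p) * tr (P w) *
        of_int (\<Sum>i<r. (w i + rho r (p i)) * (w i + rho r (p i))) * lmon r (\<lambda>i. w i + rho r (p i)) t) =
     c * (altern r (rho r) t * character t)"
proof -
  obtain c where c: "\<And>t. t \<in> torus r \<Longrightarrow> tr (casimir * R (dg r t)) = c * character t" using casimir_scalar by blast
  define N where "N = (\<Sum>i<r. rho r i * rho r i)"
  define M where "M = (\<Sum>i<r. m i)"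
  have "(\<Sum>p | p permutes {..<r}. \<Sum>w\<in>weights. of_int (sign p) * tr (P w) *
        of_int (\<Sum>i<r. (w i + rho r (p i)) * (w i + rho r (p i))) * lmon r (\<lambda>i. w i + rho r (p i)) t) =
     (of_int N + c + (of_nat r - 1) * of_int M) * (altern r (rho r) t * character t)"
    if t: "t \<in> torus r" and dist: "\<And>i j. i < r \<Longrightarrow> j < r \<Longrightarrow> i \<noteq> j \<Longrightarrow> t i \<noteq> t j" for t
  proof -
    define x where "x w = tr (P w) * lmon r w t" for w
    define Q where "Q p = of_int (sign p) * lmon r (rho r \<circ> p) t" for p
    define D where "D a = dchar (\<lambda>m. of_int (m a)) t" for a
    let ?A = "altern r (rho r) t" and ?X = "character t"
    let ?\<Pi> = "{p. p permutes {..<r}}"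
    have A: "?A = (\<Sum>p\<in>?\<Pi>. Q p)" by (simp add: altern_def Q_def)
    have X: "?X = (\<Sum>w\<in>weights. x w)" using character_sum[OF t] by (simp add: dchar_def x_def)
    have D: "D a = (\<Sum>w\<in>weights. of_int (w a) * x w)" for a by (simp add: D_def dchar_def x_def)
    have norm: "(\<Sum>i<r. (w i + rho r (p i)) * (w i + rho r (p i))) =
        N + (\<Sum>i<r. w i * w i) + (\<Sum>i<r. 2 * (w i * rho r (p i)))" if "p permutes {..<r}" for p w
    proof -
      have "(\<Sum>i<r. rho r (p i) * rho r (p i)) = N"
        unfolding N_def using sum.permute[OF that, of "\<lambda>i. rho r i * rho r i"] by (simp add: o_def)
      thus ?thesis by (simp add: algebra_simps sum.distrib)
    qed
    have "(\<Sum>p\<in>?\<Pi>. \<Sum>w\<in>weights. of_int (sign p) * tr (P w) *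
        of_int (\<Sum>i<r. (w i + rho r (p i)) * (w i + rho r (p i))) * lmon r (\<lambda>i. w i + rho r (p i)) t) =
      (\<Sum>p\<in>?\<Pi>. \<Sum>w\<in>weights. of_int N * (Q p * x w) + Q p * (\<Sum>i<r. of_int (w i) * of_int (w i) * x w) +
        (\<Sum>i<r. 2 * ((of_int (rho r (p i)) * Q p) * (of_int (w i) * x w))))"
    proof (intro sum.cong refl)
      fix p w assume "p \<in> ?\<Pi>"
      hence p: "p permutes {..<r}" by simp
      have "lmon r (\<lambda>i. w i + rho r (p i)) t = lmon r (rho r \<circ> p) t * lmon r w t"
        by (simp add: lmon_add[OF t] o_def)
      hence "of_int (sign p) * tr (P w) * of_int (\<Sum>i<r. (w i + rho r (p i)) * (w i + rho r (p i))) * lmon r (\<lambda>i. w i + rho r (p i)) t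
        = Q p * x w * (of_int N + (\<Sum>i<r. of_int (w i) * of_int (w i)) + (\<Sum>i<r. 2 * (of_int (w i) * of_int (rho r (p i)))))"
        unfolding norm[OF p] by (simp add: Q_def x_def)
      also have "\<dots> = of_int N * (Q p * x w) + Q p * (\<Sum>i<r. of_int (w i) * of_int (w i) * x w) +
        (\<Sum>i<r. 2 * ((of_int (rho r (p i)) * Q p) * (of_int (w i) * x w)))"
        by (simp add: distrib_left sum_distrib_left mult_ac)
      finally show "of_int (sign p) * tr (P w) * of_int (\<Sum>i<r. (w i + rho r (p i)) * (w i + rho r (p i))) * lmon r (\<lambda>i. w i + rho r (p i)) t
        = of_int N * (Q p * x w) + Q p * (\<Sum>i<r. of_int (w i) * of_int (w i) * x w) +
        (\<Sum>i<r. 2 * ((of_int (rho r (p i)) * Q p) * (of_int (w i) * x w)))" .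
    qed
    also have "\<dots> = (\<Sum>p\<in>?\<Pi>. \<Sum>w\<in>weights. of_int N * (Q p * x w)) +
        (\<Sum>p\<in>?\<Pi>. \<Sum>w\<in>weights. Q p * (\<Sum>i<r. of_int (w i) * of_int (w i) * x w)) +
        (\<Sum>p\<in>?\<Pi>. \<Sum>w\<in>weights. \<Sum>i<r. 2 * ((of_int (rho r (p i)) * Q p) * (of_int (w i) * x w)))"
      by (simp only: sum.distrib)
    also have "(\<Sum>p\<in>?\<Pi>. \<Sum>w\<in>weights. of_int N * (Q p * x w)) = of_int N * (?A * ?X)"
      unfolding A X sum_product by (simp only: sum_distrib_left)
    also have "(\<Sum>p\<in>?\<Pi>. \<Sum>w\<in>weights. Q p * (\<Sum>i<r. of_int (w i) * of_int (w i) * x w)) =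
        ?A * (\<Sum>w\<in>weights. \<Sum>i<r. of_int (w i) * of_int (w i) * x w)"
      unfolding A by (simp only: sum_product)
    also have "(\<Sum>w\<in>weights. \<Sum>i<r. of_int (w i) * of_int (w i) * x w) = (\<Sum>a<r. dchar (\<lambda>m. of_int (m a) * of_int (m a)) t)"
      by (subst sum.swap) (simp add: dchar_def x_def)
    also have "(\<Sum>p\<in>?\<Pi>. \<Sum>w\<in>weights. \<Sum>i<r. 2 * ((of_int (rho r (p i)) * Q p) * (of_int (w i) * x w))) =
       (\<Sum>i<r. \<Sum>p\<in>?\<Pi>. \<Sum>w\<in>weights. 2 * ((of_int (rho r (p i)) * Q p) * (of_int (w i) * x w)))"
      by (rule sum_rotate[symmetric])
    also have "\<dots> = (\<Sum>i<r. 2 * ((\<Sum>p\<in>?\<Pi>. of_int (rho r (p i)) * Q p) * D i))"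
      unfolding D sum_product by (simp only: sum_distrib_left)
    also have "\<dots> = (\<Sum>a<r. 2 * (?A * (\<Sum>b\<in>{..<r} - {a}. t a / (t a - t b)) * D a))"
    proof (intro sum.cong refl)
      fix a assume "a \<in> {..<r}"
      hence a: "a < r" by simp
      have "(\<Sum>p\<in>?\<Pi>. of_int (rho r (p a)) * Q p) = ?A * (\<Sum>b\<in>{..<r} - {a}. t a / (t a - t b))"
        using altern_rho_euler[OF t dist a] by (simp add: Q_def mult_ac)
      thus "2 * ((\<Sum>p\<in>?\<Pi>. of_int (rho r (p a)) * Q p) * D a) = 2 * (?A * (\<Sum>b\<in>{..<r} - {a}. t a / (t a - t b)) * D a)" by simp
    qed
    \<comment> \<open>2 D_a is split as (D_a - D_b) + (D_a + D_b): the first part occurs in the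
      trace of the Casimir element, the second symmetrizes to a multiple of the total degree, which
      is the same for all weights.\<close>
    also have "\<dots> = ?A * ((\<Sum>a<r. \<Sum>b\<in>{..<r} - {a}. t a / (t a - t b) * (D a - D b)) +
        (\<Sum>a<r. \<Sum>b\<in>{..<r} - {a}. t a / (t a - t b) * (D a + D b)))"
    proof -
      have "2 * (?A * (\<Sum>b\<in>{..<r} - {a}. t a / (t a - t b)) * D a) =
          ?A * ((\<Sum>b\<in>{..<r} - {a}. t a / (t a - t b) * (D a - D b)) + (\<Sum>b\<in>{..<r} - {a}. t a / (t a - t b) * (D a + D b)))" for a
      proof -
        have "(\<Sum>b\<in>{..<r} - {a}. t a / (t a - t b) * (D a - D b)) + (\<Sum>b\<in>{..<r} - {a}. t a / (t a - t b) * (D a + D b)) =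
          (\<Sum>b\<in>{..<r} - {a}. t a / (t a - t b) * (2 * D a))"
          unfolding sum.distrib[symmetric] by (rule sum.cong[OF refl]) (simp only: distrib_left[symmetric], simp)
        also have "\<dots> = (\<Sum>b\<in>{..<r} - {a}. t a / (t a - t b)) * (2 * D a)" by (rule sum_distrib_right[symmetric])
        finally show ?thesis by simp
      qed
      thus ?thesis by (simp only: sum_distrib_left[symmetric] sum.distrib[symmetric])
    qed
    also have "(\<Sum>a<r. \<Sum>b\<in>{..<r} - {a}. t a / (t a - t b) * (D a + D b)) = (of_nat r - 1) * (\<Sum>a<r. D a)"
      by (rule sum_symmetrize[OF dist])
    also have "(\<Sum>a<r. D a) = of_int M * ?X"
    proof -
      have "(\<Sum>a<r. D a) = (\<Sum>w\<in>weights. of_int (\<Sum>a<r. w a) * x w)"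
        unfolding D by (subst sum.swap) (simp add: sum_distrib_right)
      also have "\<dots> = (\<Sum>w\<in>weights. of_int M * x w)"
        by (intro sum.cong refl) (simp add: sum_weights M_def del: of_int_sum)
      finally show ?thesis by (simp add: X sum_distrib_left)
    qed
    also have "of_int N * (?A * ?X) + ?A * (\<Sum>a<r. dchar (\<lambda>m. of_int (m a) * of_int (m a)) t) +
        ?A * ((\<Sum>a<r. \<Sum>b\<in>{..<r} - {a}. t a / (t a - t b) * (D a - D b)) + (of_nat r - 1) * (of_int M * ?X))
      = of_int N * (?A * ?X) + ?A * tr (casimir * R (dg r t)) + ?A * ((of_nat r - 1) * (of_int M * ?X))"
    proof -
      have "tr (casimir * R (dg r t)) = (\<Sum>a<r. dchar (\<lambda>m. of_int (m a) * of_int (m a)) t) +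
        (\<Sum>a<r. \<Sum>b\<in>{..<r} - {a}. t a / (t a - t b) * (D a - D b))"
        unfolding D_def by (rule tr_casimir[OF t dist])
      thus ?thesis by (simp only: distrib_left add.assoc)
    qed
    also have "\<dots> = (of_int N + c + (of_nat r - 1) * of_int M) * (?A * ?X)"
      unfolding c[OF t] by (simp add: algebra_simps)
    finally show ?thesis .
  qed
  thus ?thesis by blast
qed

text \<open>Weights are below m, and initial sums of a rearrangement of the decreasing rho are at
  most those of rho.\<close>

lemma shifted_dom_le:
  assumes p: "p permutes {..<r}" and w: "w \<in> weights"
  shows "dom_le r (\<lambda>i. w i + rho r (p i)) (\<lambda>i. m i + rho r i)"
proof -
  have "(\<Sum>i<r. rho r (p i)) = (\<Sum>i<r. rho r i)"
    using sum.permute[OF p, of "rho r"] by (simp add: o_def)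
  moreover have "(\<Sum>i<n. rho r (p i)) \<le> (\<Sum>i<n. rho r i)" if "n \<le> r" for n
    by (rule sum_permute_initial_le[OF p _ that]) (auto simp: rho_def)
  ultimately show ?thesis using weights_dom_le[OF w] by (auto simp: dom_le_def sum.distrib intro!: add_mono)
qed

text \<open>The two summands of w + rho o p are dominated by m and by rho, so equality of all
  partial sums forces w = m and p = id. The multiplicity of m is 1.\<close>

lemma num_coeff_top: "num_coeff (\<lambda>i. m i + rho r i) = 1"
proof -
  have iff: "(\<lambda>i. m i + rho r i) = (\<lambda>i. w i + rho r (p i)) \<longleftrightarrow> p = id \<and> w = m"
    if p: "p permutes {..<r}" and w: "w \<in> weights" for p w
  proof
    assume eq: "(\<lambda>i. m i + rho r i) = (\<lambda>i. w i + rho r (p i))"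
    have part: "(\<Sum>i<n. w i) = (\<Sum>i<n. m i)" if n: "n \<le> r" for n
    proof -
      have "(\<Sum>i<n. m i + rho r i) = (\<Sum>i<n. w i + rho r (p i))" by (simp only: fun_cong[OF eq])
      moreover have "(\<Sum>i<n. rho r (p i)) \<le> (\<Sum>i<n. rho r i)"
        by (rule sum_permute_initial_le[OF p _ n]) (auto simp: rho_def)
      moreover have "(\<Sum>i<n. w i) \<le> (\<Sum>i<n. m i)" using weights_dom_le[OF w] n by (simp add: dom_le_def)
      ultimately show ?thesis by (simp add: sum.distrib)
    qed
    have wm: "w = m"
    proof (rule expo_eqI)
      show "w \<in> expo r" "m \<in> expo r" using w weights_expo m_expo by auto
      fix i assume "i < r"
      thus "w i = m i" using part[of "Suc i"] part[of i] by simp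
    qed
    have "p i = i" for i
    proof (cases "i < r")
      case True
      have "rho r i = rho r (p i)" using fun_cong[OF eq, of i] wm by simp
      thus ?thesis using True permutes_less[OF p True] by (simp add: rho_def)
    next
      case False thus ?thesis using p by (simp add: permutes_not_in)
    qed
    thus "p = id \<and> w = m" using wm by auto
  qed simp
  have "num_coeff (\<lambda>i. m i + rho r i) = (\<Sum>p | p permutes {..<r}. \<Sum>w\<in>weights. if w = m then (if p = id then 1 else 0) else 0)"
    unfolding num_coeff_def
    by (intro sum.cong refl) (use iff tr_P_highest in \<open>auto simp del: id_apply\<close>)
  also have "\<dots> = (\<Sum>p | p permutes {..<r}. if p = id then 1 else 0)"
    using m_weight finite_weights by simp
  also have "\<dots> = 1" by (subst sum.delta) (auto simp: finite_permutations permutes_id)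
  finally show ?thesis .
qed

text \<open>The character is symmetric and the Vandermonde determinant alternating.\<close>

lemma num_coeff_permute:
  assumes q: "q permutes {..<r}"
  shows "num_coeff (k \<circ> q) = of_int (sign q) * num_coeff k"
proof -
  have "(\<lambda>k. num_coeff (k \<circ> q)) = (\<lambda>k. of_int (sign q) * num_coeff k)"
  proof (rule laurent_unique[OF laurent_permute[OF laurent_numerator q] laurent_scale[OF laurent_numerator]])
    fix t assume t: "t \<in> torus r"
    show "altern r (rho r) (t \<circ> q) * character (t \<circ> q) = of_int (sign q) * (altern r (rho r) t * character t)"
      using char_permute[OF q t] by (simp add: altern_permute[OF q] character_def)
  qed
  thus ?thesis by meson
qed

text \<open>All exponents of the numerator have the norm of the dominating exponent m + rho; after sorting,
  dominance and equality of norms force equality.\<close>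

lemma num_coeff_support:
  assumes nz: "num_coeff k \<noteq> 0" and dom: "dominant r m"
  obtains q where "q permutes {..<r}" "k \<circ> q = (\<lambda>i. m i + rho r i)"
proof -
  let ?L = "\<lambda>i. m i + rho r i"
  let ?n = "\<lambda>k. of_int (\<Sum>i<r. k i * k i) :: complex"
  obtain c where c: "\<And>t. t \<in> torus r \<Longrightarrow> (\<And>i j. i < r \<Longrightarrow> j < r \<Longrightarrow> i \<noteq> j \<Longrightarrow> t i \<noteq> t j) \<Longrightarrow>
     (\<Sum>p | p permutes {..<r}. \<Sum>w\<in>weights. of_int (sign p) * tr (P w) *
        of_int (\<Sum>i<r. (w i + rho r (p i)) * (w i + rho r (p i))) * lmon r (\<lambda>i. w i + rho r (p i)) t) =
     c * (altern r (rho r) t * character t)" using laplace_numerator by blast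
  have "(\<lambda>k. ?n k * num_coeff k) = (\<lambda>k. c * num_coeff k)"
    by (rule laurent_unique_distinct[OF laurent_weighted[of ?n] laurent_scale[OF laurent_numerator] c])
  hence eig: "?n k * num_coeff k = c * num_coeff k" for k by meson
  \<comment> \<open>The unspecified constant is identified at m + rho, where the coefficient is
    1.\<close>
  have cL: "?n ?L = c" using eig[of ?L] num_coeff_top by simp
  have "\<exists>q. q permutes {..<r} \<and> (\<forall>i j. i \<le> j \<longrightarrow> j < r \<longrightarrow> k (q j) \<le> k (q i))"
  proof (rule permute_antitone_exists[of r k])
    fix p assume "p permutes {..<r}" "\<And>i j. i \<le> j \<Longrightarrow> j < r \<Longrightarrow> k (p j) \<le> k (p i)"
    thus ?thesis by blast
  qed
  then obtain q where q: "q permutes {..<r}" "\<And>i j. i \<le> j \<Longrightarrow> j < r \<Longrightarrow> k (q j) \<le> k (q i)" by blast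
  let ?k = "k \<circ> q"
  have nz': "num_coeff ?k \<noteq> 0" using nz num_coeff_permute[OF q(1)] by (simp add: sign_def)
  have "?n ?k = ?n ?L" using eig[of ?k] nz' cL by simp
  hence norm: "(\<Sum>i<r. ?k i * ?k i) = (\<Sum>i<r. ?L i * ?L i)" unfolding of_int_eq_iff .
  \<comment> \<open>Equal entries would make the coefficient equal to its own negative.\<close>
  have strict: "?k j < ?k i" if "i < j" "j < r" for i j
  proof (rule ccontr)
    assume "\<not> ?k j < ?k i"
    hence eq: "?k i = ?k j" using q(2)[of i j] that by simp
    let ?s = "Transposition.transpose i j"
    have s: "?s permutes {..<r}" using that by (simp add: permutes_swap_id)
    have "?k \<circ> ?s = ?k" using eq by (auto simp: fun_eq_iff Transposition.transpose_def)
    hence "num_coeff ?k = - num_coeff ?k" using num_coeff_permute[OF s, of ?k] that by (simp add: sign_swap_id)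
    thus False using nz' by simp
  qed
  \<comment> \<open>A nonzero coefficient is witnessed by an actual exponent, to which dominance
    applies.\<close>
  obtain p w where pw: "p permutes {..<r}" "w \<in> weights" "?k = (\<lambda>i. w i + rho r (p i))"
  proof -
    from nz' obtain p where p: "p \<in> {p. p permutes {..<r}}" and "(\<Sum>w\<in>weights. of_int (sign p) * tr (P w) *
        (if ?k = (\<lambda>i. w i + rho r (p i)) then 1 else 0)) \<noteq> 0"
      unfolding num_coeff_def by (rule sum.not_neutral_contains_not_neutral)
    from this(2) obtain w where "w \<in> weights" "of_int (sign p) * tr (P w) *
        (if ?k = (\<lambda>i. w i + rho r (p i)) then 1 else 0) \<noteq> 0"
      by (rule sum.not_neutral_contains_not_neutral)
    thus ?thesis using that[of p w] p by (simp split: if_splits)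
  qed
  have "dom_le r ?k ?L" unfolding pw(3) by (rule shifted_dom_le[OF pw(1,2)])
  hence "?k i = ?L i" if "i < r" for i
    by (rule dom_le_norm_eq[OF _ norm strict dominant_shift_strict[OF dom] that])
  moreover have "?k \<in> expo r" unfolding pw(3) by (rule shifted_expo[OF pw(1,2)])
  moreover have "?L \<in> expo r" by (rule expo_add[OF m_expo rho_expo])
  ultimately have "?k = ?L" by (intro expo_eqI) auto
  thus ?thesis using that q(1) by blast
qed

text \<open>Both coefficient functions are alternating, supported on the orbit of m + rho, and take
  the value 1 at m + rho.\<close>

theorem weyl_character_formula:
  assumes dom: "dominant r m" and t: "t \<in> torus r"
  shows "altern r (rho r) t * character t = altern r (\<lambda>i. m i + rho r i) t"
proof -
  let ?L = "\<lambda>i. m i + rho r i"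
  have L: "?L \<in> expo r" by (rule expo_add[OF m_expo rho_expo])
  note lA = laurent_altern[OF L]
  define \<beta> where "\<beta> k = num_coeff k - altern_coeff r ?L k" for k
  have permA: "altern_coeff r ?L (k \<circ> q) = of_int (sign q) * altern_coeff r ?L k" if q: "q permutes {..<r}" for k q
  proof -
    have "(\<lambda>k. altern_coeff r ?L (k \<circ> q)) = (\<lambda>k. of_int (sign q) * altern_coeff r ?L k)"
      by (rule laurent_unique[OF laurent_permute[OF lA q] laurent_scale[OF lA] altern_permute[OF q]])
    thus ?thesis by meson
  qed
  have L1: "altern_coeff r ?L ?L = 1"
    using altern_coeff_dominant[OF L _ L] dominant_shift_strict[OF dom]
    by (metis (mono_tags, lifting) le_neq_implies_less less_imp_le order_refl)
  have "num_coeff k = altern_coeff r ?L k" for k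
  proof (rule ccontr)
    assume ne: "num_coeff k \<noteq> altern_coeff r ?L k"
    have "\<exists>q. q permutes {..<r} \<and> k \<circ> q = ?L"
    proof (cases "num_coeff k = 0")
      case False thus ?thesis using num_coeff_support[OF False dom] by blast
    next
      case True
      hence "altern_coeff r ?L k \<noteq> 0" using ne by simp
      then obtain p where "p \<in> {p. p permutes {..<r}}" "of_int (sign p) * (if k = ?L \<circ> p then 1 else 0) \<noteq> (0 :: complex)"
        unfolding altern_coeff_def by (rule sum.not_neutral_contains_not_neutral)
      hence p: "p permutes {..<r}" "k = ?L \<circ> p" by (simp_all split: if_splits)
      have "k \<circ> Hilbert_Choice.inv p = ?L" using permutes_inverses[OF p(1)] by (auto simp: p(2) fun_eq_iff)
      thus ?thesis using permutes_inv[OF p(1)] by blast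
    qed
    then obtain q where q: "q permutes {..<r}" "k \<circ> q = ?L" by blast
    have "of_int (sign q) * num_coeff k = of_int (sign q) * altern_coeff r ?L k"
      using num_coeff_permute[OF q(1), of k] permA[OF q(1), of k] q(2) num_coeff_top L1 by simp
    thus False using ne by (simp add: sign_def split: if_splits)
  qed
  hence "num_coeff = altern_coeff r ?L" by (rule ext)
  thus ?thesis
    using laurentD[OF laurent_numerator laurent_finite[OF lA] _ t] laurentD[OF lA laurent_finite[OF lA] _ t] by simp
qed

end

section \<open>Complete reducibility\<close>

definition adj :: "complex mat \<Rightarrow> complex mat" where
  "adj A = mat (dim_col A) (dim_row A) (\<lambda>(i, j). cnj (A $$ (j, i)))"

lemma adj_carrier: "A \<in> carrier_mat n m \<Longrightarrow> adj A \<in> carrier_mat m n"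
  by (auto simp: adj_def)

lemma adj_entry: "A \<in> carrier_mat n m \<Longrightarrow> i < m \<Longrightarrow> j < n \<Longrightarrow> adj A $$ (i, j) = cnj (A $$ (j, i))"
  by (auto simp: adj_def)

lemma adj_adj [simp]: "adj (adj A) = A"
  by (rule eq_matI) (auto simp: adj_def)

lemma adj_one [simp]: "adj (1\<^sub>m n) = 1\<^sub>m n"
  by (rule eq_matI) (auto simp: adj_def)

lemma adj_mult:
  assumes "A \<in> carrier_mat n m" "B \<in> carrier_mat m k"
  shows "adj (A * B) = adj B * adj A"
proof (rule eq_matI)
  note c = adj_carrier[OF assms(1)] adj_carrier[OF assms(2)]
  fix i j assume "i < dim_row (adj B * adj A)" "j < dim_col (adj B * adj A)"
  hence ij: "i < k" "j < n" using c by auto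
  have "adj (A * B) $$ (i, j) = cnj ((A * B) $$ (j, i))"
    by (rule adj_entry[of _ n k]) (use assms ij in auto)
  also have "\<dots> = (\<Sum>l<m. adj B $$ (i, l) * adj A $$ (l, j))"
    using ij by (subst mult_entry[OF assms ij(2,1)]) (simp add: adj_entry[OF assms(1)] adj_entry[OF assms(2)] mult.commute)
  also have "\<dots> = (adj B * adj A) $$ (i, j)"
    by (rule mult_entry[symmetric, OF c(2,1) ij])
  finally show "adj (A * B) $$ (i, j) = (adj B * adj A) $$ (i, j)" .
qed (use assms in \<open>auto simp: adj_def\<close>)

lemma adj_GL: "A \<in> carrier (GL r) \<Longrightarrow> adj A \<in> carrier (GL r)"
proof -
  assume A: "A \<in> carrier (GL r)"
  obtain B where B: "B \<in> carrier (GL r)" "B * A = 1\<^sub>m r" using GL_inverse[OF A] by metis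
  have "adj A * adj B = 1\<^sub>m r" using adj_mult[OF GL_mat[OF B(1)] GL_mat[OF A]] B(2) by simp
  thus ?thesis using GL_I_right_inverse adj_carrier GL_mat[OF A] GL_mat[OF B(1)] by blast
qed

text \<open>The adjoint of every operator R(A) again lies in the image of R, so orthogonal
  complements of invariant subspaces are invariant. On unitary matrices such an R is
  unitary.\<close>

definition star_rep :: "nat \<Rightarrow> nat \<Rightarrow> (complex mat \<Rightarrow> complex mat) \<Rightarrow> bool" where
  "star_rep r d R \<longleftrightarrow> rational_rep r d R \<and> (\<forall>A\<in>carrier (GL r). R (adj A) = adj (R A))"

definition inner :: "nat \<Rightarrow> complex vec \<Rightarrow> complex vec \<Rightarrow> complex" where
  "inner d w x = (\<Sum>i<d. cnj (w $ i) * x $ i)"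

lemma inner_adj:
  assumes "A \<in> carrier_mat d k" "u \<in> carrier_vec k" "x \<in> carrier_vec d"
  shows "inner d (A *\<^sub>v u) x = inner k u (adj A *\<^sub>v x)"
proof -
  have "inner d (A *\<^sub>v u) x = (\<Sum>i<d. \<Sum>l<k. cnj (A $$ (i, l)) * cnj (u $ l) * x $ i)"
    by (simp add: inner_def mult_vec_entry[OF assms(1,2)] sum_distrib_right)
  also have "\<dots> = (\<Sum>l<k. \<Sum>i<d. cnj (A $$ (i, l)) * cnj (u $ l) * x $ i)" by (rule sum.swap)
  also have "\<dots> = inner k u (adj A *\<^sub>v x)"
    by (simp add: inner_def mult_vec_entry[OF adj_carrier[OF assms(1)] assms(3)] adj_entry[OF assms(1)] sum_distrib_left mult_ac)
  finally show ?thesis .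
qed

lemma inner_self: "inner d x x = of_real (\<Sum>i<d. (cmod (x $ i))\<^sup>2)"
  by (simp only: inner_def of_real_sum complex_norm_square mult.commute)

lemma inner_self_zero:
  assumes "x \<in> carrier_vec d" "inner d x x = 0"
  shows "x = 0\<^sub>v d"
proof (rule eq_vecI)
  fix i assume "i < dim_vec (0\<^sub>v d :: complex vec)"
  hence i: "i < d" by simp
  have 0: "(\<Sum>i<d. (cmod (x $ i))\<^sup>2) = 0" using assms(2) unfolding inner_self of_real_eq_0_iff .
  have "(cmod (x $ i))\<^sup>2 = 0"
    by (rule sum_nonneg_0[OF _ _ 0]) (use i in auto)
  thus "x $ i = 0\<^sub>v d $ i" using i by simp
qed (use assms in auto)

lemma vec_add_minus_one: "x \<in> carrier_vec n \<Longrightarrow> x + (-1) \<cdot>\<^sub>v x = (0\<^sub>v n :: complex vec)"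
  by (rule eq_vecI) auto

lemma vec_add_diff:
  "x \<in> carrier_vec n \<Longrightarrow> u \<in> carrier_vec n \<Longrightarrow> u + (x + (-1) \<cdot>\<^sub>v u) = (x :: complex vec)"
  by (rule eq_vecI) auto

lemma tr_add: "A \<in> carrier_mat n n \<Longrightarrow> B \<in> carrier_mat n n \<Longrightarrow> tr (A + B) = tr A + tr B"
  by (simp add: tr_def sum.distrib)

text \<open>Padding to k by k matrices keeps N M = 1, but the padded M has a zero row if d <
  k.\<close>

lemma isometry_dim_le:
  fixes M N :: "complex mat"
  assumes "M \<in> carrier_mat d k" "N \<in> carrier_mat k d" "N * M = 1\<^sub>m k"
  shows "k \<le> d"
proof (rule ccontr)
  assume "\<not> k \<le> d"
  hence kd: "d < k" by simp
  define M0 where "M0 = mat k k (\<lambda>(i, j). if i < d then M $$ (i, j) else 0)"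
  define N0 where "N0 = mat k k (\<lambda>(i, j). if j < d then N $$ (i, j) else 0)"
  have c: "M0 \<in> carrier_mat k k" "N0 \<in> carrier_mat k k" by (auto simp: M0_def N0_def)
  have "N0 * M0 = 1\<^sub>m k"
  proof (rule eq_matI)
    fix i j assume "i < dim_row (1\<^sub>m k :: complex mat)" "j < dim_col (1\<^sub>m k :: complex mat)"
    hence ij: "i < k" "j < k" by auto
    have "(N0 * M0) $$ (i, j) = (\<Sum>l<k. N0 $$ (i, l) * M0 $$ (l, j))" by (rule mult_entry[OF c(2,1) ij])
    also have "\<dots> = (\<Sum>l<d. N $$ (i, l) * M $$ (l, j))"
      by (rule sum.mono_neutral_cong_right) (use kd ij in \<open>auto simp: M0_def N0_def\<close>)
    also have "\<dots> = (N * M) $$ (i, j)" by (rule mult_entry[symmetric, OF assms(2,1) ij])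
    finally show "(N0 * M0) $$ (i, j) = 1\<^sub>m k $$ (i, j)" using assms(3) by simp
  qed (auto simp: M0_def N0_def)
  hence "det N0 * det M0 = 1" using det_mult[OF c(2,1)] by simp
  moreover have "det M0 = 0"
    unfolding det_leibniz[OF c(1)]
  proof (rule sum.neutral, intro ballI)
    fix p assume "p \<in> {p. p permutes {..<k}}"
    hence p: "p permutes {..<k}" by simp
    have "M0 $$ (d, p d) = 0" using kd permutes_less[OF p kd] by (simp add: M0_def)
    hence "(\<Prod>i<k. M0 $$ (i, p i)) = 0" using kd by (intro prod_zero) auto
    thus "of_int (sign p) * (\<Prod>i<k. M0 $$ (i, p i)) = 0" by simp
  qed
  ultimately show False by simp
qed

text \<open>The columns of M are an orthonormal family in W that cannot be enlarged, which exists by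
  the dimension bound. A vector of W not reproduced by the projection would yield one more column by
  Gram-Schmidt.\<close>

lemma orthonormal_basis:
  assumes W: "W \<subseteq> carrier_vec d" "0\<^sub>v d \<in> W" "\<And>x y. x \<in> W \<Longrightarrow> y \<in> W \<Longrightarrow> x + y \<in> W"
    "\<And>c x. x \<in> W \<Longrightarrow> c \<cdot>\<^sub>v x \<in> W"
  shows "\<exists>k. \<exists>M\<in>carrier_mat d k. adj M * M = 1\<^sub>m k \<and> (\<forall>u\<in>carrier_vec k. M *\<^sub>v u \<in> W) \<and>
    (\<forall>x\<in>W. x = M *\<^sub>v (adj M *\<^sub>v x))"
proof -
  define Q where "Q k M \<longleftrightarrow> M \<in> carrier_mat d k \<and> adj M * M = 1\<^sub>m k \<and> (\<forall>u\<in>carrier_vec k. M *\<^sub>v u \<in> W)" for k M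
  have Q0: "\<exists>M. Q 0 M"
  proof
    have "0\<^sub>m d 0 *\<^sub>v u = 0\<^sub>v d" if "u \<in> carrier_vec 0" for u :: "complex vec"
      using zero_mat_mult_vec[OF that] .
    moreover have "adj (0\<^sub>m d 0) * 0\<^sub>m d 0 = 1\<^sub>m 0" by (rule eq_matI) (auto simp: adj_def)
    ultimately show "Q 0 (0\<^sub>m d 0)" using W(2) by (auto simp: Q_def)
  qed
  have bound: "k \<le> d" if "Q k M" for k M
    using that isometry_dim_le[of M d k "adj M"] adj_carrier by (auto simp: Q_def)
  have "\<exists>k. (\<exists>M. Q k M) \<and> \<not> (\<exists>M. Q (Suc k) M)"
  proof (rule ccontr)
    assume "\<not> ?thesis"
    hence "\<exists>M. Q k M" for k by (induction k) (use Q0 in auto)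
    then obtain M where "Q (Suc d) M" by blast
    from bound[OF this] show False by simp
  qed
  then obtain k M where k: "Q k M" "\<And>M. \<not> Q (Suc k) M" by blast
  have M: "M \<in> carrier_mat d k" "adj M * M = 1\<^sub>m k" "\<And>u. u \<in> carrier_vec k \<Longrightarrow> M *\<^sub>v u \<in> W"
    using k(1) by (auto simp: Q_def)
  note aM = adj_carrier[OF M(1)]
  have "x = M *\<^sub>v (adj M *\<^sub>v x)" if x: "x \<in> W" for x
  proof (rule ccontr)
    assume ne: "x \<noteq> M *\<^sub>v (adj M *\<^sub>v x)"
    have xc: "x \<in> carrier_vec d" using x W(1) by blast
    have ax: "adj M *\<^sub>v x \<in> carrier_vec k" using aM xc by auto
    have Max: "M *\<^sub>v (adj M *\<^sub>v x) \<in> carrier_vec d" using M(1) ax by auto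
    define y where "y = x + (-1) \<cdot>\<^sub>v (M *\<^sub>v (adj M *\<^sub>v x))"
    have yW: "y \<in> W" unfolding y_def by (intro W(3) W(4) x M(3) ax)
    hence yc: "y \<in> carrier_vec d" using W(1) by blast
    have y0: "y \<noteq> 0\<^sub>v d"
    proof
      assume "y = 0\<^sub>v d"
      have "x $ i = (M *\<^sub>v (adj M *\<^sub>v x)) $ i" if "i < d" for i
      proof -
        have "y $ i = 0" using \<open>y = 0\<^sub>v d\<close> that by simp
        thus ?thesis using that xc Max M(1) by (simp add: y_def del: index_mult_mat_vec)
      qed
      hence "x = M *\<^sub>v (adj M *\<^sub>v x)" by (intro eq_vecI) (use xc M(1) in auto)
      thus False using ne by simp
    qed
    have ay: "adj M *\<^sub>v y = 0\<^sub>v k"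
    proof -
      have "adj M *\<^sub>v y = adj M *\<^sub>v x + (-1) \<cdot>\<^sub>v (adj M *\<^sub>v (M *\<^sub>v (adj M *\<^sub>v x)))"
        unfolding y_def using xc Max aM by (simp add: mult_add_distrib_mat_vec[OF aM] mult_mat_vec[OF aM])
      also have "adj M *\<^sub>v (M *\<^sub>v (adj M *\<^sub>v x)) = (adj M * M) *\<^sub>v (adj M *\<^sub>v x)"
        by (rule assoc_mult_mat_vec[symmetric, OF aM M(1) ax])
      also have "\<dots> = adj M *\<^sub>v x" using M(2) ax by simp
      also have "adj M *\<^sub>v x + (-1) \<cdot>\<^sub>v (adj M *\<^sub>v x) = 0\<^sub>v k" by (rule vec_add_minus_one[OF ax])
      finally show ?thesis .
    qed
    define n where "n = (\<Sum>i<d. (cmod (y $ i))\<^sup>2)"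
    have "n \<ge> 0" unfolding n_def by (intro sum_nonneg) auto
    moreover have "n \<noteq> 0"
    proof
      assume "n = 0"
      hence "inner d y y = 0" unfolding inner_self n_def by simp
      thus False using inner_self_zero[OF yc] y0 by blast
    qed
    ultimately have n: "n > 0" by simp
    \<comment> \<open>Normalising factor: n is the squared length of y, so s is real and s^2 n =
      1.\<close>
    define s where "s = complex_of_real (1 / sqrt n)"
    have cs: "cnj s = s" by (simp add: s_def)
    have "1 / sqrt n * (1 / sqrt n) * n = 1" using n by (simp add: real_sqrt_mult_self field_simps)
    hence ss: "s * s * complex_of_real n = 1" unfolding s_def of_real_mult[symmetric] by simp
    define z where "z = s \<cdot>\<^sub>v y"
    have zW: "z \<in> W" unfolding z_def by (rule W(4)[OF yW])
    have zc: "z \<in> carrier_vec d" using zW W(1) by blast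
    have az: "(\<Sum>i<d. cnj (M $$ (i, a)) * z $ i) = 0" if a: "a < k" for a
    proof -
      have "(\<Sum>i<d. cnj (M $$ (i, a)) * y $ i) = (adj M *\<^sub>v y) $ a"
        by (subst mult_vec_entry[OF aM yc a]) (simp add: adj_entry[OF M(1) a])
      also have "\<dots> = 0" using ay a by simp
      finally have 0: "(\<Sum>i<d. cnj (M $$ (i, a)) * y $ i) = 0" .
      have "(\<Sum>i<d. cnj (M $$ (i, a)) * z $ i) = s * (\<Sum>i<d. cnj (M $$ (i, a)) * y $ i)"
        using yc by (simp add: z_def sum_distrib_left mult_ac)
      thus ?thesis using 0 by simp
    qed
    have az': "(\<Sum>i<d. cnj (z $ i) * M $$ (i, a)) = 0" if a: "a < k" for a
      using arg_cong[OF az[OF a], of cnj] by (simp add: mult.commute)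
    have zz: "(\<Sum>i<d. cnj (z $ i) * z $ i) = 1"
    proof -
      have "(\<Sum>i<d. cnj (z $ i) * z $ i) = s * s * inner d y y"
        using yc cs by (simp add: z_def inner_def sum_distrib_left mult_ac)
      also have "inner d y y = complex_of_real n" unfolding inner_self n_def ..
      finally show ?thesis using ss by simp
    qed
    define M' where "M' = mat d (Suc k) (\<lambda>(i, j). if j < k then M $$ (i, j) else z $ i)"
    have M'c: "M' \<in> carrier_mat d (Suc k)" by (simp add: M'_def)
    have "adj M' * M' = 1\<^sub>m (Suc k)"
    proof (rule eq_matI)
      fix a b assume "a < dim_row (1\<^sub>m (Suc k) :: complex mat)" "b < dim_col (1\<^sub>m (Suc k) :: complex mat)"
      hence ab: "a < Suc k" "b < Suc k" by auto
      have e: "(adj M' * M') $$ (a, b) = (\<Sum>i<d. cnj (M' $$ (i, a)) * M' $$ (i, b))"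
        by (subst mult_entry[OF adj_carrier[OF M'c] M'c ab]) (simp add: adj_entry[OF M'c ab(1)])
      consider "a < k" "b < k" | "a < k" "b = k" | "a = k" "b < k" | "a = k" "b = k" using ab by linarith
      thus "(adj M' * M') $$ (a, b) = 1\<^sub>m (Suc k) $$ (a, b)"
      proof cases
        case 1
        have "(\<Sum>i<d. cnj (M' $$ (i, a)) * M' $$ (i, b)) = (adj M * M) $$ (a, b)"
          using 1 by (subst mult_entry[OF aM M(1) 1]) (simp add: adj_entry[OF M(1)] M'_def)
        thus ?thesis unfolding e M(2) using 1 by simp
      next
        case 2 thus ?thesis unfolding e using az by (simp add: M'_def)
      next
        case 3 thus ?thesis unfolding e using az' by (simp add: M'_def)
      next
        case 4 thus ?thesis unfolding e using zz by (simp add: M'_def)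
      qed
    qed (use M'c in \<open>auto simp: adj_def\<close>)
    moreover have "M' *\<^sub>v u \<in> W" if u: "u \<in> carrier_vec (Suc k)" for u
    proof -
      have uk: "vec k (\<lambda>i. u $ i) \<in> carrier_vec k" by simp
      have "M' *\<^sub>v u = M *\<^sub>v vec k (\<lambda>i. u $ i) + u $ k \<cdot>\<^sub>v z"
      proof (rule eq_vecI)
        fix i assume "i < dim_vec (M *\<^sub>v vec k (\<lambda>i. u $ i) + u $ k \<cdot>\<^sub>v z)"
        hence i: "i < d" using zc by simp
        have "(M' *\<^sub>v u) $ i = (\<Sum>l<k. M $$ (i, l) * u $ l) + z $ i * u $ k"
          using i by (subst mult_vec_entry[OF M'c u i]) (simp add: M'_def)
        also have "\<dots> = (M *\<^sub>v vec k (\<lambda>i. u $ i)) $ i + (u $ k \<cdot>\<^sub>v z) $ i"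
          using i zc by (subst mult_vec_entry[OF M(1) uk i]) simp
        finally show "(M' *\<^sub>v u) $ i = (M *\<^sub>v vec k (\<lambda>i. u $ i) + u $ k \<cdot>\<^sub>v z) $ i"
          using i zc by (simp del: index_mult_mat_vec)
      qed (use M'c zc in auto)
      thus ?thesis using W(3)[OF M(3)[OF uk] W(4)[OF zW]] by simp
    qed
    ultimately have "Q (Suc k) M'" using M'c by (simp add: Q_def)
    thus False using k(2) by blast
  qed
  thus ?thesis using M by blast
qed

lemma sum_lessThan_add: "(\<Sum>l<k + n. f l) = (\<Sum>l<k. f l) + (\<Sum>l<n. f (k + l))" for f :: "nat \<Rightarrow> complex"
  by (induction n) (simp_all add: add.assoc)

text \<open>R restricted to the range of M, in the orthonormal coordinates given by M. The
  assumption \<open>inv\<close> says that this range is invariant, which yields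
  multiplicativity.\<close>

lemma compressed_rep:
  assumes R: "star_rep r d R" and M: "M \<in> carrier_mat d k" "adj M * M = 1\<^sub>m k"
    and inv: "\<And>A. A \<in> carrier (GL r) \<Longrightarrow> R A * M = M * (adj M * (R A * M))"
  shows "star_rep r k (\<lambda>A. adj M * (R A * M))"
proof -
  interpret rational r d R using R by unfold_locales (simp add: star_rep_def)
  note aM = adj_carrier[OF M(1)]
  let ?S = "\<lambda>A. adj M * (R A * M)"
  have RM: "R A * M \<in> carrier_mat d k" if "A \<in> carrier (GL r)" for A using R_mat[OF that] M(1) by auto
  have S: "?S A \<in> carrier_mat k k" if "A \<in> carrier (GL r)" for A using RM[OF that] aM by auto
  have mult: "?S (A * B) = ?S A * ?S B" if A: "A \<in> carrier (GL r)" and B: "B \<in> carrier (GL r)" for A B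
  proof -
    have "?S (A * B) = adj M * (R A * (R B * M))"
      unfolding R_mult[OF A B] by (subst assoc_mult_mat[OF R_mat[OF A] R_mat[OF B] M(1)]) simp
    also have "\<dots> = adj M * (R A * (M * ?S B))" by (subst inv[OF B]) simp
    also have "\<dots> = adj M * ((R A * M) * ?S B)"
      by (subst assoc_mult_mat[OF R_mat[OF A] M(1) S[OF B]]) simp
    also have "\<dots> = ?S A * ?S B" by (rule assoc_mult_mat[symmetric, OF aM RM[OF A] S[OF B]])
    finally show ?thesis .
  qed
  have one: "?S (1\<^sub>m r) = 1\<^sub>m k" using M by (simp add: R_one)
  have GL: "?S A \<in> carrier (GL k)" if A: "A \<in> carrier (GL r)" for A
  proof -
    obtain B where B: "B \<in> carrier (GL r)" "A * B = 1\<^sub>m r" using GL_inverse[OF A] by metis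
    show ?thesis
      by (rule GL_I_right_inverse[OF S[OF A] S[OF B(1)]]) (use mult[OF A B(1)] B(2) one in simp)
  qed
  have "rational_rep r k ?S"
  proof (rule rational_repI[OF GL mult])
    fix i j assume ij: "i < k" "j < k"
    show "reg_on r (\<lambda>A. ?S A $$ (i, j))"
    proof (rule reg_on_cong)
      show "reg_on r (\<lambda>A. \<Sum>l<d. adj M $$ (i, l) * (\<Sum>a<d. M $$ (a, j) * R A $$ (l, a)))"
        by (intro reg_on_sum reg_on_scale R_reg_on) auto
      fix A assume A: "A \<in> carrier (GL r)"
      show "(\<Sum>l<d. adj M $$ (i, l) * (\<Sum>a<d. M $$ (a, j) * R A $$ (l, a))) = ?S A $$ (i, j)"
        by (subst mult_entry[OF aM RM[OF A] ij], rule sum.cong[OF refl], subst mult_entry[OF R_mat[OF A] M(1) _ ij(2)])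
           (auto simp: mult.commute)
    qed
  qed
  moreover have "?S (adj A) = adj (?S A)" if A: "A \<in> carrier (GL r)" for A
  proof -
    have "adj (?S A) = adj (R A * M) * M" by (simp add: adj_mult[OF aM RM[OF A]])
    also have "\<dots> = (adj M * adj (R A)) * M" by (simp only: adj_mult[OF R_mat[OF A] M(1)])
    also have "\<dots> = adj M * (adj (R A) * M)" by (rule assoc_mult_mat[OF aM adj_carrier[OF R_mat[OF A]] M(1)])
    also have "adj (R A) = R (adj A)" using R A by (simp add: star_rep_def)
    finally show ?thesis ..
  qed
  ultimately show ?thesis by (simp add: star_rep_def)
qed

section \<open>Equivalence of representations and orthogonal splitting\<close>

lemma rep_equiv_refl: "(\<And>A. A \<in> carrier (GL r) \<Longrightarrow> R A \<in> carrier_mat d d) \<Longrightarrow> rep_equiv r d R R"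
  unfolding rep_equiv_def
proof (rule bexI[OF _ GL_one], intro ballI)
  fix A assume "\<And>A. A \<in> carrier (GL r) \<Longrightarrow> R A \<in> carrier_mat d d" "A \<in> carrier (GL r)"
  hence "R A \<in> carrier_mat d d" by blast
  thus "1\<^sub>m d * R A = R A * 1\<^sub>m d" by simp
qed

lemma rep_equiv_trans:
  assumes "rep_equiv r d R S" "rep_equiv r d S T" and "\<And>A. A \<in> carrier (GL r) \<Longrightarrow> R A \<in> carrier_mat d d"
    "\<And>A. A \<in> carrier (GL r) \<Longrightarrow> S A \<in> carrier_mat d d" "\<And>A. A \<in> carrier (GL r) \<Longrightarrow> T A \<in> carrier_mat d d"
  shows "rep_equiv r d R T"
proof -
  obtain P where P: "P \<in> carrier (GL d)" "\<And>A. A \<in> carrier (GL r) \<Longrightarrow> P * R A = S A * P"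
    using assms(1) unfolding rep_equiv_def by blast
  obtain Q where Q: "Q \<in> carrier (GL d)" "\<And>A. A \<in> carrier (GL r) \<Longrightarrow> Q * S A = T A * Q"
    using assms(2) unfolding rep_equiv_def by blast
  note c = GL_mat[OF P(1)] GL_mat[OF Q(1)]
  have "(Q * P) * R A = T A * (Q * P)" if A: "A \<in> carrier (GL r)" for A
  proof -
    note cA = assms(3)[OF A] assms(4)[OF A] assms(5)[OF A]
    have "(Q * P) * R A = Q * (P * R A)" by (rule assoc_mult_mat[OF c(2,1) cA(1)])
    also have "\<dots> = (Q * S A) * P" unfolding P(2)[OF A] by (rule assoc_mult_mat[symmetric, OF c(2) cA(2) c(1)])
    also have "\<dots> = T A * (Q * P)" unfolding Q(2)[OF A] by (rule assoc_mult_mat[OF cA(3) c(2) c(1)])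
    finally show ?thesis .
  qed
  thus ?thesis unfolding rep_equiv_def using GL_mult[OF Q(1) P(1)] by blast
qed

lemma rep_equiv_sym:
  assumes "rep_equiv r d R S" and "\<And>A. A \<in> carrier (GL r) \<Longrightarrow> R A \<in> carrier_mat d d"
    "\<And>A. A \<in> carrier (GL r) \<Longrightarrow> S A \<in> carrier_mat d d"
  shows "rep_equiv r d S R"
proof -
  obtain P where P: "P \<in> carrier (GL d)" "\<And>A. A \<in> carrier (GL r) \<Longrightarrow> P * R A = S A * P"
    using assms(1) unfolding rep_equiv_def by blast
  obtain Q where Q: "Q \<in> carrier (GL d)" "P * Q = 1\<^sub>m d" "Q * P = 1\<^sub>m d" using GL_inverse[OF P(1)] by metis
  note c = GL_mat[OF P(1)] GL_mat[OF Q(1)]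
  have "Q * S A = R A * Q" if A: "A \<in> carrier (GL r)" for A
  proof -
    note cA = assms(2)[OF A] assms(3)[OF A]
    have "R A * Q = (Q * P) * (R A * Q)" unfolding Q(3) by (rule left_mult_one_mat[symmetric, OF mult_square_carrier[OF cA(1) c(2)]])
    also have "\<dots> = Q * ((P * R A) * Q)"
      using c cA by (simp add: assoc_mult_mat[of _ d d _ d _ d] mult_square_carrier)
    also have "\<dots> = (Q * S A) * (P * Q)" unfolding P(2)[OF A]
      using c cA by (simp add: assoc_mult_mat[of _ d d _ d _ d] mult_square_carrier)
    also have "\<dots> = Q * S A" unfolding Q(2) by (rule right_mult_one_mat[OF mult_square_carrier[OF c(2) cA(2)]])
    finally show ?thesis ..
  qed
  thus ?thesis unfolding rep_equiv_def using Q(1) by blast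
qed

lemma rep_equiv_tr:
  assumes "rep_equiv r d R S" "A \<in> carrier (GL r)" "R A \<in> carrier_mat d d" "S A \<in> carrier_mat d d"
  shows "tr (R A) = tr (S A)"
proof -
  obtain P where P: "P \<in> carrier (GL d)" "P * R A = S A * P"
    using assms(1,2) unfolding rep_equiv_def by blast
  obtain Q where Q: "Q \<in> carrier (GL d)" "P * Q = 1\<^sub>m d" "Q * P = 1\<^sub>m d" using GL_inverse[OF P(1)] by metis
  note c = GL_mat[OF P(1)] GL_mat[OF Q(1)]
  have "R A = (Q * P) * R A" unfolding Q(3) by (rule left_mult_one_mat[symmetric, OF assms(3)])
  also have "\<dots> = Q * (S A * P)" unfolding P(2)[symmetric] by (rule assoc_mult_mat[OF c(2,1) assms(3)])
  finally have "tr (R A) = tr (Q * (S A * P))" by simp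
  also have "\<dots> = tr ((S A * P) * Q)"
    by (rule tr_mult_comm[OF c(2) mult_square_carrier[OF assms(4) c(1)]])
  also have "(S A * P) * Q = S A * (P * Q)" by (rule assoc_mult_mat[OF assms(4) c])
  also have "\<dots> = S A" unfolding Q(2) by (rule right_mult_one_mat[OF assms(4)])
  finally show ?thesis .
qed

lemma rep_equiv_rational:
  assumes "rep_equiv r d R S" "rational_rep r d R" "\<And>A. A \<in> carrier (GL r) \<Longrightarrow> S A \<in> carrier_mat d d"
  shows "rational_rep r d S"
proof -
  interpret rational r d R using assms(2) by unfold_locales
  obtain P where P: "P \<in> carrier (GL d)" "\<And>A. A \<in> carrier (GL r) \<Longrightarrow> P * R A = S A * P"
    using assms(1) unfolding rep_equiv_def by blast
  obtain Q where Q: "Q \<in> carrier (GL d)" "P * Q = 1\<^sub>m d" "Q * P = 1\<^sub>m d" using GL_inverse[OF P(1)] by metis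
  note c = GL_mat[OF P(1)] GL_mat[OF Q(1)]
  have SA: "S A = P * R A * Q" if A: "A \<in> carrier (GL r)" for A
  proof -
    have "P * R A * Q = S A * (P * Q)" unfolding P(2)[OF A] by (rule assoc_mult_mat[OF assms(3)[OF A] c])
    also have "\<dots> = S A" unfolding Q(2) by (rule right_mult_one_mat[OF assms(3)[OF A]])
    finally show ?thesis ..
  qed
  show ?thesis
  proof (rule rational_repI)
    show "S A \<in> carrier (GL d)" if "A \<in> carrier (GL r)" for A
      unfolding SA[OF that] by (intro GL_mult P(1) Q(1) R_GL that)
    show "S (A * B) = S A * S B" if A: "A \<in> carrier (GL r)" and B: "B \<in> carrier (GL r)" for A B
    proof -
      note cc = R_mat[OF A] R_mat[OF B]
      have "S A * S B = (P * R A * Q) * (P * (R B * Q))"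
        unfolding SA[OF A] SA[OF B] using assoc_mult_mat[OF c(1) cc(2) c(2)] by simp
      also have "\<dots> = P * R A * (Q * P) * (R B * Q)"
        using c cc by (simp add: assoc_mult_mat[of _ d d _ d _ d] mult_square_carrier)
      also have "\<dots> = P * R A * (R B * Q)" unfolding Q(3) using c cc by (simp add: right_mult_one_mat[OF mult_square_carrier])
      also have "\<dots> = P * R (A * B) * Q"
        unfolding R_mult[OF A B] using c cc by (simp add: assoc_mult_mat[of _ d d _ d _ d] mult_square_carrier)
      finally show ?thesis using SA[OF GL_mult[OF A B]] by simp
    qed
    fix i j assume ij: "i < d" "j < d"
    show "reg_on r (\<lambda>A. S A $$ (i, j))"
    proof (rule reg_on_cong)
      show "reg_on r (\<lambda>A. \<Sum>b<d. \<Sum>a<d. (P $$ (i, a) * Q $$ (b, j)) * R A $$ (a, b))"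
        by (intro reg_on_sum reg_on_scale R_reg_on) auto
      fix A assume A: "A \<in> carrier (GL r)"
      show "(\<Sum>b<d. \<Sum>a<d. (P $$ (i, a) * Q $$ (b, j)) * R A $$ (a, b)) = S A $$ (i, j)"
        unfolding SA[OF A] mult3_entry[OF c(1) R_mat[OF A] c(2) ij] by (simp add: mult_ac)
    qed
  qed
qed

text \<open>The orthogonal complement W' of an invariant W is invariant, because R(A) moves to the
  other side of the inner product as R(adj A). Orthonormal bases of W and W' together form a unitary
  matrix that block-diagonalises R.\<close>

lemma star_rep_split:
  assumes R: "star_rep r d R" and d: "d > 0" and nirr: "\<not> irreducible_rep r d R"
  obtains k k' S S' where "star_rep r k S" "star_rep r k' S'" "k < d" "k' < d" "d = k + k'"
    "rep_equiv r d R (\<lambda>A. four_block_mat (S A) (0\<^sub>m k k') (0\<^sub>m k' k) (S' A))"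
proof -
  interpret rational r d R using R by unfold_locales (simp add: star_rep_def)
  obtain W where W: "VectorSpace.subspace class_ring W (module_vec TYPE(complex) d)"
    "\<And>A w. A \<in> carrier (GL r) \<Longrightarrow> w \<in> W \<Longrightarrow> R A *\<^sub>v w \<in> W" "W \<noteq> {0\<^sub>v d}" "W \<noteq> carrier_vec d"
    using nirr d rational unfolding irreducible_rep_def by blast
  note Ws = subspaceD[OF W(1)]
  define W' where "W' = {x\<in>carrier_vec d. \<forall>w\<in>W. inner d w x = 0}"
  obtain k M where M: "M \<in> carrier_mat d k" "adj M * M = 1\<^sub>m k" "\<And>u. u \<in> carrier_vec k \<Longrightarrow> M *\<^sub>v u \<in> W"
    "\<And>x. x \<in> W \<Longrightarrow> x = M *\<^sub>v (adj M *\<^sub>v x)"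
    using orthonormal_basis[OF Ws] by blast
  have W'c: "W' \<subseteq> carrier_vec d" by (auto simp: W'_def)
  have "\<exists>k. \<exists>M\<in>carrier_mat d k. adj M * M = 1\<^sub>m k \<and> (\<forall>u\<in>carrier_vec k. M *\<^sub>v u \<in> W') \<and>
    (\<forall>x\<in>W'. x = M *\<^sub>v (adj M *\<^sub>v x))"
  proof (rule orthonormal_basis[OF W'c])
    show "0\<^sub>v d \<in> W'" by (auto simp: W'_def inner_def)
    show "x + y \<in> W'" if "x \<in> W'" "y \<in> W'" for x y
      using that by (auto simp: W'_def inner_def distrib_left sum.distrib)
    show "c \<cdot>\<^sub>v x \<in> W'" if x: "x \<in> W'" for c x
    proof -
      have "inner d w (c \<cdot>\<^sub>v x) = c * inner d w x" for w
        using x by (auto simp: W'_def inner_def sum_distrib_left mult_ac)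
      thus ?thesis using x by (auto simp: W'_def)
    qed
  qed
  then obtain k' M' where M': "M' \<in> carrier_mat d k'" "adj M' * M' = 1\<^sub>m k'" "\<And>u. u \<in> carrier_vec k' \<Longrightarrow> M' *\<^sub>v u \<in> W'"
    "\<And>x. x \<in> W' \<Longrightarrow> x = M' *\<^sub>v (adj M' *\<^sub>v x)" by blast
  note aM = adj_carrier[OF M(1)] and aM' = adj_carrier[OF M'(1)]
  have W'inv: "R A *\<^sub>v x \<in> W'" if A: "A \<in> carrier (GL r)" and x: "x \<in> W'" for A x
  proof -
    have xc: "x \<in> carrier_vec d" using x W'c by blast
    have "inner d w (R A *\<^sub>v x) = 0" if w: "w \<in> W" for w
    proof -
      have wc: "w \<in> carrier_vec d" using w Ws by blast
      have "R A = adj (R (adj A))" using R A by (simp add: star_rep_def)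
      hence "inner d w (R A *\<^sub>v x) = inner d (R (adj A) *\<^sub>v w) x"
        using inner_adj[OF R_mat[OF adj_GL[OF A]] wc xc] by simp
      thus ?thesis using W(2)[OF adj_GL[OF A] w] x by (simp add: W'_def)
    qed
    thus ?thesis using xc R_mat[OF A] by (auto simp: W'_def)
  qed
  have RM: "R A * M = M * (adj M * (R A * M))" if A: "A \<in> carrier (GL r)" for A
  proof (rule mat_eq_by_vec[of _ d k])
    note cA = R_mat[OF A]
    show "R A * M \<in> carrier_mat d k" "M * (adj M * (R A * M)) \<in> carrier_mat d k" using cA M(1) aM by auto
    fix u :: "complex vec" assume u: "u \<in> carrier_vec k"
    have "(R A * M) *\<^sub>v u = R A *\<^sub>v (M *\<^sub>v u)" by (rule assoc_mult_mat_vec[OF cA M(1) u])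
    moreover have "R A *\<^sub>v (M *\<^sub>v u) \<in> W" by (rule W(2)[OF A M(3)[OF u]])
    ultimately have "(R A * M) *\<^sub>v u = M *\<^sub>v (adj M *\<^sub>v ((R A * M) *\<^sub>v u))" using M(4) by simp
    also have "\<dots> = (M * (adj M * (R A * M))) *\<^sub>v u"
      using cA M(1) aM u by (simp add: assoc_mult_mat_vec[of _ d k _ k] assoc_mult_mat_vec[of _ k d _ k])
    finally show "(R A * M) *\<^sub>v u = (M * (adj M * (R A * M))) *\<^sub>v u" .
  qed
  have RM': "R A * M' = M' * (adj M' * (R A * M'))" if A: "A \<in> carrier (GL r)" for A
  proof (rule mat_eq_by_vec[of _ d k'])
    note cA = R_mat[OF A]
    show "R A * M' \<in> carrier_mat d k'" "M' * (adj M' * (R A * M')) \<in> carrier_mat d k'" using cA M'(1) aM' by auto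
    fix u :: "complex vec" assume u: "u \<in> carrier_vec k'"
    have "(R A * M') *\<^sub>v u = R A *\<^sub>v (M' *\<^sub>v u)" by (rule assoc_mult_mat_vec[OF cA M'(1) u])
    moreover have "R A *\<^sub>v (M' *\<^sub>v u) \<in> W'" by (rule W'inv[OF A M'(3)[OF u]])
    ultimately have "(R A * M') *\<^sub>v u = M' *\<^sub>v (adj M' *\<^sub>v ((R A * M') *\<^sub>v u))" using M'(4) by simp
    also have "\<dots> = (M' * (adj M' * (R A * M'))) *\<^sub>v u"
      using cA M'(1) aM' u by (simp add: assoc_mult_mat_vec[of _ d k' _ k'] assoc_mult_mat_vec[of _ k' d _ k'])
    finally show "(R A * M') *\<^sub>v u = (M' * (adj M' * (R A * M'))) *\<^sub>v u" .
  qed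
  have MM': "adj M *\<^sub>v x = 0\<^sub>v k" if x: "x \<in> W'" for x
  proof -
    have xc: "x \<in> carrier_vec d" using x W'c by blast
    have ac: "adj M *\<^sub>v x \<in> carrier_vec k" using aM xc by auto
    have "inner k (adj M *\<^sub>v x) (adj M *\<^sub>v x) = inner d (M *\<^sub>v (adj M *\<^sub>v x)) x"
      by (rule inner_adj[symmetric, OF M(1) ac xc])
    also have "\<dots> = 0" using x M(3)[OF ac] by (simp add: W'_def)
    finally show ?thesis using inner_self_zero[OF ac] by blast
  qed
  have orth: "adj M * M' = 0\<^sub>m k k'"
  proof (rule mat_eq_by_vec[of _ k k'])
    fix u :: "complex vec" assume u: "u \<in> carrier_vec k'"
    have "(adj M * M') *\<^sub>v u = adj M *\<^sub>v (M' *\<^sub>v u)" by (rule assoc_mult_mat_vec[OF aM M'(1) u])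
    also have "\<dots> = 0\<^sub>v k" by (rule MM'[OF M'(3)[OF u]])
    finally show "(adj M * M') *\<^sub>v u = 0\<^sub>m k k' *\<^sub>v u" using zero_mat_mult_vec[OF u] by simp
  qed (use aM M'(1) in auto)
  have "adj (0\<^sub>m k k') = 0\<^sub>m k' k" by (rule eq_matI) (auto simp: adj_def)
  hence orth': "adj M' * M = 0\<^sub>m k' k" using adj_mult[OF aM M'(1)] orth by simp
  \<comment> \<open>The two orthogonal projections add up to 1, because what the first leaves of x
    lies in W'. Taking traces then gives d = k + k'.\<close>
  have resol: "M * adj M + M' * adj M' = 1\<^sub>m d"
  proof (rule mat_eq_by_vec[of _ d d])
    fix x :: "complex vec" assume x: "x \<in> carrier_vec d"
    have ax: "adj M *\<^sub>v x \<in> carrier_vec k" "M *\<^sub>v (adj M *\<^sub>v x) \<in> carrier_vec d" using aM M(1) x by auto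
    define y where "y = x + (-1) \<cdot>\<^sub>v (M *\<^sub>v (adj M *\<^sub>v x))"
    have yc: "y \<in> carrier_vec d" using x ax by (simp add: y_def)
    have ay: "N *\<^sub>v y = N *\<^sub>v x + (-1) \<cdot>\<^sub>v ((N * M) *\<^sub>v (adj M *\<^sub>v x))" if N: "N \<in> carrier_mat n d" for N n
      unfolding y_def using x ax N
      by (simp add: mult_add_distrib_mat_vec[OF N] mult_mat_vec[OF N] assoc_mult_mat_vec[OF N M(1) ax(1)])
    have "inner d w y = 0" if w: "w \<in> W" for w
    proof -
      have wc: "w \<in> carrier_vec d" "adj M *\<^sub>v w \<in> carrier_vec k" using w Ws aM by auto
      have "inner d w y = inner d (M *\<^sub>v (adj M *\<^sub>v w)) y" using M(4)[OF w] by simp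
      also have "\<dots> = inner k (adj M *\<^sub>v w) (adj M *\<^sub>v y)" by (rule inner_adj[OF M(1) wc(2) yc])
      also have "adj M *\<^sub>v y = 0\<^sub>v k" unfolding ay[OF aM] M(2) one_mult_mat_vec[OF ax(1)] by (rule vec_add_minus_one[OF ax(1)])
      finally show ?thesis by (simp add: inner_def)
    qed
    hence "y \<in> W'" using yc by (simp add: W'_def)
    hence "y = M' *\<^sub>v (adj M' *\<^sub>v y)" by (rule M'(4))
    also have "adj M' *\<^sub>v y = adj M' *\<^sub>v x"
      unfolding ay[OF aM'] orth' zero_mat_mult_vec[OF ax(1)] using aM' x by (intro eq_vecI) auto
    finally have y: "y = M' *\<^sub>v (adj M' *\<^sub>v x)" .
    have "(M * adj M + M' * adj M') *\<^sub>v x = M *\<^sub>v (adj M *\<^sub>v x) + M' *\<^sub>v (adj M' *\<^sub>v x)"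
      using add_mult_distrib_mat_vec[of "M * adj M" d d "M' * adj M'" x] M(1) M'(1) aM aM' x
        assoc_mult_mat_vec[OF M(1) aM x] assoc_mult_mat_vec[OF M'(1) aM' x] by simp
    also have "\<dots> = x" unfolding y[symmetric] unfolding y_def by (rule vec_add_diff[OF x ax(2)])
    finally show "(M * adj M + M' * adj M') *\<^sub>v x = 1\<^sub>m d *\<^sub>v x" using x by simp
  qed (use M(1) M'(1) aM aM' in auto)
  have dk: "d = k + k'"
  proof -
    have "(of_nat d :: complex) = tr (M * adj M + M' * adj M')" unfolding resol by (simp add: tr_def)
    also have "\<dots> = tr (M * adj M) + tr (M' * adj M')"
      by (rule tr_add[OF mult_carrier_mat[OF M(1) aM] mult_carrier_mat[OF M'(1) aM']])
    also have "\<dots> = tr (adj M * M) + tr (adj M' * M')" by (simp only: tr_mult_comm[OF M(1) aM] tr_mult_comm[OF M'(1) aM'])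
    also have "\<dots> = of_nat (k + k')" unfolding M(2) M'(2) by (simp add: tr_def)
    finally show ?thesis unfolding of_nat_eq_iff .
  qed
  have k0: "k > 0"
  proof (rule ccontr)
    assume "\<not> k > 0"
    hence k: "k = 0" by simp
    have "x = 0\<^sub>v d" if x: "x \<in> W" for x
    proof (rule eq_vecI)
      have xc: "x \<in> carrier_vec d" using x Ws(1) by blast
      hence u: "adj M *\<^sub>v x \<in> carrier_vec k" using aM by auto
      fix i assume "i < dim_vec (0\<^sub>v d :: complex vec)"
      hence i: "i < d" by simp
      have "(M *\<^sub>v (adj M *\<^sub>v x)) $ i = 0" using mult_vec_entry[OF M(1) u i] k by simp
      thus "x $ i = 0\<^sub>v d $ i" using M(4)[OF x] i by simp
    qed (use x Ws(1) in auto)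
    thus False using W(3) Ws(2) by blast
  qed
  have k'0: "k' > 0"
  proof (rule ccontr)
    assume "\<not> k' > 0"
    hence "M' * adj M' = 0\<^sub>m d d" using M'(1) aM' by (intro eq_matI) (auto simp: scalar_prod_def)
    hence MM: "M * adj M = 1\<^sub>m d" using resol M(1) aM by simp
    have "x \<in> W" if x: "x \<in> carrier_vec d" for x
    proof -
      have "M *\<^sub>v (adj M *\<^sub>v x) = x" using assoc_mult_mat_vec[OF M(1) aM x] MM x by simp
      moreover have "adj M *\<^sub>v x \<in> carrier_vec k" using aM x by auto
      ultimately show ?thesis using M(3) by metis
    qed
    thus False using W(4) Ws(1) by blast
  qed
  define S where "S A = adj M * (R A * M)" for A
  define S' where "S' A = adj M' * (R A * M')" for A
  have S: "star_rep r k S" unfolding S_def[abs_def] by (rule compressed_rep[OF R M(1,2) RM])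
  have S': "star_rep r k' S'" unfolding S'_def[abs_def] by (rule compressed_rep[OF R M'(1,2) RM'])
  define U where "U = mat d d (\<lambda>(i, j). if j < k then M $$ (i, j) else M' $$ (i, j - k))"
  have Uc: "U \<in> carrier_mat d d" by (simp add: U_def)
  have UU: "U * adj U = 1\<^sub>m d"
  proof (rule eq_matI)
    fix i j assume "i < dim_row (1\<^sub>m d :: complex mat)" "j < dim_col (1\<^sub>m d :: complex mat)"
    hence ij: "i < d" "j < d" by auto
    have "(U * adj U) $$ (i, j) = (\<Sum>l<k + k'. U $$ (i, l) * cnj (U $$ (j, l)))"
      using ij by (subst mult_entry[OF Uc adj_carrier[OF Uc] ij]) (simp add: adj_entry[OF Uc] dk)
    also have "\<dots> = (\<Sum>l<k. M $$ (i, l) * cnj (M $$ (j, l))) + (\<Sum>l<k'. M' $$ (i, l) * cnj (M' $$ (j, l)))"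
      unfolding sum_lessThan_add using ij dk by (simp add: U_def)
    also have "\<dots> = (M * adj M) $$ (i, j) + (M' * adj M') $$ (i, j)"
      using ij by (subst mult_entry[OF M(1) aM ij], subst mult_entry[OF M'(1) aM' ij]) (simp add: adj_entry[OF M(1)] adj_entry[OF M'(1)])
    also have "\<dots> = (M * adj M + M' * adj M') $$ (i, j)" using ij M(1) M'(1) aM aM' by simp
    finally show "(U * adj U) $$ (i, j) = 1\<^sub>m d $$ (i, j)" unfolding resol .
  qed (use Uc in \<open>auto simp: adj_def\<close>)
  have U: "U \<in> carrier (GL d)" by (rule GL_I_right_inverse[OF Uc adj_carrier[OF Uc] UU])
  let ?B = "\<lambda>A. four_block_mat (S A) (0\<^sub>m k k') (0\<^sub>m k' k) (S' A)"
  have Sc: "S A \<in> carrier_mat k k" "S' A \<in> carrier_mat k' k'" if "A \<in> carrier (GL r)" for A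
    using R_mat[OF that] M(1) M'(1) aM aM' by (auto simp: S_def S'_def)
  have Bc: "?B A \<in> carrier_mat d d" if "A \<in> carrier (GL r)" for A
    unfolding dk by (rule four_block_carrier_mat[OF Sc[OF that]])
  have RU: "U * ?B A = R A * U" if A: "A \<in> carrier (GL r)" for A
  proof (rule eq_matI)
    fix i j assume "i < dim_row (R A * U)" "j < dim_col (R A * U)"
    hence ij: "i < d" "j < d" using R_mat[OF A] Uc by auto
    have e1: "(U * ?B A) $$ (i, j) = (\<Sum>l<k. M $$ (i, l) * ?B A $$ (l, j)) + (\<Sum>l<k'. M' $$ (i, l) * ?B A $$ (k + l, j))"
    proof -
      have "(U * ?B A) $$ (i, j) = (\<Sum>l<k + k'. U $$ (i, l) * ?B A $$ (l, j))"
        by (subst mult_entry[OF Uc Bc[OF A] ij]) (simp only: dk)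
      thus ?thesis unfolding sum_lessThan_add using ij dk by (simp add: U_def)
    qed
    have e2: "(R A * U) $$ (i, j) = (\<Sum>l<d. R A $$ (i, l) * U $$ (l, j))"
      by (rule mult_entry[OF R_mat[OF A] Uc ij])
    show "(U * ?B A) $$ (i, j) = (R A * U) $$ (i, j)"
    proof (cases "j < k")
      case True
      have "(U * ?B A) $$ (i, j) = (\<Sum>l<k. M $$ (i, l) * S A $$ (l, j))"
        unfolding e1 using True Sc[OF A] by simp
      also have "\<dots> = (M * S A) $$ (i, j)" by (rule mult_entry[symmetric, OF M(1) Sc(1)[OF A] ij(1) True])
      also have "M * S A = R A * M" using RM[OF A] by (simp add: S_def)
      also have "(R A * M) $$ (i, j) = (\<Sum>l<d. R A $$ (i, l) * M $$ (l, j))"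
        by (rule mult_entry[OF R_mat[OF A] M(1) ij(1) True])
      also have "\<dots> = (R A * U) $$ (i, j)" unfolding e2 using True ij by (intro sum.cong) (auto simp: U_def)
      finally show ?thesis .
    next
      case False
      hence jk: "j - k < k'" using ij dk by simp
      have "(U * ?B A) $$ (i, j) = (\<Sum>l<k'. M' $$ (i, l) * S' A $$ (l, j - k))"
        unfolding e1 using False Sc[OF A] jk by simp
      also have "\<dots> = (M' * S' A) $$ (i, j - k)" by (rule mult_entry[symmetric, OF M'(1) Sc(2)[OF A] ij(1) jk])
      also have "M' * S' A = R A * M'" using RM'[OF A] by (simp add: S'_def)
      also have "(R A * M') $$ (i, j - k) = (\<Sum>l<d. R A $$ (i, l) * M' $$ (l, j - k))"
        by (rule mult_entry[OF R_mat[OF A] M'(1) ij(1) jk])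
      also have "\<dots> = (R A * U) $$ (i, j)" unfolding e2 using False ij by (intro sum.cong) (auto simp: U_def)
      finally show ?thesis .
    qed
  qed (use R_mat[OF A] Uc Bc[OF A] in auto)
  have "rep_equiv r d ?B R" unfolding rep_equiv_def using U RU by blast
  hence "rep_equiv r d R ?B" by (rule rep_equiv_sym[OF _ Bc R_mat])
  thus ?thesis using that[OF S S'] dk k0 k'0 by simp
qed

text \<open>Each entry of ps is a constituent together with its highest weight. Star compatibility
  is recorded because the existence proof tensors the constituents found here again.\<close>

definition decomposition where
  "decomposition r d R ps \<longleftrightarrow>
     (\<forall>p\<in>set ps. \<exists>n v. irreducible r n (fst p) (snd p) v \<and> dominant r (snd p) \<and> star_rep r n (fst p)) \<and>
     (\<forall>A\<in>carrier (GL r). direct_sum_rep (map fst ps) A \<in> carrier_mat d d) \<and>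
     rep_equiv r d R (direct_sum_rep (map fst ps))"

lemma rep_equiv_block:
  assumes "rep_equiv r k S D" "rep_equiv r k' S' D'"
    and c: "\<And>A. A \<in> carrier (GL r) \<Longrightarrow> S A \<in> carrier_mat k k" "\<And>A. A \<in> carrier (GL r) \<Longrightarrow> S' A \<in> carrier_mat k' k'"
    "\<And>A. A \<in> carrier (GL r) \<Longrightarrow> D A \<in> carrier_mat k k" "\<And>A. A \<in> carrier (GL r) \<Longrightarrow> D' A \<in> carrier_mat k' k'"
  shows "rep_equiv r (k + k') (\<lambda>A. four_block_mat (S A) (0\<^sub>m k k') (0\<^sub>m k' k) (S' A))
    (\<lambda>A. four_block_mat (D A) (0\<^sub>m k k') (0\<^sub>m k' k) (D' A))"
proof -
  obtain P where P: "P \<in> carrier (GL k)" "\<And>A. A \<in> carrier (GL r) \<Longrightarrow> P * S A = D A * P"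
    using assms(1) unfolding rep_equiv_def by blast
  obtain P' where P': "P' \<in> carrier (GL k')" "\<And>A. A \<in> carrier (GL r) \<Longrightarrow> P' * S' A = D' A * P'"
    using assms(2) unfolding rep_equiv_def by blast
  let ?Q = "four_block_mat P (0\<^sub>m k k') (0\<^sub>m k' k) P'"
  note cP = GL_mat[OF P(1)] GL_mat[OF P'(1)]
  have prod: "four_block_mat X (0\<^sub>m k k') (0\<^sub>m k' k) X' * four_block_mat Y (0\<^sub>m k k') (0\<^sub>m k' k) Y' =
      four_block_mat (X * Y) (0\<^sub>m k k') (0\<^sub>m k' k) (X' * Y')"
    if "X \<in> carrier_mat k k" "X' \<in> carrier_mat k' k'" "Y \<in> carrier_mat k k" "Y' \<in> carrier_mat k' k'" for X X' Y Y' :: "complex mat"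
    using that by (subst mult_four_block_mat[of _ k k _ k' _ k' _ _ k _ k']) auto
  have "?Q \<in> carrier_mat (k + k') (k + k')" by (rule four_block_carrier_mat[OF cP])
  moreover have "det ?Q = det P * det P'"
    by (rule det_four_block_mat_upper_right_zero[of _ k _ k']) (use cP in auto)
  ultimately have "?Q \<in> carrier (GL (k + k'))" using P(1) P'(1) by (simp add: GL_iff)
  moreover have "?Q * four_block_mat (S A) (0\<^sub>m k k') (0\<^sub>m k' k) (S' A) = four_block_mat (D A) (0\<^sub>m k k') (0\<^sub>m k' k) (D' A) * ?Q"
    if A: "A \<in> carrier (GL r)" for A
    by (simp only: prod[OF cP c(1)[OF A] c(2)[OF A]] prod[OF c(3)[OF A] c(4)[OF A] cP] P(2)[OF A] P'(2)[OF A])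
  ultimately show ?thesis unfolding rep_equiv_def by blast
qed

lemma direct_sum_rep_append:
  assumes "direct_sum_rep l A \<in> carrier_mat k k" "direct_sum_rep l' A \<in> carrier_mat k' k'"
  shows "direct_sum_rep (l @ l') A = four_block_mat (direct_sum_rep l A) (0\<^sub>m k k') (0\<^sub>m k' k) (direct_sum_rep l' A)"
  using assms by (simp add: direct_sum_rep_def diag_block_mat_append Let_def)

theorem star_rep_decomposition:
  assumes "star_rep r d R"
  shows "\<exists>ps. decomposition r d R ps"
  using assms
proof (induction d arbitrary: R rule: less_induct)
  case (less d)
  interpret rational r d R using less.prems by unfold_locales (simp add: star_rep_def)
  consider "d = 0" | "d > 0" "irreducible_rep r d R" | "d > 0" "\<not> irreducible_rep r d R" by blast
  thus ?case
  proof cases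
    \<comment> \<open>Irreducibility asks for positive dimension, so the zero representation is the
      empty sum.\<close>
    case 1
    have e: "R A = 0\<^sub>m 0 0" if "A \<in> carrier (GL r)" for A using R_mat[OF that] 1 by (intro eq_matI) auto
    have "rep_equiv r 0 R (direct_sum_rep [])"
      unfolding rep_equiv_def by (rule bexI[OF _ GL_one]) (auto simp: e direct_sum_rep_def)
    hence "decomposition r d R []" using 1 by (simp add: decomposition_def direct_sum_rep_def)
    thus ?thesis by blast
  next
    case 2
    obtain m v where mv: "m \<in> weights" "dominant r m" "hwv m v" using hwv_exists[OF 2(1)] .
    have "irreducible r d R m v"
      using 2 mv weights_expo by unfold_locales auto
    moreover have "rep_equiv r d R R" by (rule rep_equiv_refl) (rule R_mat)
    moreover have "direct_sum_rep [R] = R"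
      by (rule ext) (simp only: direct_sum_rep_def list.map diag_block_mat_singleton)
    ultimately have "decomposition r d R [(R, m)]"
      using mv less.prems R_mat by (auto simp: decomposition_def)
    thus ?thesis by blast
  next
    case 3
    obtain k k' S S' where S: "star_rep r k S" "star_rep r k' S'" "k < d" "k' < d" "d = k + k'"
      "rep_equiv r d R (\<lambda>A. four_block_mat (S A) (0\<^sub>m k k') (0\<^sub>m k' k) (S' A))"
      using star_rep_split[OF less.prems 3] .
    obtain ps where ps: "decomposition r k S ps" using less.IH[OF S(3) S(1)] by blast
    obtain ps' where ps': "decomposition r k' S' ps'" using less.IH[OF S(4) S(2)] by blast
    interpret S: rational r k S using S by unfold_locales (simp add: star_rep_def)
    interpret S': rational r k' S' using S by unfold_locales (simp add: star_rep_def)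
    let ?D = "direct_sum_rep (map fst ps)" and ?D' = "direct_sum_rep (map fst ps')"
    have Dc: "?D A \<in> carrier_mat k k" "?D' A \<in> carrier_mat k' k'" if "A \<in> carrier (GL r)" for A
      using ps ps' that by (auto simp: decomposition_def)
    let ?B = "\<lambda>A. four_block_mat (?D A) (0\<^sub>m k k') (0\<^sub>m k' k) (?D' A)"
    have app: "direct_sum_rep (map fst (ps @ ps')) A = ?B A" if "A \<in> carrier (GL r)" for A
      using direct_sum_rep_append[OF Dc[OF that]] by simp
    have Bc: "?B A \<in> carrier_mat d d" if "A \<in> carrier (GL r)" for A
      unfolding S(5) by (rule four_block_carrier_mat[OF Dc[OF that]])
    have "rep_equiv r (k + k') (\<lambda>A. four_block_mat (S A) (0\<^sub>m k k') (0\<^sub>m k' k) (S' A)) ?B"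
      by (rule rep_equiv_block) (use ps ps' Dc S.R_mat S'.R_mat in \<open>auto simp: decomposition_def\<close>)
    hence "rep_equiv r d R ?B"
      using rep_equiv_trans[OF S(6), of ?B] R_mat Bc S(5) four_block_carrier_mat[OF S.R_mat S'.R_mat] by simp
    hence "rep_equiv r d R (direct_sum_rep (map fst (ps @ ps')))"
      unfolding rep_equiv_def using app by simp
    hence "decomposition r d R (ps @ ps')"
      using ps ps' app Bc unfolding decomposition_def by (simp add: ball_Un)
    thus ?thesis by blast
  qed
qed

section \<open>Tensor products\<close>

lemma div_mod_less: "i < n * k \<Longrightarrow> i div k < n" "i < n * k \<Longrightarrow> i mod k < (k :: nat)"
  by (simp_all add: less_mult_imp_div_less) (metis mod_less_divisor mult_0_right not_gr_zero not_less_zero)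

text \<open>Kronecker indices encode the pair (a, b) as a * k + b.\<close>

lemma sum_div_mod: "(\<Sum>l<n * k. f (l div k) (l mod k)) = (\<Sum>a<n. \<Sum>b<k. f a b)"
  for f :: "nat \<Rightarrow> nat \<Rightarrow> complex"
proof (induction n)
  case (Suc n)
  have "(\<Sum>l<Suc n * k. f (l div k) (l mod k)) = (\<Sum>l<n * k + k. f (l div k) (l mod k))" by (simp add: add.commute)
  also have "\<dots> = (\<Sum>a<n. \<Sum>b<k. f a b) + (\<Sum>l<k. f ((n * k + l) div k) ((n * k + l) mod k))"
    unfolding sum_lessThan_add Suc.IH ..
  also have "(\<Sum>l<k. f ((n * k + l) div k) ((n * k + l) mod k)) = (\<Sum>b<k. f n b)"
    by (rule sum.cong) auto
  finally show ?case by simp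
qed simp

lemma kronecker_carrier: "A \<in> carrier_mat n m \<Longrightarrow> B \<in> carrier_mat n' m' \<Longrightarrow> kronecker A B \<in> carrier_mat (n * n') (m * m')"
  by (auto simp: kronecker_def)

lemma kronecker_entry:
  "A \<in> carrier_mat n m \<Longrightarrow> B \<in> carrier_mat n' m' \<Longrightarrow> i < n * n' \<Longrightarrow> j < m * m' \<Longrightarrow>
   kronecker A B $$ (i, j) = A $$ (i div n', j div m') * B $$ (i mod n', j mod m')"
  by (auto simp: kronecker_def)

lemma kronecker_mult:
  assumes A: "A \<in> carrier_mat n m" and C: "C \<in> carrier_mat m p" and B: "B \<in> carrier_mat n' m'" and D: "D \<in> carrier_mat m' p'"
  shows "kronecker A B * kronecker C D = kronecker (A * C) (B * D)"
proof (rule eq_matI)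
  note c = kronecker_carrier[OF A B] kronecker_carrier[OF C D]
  have AC: "A * C \<in> carrier_mat n p" and BD: "B * D \<in> carrier_mat n' p'" using A B C D by auto
  fix i j assume "i < dim_row (kronecker (A * C) (B * D))" "j < dim_col (kronecker (A * C) (B * D))"
  hence ij: "i < n * n'" "j < p * p'" using kronecker_carrier[OF AC BD] by auto
  note dm = div_mod_less[OF ij(1)] div_mod_less[OF ij(2)]
  have "(kronecker A B * kronecker C D) $$ (i, j) = (\<Sum>l<m * m'. kronecker A B $$ (i, l) * kronecker C D $$ (l, j))"
    by (rule mult_entry[OF c ij])
  also have "\<dots> = (\<Sum>l<m * m'. (A $$ (i div n', l div m') * C $$ (l div m', j div p')) * (B $$ (i mod n', l mod m') * D $$ (l mod m', j mod p')))"
    by (intro sum.cong refl) (use ij in \<open>simp add: kronecker_entry[OF A B] kronecker_entry[OF C D]\<close>)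
  also have "\<dots> = (\<Sum>a<m. \<Sum>b<m'. (A $$ (i div n', a) * C $$ (a, j div p')) * (B $$ (i mod n', b) * D $$ (b, j mod p')))"
    by (rule sum_div_mod[of "\<lambda>a b. (A $$ (i div n', a) * C $$ (a, j div p')) * (B $$ (i mod n', b) * D $$ (b, j mod p'))"])
  also have "\<dots> = (A * C) $$ (i div n', j div p') * (B * D) $$ (i mod n', j mod p')"
    by (simp only: mult_entry[OF A C dm(1,3)] mult_entry[OF B D dm(2,4)] sum_product)
  also have "\<dots> = kronecker (A * C) (B * D) $$ (i, j)" by (rule kronecker_entry[symmetric, OF AC BD ij])
  finally show "(kronecker A B * kronecker C D) $$ (i, j) = kronecker (A * C) (B * D) $$ (i, j)" .
qed (use assms in \<open>auto simp: kronecker_def\<close>)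

lemma kronecker_one: "kronecker (1\<^sub>m n) (1\<^sub>m k) = 1\<^sub>m (n * k)"
proof (rule eq_matI)
  fix i j assume "i < dim_row (1\<^sub>m (n * k) :: complex mat)" "j < dim_col (1\<^sub>m (n * k) :: complex mat)"
  hence ij: "i < n * k" "j < n * k" by auto
  have "i = j" if "i div k = j div k" "i mod k = j mod k" using that by (metis div_mult_mod_eq)
  thus "kronecker (1\<^sub>m n) (1\<^sub>m k) $$ (i, j) = 1\<^sub>m (n * k) $$ (i, j)"
    using ij div_mod_less[OF ij(1)] div_mod_less[OF ij(2)]
    by (subst kronecker_entry[of _ n n _ k k]) auto
qed (auto simp: kronecker_def)

lemma kronecker_GL:
  assumes "A \<in> carrier (GL n)" "B \<in> carrier (GL k)"
  shows "kronecker A B \<in> carrier (GL (n * k))"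
proof -
  obtain A' where A': "A' \<in> carrier (GL n)" "A * A' = 1\<^sub>m n" using GL_inverse[OF assms(1)] by metis
  obtain B' where B': "B' \<in> carrier (GL k)" "B * B' = 1\<^sub>m k" using GL_inverse[OF assms(2)] by metis
  note c = GL_mat[OF assms(1)] GL_mat[OF A'(1)] GL_mat[OF assms(2)] GL_mat[OF B'(1)]
  show ?thesis
    by (rule GL_I_right_inverse[OF kronecker_carrier[OF c(1,3)] kronecker_carrier[OF c(2,4)]])
       (simp add: kronecker_mult[OF c] A'(2) B'(2) kronecker_one)
qed

lemma kronecker_adj:
  assumes A: "A \<in> carrier_mat n m" and B: "B \<in> carrier_mat n' m'"
  shows "adj (kronecker A B) = kronecker (adj A) (adj B)"
proof (rule eq_matI)
  note aA = adj_carrier[OF A] and aB = adj_carrier[OF B]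
  fix i j assume "i < dim_row (kronecker (adj A) (adj B))" "j < dim_col (kronecker (adj A) (adj B))"
  hence ij: "i < m * m'" "j < n * n'" using kronecker_carrier[OF aA aB] by auto
  show "adj (kronecker A B) $$ (i, j) = kronecker (adj A) (adj B) $$ (i, j)"
    using div_mod_less[OF ij(1)] div_mod_less[OF ij(2)]
    by (simp add: adj_entry[OF kronecker_carrier[OF A B] ij] kronecker_entry[OF A B ij(2,1)] kronecker_entry[OF aA aB ij]
        adj_entry[OF A] adj_entry[OF B])
qed (use assms in \<open>auto simp: kronecker_def adj_def\<close>)

lemma kronecker_tr:
  assumes A: "A \<in> carrier_mat n n" and B: "B \<in> carrier_mat k k"
  shows "tr (kronecker A B) = tr A * tr B"
proof -
  have "tr (kronecker A B) = (\<Sum>l<n * k. A $$ (l div k, l div k) * B $$ (l mod k, l mod k))"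
    using kronecker_entry[OF A B] by (simp add: tr_carrier[OF kronecker_carrier[OF A B]])
  also have "\<dots> = (\<Sum>a<n. \<Sum>b<k. A $$ (a, a) * B $$ (b, b))"
    by (rule sum_div_mod[of "\<lambda>a b. A $$ (a, a) * B $$ (b, b)"])
  finally show ?thesis by (simp add: tr_carrier[OF A] tr_carrier[OF B] sum_product)
qed

lemma tensor_rational:
  assumes "rational_rep r d R" "rational_rep r d' R'"
  shows "rational_rep r (d * d') (tensor_rep R R')"
proof -
  interpret R: rational r d R using assms by unfold_locales
  interpret R': rational r d' R' using assms by unfold_locales
  show ?thesis
  proof (rule rational_repI)
    show "tensor_rep R R' A \<in> carrier (GL (d * d'))" if "A \<in> carrier (GL r)" for A
      unfolding tensor_rep_def by (rule kronecker_GL[OF R.R_GL[OF that] R'.R_GL[OF that]])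
    show "tensor_rep R R' (A * B) = tensor_rep R R' A * tensor_rep R R' B"
      if "A \<in> carrier (GL r)" "B \<in> carrier (GL r)" for A B
      unfolding tensor_rep_def R.R_mult[OF that] R'.R_mult[OF that]
      by (rule kronecker_mult[symmetric, OF R.R_mat[OF that(1)] R.R_mat[OF that(2)] R'.R_mat[OF that(1)] R'.R_mat[OF that(2)]])
    fix i j assume ij: "i < d * d'" "j < d * d'"
    show "reg_on r (\<lambda>A. tensor_rep R R' A $$ (i, j))"
    proof (rule reg_on_cong)
      show "reg_on r (\<lambda>A. R A $$ (i div d', j div d') * R' A $$ (i mod d', j mod d'))"
        by (rule reg_on_mult[OF R.R_reg_on[OF div_mod_less(1)[OF ij(1)] div_mod_less(1)[OF ij(2)]]
            R'.R_reg_on[OF div_mod_less(2)[OF ij(1)] div_mod_less(2)[OF ij(2)]]])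
      show "R A $$ (i div d', j div d') * R' A $$ (i mod d', j mod d') = tensor_rep R R' A $$ (i, j)"
        if "A \<in> carrier (GL r)" for A
        unfolding tensor_rep_def by (rule kronecker_entry[symmetric, OF R.R_mat[OF that] R'.R_mat[OF that] ij])
    qed
  qed
qed

lemma tensor_star:
  assumes "star_rep r d R" "star_rep r d' R'"
  shows "star_rep r (d * d') (tensor_rep R R')"
proof -
  interpret R: rational r d R using assms by unfold_locales (simp add: star_rep_def)
  interpret R': rational r d' R' using assms by unfold_locales (simp add: star_rep_def)
  have "tensor_rep R R' (adj A) = adj (tensor_rep R R' A)" if "A \<in> carrier (GL r)" for A
    unfolding tensor_rep_def kronecker_adj[OF R.R_mat[OF that] R'.R_mat[OF that]]
    using assms that by (simp add: star_rep_def)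
  thus ?thesis using tensor_rational assms by (simp add: star_rep_def)
qed

lemma tensor_equiv:
  assumes "rep_equiv r d R S" "rep_equiv r d' R' S'"
    and c: "\<And>A. A \<in> carrier (GL r) \<Longrightarrow> R A \<in> carrier_mat d d" "\<And>A. A \<in> carrier (GL r) \<Longrightarrow> R' A \<in> carrier_mat d' d'"
    "\<And>A. A \<in> carrier (GL r) \<Longrightarrow> S A \<in> carrier_mat d d" "\<And>A. A \<in> carrier (GL r) \<Longrightarrow> S' A \<in> carrier_mat d' d'"
  shows "rep_equiv r (d * d') (tensor_rep R R') (tensor_rep S S')"
proof -
  obtain P where P: "P \<in> carrier (GL d)" "\<And>A. A \<in> carrier (GL r) \<Longrightarrow> P * R A = S A * P"
    using assms(1) unfolding rep_equiv_def by blast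
  obtain P' where P': "P' \<in> carrier (GL d')" "\<And>A. A \<in> carrier (GL r) \<Longrightarrow> P' * R' A = S' A * P'"
    using assms(2) unfolding rep_equiv_def by blast
  note cP = GL_mat[OF P(1)] GL_mat[OF P'(1)]
  have "kronecker P P' * tensor_rep R R' A = tensor_rep S S' A * kronecker P P'" if A: "A \<in> carrier (GL r)" for A
    unfolding tensor_rep_def
    by (simp only: kronecker_mult[OF cP(1) c(1)[OF A] cP(2) c(2)[OF A]] kronecker_mult[OF c(3)[OF A] cP(1) c(4)[OF A] cP(2)]
        P(2)[OF A] P'(2)[OF A])
  thus ?thesis unfolding rep_equiv_def using kronecker_GL[OF P(1) P'(1)] by blast
qed

section \<open>Direct sums\<close>

lemma tr_four_block:
  assumes "A \<in> carrier_mat n n" "D \<in> carrier_mat m m"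
  shows "tr (four_block_mat A B C D) = tr A + tr D"
proof -
  have "tr (four_block_mat A B C D) = (\<Sum>i<n + m. four_block_mat A B C D $$ (i, i))"
    by (rule tr_carrier[OF four_block_carrier_mat[OF assms]])
  thus ?thesis unfolding sum_lessThan_add using assms by (simp add: tr_carrier[OF assms(1)] tr_carrier[OF assms(2)])
qed

lemma direct_sum_carrier:
  "(\<And>x. x \<in> set l \<Longrightarrow> f x A \<in> carrier_mat (n x) (n x)) \<Longrightarrow>
    direct_sum_rep (map f l) A \<in> carrier_mat (sum_list (map n l)) (sum_list (map n l))"
proof (induction l)
  case Nil show ?case by (simp add: direct_sum_rep_def)
next
  case (Cons x l)
  have "direct_sum_rep (map f l) A \<in> carrier_mat (sum_list (map n l)) (sum_list (map n l))"
    by (rule Cons.IH) (use Cons.prems in simp)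
  from four_block_carrier_mat[OF Cons.prems[of x] this]
  show ?case by (simp add: direct_sum_rep_def Let_def)
qed

lemma direct_sum_tr:
  "(\<And>x. x \<in> set l \<Longrightarrow> f x A \<in> carrier_mat (n x) (n x)) \<Longrightarrow>
    tr (direct_sum_rep (map f l) A) = (\<Sum>x\<leftarrow>l. tr (f x A))"
proof (induction l)
  case Nil show ?case by (simp add: direct_sum_rep_def tr_def)
next
  case (Cons x l)
  have c: "direct_sum_rep (map f l) A \<in> carrier_mat (sum_list (map n l)) (sum_list (map n l))"
    by (rule direct_sum_carrier) (use Cons.prems in simp)
  have "tr (direct_sum_rep (map f (x # l)) A) = tr (f x A) + tr (direct_sum_rep (map f l) A)"
    using tr_four_block[OF Cons.prems[of x] c] by (simp add: direct_sum_rep_def Let_def)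
  thus ?case using Cons.IH Cons.prems by simp
qed

lemma direct_sum_append:
  assumes "\<And>x. x \<in> set l \<union> set l' \<Longrightarrow> f x A \<in> carrier_mat (n x) (n x)"
  shows "direct_sum_rep (map f (l @ l')) A =
    four_block_mat (direct_sum_rep (map f l) A) (0\<^sub>m (sum_list (map n l)) (sum_list (map n l')))
      (0\<^sub>m (sum_list (map n l')) (sum_list (map n l))) (direct_sum_rep (map f l') A)"
  unfolding map_append
  by (rule direct_sum_rep_append; rule direct_sum_carrier) (use assms in auto)

lemma rep_equiv_block_swap:
  assumes c: "\<And>A. A \<in> carrier (GL r) \<Longrightarrow> S A \<in> carrier_mat k k" "\<And>A. A \<in> carrier (GL r) \<Longrightarrow> S' A \<in> carrier_mat k' k'"
  shows "rep_equiv r (k + k') (\<lambda>A. four_block_mat (S A) (0\<^sub>m k k') (0\<^sub>m k' k) (S' A))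
    (\<lambda>A. four_block_mat (S' A) (0\<^sub>m k' k) (0\<^sub>m k k') (S A))"
proof -
  let ?Q = "four_block_mat (0\<^sub>m k' k) (1\<^sub>m k') (1\<^sub>m k) (0\<^sub>m k k') :: complex mat"
  let ?Q' = "four_block_mat (0\<^sub>m k k') (1\<^sub>m k) (1\<^sub>m k') (0\<^sub>m k' k) :: complex mat"
  have Qc: "?Q \<in> carrier_mat (k + k') (k + k')" "?Q' \<in> carrier_mat (k + k') (k + k')" by auto
  have "?Q * ?Q' = four_block_mat (1\<^sub>m k') (0\<^sub>m k' k) (0\<^sub>m k k') (1\<^sub>m k)"
    by (subst mult_four_block_mat[of _ k' k _ k' _ k _ _ k' _ k]) auto
  also have "\<dots> = 1\<^sub>m (k + k')" by (rule eq_matI) auto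
  finally have "?Q \<in> carrier (GL (k + k'))" by (rule GL_I_right_inverse[OF Qc])
  moreover have "?Q * four_block_mat (S A) (0\<^sub>m k k') (0\<^sub>m k' k) (S' A) = four_block_mat (S' A) (0\<^sub>m k' k) (0\<^sub>m k k') (S A) * ?Q"
    if A: "A \<in> carrier (GL r)" for A
  proof -
    have "?Q * four_block_mat (S A) (0\<^sub>m k k') (0\<^sub>m k' k) (S' A) = four_block_mat (0\<^sub>m k' k) (S' A) (S A) (0\<^sub>m k k')"
      using c[OF A] by (subst mult_four_block_mat[of _ k' k _ k' _ k _ _ k _ k']) auto
    moreover have "four_block_mat (S' A) (0\<^sub>m k' k) (0\<^sub>m k k') (S A) * ?Q = four_block_mat (0\<^sub>m k' k) (S' A) (S A) (0\<^sub>m k k')"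
      using c[OF A] by (subst mult_four_block_mat[of _ k' k' _ k _ k _ _ k _ k']) auto
    ultimately show ?thesis by simp
  qed
  ultimately show ?thesis unfolding rep_equiv_def by blast
qed

lemma rep_equiv_cong:
  assumes "rep_equiv r d R S" "\<And>A. A \<in> carrier (GL r) \<Longrightarrow> R A = R' A" "\<And>A. A \<in> carrier (GL r) \<Longrightarrow> S A = S' A"
  shows "rep_equiv r d R' S'"
  using assms unfolding rep_equiv_def by simp

lemma rep_equiv_direct_sum_append:
  assumes sz: "\<And>x A. A \<in> carrier (GL r) \<Longrightarrow> x \<in> set l1 \<union> set l2 \<Longrightarrow> f x A \<in> carrier_mat (n x) (n x)"
    and sz': "\<And>x A. A \<in> carrier (GL r) \<Longrightarrow> x \<in> set l1' \<union> set l2' \<Longrightarrow> g x A \<in> carrier_mat (n' x) (n' x)"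
    and eq: "rep_equiv r k1 (direct_sum_rep (map f l1)) (direct_sum_rep (map g l1'))"
      "rep_equiv r k2 (direct_sum_rep (map f l2)) (direct_sum_rep (map g l2'))"
    and k: "k1 = sum_list (map n l1)" "k1 = sum_list (map n' l1')" "k2 = sum_list (map n l2)" "k2 = sum_list (map n' l2')"
  shows "rep_equiv r (k1 + k2) (direct_sum_rep (map f (l1 @ l2))) (direct_sum_rep (map g (l1' @ l2')))"
proof (rule rep_equiv_cong[OF rep_equiv_block[OF eq]])
  fix A assume A: "A \<in> carrier (GL r)"
  show "direct_sum_rep (map f l1) A \<in> carrier_mat k1 k1" unfolding k(1)
    by (rule direct_sum_carrier[where n = n]) (use sz[OF A] in auto)
  show "direct_sum_rep (map f l2) A \<in> carrier_mat k2 k2" unfolding k(3)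
    by (rule direct_sum_carrier[where n = n]) (use sz[OF A] in auto)
  show "direct_sum_rep (map g l1') A \<in> carrier_mat k1 k1" unfolding k(2)
    by (rule direct_sum_carrier[where n = n']) (use sz'[OF A] in auto)
  show "direct_sum_rep (map g l2') A \<in> carrier_mat k2 k2" unfolding k(4)
    by (rule direct_sum_carrier[where n = n']) (use sz'[OF A] in auto)
  show "four_block_mat (direct_sum_rep (map f l1) A) (0\<^sub>m k1 k2) (0\<^sub>m k2 k1) (direct_sum_rep (map f l2) A) =
      direct_sum_rep (map f (l1 @ l2)) A"
    unfolding k(1,3) by (rule direct_sum_append[symmetric]) (use sz[OF A] in auto)
  show "four_block_mat (direct_sum_rep (map g l1') A) (0\<^sub>m k1 k2) (0\<^sub>m k2 k1) (direct_sum_rep (map g l2') A) =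
      direct_sum_rep (map g (l1' @ l2')) A"
    unfolding k(2,4) by (rule direct_sum_append[symmetric]) (use sz'[OF A] in auto)
qed

text \<open>Decompositions list constituents in no particular order, whereas the definition of the
  coefficients groups equal ones. In the induction the head of l is moved past the segment a of l'
  that precedes it.\<close>

lemma rep_equiv_direct_sum_perm:
  assumes "mset l = mset l'" and "\<And>x A. A \<in> carrier (GL r) \<Longrightarrow> x \<in> set l \<Longrightarrow> f x A \<in> carrier_mat (n x) (n x)"
  shows "rep_equiv r (sum_list (map n l)) (direct_sum_rep (map f l)) (direct_sum_rep (map f l'))"
  using assms
proof (induction l arbitrary: l')
  case Nil
  hence "l' = []" by simp
  moreover have "rep_equiv r 0 (direct_sum_rep []) (direct_sum_rep [])"
    by (rule rep_equiv_refl) (simp add: direct_sum_rep_def)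
  ultimately show ?case by simp
next
  case (Cons x l)
  have "x \<in> set l'" using Cons.prems(1) by (metis list.set_intros(1) mset_eq_setD)
  then obtain a b where l': "l' = a @ x # b" by (meson split_list)
  have ms: "mset l = mset (a @ b)" using Cons.prems(1) l' by simp
  have set_eq: "set l = set a \<union> set b" using mset_eq_setD[OF ms] by simp
  have sz: "f y A \<in> carrier_mat (n y) (n y)" if "A \<in> carrier (GL r)" "y \<in> insert x (set a \<union> set b)" for y A
    using Cons.prems(2)[OF that(1), of y] that(2) set_eq by auto
  have suml: "sum_list (map n l) = sum_list (map n (a @ b))" by (metis ms mset_map sum_mset_sum_list)
  have ca: "direct_sum_rep (map f l0) A \<in> carrier_mat (sum_list (map n l0)) (sum_list (map n l0))"
    if "set l0 \<subseteq> insert x (set a \<union> set b)" "A \<in> carrier (GL r)" for l0 A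
    by (rule direct_sum_carrier) (use sz that in auto)
  have IH: "rep_equiv r (sum_list (map n l)) (direct_sum_rep (map f l)) (direct_sum_rep (map f (a @ b)))"
    by (rule Cons.IH[OF ms]) (use Cons.prems(2) in auto)
  have 1: "rep_equiv r (n x + sum_list (map n l)) (direct_sum_rep (map f ([x] @ l))) (direct_sum_rep (map f ([x] @ (a @ b))))"
  proof (rule rep_equiv_direct_sum_append[where n = n and n' = n])
    show "rep_equiv r (n x) (direct_sum_rep (map f [x])) (direct_sum_rep (map f [x]))"
      by (rule rep_equiv_refl) (use ca[of "[x]"] in auto)
    show "rep_equiv r (sum_list (map n l)) (direct_sum_rep (map f l)) (direct_sum_rep (map f (a @ b)))" by (rule IH)
  qed (use sz set_eq suml in auto)
  have 2: "rep_equiv r (n x + sum_list (map n a)) (direct_sum_rep (map f ([x] @ a))) (direct_sum_rep (map f (a @ [x])))"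
  proof (rule rep_equiv_cong[OF rep_equiv_block_swap[of r "direct_sum_rep (map f [x])" "n x" "direct_sum_rep (map f a)" "sum_list (map n a)"]])
    fix A assume A: "A \<in> carrier (GL r)"
    show "direct_sum_rep (map f [x]) A \<in> carrier_mat (n x) (n x)" using ca[OF _ A, of "[x]"] by simp
    show "direct_sum_rep (map f a) A \<in> carrier_mat (sum_list (map n a)) (sum_list (map n a))" using ca[OF _ A, of a] by auto
    show "four_block_mat (direct_sum_rep (map f [x]) A) (0\<^sub>m (n x) (sum_list (map n a))) (0\<^sub>m (sum_list (map n a)) (n x))
       (direct_sum_rep (map f a) A) = direct_sum_rep (map f ([x] @ a)) A"
      by (subst direct_sum_append[where n = n]) (use sz[OF A] in auto)
    show "four_block_mat (direct_sum_rep (map f a) A) (0\<^sub>m (sum_list (map n a)) (n x)) (0\<^sub>m (n x) (sum_list (map n a)))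
       (direct_sum_rep (map f [x]) A) = direct_sum_rep (map f (a @ [x])) A"
      by (subst direct_sum_append[where n = n]) (use sz[OF A] in auto)
  qed
  have 3: "rep_equiv r ((n x + sum_list (map n a)) + sum_list (map n b)) (direct_sum_rep (map f (([x] @ a) @ b)))
      (direct_sum_rep (map f ((a @ [x]) @ b)))"
  proof (rule rep_equiv_direct_sum_append[where n = n and n' = n])
    show "rep_equiv r (sum_list (map n b)) (direct_sum_rep (map f b)) (direct_sum_rep (map f b))"
      by (rule rep_equiv_refl) (use ca[of b] in auto)
    show "rep_equiv r (n x + sum_list (map n a)) (direct_sum_rep (map f ([x] @ a))) (direct_sum_rep (map f (a @ [x])))" by (rule 2)
  qed (use sz in auto)
  let ?N = "n x + (sum_list (map n a) + sum_list (map n b))"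
  have N: "n x + sum_list (map n l) = ?N" "n x + sum_list (map n a) + sum_list (map n b) = ?N" using suml by auto
  have "rep_equiv r ?N (direct_sum_rep (map f (x # l))) (direct_sum_rep (map f l'))"
  proof (rule rep_equiv_trans)
    show "rep_equiv r ?N (direct_sum_rep (map f (x # l))) (direct_sum_rep (map f (x # a @ b)))"
      using 1 unfolding N by simp
    show "rep_equiv r ?N (direct_sum_rep (map f (x # a @ b))) (direct_sum_rep (map f l'))"
      using 3 unfolding N l' by simp
    fix A assume A: "A \<in> carrier (GL r)"
    show "direct_sum_rep (map f (x # l)) A \<in> carrier_mat ?N ?N" using ca[OF _ A, of "x # l"] set_eq suml by simp
    show "direct_sum_rep (map f (x # a @ b)) A \<in> carrier_mat ?N ?N" using ca[OF _ A, of "x # a @ b"] by simp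
    show "direct_sum_rep (map f l') A \<in> carrier_mat ?N ?N" using ca[OF _ A, of l'] l' by (simp add: add.left_commute)
  qed
  thus ?case using N by simp
qed

section \<open>Existence of irreducible representations\<close>

text \<open>The Weyl formulas of the constituents are added; keeping the Vandermonde factor on the
  left avoids division.\<close>

lemma decomposition_character:
  assumes dec: "decomposition r d R ps" and R: "rational_rep r d R" and t: "t \<in> torus r"
  shows "altern r (rho r) t * tr (R (dg r t)) = (\<Sum>p\<leftarrow>ps. altern r (\<lambda>i. snd p i + rho r i) t)"
proof -
  interpret rational r d R using R by unfold_locales
  have "\<forall>p\<in>set ps. \<exists>n v. irreducible r n (fst p) (snd p) v \<and> dominant r (snd p)"
    using dec unfolding decomposition_def by blast
  then obtain n v where nv: "\<And>p. p \<in> set ps \<Longrightarrow> irreducible r (n p) (fst p) (snd p) (v p)" "\<And>p. p \<in> set ps \<Longrightarrow> dominant r (snd p)"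
    by metis
  have c: "fst p (dg r t) \<in> carrier_mat (n p) (n p)" if "p \<in> set ps" for p
  proof -
    interpret p: irreducible r "n p" "fst p" "snd p" "v p" by (rule nv(1)[OF that])
    show ?thesis by (rule p.R_mat[OF dg_GL[OF t]])
  qed
  have "tr (R (dg r t)) = tr (direct_sum_rep (map fst ps) (dg r t))"
    by (rule rep_equiv_tr[of r d]) (use dec dg_GL[OF t] R_mat in \<open>auto simp: decomposition_def\<close>)
  also have "\<dots> = (\<Sum>p\<leftarrow>ps. tr (fst p (dg r t)))" by (rule direct_sum_tr[where f = fst and n = n]) (rule c)
  finally have "altern r (rho r) t * tr (R (dg r t)) = (\<Sum>p\<leftarrow>ps. altern r (rho r) t * tr (fst p (dg r t)))"
    by (simp add: sum_list_const_mult)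
  also have "\<dots> = (\<Sum>p\<leftarrow>ps. altern r (\<lambda>i. snd p i + rho r i) t)"
  proof (rule arg_cong[of _ _ sum_list], rule map_cong[OF refl])
    fix p assume p: "p \<in> set ps"
    interpret p: irreducible r "n p" "fst p" "snd p" "v p" by (rule nv(1)[OF p])
    show "altern r (rho r) t * tr (fst p (dg r t)) = altern r (\<lambda>i. snd p i + rho r i) t"
      using p.weyl_character_formula[OF nv(2)[OF p] t] by (simp add: p.character_def)
  qed
  finally show ?thesis .
qed

lemma laurent_sum_list:
  "(\<And>x. x \<in> set xs \<Longrightarrow> laurent r (F x) (b x)) \<Longrightarrow> laurent r (\<lambda>t. \<Sum>x\<leftarrow>xs. F x t) (\<lambda>m. \<Sum>x\<leftarrow>xs. b x m)"
proof (induction xs)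
  case Nil show ?case using laurent_zero by simp
next
  case (Cons x xs)
  have "laurent r (\<lambda>t. F x t + (\<Sum>x\<leftarrow>xs. F x t)) (\<lambda>m. b x m + (\<Sum>x\<leftarrow>xs. b x m))"
    by (rule laurent_add) (use Cons in simp_all)
  thus ?case by simp
qed

text \<open>Through this the coefficient at m + rho of a sum of alternants counts the constituents
  of highest weight m.\<close>

lemma altern_coeff_shift:
  assumes "k \<in> expo r" "dominant r k" "m \<in> expo r" "dominant r m"
  shows "altern_coeff r (\<lambda>i. k i + rho r i) (\<lambda>i. m i + rho r i) = (if m = k then 1 else 0)"
proof -
  have "altern_coeff r (\<lambda>i. k i + rho r i) (\<lambda>i. m i + rho r i) =
     (if (\<lambda>i. m i + rho r i) = (\<lambda>i. k i + rho r i) then 1 else 0)"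
    by (rule altern_coeff_dominant)
       (use assms in \<open>auto intro: expo_add rho_expo dominant_shift_strict dominant_shift_mono\<close>)
  also have "(\<lambda>i. m i + rho r i) = (\<lambda>i. k i + rho r i) \<longleftrightarrow> m = k" by (auto simp: fun_eq_iff)
  finally show ?thesis .
qed

text \<open>For each p, summing over p(j) instead of j leaves the sum of the variables. Terms with
  two equal exponents are kept; they vanish as alternants.\<close>

lemma altern_pieri:
  assumes t: "t \<in> torus r"
  shows "altern r l t * (\<Sum>j<r. t j) = (\<Sum>j<r. altern r (\<lambda>i. l i + (if i = j then 1 else 0)) t)"
proof -
  have "(\<Sum>j<r. altern r (\<lambda>i. l i + (if i = j then 1 else 0)) t) =
    (\<Sum>j<r. \<Sum>p | p permutes {..<r}. of_int (sign p) * (lmon r (l \<circ> p) t * lmon r (\<lambda>i. if p i = j then 1 else 0) t))"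
    by (simp add: altern_def o_def lmon_add[OF t])
  also have "\<dots> = (\<Sum>p | p permutes {..<r}. \<Sum>j<r. of_int (sign p) * (lmon r (l \<circ> p) t * lmon r (\<lambda>i. if p i = j then 1 else 0) t))"
    by (rule sum.swap)
  also have "\<dots> = (\<Sum>p | p permutes {..<r}. of_int (sign p) * lmon r (l \<circ> p) t * (\<Sum>j<r. t j))"
  proof (rule sum.cong[OF refl])
    fix p assume "p \<in> {p. p permutes {..<r}}"
    hence p: "p permutes {..<r}" by simp
    have "(\<Sum>j<r. lmon r (\<lambda>i. if p i = j then 1 else 0) t) = (\<Sum>j<r. lmon r (\<lambda>i. if p i = p j then 1 else 0) t)"
      using sum.permute[OF p, of "\<lambda>j. lmon r (\<lambda>i. if p i = j then 1 else 0) t"] by (simp add: o_def)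
    also have "\<dots> = (\<Sum>j<r. lmon r (\<lambda>i. if i = j then 1 else 0) t)"
      using permutes_inj[OF p] by (simp add: inj_eq)
    also have "\<dots> = (\<Sum>j<r. t j)" by (simp add: lmon_unit)
    finally show "(\<Sum>j<r. of_int (sign p) * (lmon r (l \<circ> p) t * lmon r (\<lambda>i. if p i = j then 1 else 0) t)) =
        of_int (sign p) * lmon r (l \<circ> p) t * (\<Sum>j<r. t j)"
      by (simp add: sum_distrib_left[symmetric] mult.assoc[symmetric])
  qed
  finally show ?thesis by (simp add: altern_def sum_distrib_right)
qed

lemma standard_star_rep: "star_rep r r (\<lambda>A. A)"
  unfolding star_rep_def by (auto intro!: rational_repI reg_on_entry)

text \<open>Its highest weight (-N, ..., -N) is a starting point below any given weight for large N;
  tensoring with the standard representation then raises entries.\<close>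

definition det_rep :: "nat \<Rightarrow> complex mat \<Rightarrow> complex mat" where
  "det_rep N A = mat 1 1 (\<lambda>_. inverse (det A) ^ N)"

lemma det_adj: "A \<in> carrier_mat r r \<Longrightarrow> det (adj A) = cnj (det A)"
proof -
  assume A: "A \<in> carrier_mat r r"
  have "det (adj A) = det (transpose_mat (adj A))" by (rule det_transpose[symmetric, OF adj_carrier[OF A]])
  also have "transpose_mat (adj A) = mat r r (\<lambda>ij. cnj (A $$ ij))" using A by (intro eq_matI) (auto simp: adj_def)
  also have "det \<dots> = cnj (det A)"
    unfolding det_leibniz[OF A] by (subst det_leibniz[of _ r]) (auto simp: permutes_less intro!: sum.cong prod.cong)
  finally show ?thesis .
qed

lemma det_rep_star: "star_rep r 1 (det_rep N)"
proof -
  have "rational_rep r 1 (det_rep N)"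
  proof (rule rational_repI)
    show "det_rep N A \<in> carrier (GL 1)" if "A \<in> carrier (GL r)" for A
      using that by (simp add: det_rep_def GL_iff det_single)
    show "det_rep N (A * B) = det_rep N A * det_rep N B" if "A \<in> carrier (GL r)" "B \<in> carrier (GL r)" for A B
      using det_mult[OF GL_mat[OF that(1)] GL_mat[OF that(2)]]
      by (intro eq_matI) (auto simp: det_rep_def scalar_prod_def power_mult_distrib)
    have "reg_on r (\<lambda>A. \<Prod>i<N. inverse (det A))" by (intro reg_on_prod reg_on_inverse_det) auto
    thus "reg_on r (\<lambda>A. det_rep N A $$ (i, j))" if "i < 1" "j < 1" for i j
      using that by (simp add: det_rep_def)
  qed
  moreover have "det_rep N (adj A) = adj (det_rep N A)" if "A \<in> carrier (GL r)" for A
    using det_adj[OF GL_mat[OF that]] by (intro eq_matI) (auto simp: det_rep_def adj_def)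
  ultimately show ?thesis by (simp add: star_rep_def)
qed

lemma det_rep_irreducible: "irreducible r 1 (det_rep N) (\<lambda>i. if i < r then - int N else 0) (unit_vec 1 0)"
proof -
  interpret rational r 1 "det_rep N" using det_rep_star by unfold_locales (simp add: star_rep_def)
  have "irreducible_rep r 1 (det_rep N)"
    unfolding irreducible_rep_def
  proof (intro conjI allI impI)
    show "rational_rep r 1 (det_rep N)" using det_rep_star by (simp add: star_rep_def)
    show "(1::nat) > 0" by simp
    fix W assume W: "VectorSpace.subspace class_ring W (module_vec TYPE(complex) 1)"
    note Ws = subspaceD[OF W]
    show "W = {0\<^sub>v 1} \<or> W = carrier_vec 1"
    proof (cases "W = {0\<^sub>v 1}")
      case False
      then obtain x where x: "x \<in> W" "x \<noteq> 0\<^sub>v 1" using Ws(2) by blast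
      have xc: "x \<in> carrier_vec 1" using x Ws(1) by blast
      have x0: "x $ 0 \<noteq> 0"
      proof
        assume "x $ 0 = 0"
        hence "x = 0\<^sub>v 1" using xc by (intro eq_vecI) auto
        thus False using x by simp
      qed
      have "y \<in> W" if y: "y \<in> carrier_vec 1" for y
      proof -
        have "y = (y $ 0 / x $ 0) \<cdot>\<^sub>v x" using x0 xc y by (intro eq_vecI) auto
        thus ?thesis using Ws(4)[OF x(1)] by metis
      qed
      thus ?thesis using Ws(1) by blast
    qed simp
  qed
  moreover have "hwv (\<lambda>i. if i < r then - int N else 0) (unit_vec 1 0)"
    unfolding hwv_def
  proof (intro conjI ballI impI)
    show "unit_vec 1 0 \<in> carrier_vec 1" by simp
    have "unit_vec 1 0 $ 0 \<noteq> (0\<^sub>v 1 $ 0 :: complex)" by simp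
    thus "unit_vec 1 0 \<noteq> (0\<^sub>v 1 :: complex vec)" by metis
    fix B assume B: "B \<in> carrier (GL r)" "upper_triangular B"
    have Bc: "B \<in> carrier_mat r r" using B GL_iff by blast
    have "det B = prod_list (diag_mat B)" by (rule det_upper_triangular[OF B(2) Bc])
    also have "diag_mat B = map (\<lambda>i. B $$ (i, i)) [0..<r]" using Bc by (simp add: diag_mat_def)
    also have "prod_list \<dots> = (\<Prod>i<r. B $$ (i, i))"
      by (simp add: prod.distinct_set_conv_list[symmetric] lessThan_atLeast0)
    finally have detB: "det B = (\<Prod>i<r. B $$ (i, i))" .
    have "lmon r (\<lambda>i. if i < r then - int N else 0) (\<lambda>i. B $$ (i, i)) = (\<Prod>i<r. inverse (B $$ (i, i)) ^ N)"
      unfolding lmon_def by (rule prod.cong) (auto simp: power_int_minus power_inverse)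
    also have "\<dots> = inverse (det B) ^ N"
      by (simp only: detB prod_power_distrib[symmetric] prod_inversef[unfolded o_def])
    finally show "det_rep N B *\<^sub>v unit_vec 1 0 = lmon r (\<lambda>i. if i < r then - int N else 0) (\<lambda>i. B $$ (i, i)) \<cdot>\<^sub>v unit_vec 1 0"
      by (intro eq_vecI) (auto simp: det_rep_def scalar_prod_def)
  qed
  ultimately show ?thesis by unfold_locales (auto simp: expo_def)
qed

text \<open>Lower the last entry of m above the common lower bound - N. By the Pieri rule, m is the highest weight of a
  constituent of the tensor product of the resulting representation with the standard one.\<close>

theorem irreducible_exists:
  assumes "m \<in> expo r" "dominant r m"
  shows "\<exists>d R v. star_rep r d R \<and> irreducible r d R m v"
proof -
  obtain N where N: "\<And>i. i < r \<Longrightarrow> m i \<ge> - int N"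
  proof -
    have "m i \<ge> - int (nat (\<Sum>i<r. \<bar>m i\<bar>))" if "i < r" for i
    proof -
      have "\<bar>m i\<bar> \<le> (\<Sum>i<r. \<bar>m i\<bar>)" using that by (intro member_le_sum) auto
      thus ?thesis by linarith
    qed
    thus ?thesis using that by blast
  qed
  \<comment> \<open>Induction on the total excess of m over -N.\<close>
  have "\<And>m. m \<in> expo r \<Longrightarrow> dominant r m \<Longrightarrow> (\<And>i. i < r \<Longrightarrow> m i \<ge> - int N) \<Longrightarrow> n = nat (\<Sum>i<r. m i + int N) \<Longrightarrow>
      \<exists>d R v. star_rep r d R \<and> irreducible r d R m v" for n
  proof (induction n rule: less_induct)
    case (less n m)
    show ?case
    proof (cases "\<exists>i<r. m i > - int N")
      case False
      hence "m = (\<lambda>i. if i < r then - int N else 0)"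
        using less.prems(3) by (intro expo_eqI[OF less.prems(1)]) (fastforce simp: expo_def)+
      thus ?thesis using det_rep_star[of r N] det_rep_irreducible[of r N] by blast
    next
      case True
      \<comment> \<open>Lowering the last entry above -N keeps the tuple decreasing, because all
        later entries are equal to -N.\<close>
      define i where "i = Max {i. i < r \<and> m i > - int N}"
      have fin: "finite {i. i < r \<and> m i > - int N}" by simp
      have "i \<in> {i. i < r \<and> m i > - int N}" unfolding i_def by (rule Max_in[OF fin]) (use True in blast)
      hence i: "i < r" "m i > - int N" by auto
      have after: "m j = - int N" if "i < j" "j < r" for j
      proof (rule ccontr)
        assume "m j \<noteq> - int N"
        hence "j \<in> {i. i < r \<and> m i > - int N}" using less.prems(3)[OF that(2)] that by auto
        hence "j \<le> i" unfolding i_def by (rule Max_ge[OF fin])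
        thus False using that by simp
      qed
      define m' where "m' = m(i := m i - 1)"
      have m'e: "m' \<in> expo r" using less.prems(1) i by (auto simp: m'_def expo_def)
      have m'd: "dominant r m'"
        unfolding dominant_def
      proof (intro allI impI)
        fix a b assume ab: "a \<le> b" "b < r"
        have "m b \<le> m a" using less.prems(2) ab by (auto simp: dominant_def)
        thus "m' b \<le> m' a" using after[of b] i ab by (cases "a = i"; cases "b = i") (auto simp: m'_def)
      qed
      have m'N: "\<And>j. j < r \<Longrightarrow> m' j \<ge> - int N" using less.prems(3) i by (auto simp: m'_def)
      have "(\<Sum>j<r. m' j + int N) = (\<Sum>j<r. m j + int N - (if j = i then 1 else 0))"
        by (rule sum.cong) (auto simp: m'_def)
      also have "\<dots> = (\<Sum>j<r. m j + int N) - 1" using i by (simp add: sum_subtractf)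
      finally have s: "(\<Sum>j<r. m' j + int N) = (\<Sum>j<r. m j + int N) - 1" .
      have "(\<Sum>j<r. m' j + int N) \<ge> 0" by (rule sum_nonneg) (use m'N in force)
      hence lt: "nat (\<Sum>j<r. m' j + int N) < n" using s less.prems(4) by simp
      obtain d' R' v' where R': "star_rep r d' R'" "irreducible r d' R' m' v'"
        using less.IH[OF lt m'e m'd m'N refl] by blast
      interpret R': irreducible r d' R' m' v' by (rule R'(2))
      define T where "T = tensor_rep R' (\<lambda>A. A)"
      have T: "star_rep r (d' * r) T" unfolding T_def by (rule tensor_star[OF R'(1) standard_star_rep])
      obtain ps where ps: "decomposition r (d' * r) T ps" using star_rep_decomposition[OF T] by blast
      have irr: "\<exists>n v. irreducible r n (fst p) (snd p) v \<and> dominant r (snd p) \<and> star_rep r n (fst p)" if "p \<in> set ps" for p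
        using ps that by (auto simp: decomposition_def)
      have ex: "snd p \<in> expo r" if "p \<in> set ps" for p
        using irr[OF that] irreducible.m_expo by blast
      let ?l = "\<lambda>i. m' i + rho r i" and ?L = "\<lambda>i. m i + rho r i"
      have le: "?l \<in> expo r" by (rule expo_add[OF m'e rho_expo])
      have Le: "?L \<in> expo r" by (rule expo_add[OF less.prems(1) rho_expo])
      have lje: "(\<lambda>i. ?l i + (if i = j then 1 else 0)) \<in> expo r" if "j < r" for j
        using le that by (auto simp: expo_def)
      have char: "(\<Sum>j<r. altern r (\<lambda>i. ?l i + (if i = j then 1 else 0)) t) = (\<Sum>p\<leftarrow>ps. altern r (\<lambda>i. snd p i + rho r i) t)"
        if t: "t \<in> torus r" for t
      proof -
        have "tr (T (dg r t)) = tr (R' (dg r t)) * tr (dg r t)"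
          unfolding T_def tensor_rep_def by (rule kronecker_tr[OF R'.R_mat[OF dg_GL[OF t]] dg_carrier])
        moreover have "tr (dg r t) = (\<Sum>j<r. t j)" by (simp add: tr_carrier[OF dg_carrier] dg_entry)
        ultimately have "altern r (rho r) t * tr (T (dg r t)) = altern r ?l t * (\<Sum>j<r. t j)"
          using R'.weyl_character_formula[OF m'd t] by (simp add: R'.character_def mult.assoc[symmetric])
        thus ?thesis using decomposition_character[OF ps _ t] T altern_pieri[OF t] by (simp add: star_rep_def)
      qed
      have "(\<lambda>k. \<Sum>j<r. altern_coeff r (\<lambda>i. ?l i + (if i = j then 1 else 0)) k) = (\<lambda>k. \<Sum>p\<leftarrow>ps. altern_coeff r (\<lambda>i. snd p i + rho r i) k)"
      proof (rule laurent_unique)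
        show "laurent r (\<lambda>t. \<Sum>j<r. altern r (\<lambda>i. ?l i + (if i = j then 1 else 0)) t)
          (\<lambda>k. \<Sum>j<r. altern_coeff r (\<lambda>i. ?l i + (if i = j then 1 else 0)) k)"
          by (rule laurent_sum, simp, rule laurent_altern, rule lje) simp
        show "laurent r (\<lambda>t. \<Sum>p\<leftarrow>ps. altern r (\<lambda>i. snd p i + rho r i) t) (\<lambda>k. \<Sum>p\<leftarrow>ps. altern_coeff r (\<lambda>i. snd p i + rho r i) k)"
          by (rule laurent_sum_list, rule laurent_altern, rule expo_add[OF ex rho_expo])
      qed (rule char)
      hence "(\<Sum>j<r. altern_coeff r (\<lambda>i. ?l i + (if i = j then 1 else 0)) ?L) = (\<Sum>p\<leftarrow>ps. altern_coeff r (\<lambda>i. snd p i + rho r i) ?L)"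
        by meson
      also have "(\<Sum>j<r. altern_coeff r (\<lambda>i. ?l i + (if i = j then 1 else 0)) ?L) = (\<Sum>j<r. if j = i then 1 else 0)"
      proof (rule sum.cong[OF refl])
        fix j assume "j \<in> {..<r}"
        hence j: "j < r" by simp
        have "altern_coeff r (\<lambda>i. ?l i + (if i = j then 1 else 0)) ?L = (if ?L = (\<lambda>i. ?l i + (if i = j then 1 else 0)) then 1 else 0)"
        proof (rule altern_coeff_dominant[OF lje[OF j] _ Le])
          show "?L b < ?L a" if "a < b" "b < r" for a b by (rule dominant_shift_strict[OF less.prems(2) that])
          show "?l b + (if b = j then 1 else 0) \<le> ?l a + (if a = j then 1 else 0)" if "a \<le> b" "b < r" for a b
            using dominant_shift_strict[OF m'd, of a b] that by (cases "a = b") auto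
        qed
        also have "?L = (\<lambda>i. ?l i + (if i = j then 1 else 0)) \<longleftrightarrow> j = i"
          by (auto simp: fun_eq_iff m'_def split: if_splits)
        finally show "altern_coeff r (\<lambda>i. ?l i + (if i = j then 1 else 0)) ?L = (if j = i then 1 else 0)" .
      qed
      also have "\<dots> = 1" using i by simp
      finally have one: "(\<Sum>p\<leftarrow>ps. altern_coeff r (\<lambda>i. snd p i + rho r i) ?L) = 1" ..
      \<comment> \<open>The coefficient at m + rho is 1 for the tensor product, and every
        constituent with another highest weight contributes 0.\<close>
      have "\<exists>p\<in>set ps. snd p = m"
      proof (rule ccontr)
        assume no: "\<not> (\<exists>p\<in>set ps. snd p = m)"
        have "altern_coeff r (\<lambda>i. snd p i + rho r i) ?L = 0" if "p \<in> set ps" for p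
          using altern_coeff_shift[OF ex[OF that] _ less.prems(1,2)] irr[OF that] no that by auto
        hence "(\<Sum>p\<leftarrow>ps. altern_coeff r (\<lambda>i. snd p i + rho r i) ?L) = (\<Sum>p\<leftarrow>ps. 0)"
          by (intro arg_cong[of _ _ sum_list] map_cong refl)
        thus False using one by simp
      qed
      thus ?thesis using irr by blast
    qed
  qed
  thus ?thesis using assms N by blast
qed

section \<open>Littlewood-Richardson coefficients\<close>

definition expo_of :: "int list \<Rightarrow> nat \<Rightarrow> int" where
  "expo_of lam = (\<lambda>i. if i < length lam then lam ! i else 0)"

lemma expo_of_expo: "lam \<in> partitions r \<Longrightarrow> expo_of lam \<in> expo r"
  by (auto simp: partitions_def expo_of_def expo_def)

lemma expo_of_dominant: "lam \<in> partitions r \<Longrightarrow> dominant r (expo_of lam)"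
  unfolding dominant_def
proof (intro allI impI)
  fix i j assume "lam \<in> partitions r" "i \<le> j" "j < r"
  thus "expo_of lam j \<le> expo_of lam i"
    using sorted_wrt_nth_less[of "(\<ge>)" lam i j] by (cases "i = j") (auto simp: partitions_def expo_of_def)
qed

lemma partition_of_dominant:
  assumes "m \<in> expo r" "dominant r m"
  shows "map m [0..<r] \<in> partitions r" "expo_of (map m [0..<r]) = m"
  using assms by (auto simp: partitions_def dominant_def sorted_wrt_iff_nth_less expo_of_def expo_def fun_eq_iff)

lemma expo_of_inject: "lam \<in> partitions r \<Longrightarrow> mu \<in> partitions r \<Longrightarrow> expo_of lam = expo_of mu \<longleftrightarrow> lam = mu"
  by (auto simp: partitions_def expo_of_def fun_eq_iff intro!: nth_equalityI)

lemma (in rational) has_highest_weight_iff: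
  assumes "length lam = r"
  shows "has_highest_weight r d lam R \<longleftrightarrow> (\<exists>v. hwv (expo_of lam) v)"
proof -
  have "(\<Prod>i<r. B $$ (i, i) powi (lam ! i)) = lmon r (expo_of lam) (\<lambda>i. B $$ (i, i))" for B :: "complex mat"
    unfolding lmon_def by (rule prod.cong) (auto simp: expo_of_def assms)
  thus ?thesis unfolding has_highest_weight_def hwv_def by auto
qed

text \<open>Existence for every highest weight gives the choice in \<open>highest_weight_rep\<close>
  its intended value.\<close>

lemma highest_weight_rep_irreducible:
  assumes lam: "lam \<in> partitions r"
  shows "\<exists>d v. irreducible r d (highest_weight_rep r lam) (expo_of lam) v"
proof -
  have len: "length lam = r" using lam by (simp add: partitions_def)
  obtain d R v where R: "irreducible r d R (expo_of lam) v"
    using irreducible_exists[OF expo_of_expo[OF lam] expo_of_dominant[OF lam]] by blast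
  interpret R: irreducible r d R "expo_of lam" v by (rule R)
  have "has_highest_weight r d lam R"
    unfolding R.has_highest_weight_iff[OF len] by (rule exI[where x = v]) (rule R.hw)
  hence "\<exists>R. \<exists>d. irreducible_rep r d R \<and> has_highest_weight r d lam R"
    by (intro exI[where x = R] exI[where x = d] conjI R.irred)
  hence "\<exists>d. irreducible_rep r d (highest_weight_rep r lam) \<and> has_highest_weight r d lam (highest_weight_rep r lam)"
    unfolding highest_weight_rep_def by (rule someI_ex)
  then obtain n where n: "irreducible_rep r n (highest_weight_rep r lam)" "has_highest_weight r n lam (highest_weight_rep r lam)" by blast
  interpret V: rational r n "highest_weight_rep r lam" using n(1) by unfold_locales (simp add: irreducible_rep_def)
  obtain w where "V.hwv (expo_of lam) w" using n(2) V.has_highest_weight_iff[OF len] by blast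
  hence "irreducible r n (highest_weight_rep r lam) (expo_of lam) w"
    using n expo_of_expo[OF lam] by unfold_locales auto
  thus ?thesis by blast
qed

text \<open>The chosen representation need not be compatible with adjoints; uniqueness makes it
  equivalent to any model, in particular to one that is.\<close>

lemma highest_weight_rep_equiv:
  assumes "lam \<in> partitions r" "irreducible r n S (expo_of lam) v"
  shows "rep_equiv r n (highest_weight_rep r lam) S"
    "\<And>A. A \<in> carrier (GL r) \<Longrightarrow> highest_weight_rep r lam A \<in> carrier_mat n n"
    "\<exists>w. irreducible r n (highest_weight_rep r lam) (expo_of lam) w"
proof -
  obtain d w where w: "irreducible r d (highest_weight_rep r lam) (expo_of lam) w"
    using highest_weight_rep_irreducible[OF assms(1)] by blast
  note u = irreducible_unique[OF w assms(2)]
  interpret V: irreducible r d "highest_weight_rep r lam" "expo_of lam" w by (rule w)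
  show "rep_equiv r n (highest_weight_rep r lam) S" using u by simp
  show "\<And>A. A \<in> carrier (GL r) \<Longrightarrow> highest_weight_rep r lam A \<in> carrier_mat n n" using V.R_mat u(1) by simp
  show "\<exists>w. irreducible r n (highest_weight_rep r lam) (expo_of lam) w" using w u(1) by blast
qed

text \<open>The condition under the definite description in \<open>LR_coeff\<close>, with its list
  exposed.\<close>

definition LR_spec :: "nat \<Rightarrow> int list \<Rightarrow> int list \<Rightarrow> (int list \<Rightarrow> nat) \<Rightarrow> int list list \<Rightarrow> bool" where
  "LR_spec r lam mu c ks \<longleftrightarrow> distinct ks \<and> set ks \<subseteq> partitions r \<and> (\<forall>k. k \<notin> set ks \<longrightarrow> c k = 0) \<and>
     rep_iso r (tensor_rep (highest_weight_rep r lam) (highest_weight_rep r mu))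
       (direct_sum_rep (concat (map (\<lambda>k. replicate (c k) (highest_weight_rep r k)) ks)))"

lemma rep_equiv_direct_sum_map:
  assumes "\<And>x. x \<in> set l \<Longrightarrow> rep_equiv r (n x) (f x) (g x)"
    "\<And>x A. A \<in> carrier (GL r) \<Longrightarrow> x \<in> set l \<Longrightarrow> f x A \<in> carrier_mat (n x) (n x)"
    "\<And>x A. A \<in> carrier (GL r) \<Longrightarrow> x \<in> set l \<Longrightarrow> g x A \<in> carrier_mat (n x) (n x)"
  shows "rep_equiv r (sum_list (map n l)) (direct_sum_rep (map f l)) (direct_sum_rep (map g l))"
  using assms
proof (induction l)
  case Nil
  have "rep_equiv r 0 (direct_sum_rep []) (direct_sum_rep [])"
    by (rule rep_equiv_refl) (simp add: direct_sum_rep_def)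
  thus ?case by simp
next
  case (Cons x l)
  have one: "direct_sum_rep (map h [x]) = h x" for h :: "_ \<Rightarrow> complex mat \<Rightarrow> complex mat"
    by (rule ext) (simp only: direct_sum_rep_def list.map diag_block_mat_singleton)
  have "rep_equiv r (n x + sum_list (map n l)) (direct_sum_rep (map f ([x] @ l))) (direct_sum_rep (map g ([x] @ l)))"
  proof (rule rep_equiv_direct_sum_append[where n = n and n' = n])
    show "rep_equiv r (n x) (direct_sum_rep (map f [x])) (direct_sum_rep (map g [x]))"
      unfolding one by (rule Cons.prems) simp
    show "rep_equiv r (sum_list (map n l)) (direct_sum_rep (map f l)) (direct_sum_rep (map g l))"
      by (rule Cons.IH) (use Cons.prems in auto)
  qed (use Cons.prems in auto)
  thus ?case by simp
qed

lemma count_concat_replicate: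
  "distinct ks \<Longrightarrow> count (mset (concat (map (\<lambda>k. replicate (c k) k) ks))) x = (if x \<in> set ks then c x else 0)"
  by (induction ks) auto

text \<open>Star-compatible models of both factors are tensored and decomposed; then every
  constituent is replaced by the chosen representation of its highest weight, and equal ones are
  collected.\<close>

lemma LR_exists:
  assumes lam: "lam \<in> partitions r" and mu: "mu \<in> partitions r"
  shows "\<exists>c ks. LR_spec r lam mu c ks"
proof -
  let ?V = "highest_weight_rep r"
  obtain d S v where S: "star_rep r d S" "irreducible r d S (expo_of lam) v"
    using irreducible_exists[OF expo_of_expo[OF lam] expo_of_dominant[OF lam]] by blast
  obtain d' S' v' where S': "star_rep r d' S'" "irreducible r d' S' (expo_of mu) v'"
    using irreducible_exists[OF expo_of_expo[OF mu] expo_of_dominant[OF mu]] by blast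
  interpret S: irreducible r d S "expo_of lam" v by (rule S(2))
  interpret S': irreducible r d' S' "expo_of mu" v' by (rule S'(2))
  note V = highest_weight_rep_equiv[OF lam S(2)] and V' = highest_weight_rep_equiv[OF mu S'(2)]
  let ?D = "d * d'"
  have T: "star_rep r ?D (tensor_rep S S')" by (rule tensor_star[OF S(1) S'(1)])
  obtain ps where ps: "decomposition r ?D (tensor_rep S S') ps" using star_rep_decomposition[OF T] by blast
  have "\<forall>p\<in>set ps. \<exists>n v. irreducible r n (fst p) (snd p) v \<and> dominant r (snd p)"
    using ps unfolding decomposition_def by blast
  then obtain n w where nw: "\<And>p. p \<in> set ps \<Longrightarrow> irreducible r (n p) (fst p) (snd p) (w p)" "\<And>p. p \<in> set ps \<Longrightarrow> dominant r (snd p)"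
    by metis
  define K where "K p = map (snd p) [0..<r]" for p :: "(complex mat \<Rightarrow> complex mat) \<times> (nat \<Rightarrow> int)"
  have K: "K p \<in> partitions r" "irreducible r (n p) (fst p) (expo_of (K p)) (w p)" if p: "p \<in> set ps" for p
  proof -
    have e: "snd p \<in> expo r" using irreducible.m_expo[OF nw(1)[OF p]] .
    show "K p \<in> partitions r" unfolding K_def by (rule partition_of_dominant(1)[OF e nw(2)[OF p]])
    have "expo_of (K p) = snd p" unfolding K_def by (rule partition_of_dominant(2)[OF e nw(2)[OF p]])
    thus "irreducible r (n p) (fst p) (expo_of (K p)) (w p)" using nw(1)[OF p] by simp
  qed
  note VK = highest_weight_rep_equiv[OF K]
  have fc: "fst p A \<in> carrier_mat (n p) (n p)" if "p \<in> set ps" "A \<in> carrier (GL r)" for p A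
  proof -
    interpret p: irreducible r "n p" "fst p" "snd p" "w p" by (rule nw(1)[OF that(1)])
    show ?thesis by (rule p.R_mat[OF that(2)])
  qed
  have gc: "?V (K p) A \<in> carrier_mat (n p) (n p)" if "p \<in> set ps" "A \<in> carrier (GL r)" for p A
    by (rule VK(2)[OF that(1) that(1) that(2)])
  have e1: "rep_equiv r (sum_list (map n ps)) (direct_sum_rep (map fst ps)) (direct_sum_rep (map (\<lambda>p. ?V (K p)) ps))"
  proof (rule rep_equiv_direct_sum_map)
    show "rep_equiv r (n p) (fst p) (?V (K p))" if p: "p \<in> set ps" for p
      by (rule rep_equiv_sym[OF VK(1)[OF p p] gc[OF p] fc[OF p]])
  qed (use fc gc in auto)
  \<comment> \<open>The same matrix lies in both carriers, so the dimensions agree.\<close>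
  have sumn: "sum_list (map n ps) = ?D"
  proof -
    have "direct_sum_rep (map fst ps) (1\<^sub>m r) \<in> carrier_mat (sum_list (map n ps)) (sum_list (map n ps))"
      by (rule direct_sum_carrier[where f = fst]) (rule fc[OF _ GL_one])
    moreover have "direct_sum_rep (map fst ps) (1\<^sub>m r) \<in> carrier_mat ?D ?D"
      using ps GL_one by (auto simp: decomposition_def)
    ultimately show ?thesis by auto
  qed
  define kl where "kl = map K ps"
  define ks where "ks = remdups kl"
  define c where "c k = count (mset kl) k" for k
  define kl' where "kl' = concat (map (\<lambda>k. replicate (c k) k) ks)"
  \<comment> \<open>The dimension of V(k), read off from its value at the identity.\<close>
  define nk where "nk k = dim_row (?V k (1\<^sub>m r))" for k
  have nk: "nk (K p) = n p" if "p \<in> set ps" for p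
    using gc[OF that GL_one] by (simp add: nk_def)
  have ms: "mset kl = mset kl'"
  proof (rule multiset_eqI)
    fix x
    have "count (mset kl') x = (if x \<in> set ks then c x else 0)"
      unfolding kl'_def by (rule count_concat_replicate) (simp add: ks_def)
    thus "count (mset kl) x = count (mset kl') x" by (auto simp: ks_def c_def count_mset_0_iff)
  qed
  have Vc: "?V k A \<in> carrier_mat (nk k) (nk k)" if "A \<in> carrier (GL r)" "k \<in> set kl" for k A
    using that gc nk by (auto simp: kl_def)
  have e2: "rep_equiv r (sum_list (map nk kl)) (direct_sum_rep (map ?V kl)) (direct_sum_rep (map ?V kl'))"
    by (rule rep_equiv_direct_sum_perm[OF ms Vc])
  have snk: "sum_list (map nk kl) = ?D"
    unfolding sumn[symmetric] kl_def map_map by (rule arg_cong[of _ _ sum_list], rule map_cong) (auto simp: nk)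
  have snk': "sum_list (map nk kl') = ?D" unfolding snk[symmetric] by (metis ms mset_map sum_mset_sum_list)
  have mapV: "map ?V kl = map (\<lambda>p. ?V (K p)) ps" by (simp add: kl_def)
  have mapV': "map ?V kl' = concat (map (\<lambda>k. replicate (c k) (?V k)) ks)"
    by (simp add: kl'_def map_concat o_def)
  have cT: "tensor_rep S S' A \<in> carrier_mat ?D ?D" if "A \<in> carrier (GL r)" for A
    unfolding tensor_rep_def by (rule kronecker_carrier[OF S.R_mat[OF that] S'.R_mat[OF that]])
  have cV: "tensor_rep (?V lam) (?V mu) A \<in> carrier_mat ?D ?D" if "A \<in> carrier (GL r)" for A
    unfolding tensor_rep_def by (rule kronecker_carrier[OF V(2)[OF that] V'(2)[OF that]])
  have cps: "direct_sum_rep (map fst ps) A \<in> carrier_mat ?D ?D" if "A \<in> carrier (GL r)" for A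
    using ps that by (auto simp: decomposition_def)
  have ckl: "direct_sum_rep (map ?V kl) A \<in> carrier_mat ?D ?D" if "A \<in> carrier (GL r)" for A
    unfolding snk[symmetric] by (rule direct_sum_carrier) (rule Vc[OF that])
  have ckl': "direct_sum_rep (map ?V kl') A \<in> carrier_mat ?D ?D" if "A \<in> carrier (GL r)" for A
    unfolding snk'[symmetric] by (rule direct_sum_carrier) (use Vc[OF that] mset_eq_setD[OF ms] in auto)
  have E0: "rep_equiv r ?D (tensor_rep (?V lam) (?V mu)) (tensor_rep S S')"
    by (rule tensor_equiv[OF V(1) V'(1) V(2) V'(2) S.R_mat S'.R_mat])
  have E1: "rep_equiv r ?D (tensor_rep S S') (direct_sum_rep (map fst ps))" using ps by (simp add: decomposition_def)
  have E2: "rep_equiv r ?D (direct_sum_rep (map fst ps)) (direct_sum_rep (map ?V kl))" using e1 unfolding mapV sumn .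
  have E3: "rep_equiv r ?D (direct_sum_rep (map ?V kl)) (direct_sum_rep (map ?V kl'))" using e2 unfolding snk .
  have E: "rep_equiv r ?D (tensor_rep (?V lam) (?V mu)) (direct_sum_rep (map ?V kl'))"
    by (rule rep_equiv_trans[OF rep_equiv_trans[OF rep_equiv_trans[OF E0 E1 cV cT cps] E2 cV cps ckl] E3 cV ckl ckl'])
  obtain x where "irreducible r d (?V lam) (expo_of lam) x" using V(3) by blast
  then interpret VL: irreducible r d "?V lam" "expo_of lam" x .
  obtain x' where "irreducible r d' (?V mu) (expo_of mu) x'" using V'(3) by blast
  then interpret VM: irreducible r d' "?V mu" "expo_of mu" x' .
  have rat: "rational_rep r ?D (tensor_rep (?V lam) (?V mu))" by (rule tensor_rational[OF VL.rational VM.rational])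
  have rat': "rational_rep r ?D (direct_sum_rep (map ?V kl'))" by (rule rep_equiv_rational[OF E rat ckl'])
  have "rep_iso r (tensor_rep (?V lam) (?V mu)) (direct_sum_rep (map ?V kl'))"
    unfolding rep_iso_def using rat rat' E unfolding rep_equiv_def by blast
  moreover have "set ks \<subseteq> partitions r" using K(1) by (auto simp: ks_def kl_def)
  moreover have "\<forall>k. k \<notin> set ks \<longrightarrow> c k = 0" by (auto simp: ks_def c_def count_mset_0_iff)
  ultimately have "LR_spec r lam mu c ks" unfolding LR_spec_def mapV'[symmetric] by (simp add: ks_def)
  thus ?thesis by blast
qed

lemma highest_weight_rep_character:
  assumes "lam \<in> partitions r" "t \<in> torus r"
  shows "altern r (rho r) t * tr (highest_weight_rep r lam (dg r t)) = altern r (\<lambda>i. expo_of lam i + rho r i) t"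
proof -
  obtain d v where "irreducible r d (highest_weight_rep r lam) (expo_of lam) v"
    using highest_weight_rep_irreducible[OF assms(1)] by blast
  then interpret V: irreducible r d "highest_weight_rep r lam" "expo_of lam" v .
  show ?thesis using V.weyl_character_formula[OF expo_of_dominant[OF assms(1)] assms(2)] by (simp add: V.character_def)
qed

text \<open>The Vandermonde factor is absorbed by the character of V(lam), while that of V(mu) stays
  a trace; so no quotient appears and points with equal coordinates are covered.\<close>

lemma LR_character:
  assumes lam: "lam \<in> partitions r" and mu: "mu \<in> partitions r" and c: "LR_spec r lam mu c ks" and t: "t \<in> torus r"
  shows "altern r (\<lambda>i. expo_of lam i + rho r i) t * tr (highest_weight_rep r mu (dg r t)) =
    (\<Sum>k\<in>set ks. of_nat (c k) * altern r (\<lambda>i. expo_of k i + rho r i) t)"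
proof -
  let ?V = "highest_weight_rep r" and ?A = "dg r t"
  define kl where "kl = concat (map (\<lambda>k. replicate (c k) k) ks)"
  have mapV: "concat (map (\<lambda>k. replicate (c k) (?V k)) ks) = map ?V kl"
    by (simp add: kl_def map_concat o_def)
  have klp: "k \<in> partitions r" if "k \<in> set kl" for k using that c by (auto simp: kl_def LR_spec_def)
  note A = dg_GL[OF t]
  have sq: "\<exists>n. ?V k ?A \<in> carrier_mat n n" if k: "k \<in> partitions r" for k
  proof -
    obtain d v where "irreducible r d (?V k) (expo_of k) v" using highest_weight_rep_irreducible[OF k] by blast
    then interpret V: irreducible r d "?V k" "expo_of k" v .
    show ?thesis using V.R_mat[OF A] by blast
  qed
  have "\<forall>k. \<exists>n. k \<in> partitions r \<longrightarrow> ?V k ?A \<in> carrier_mat n n" using sq by blast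
  then obtain n where n: "\<And>k. k \<in> partitions r \<Longrightarrow> ?V k ?A \<in> carrier_mat (n k) (n k)" by metis
  obtain D P where D: "rational_rep r D (tensor_rep (?V lam) (?V mu))" "rational_rep r D (direct_sum_rep (map ?V kl))"
    "P \<in> carrier (GL D)" "\<forall>A\<in>carrier (GL r). P * tensor_rep (?V lam) (?V mu) A = direct_sum_rep (map ?V kl) A * P"
    using c unfolding LR_spec_def rep_iso_def mapV by blast
  interpret X: rational r D "tensor_rep (?V lam) (?V mu)" using D(1) by unfold_locales
  interpret Y: rational r D "direct_sum_rep (map ?V kl)" using D(2) by unfold_locales
  have "rep_equiv r D (tensor_rep (?V lam) (?V mu)) (direct_sum_rep (map ?V kl))"
    using D unfolding rep_equiv_def by blast
  from rep_equiv_tr[OF this A X.R_mat[OF A] Y.R_mat[OF A]]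
  have "tr (?V lam ?A) * tr (?V mu ?A) = (\<Sum>k\<leftarrow>kl. tr (?V k ?A))"
    unfolding tensor_rep_def using kronecker_tr[OF n[OF lam] n[OF mu]]
      direct_sum_tr[where l = kl and f = ?V and A = ?A and n = n] n klp by simp
  also have "\<dots> = (\<Sum>k\<leftarrow>ks. of_nat (c k) * tr (?V k ?A))"
    unfolding kl_def by (induction ks) (simp_all add: sum_list_replicate)
  also have "\<dots> = (\<Sum>k\<in>set ks. of_nat (c k) * tr (?V k ?A))"
    using c by (simp add: sum_list_distinct_conv_sum_set LR_spec_def)
  finally have "altern r (rho r) t * (tr (?V lam ?A) * tr (?V mu ?A)) =
     (\<Sum>k\<in>set ks. of_nat (c k) * (altern r (rho r) t * tr (?V k ?A)))"
    by (simp add: sum_distrib_left mult_ac)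
  also have "\<dots> = (\<Sum>k\<in>set ks. of_nat (c k) * altern r (\<lambda>i. expo_of k i + rho r i) t)"
    using c highest_weight_rep_character[OF _ t] by (intro sum.cong refl) (auto simp: LR_spec_def)
  finally show ?thesis using highest_weight_rep_character[OF lam t] by (simp add: mult.assoc[symmetric])
qed

lemma LR_laurent:
  assumes lam: "lam \<in> partitions r" and mu: "mu \<in> partitions r" and c: "LR_spec r lam mu c ks"
  shows "laurent r (\<lambda>t. altern r (\<lambda>i. expo_of lam i + rho r i) t * tr (highest_weight_rep r mu (dg r t)))
    (\<lambda>m. \<Sum>k\<in>set ks. of_nat (c k) * altern_coeff r (\<lambda>i. expo_of k i + rho r i) m)"
proof (rule laurent_cong)
  show "laurent r (\<lambda>t. \<Sum>k\<in>set ks. of_nat (c k) * altern r (\<lambda>i. expo_of k i + rho r i) t)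
    (\<lambda>m. \<Sum>k\<in>set ks. of_nat (c k) * altern_coeff r (\<lambda>i. expo_of k i + rho r i) m)"
    by (rule laurent_sum, simp, rule laurent_scale, rule laurent_altern, rule expo_add[OF expo_of_expo rho_expo])
       (use c in \<open>auto simp: LR_spec_def\<close>)
qed (simp add: LR_character[OF lam mu c])

lemma LR_coeff_extract:
  assumes c: "LR_spec r lam mu c ks" and nu: "nu \<in> partitions r"
  shows "(\<Sum>k\<in>set ks. of_nat (c k) * altern_coeff r (\<lambda>i. expo_of k i + rho r i) (\<lambda>i. expo_of nu i + rho r i)) = of_nat (c nu)"
proof -
  have "(\<Sum>k\<in>set ks. of_nat (c k) * altern_coeff r (\<lambda>i. expo_of k i + rho r i) (\<lambda>i. expo_of nu i + rho r i)) =
    (\<Sum>k\<in>set ks. if k = nu then of_nat (c nu) else 0)"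
  proof (rule sum.cong[OF refl])
    fix k assume "k \<in> set ks"
    hence k: "k \<in> partitions r" using c by (auto simp: LR_spec_def)
    show "of_nat (c k) * altern_coeff r (\<lambda>i. expo_of k i + rho r i) (\<lambda>i. expo_of nu i + rho r i) = (if k = nu then of_nat (c nu) else 0)"
      using altern_coeff_shift[OF expo_of_expo[OF k] expo_of_dominant[OF k] expo_of_expo[OF nu] expo_of_dominant[OF nu]]
        expo_of_inject[OF nu k] by simp
  qed
  also have "\<dots> = of_nat (c nu)" using c by (auto simp: LR_spec_def)
  finally show ?thesis .
qed

text \<open>Both multiplicity functions are read off from the Laurent coefficients of one function
  at nu + rho; outside the partitions both are 0.\<close>

lemma LR_unique:
  assumes lam: "lam \<in> partitions r" and mu: "mu \<in> partitions r"
    and c: "LR_spec r lam mu c ks" and c': "LR_spec r lam mu c' ks'"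
  shows "c = c'"
proof
  fix nu
  show "c nu = c' nu"
  proof (cases "nu \<in> partitions r")
    case True
    have "(of_nat (c nu) :: complex) = of_nat (c' nu)"
      using LR_coeff_extract[OF c True] LR_coeff_extract[OF c' True]
        laurent_unique[OF LR_laurent[OF lam mu c] LR_laurent[OF lam mu c'] refl] by metis
    thus ?thesis by simp
  next
    case False
    hence "nu \<notin> set ks" "nu \<notin> set ks'" using c c' by (auto simp: LR_spec_def)
    thus ?thesis using c c' by (simp add: LR_spec_def)
  qed
qed

lemma LR_coeff_spec:
  assumes lam: "lam \<in> partitions r" and mu: "mu \<in> partitions r"
  shows "\<exists>ks. LR_spec r lam mu (LR_coeff r lam mu) ks"
proof -
  have "LR_coeff r lam mu = (THE c. \<exists>ks. LR_spec r lam mu c ks)"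
    by (simp add: LR_coeff_def LR_spec_def)
  moreover have "\<exists>!c. \<exists>ks. LR_spec r lam mu c ks"
    using LR_exists[OF lam mu] LR_unique[OF lam mu] by blast
  ultimately show ?thesis using theI'[of "\<lambda>c. \<exists>ks. LR_spec r lam mu c ks"] by simp
qed

text \<open>Expanding the character of V(mu) into weights w, the numerator has only exponents w +
  (lam + rho) o p. So k + rho has this form, and the dominance bound on w controls its first entry,
  its last entry and its sum.\<close>

lemma LR_bounds:
  assumes r: "r > 0" and lam: "lam \<in> partitions r" and mu: "mu \<in> partitions r" and c: "LR_spec r lam mu c ks"
    and k: "k \<in> partitions r" and nz: "c k \<noteq> 0"
  shows "expo_of k 0 \<le> expo_of lam 0 + expo_of mu 0"
    "expo_of k (r - 1) \<ge> expo_of lam (r - 1) + expo_of mu (r - 1)"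
    "(\<Sum>i<r. expo_of k i) = (\<Sum>i<r. expo_of lam i) + (\<Sum>i<r. expo_of mu i)"
proof -
  let ?l = "\<lambda>i. expo_of lam i + rho r i" and ?k = "\<lambda>i. expo_of k i + rho r i"
  obtain d v where "irreducible r d (highest_weight_rep r mu) (expo_of mu) v"
    using highest_weight_rep_irreducible[OF mu] by blast
  then interpret V: irreducible r d "highest_weight_rep r mu" "expo_of mu" v .
  have le: "?l \<in> expo r" by (rule expo_add[OF expo_of_expo[OF lam] rho_expo])
  \<comment> \<open>A second expansion of the function in \<open>LR_laurent\<close>; comparison at k
    + rho expresses c(k) through weights of V(mu).\<close>
  have L: "laurent r (\<lambda>t. altern r ?l t * tr (highest_weight_rep r mu (dg r t)))
    (\<lambda>m. \<Sum>p | p permutes {..<r}. \<Sum>w\<in>V.weights. of_int (sign p) * tr (V.P w) * (if m = (\<lambda>i. w i + ?l (p i)) then 1 else 0))"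
  proof (rule laurent_cong)
    show "laurent r (\<lambda>t. \<Sum>p | p permutes {..<r}. \<Sum>w\<in>V.weights. of_int (sign p) * tr (V.P w) * lmon r (\<lambda>i. w i + ?l (p i)) t)
      (\<lambda>m. \<Sum>p | p permutes {..<r}. \<Sum>w\<in>V.weights. of_int (sign p) * tr (V.P w) * (if m = (\<lambda>i. w i + ?l (p i)) then 1 else 0))"
    proof (rule laurent_sum, simp add: finite_permutations, rule laurent_sum[OF V.finite_weights], rule laurent_scale, rule laurent_lmon)
      fix p w assume "p \<in> {p. p permutes {..<r}}" "w \<in> V.weights"
      thus "(\<lambda>i. w i + ?l (p i)) \<in> expo r"
        using expo_add[of w r "?l \<circ> p"] V.weights_expo expo_permute[OF _ le, of p] by (auto simp: o_def)
    qed
    fix t assume t: "t \<in> torus r"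
    show "(\<Sum>p | p permutes {..<r}. \<Sum>w\<in>V.weights. of_int (sign p) * tr (V.P w) * lmon r (\<lambda>i. w i + ?l (p i)) t) =
       altern r ?l t * tr (highest_weight_rep r mu (dg r t))"
      unfolding V.character_def[symmetric] V.character_sum[OF t] V.dchar_def altern_def sum_product
      by (intro sum.cong refl) (simp add: lmon_add[OF t, of _ "\<lambda>i. expo_of lam (p i) + rho r (p i)" for p] o_def mult_ac)
  qed
  have "(\<Sum>p | p permutes {..<r}. \<Sum>w\<in>V.weights. of_int (sign p) * tr (V.P w) * (if ?k = (\<lambda>i. w i + ?l (p i)) then 1 else 0)) = of_nat (c k)"
    using fun_cong[OF laurent_unique[OF L LR_laurent[OF lam mu c] refl], of ?k] LR_coeff_extract[OF c k] by simp
  hence "(\<Sum>p | p permutes {..<r}. \<Sum>w\<in>V.weights. of_int (sign p) * tr (V.P w) * (if ?k = (\<lambda>i. w i + ?l (p i)) then 1 else 0)) \<noteq> 0"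
    using nz by simp
  then obtain p where p: "p \<in> {p. p permutes {..<r}}"
    and "(\<Sum>w\<in>V.weights. of_int (sign p) * tr (V.P w) * (if ?k = (\<lambda>i. w i + ?l (p i)) then 1 else 0)) \<noteq> 0"
    by (rule sum.not_neutral_contains_not_neutral)
  from this(2) obtain w where w: "w \<in> V.weights" and "of_int (sign p) * tr (V.P w) * (if ?k = (\<lambda>i. w i + ?l (p i)) then 1 else 0) \<noteq> 0"
    by (rule sum.not_neutral_contains_not_neutral)
  hence eq: "?k = (\<lambda>i. w i + ?l (p i))" by (simp split: if_splits)
  have eqi: "expo_of k i + rho r i = w i + (expo_of lam (p i) + rho r (p i))" for i by (rule fun_cong[OF eq])
  have p': "p permutes {..<r}" using p by simp
  note wd = V.weights_dom_le[OF w]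
  have "(\<Sum>i<1. w i) \<le> (\<Sum>i<1. expo_of mu i)" using wd r unfolding dom_le_def by (metis Suc_leI One_nat_def)
  hence w0: "w 0 \<le> expo_of mu 0" by simp
  have mono: "?l j \<le> ?l i" if "i \<le> j" "j < r" for i j
    by (rule dominant_shift_mono[OF expo_of_dominant[OF lam] that])
  show "expo_of k 0 \<le> expo_of lam 0 + expo_of mu 0"
    using eqi[of 0] w0 mono[of 0 "p 0"] permutes_less[OF p' r] by simp
  obtain n where n: "r = Suc n" using r by (cases r) auto
  \<comment> \<open>The last entry is the total minus the first n = r - 1 entries, so the bound on
    the partial sum becomes a lower bound.\<close>
  have "(\<Sum>i<n. w i) \<le> (\<Sum>i<n. expo_of mu i)" "(\<Sum>i<Suc n. w i) = (\<Sum>i<Suc n. expo_of mu i)"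
    using wd n unfolding dom_le_def by auto
  hence wn: "w n \<ge> expo_of mu n" by simp
  show "expo_of k (r - 1) \<ge> expo_of lam (r - 1) + expo_of mu (r - 1)"
    using eqi[of n] wn mono[of "p n" n] permutes_less[OF p', of n] n by (simp add: rho_def)
  have "(\<Sum>i<r. expo_of k i + rho r i) = (\<Sum>i<r. w i + ?l (p i))" by (simp only: eqi)
  moreover have "(\<Sum>i<r. ?l (p i)) = (\<Sum>i<r. ?l i)" using sum.permute[OF p', of ?l] by (simp add: o_def)
  ultimately show "(\<Sum>i<r. expo_of k i) = (\<Sum>i<r. expo_of lam i) + (\<Sum>i<r. expo_of mu i)"
    using V.sum_weights[OF w] by (simp add: sum.distrib)
qed

section \<open>Averages over roots of unity\<close>

lemma cnj_lmon:
  assumes "\<And>i. i < r \<Longrightarrow> norm (t i) = 1"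
  shows "cnj (lmon r m t) = lmon r (\<lambda>i. - m i) t"
  unfolding lmon_def cnj_prod
proof (rule prod.cong[OF refl])
  fix i assume "i \<in> {..<r}"
  hence "norm (t i) = 1" using assms by simp
  hence "t i powi m i * cnj (t i powi m i) = 1"
    unfolding complex_norm_square[symmetric] by (simp add: norm_power_int)
  thus "cnj (t i powi m i) = t i powi - m i"
    by (simp add: power_int_minus inverse_unique)
qed

lemma cnj_altern:
  assumes "\<And>i. i < r \<Longrightarrow> norm (t i) = 1"
  shows "cnj (altern r k t) = altern r (\<lambda>i. - k i) t"
  unfolding altern_def cnj_sum
  by (rule sum.cong[OF refl]) (simp add: cnj_lmon[OF assms] o_def)

text \<open>A nonzero tuple of sum 0 has a positive and a negative entry; as multiples of n these
  differ by at least 2 n. The condition on the sum is what doubles the admissible width.\<close>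

lemma multiples_eq_zero:
  fixes d :: "nat \<Rightarrow> int"
  assumes dvd: "\<And>i. i < r \<Longrightarrow> int n dvd d i" and sum: "(\<Sum>i<r. d i) = 0"
    and width: "\<And>i j. i < r \<Longrightarrow> j < r \<Longrightarrow> d i - d j < 2 * int n" and i: "i < r"
  shows "d i = 0"
proof (rule ccontr)
  assume di: "d i \<noteq> 0"
  have "\<exists>a<r. d a > 0"
  proof (rule ccontr)
    assume "\<not> (\<exists>a<r. d a > 0)"
    hence "\<forall>a\<in>{..<r}. 0 \<le> - d a" by auto
    moreover have "(\<Sum>a<r. - d a) = 0" using sum by (simp add: sum_negf)
    ultimately have "\<forall>a\<in>{..<r}. - d a = 0" using sum_nonneg_eq_0_iff[of "{..<r}" "\<lambda>a. - d a"] by simp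
    thus False using di i by simp
  qed
  then obtain a where a: "a < r" "d a > 0" by blast
  have "\<exists>b<r. d b < 0"
  proof (rule ccontr)
    assume "\<not> (\<exists>b<r. d b < 0)"
    hence "\<forall>b\<in>{..<r}. 0 \<le> d b" by auto
    hence "\<forall>b\<in>{..<r}. d b = 0" using sum sum_nonneg_eq_0_iff[of "{..<r}" d] by simp
    thus False using di i by simp
  qed
  then obtain b where b: "b < r" "d b < 0" by blast
  have "int n \<le> d a" using dvd[OF a(1)] a(2) by (rule zdvd_imp_le)
  moreover have "int n \<le> - d b" using dvd[OF b(1)] b(2) by (intro zdvd_imp_le) auto
  ultimately show False using width[OF a(1) b(1)] by simp
qed

text \<open>q o inv p rearranges l into the decreasing tuple k; for strictly decreasing tuples this
  rearrangement is the identity.\<close>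

lemma strict_antitone_permute_unique:
  fixes k l :: "nat \<Rightarrow> int"
  assumes k: "\<And>i j. i < j \<Longrightarrow> j < r \<Longrightarrow> k j < k i" and l: "\<And>i j. i < j \<Longrightarrow> j < r \<Longrightarrow> l j < l i"
    and p: "p permutes {..<r}" and q: "q permutes {..<r}" and eq: "\<And>i. i < r \<Longrightarrow> k (p i) = l (q i)"
  shows "(\<forall>i<r. k i = l i) \<and> p = q"
proof -
  let ?s = "q \<circ> Hilbert_Choice.inv p"
  have ip: "Hilbert_Choice.inv p permutes {..<r}" by (rule permutes_inv[OF p])
  have s: "?s permutes {..<r}" by (rule permutes_compose[OF ip q])
  have ks: "k i = l (?s i)" if "i < r" for i
    using eq[of "Hilbert_Choice.inv p i"] permutes_less[OF ip that] permutes_inverses(1)[OF p, of i] by simp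
  have mono: "l j \<le> l i" if "i \<le> j" "j < r" for i j using l[of i j] that by (cases "i = j") auto
  have mono': "k j \<le> k i" if "i \<le> j" "j < r" for i j using k[of i j] that by (cases "i = j") auto
  have ls: "l (?s i) = l i" if i: "i < r" for i
    by (rule permute_antitone_eq[OF s mono _ i]) (use mono' ks in \<open>simp_all del: o_apply\<close>)
  have inj: "x = y" if "l x = l y" "x < r" "y < r" for x y
    using l[of x y] l[of y x] that by (metis less_irrefl linorder_neqE_nat)
  have si: "?s i = i" if "i < r" for i
    using inj[OF ls[OF that] permutes_less[OF s that] that] .
  have "p = q"
  proof
    fix i
    show "p i = q i"
    proof (cases "i < r")
      case True
      show ?thesis using si[OF permutes_less[OF p True]] permutes_inverses(2)[OF p, of i] by simp
    next
      case False
      thus ?thesis using p q by (simp add: permutes_not_in)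
    qed
  qed
  thus ?thesis using ks ls by simp
qed

text \<open>A pair p, q contributes only if all entries of k o p - l o q are divisible by n. These
  entries vary by at most the width of k plus that of l, hence vanish, which forces k = l and p = q;
  then the signs cancel.\<close>

lemma altern_orthogonal:
  assumes n: "n > 0" and r: "r > 0"
    and k: "k \<in> expo r" "\<And>i j. i < j \<Longrightarrow> j < r \<Longrightarrow> k j < k i"
    and l: "l \<in> expo r" "\<And>i j. i < j \<Longrightarrow> j < r \<Longrightarrow> l j < l i"
    and sum: "(\<Sum>i<r. k i) = (\<Sum>i<r. l i)"
    and width: "k 0 - k (r - 1) + (l 0 - l (r - 1)) < 2 * int n"
  shows "(\<Sum>v\<in>residues r n. altern r k (root_tuple n v) * cnj (altern r l (root_tuple n v))) =
    (if k = l then of_nat n ^ r * fact r else 0)"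
proof -
  let ?Q = "{p. p permutes {..<r}}"
  let ?z = "root_tuple n"
  have unit: "norm (?z v i) = 1" for v i by (simp add: root_tuple_def)
  have key: "(\<forall>i<r. int n dvd k (p i) - l (q i)) \<longleftrightarrow> k = l \<and> p = q" if pq: "p \<in> ?Q" "q \<in> ?Q" for p q
  proof
    assume dvd: "\<forall>i<r. int n dvd k (p i) - l (q i)"
    have p: "p permutes {..<r}" and q: "q permutes {..<r}" using pq by auto
    have kb: "k i \<le> k 0" "k (r - 1) \<le> k i" "l i \<le> l 0" "l (r - 1) \<le> l i" if "i < r" for i
      using k(2)[of 0 i] k(2)[of i "r - 1"] l(2)[of 0 i] l(2)[of i "r - 1"] that r
      by (cases "i = 0"; cases "i = r - 1"; force)+
    have zero: "k (p i) - l (q i) = 0" if i: "i < r" for i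
    proof (rule multiples_eq_zero[where d = "\<lambda>i. k (p i) - l (q i)" and r = r and n = n])
      show "(\<Sum>i<r. k (p i) - l (q i)) = 0"
        using sum.permute[OF p, of k] sum.permute[OF q, of l] sum by (simp add: sum_subtractf o_def)
      fix a b assume "a < r" "b < r"
      thus "k (p a) - l (q a) - (k (p b) - l (q b)) < 2 * int n"
        using kb(1)[of "p a"] kb(2)[of "p b"] kb(4)[of "q a"] kb(3)[of "q b"] permutes_less[OF p] permutes_less[OF q] width by smt
    qed (use dvd i in auto)
    have "(\<forall>i<r. k i = l i) \<and> p = q"
      by (rule strict_antitone_permute_unique[OF k(2) l(2) p q]) (use zero in auto)
    thus "k = l \<and> p = q" using expo_eqI[OF k(1) l(1)] by blast
  qed auto
  have "(\<Sum>v\<in>residues r n. altern r k (?z v) * cnj (altern r l (?z v))) =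
    (\<Sum>v\<in>residues r n. \<Sum>p\<in>?Q. \<Sum>q\<in>?Q. of_int (sign p * sign q) * lmon r (\<lambda>i. k (p i) - l (q i)) (?z v))"
  proof (rule sum.cong[OF refl])
    fix v
    have "lmon r (\<lambda>i. k (p i) - l (q i)) (?z v) = lmon r (k \<circ> p) (?z v) * lmon r (\<lambda>i. - (l \<circ> q) i) (?z v)" for p q
      using lmon_add[OF root_tuple_torus[of n v r], of "k \<circ> p" "\<lambda>i. - (l \<circ> q) i"] by simp
    thus "altern r k (?z v) * cnj (altern r l (?z v)) = (\<Sum>p\<in>?Q. \<Sum>q\<in>?Q. of_int (sign p * sign q) * lmon r (\<lambda>i. k (p i) - l (q i)) (?z v))"
      unfolding cnj_altern[OF unit] unfolding altern_def sum_product
      by (intro sum.cong refl) (simp add: o_def mult_ac)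
  qed
  also have "\<dots> = (\<Sum>p\<in>?Q. \<Sum>v\<in>residues r n. \<Sum>q\<in>?Q. of_int (sign p * sign q) * lmon r (\<lambda>i. k (p i) - l (q i)) (?z v))"
    by (rule sum.swap)
  also have "\<dots> = (\<Sum>p\<in>?Q. \<Sum>q\<in>?Q. \<Sum>v\<in>residues r n. of_int (sign p * sign q) * lmon r (\<lambda>i. k (p i) - l (q i)) (?z v))"
    by (rule sum.cong[OF refl], rule sum.swap)
  also have "\<dots> = (\<Sum>p\<in>?Q. \<Sum>q\<in>?Q. if p = q then (if k = l then of_nat n ^ r else 0) else 0)"
  proof (intro sum.cong refl)
    fix p q assume pq: "p \<in> ?Q" "q \<in> ?Q"
    show "(\<Sum>v\<in>residues r n. of_int (sign p * sign q) * lmon r (\<lambda>i. k (p i) - l (q i)) (?z v)) =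
       (if p = q then (if k = l then of_nat n ^ r else 0) else (0::complex))"
      unfolding sum_distrib_left[symmetric] root_tuple_sum[OF n] key[OF pq] by (auto simp: sign_def)
  qed
  also have "\<dots> = (if k = l then of_nat n ^ r * fact r else 0)"
    by (simp add: finite_permutations card_permutations[of "{..<r}" r])
  finally show ?thesis .
qed

text \<open>\<open>verlinde_vectors\<close> for n = r + K, with lists replaced by functions.\<close>

definition decreasing_residues :: "nat \<Rightarrow> nat \<Rightarrow> (nat \<Rightarrow> int) set" where
  "decreasing_residues r n = {v \<in> residues r n. v (r - 1) = 0 \<and> (\<forall>i j. i < j \<longrightarrow> j < r \<longrightarrow> v j < v i)}"

lemma finite_residues: "finite (residues r n)"
  unfolding residues_def by (rule finite_PiE) auto

text \<open>Adding constants modulo n maps the fibres of the entry at s onto each other without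
  changing G, so all n fibres contribute equally.\<close>

lemma sum_residues_shift:
  fixes G :: "(nat \<Rightarrow> int) \<Rightarrow> complex"
  assumes n: "n > 0" and s: "s < r"
    and per: "\<And>v w. (\<And>i. i < r \<Longrightarrow> v i mod int n = w i mod int n) \<Longrightarrow> G v = G w"
    and shift: "\<And>v c. G (\<lambda>i. v i + c) = G v"
  shows "(\<Sum>v\<in>residues r n. G v) = of_nat n * (\<Sum>v | v \<in> residues r n \<and> v s = 0. G v)"
proof -
  let ?R = "residues r n" and ?C = "{0..<int n}"
  have fiber: "(\<Sum>v | v \<in> ?R \<and> v s = c. G v) = (\<Sum>v | v \<in> ?R \<and> v s = 0. G v)" if c: "c \<in> ?C" for c
  proof (rule sum.reindex_bij_witness[of _ "\<lambda>v. restrict (\<lambda>i. (v i + c) mod int n) {..<r}" "\<lambda>v. restrict (\<lambda>i. (v i - c) mod int n) {..<r}"])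
    fix v assume v: "v \<in> {v. v \<in> ?R \<and> v s = c}"
    hence vb: "v i mod int n = v i" if "i < r" for i using that by (auto simp: residues_def PiE_iff)
    show "restrict (\<lambda>i. (restrict (\<lambda>i. (v i - c) mod int n) {..<r} i + c) mod int n) {..<r} = v"
      using v vb by (auto simp: fun_eq_iff mod_simps residues_def PiE_iff extensional_def)
    show "restrict (\<lambda>i. (v i - c) mod int n) {..<r} \<in> {v. v \<in> ?R \<and> v s = 0}"
      using v n s by (auto simp: residues_def)
    have "G (restrict (\<lambda>i. (v i - c) mod int n) {..<r}) = G (\<lambda>i. v i + (- c))"
      by (rule per) simp
    thus "G (restrict (\<lambda>i. (v i - c) mod int n) {..<r}) = G v" unfolding shift .
  next
    fix v assume v: "v \<in> {v. v \<in> ?R \<and> v s = 0}"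
    hence vb: "v i mod int n = v i" if "i < r" for i using that by (auto simp: residues_def PiE_iff)
    show "restrict (\<lambda>i. (restrict (\<lambda>i. (v i + c) mod int n) {..<r} i - c) mod int n) {..<r} = v"
      using v vb by (auto simp: fun_eq_iff mod_simps residues_def PiE_iff extensional_def)
    show "restrict (\<lambda>i. (v i + c) mod int n) {..<r} \<in> {v. v \<in> ?R \<and> v s = c}"
      using v n s c by (auto simp: residues_def)
  qed
  have "(\<Sum>v\<in>?R. G v) = (\<Sum>c\<in>?C. \<Sum>v | v \<in> ?R \<and> v s = c. G v)"
    by (rule sum.group[symmetric]) (use s finite_residues in \<open>auto simp: residues_def PiE_iff\<close>)
  also have "\<dots> = (\<Sum>c\<in>?C. \<Sum>v | v \<in> ?R \<and> v s = 0. G v)" by (rule sum.cong[OF refl fiber])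
  finally show ?thesis by simp
qed

text \<open>Only the first r - 1 positions are permuted: the entry 0 is the least residue and
  already stands last.\<close>

lemma residues_sort_bij:
  assumes r: "r > 0"
  shows "bij_betw (\<lambda>(w, p). w \<circ> p) (decreasing_residues r n \<times> {p. p permutes {..<r - 1}})
    {v \<in> residues r n. v (r - 1) = 0 \<and> inj_on v {..<r}}"
proof -
  obtain s where rs: "r = Suc s" using r by (cases r) auto
  let ?Z = "{v \<in> residues r n. v (r - 1) = 0 \<and> inj_on v {..<r}}"
  let ?D = "decreasing_residues r n" and ?Q = "{p. p permutes {..<r - 1}}"
  have sub: "p permutes {..<r}" if "p \<in> ?Q" for p using that rs by (auto intro: permutes_subset)
  have out: "w i = undefined" if "w \<in> residues r n" "i \<ge> r" for w i
    using that by (auto simp: residues_def PiE_iff extensional_def)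
  have inj_dec: "inj_on w {..<r}" if "w \<in> ?D" for w
    using that by (auto simp: decreasing_residues_def inj_on_def) (metis less_irrefl linorder_neqE_nat)
  show ?thesis
  proof (rule bij_betwI')
    fix x y assume xy: "x \<in> ?D \<times> ?Q" "y \<in> ?D \<times> ?Q"
    obtain w p w' p' where x: "x = (w, p)" and y: "y = (w', p')" by (cases x, cases y)
    have eq: "w = w' \<and> p = p'" if e: "w \<circ> p = w' \<circ> p'"
    proof -
      have "(\<forall>i<r. w i = w' i) \<and> p = p'"
        by (rule strict_antitone_permute_unique)
           (use xy x y sub fun_cong[OF e] in \<open>auto simp: decreasing_residues_def\<close>)
      moreover have "w i = w' i" if "i \<ge> r" for i
        using out[OF _ that, of w] out[OF _ that, of w'] xy x y by (simp add: decreasing_residues_def)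
      ultimately show ?thesis by (metis ext linorder_not_le)
    qed
    show "((case x of (w, p) \<Rightarrow> w \<circ> p) = (case y of (w, p) \<Rightarrow> w \<circ> p)) = (x = y)"
      using eq by (auto simp: x y)
  next
    fix x assume "x \<in> ?D \<times> ?Q"
    then obtain w p where x: "x = (w, p)" "w \<in> ?D" "p \<in> ?Q" by blast
    have w: "w \<in> residues r n" "w s = 0" using x rs by (auto simp: decreasing_residues_def)
    have p: "p permutes {..<r}" by (rule sub[OF x(3)])
    have "w \<circ> p \<in> residues r n"
      using w(1) permutes_less[OF p] p by (auto simp: residues_def PiE_iff extensional_def permutes_not_in)
    moreover have "p s = s" using x(3) rs by (simp add: permutes_not_in)
    moreover have "inj_on (w \<circ> p) {..<r}"
      by (rule comp_inj_on) (use permutes_inj_on[OF p] permutes_image[OF p] inj_dec[OF x(2)] in auto)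
    ultimately show "(case x of (w, p) \<Rightarrow> w \<circ> p) \<in> ?Z" using w rs by (simp add: x)
  next
    fix v assume v: "v \<in> ?Z"
    obtain p where p: "p permutes {..<s}" "\<And>i j. i \<le> j \<Longrightarrow> j < s \<Longrightarrow> v (p j) \<le> v (p i)"
      by (rule permute_antitone_exists[of s v]) blast
    have pQ: "p \<in> ?Q" using p rs by simp
    note p' = sub[OF pQ]
    have ps: "p s = s" using p(1) by (simp add: permutes_not_in)
    have "v \<circ> p \<in> residues r n"
      using v permutes_less[OF p'] p' by (auto simp: residues_def PiE_iff extensional_def permutes_not_in)
    moreover have "(v \<circ> p) j < (v \<circ> p) i" if ij: "i < j" "j < r" for i j
    proof -
      have pij: "p i < r" "p j < r" "p i \<noteq> p j"
        using ij permutes_less[OF p'] permutes_inj[OF p'] by (auto dest: injD)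
      hence "v (p i) \<noteq> v (p j)" using v by (auto dest: inj_onD)
      moreover have "v (p j) \<le> v (p i)"
      \<comment> \<open>p sorts the first s positions only; the entry 0 at the last one is compared
        through nonnegativity of residues.\<close>
      proof (cases "j = s")
        case True
        have "0 \<le> v (p i)" using v pij(1) by (auto simp: residues_def PiE_iff)
        thus ?thesis using v True ps rs by simp
      next
        case False
        thus ?thesis using p(2)[of i j] ij rs by simp
      qed
      ultimately show ?thesis by simp
    qed
    ultimately have "v \<circ> p \<in> ?D" using v ps rs by (simp add: decreasing_residues_def)
    moreover have "Hilbert_Choice.inv p \<in> ?Q" using permutes_inv[OF p(1)] rs by simp
    moreover have "v = (v \<circ> p) \<circ> Hilbert_Choice.inv p" using permutes_inverses(1)[OF p(1)] by (simp add: fun_eq_iff)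
    ultimately show "\<exists>x\<in>?D \<times> ?Q. v = (case x of (w, p) \<Rightarrow> w \<circ> p)"
      by (intro bexI[where x = "(v \<circ> p, Hilbert_Choice.inv p)"]) auto
  qed
qed

text \<open>The factor n comes from normalising the last entry to 0, the factor (r - 1)! from
  sorting the remaining entries.\<close>

lemma sum_residues_symmetric:
  fixes G :: "(nat \<Rightarrow> int) \<Rightarrow> complex"
  assumes n: "n > 0" and r: "r > 0"
    and per: "\<And>v w. (\<And>i. i < r \<Longrightarrow> v i mod int n = w i mod int n) \<Longrightarrow> G v = G w"
    and shift: "\<And>v c. G (\<lambda>i. v i + c) = G v"
    and perm: "\<And>v p. p permutes {..<r} \<Longrightarrow> G (v \<circ> p) = G v"
    and coincide: "\<And>v i j. i < r \<Longrightarrow> j < r \<Longrightarrow> i \<noteq> j \<Longrightarrow> v i = v j \<Longrightarrow> G v = 0"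
  shows "(\<Sum>v\<in>residues r n. G v) = of_nat n * fact (r - 1) * (\<Sum>v\<in>decreasing_residues r n. G v)"
proof -
  let ?Q = "{p. p permutes {..<r - 1}}"
  have "(\<Sum>v | v \<in> residues r n \<and> v (r - 1) = 0. G v) =
        (\<Sum>v\<in>{v \<in> residues r n. v (r - 1) = 0 \<and> inj_on v {..<r}}. G v)"
  proof (rule sum.mono_neutral_right)
    show "\<forall>v\<in>{v. v \<in> residues r n \<and> v (r - 1) = 0} - {v \<in> residues r n. v (r - 1) = 0 \<and> inj_on v {..<r}}. G v = 0"
    proof
      fix v assume "v \<in> {v. v \<in> residues r n \<and> v (r - 1) = 0} - {v \<in> residues r n. v (r - 1) = 0 \<and> inj_on v {..<r}}"
      hence "\<not> inj_on v {..<r}" by auto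
      then obtain i j where "i < r" "j < r" "i \<noteq> j" "v i = v j" unfolding inj_on_def by auto
      thus "G v = 0" by (rule coincide)
    qed
  qed (auto simp: finite_residues)
  also have "\<dots> = (\<Sum>x\<in>decreasing_residues r n \<times> ?Q. G (case x of (w, p) \<Rightarrow> w \<circ> p))"
    by (rule sum.reindex_bij_betw[OF residues_sort_bij[OF r], symmetric])
  also have "\<dots> = (\<Sum>x\<in>decreasing_residues r n \<times> ?Q. G (fst x))"
  proof (rule sum.cong[OF refl])
    fix x assume "x \<in> decreasing_residues r n \<times> ?Q"
    then obtain w p where x: "x = (w, p)" "p permutes {..<r - 1}" by blast
    have "p permutes {..<r}" by (rule permutes_subset[OF x(2)]) auto
    thus "G (case x of (w, p) \<Rightarrow> w \<circ> p) = G (fst x)" using perm by (simp add: x)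
  qed
  also have "\<dots> = (\<Sum>w\<in>decreasing_residues r n. \<Sum>p\<in>?Q. G w)"
    unfolding sum.cartesian_product by (rule sum.cong) auto
  also have "\<dots> = fact (r - 1) * (\<Sum>w\<in>decreasing_residues r n. G w)"
    using card_permutations[of "{..<r - 1}" "r - 1"] by (simp del: One_nat_def add: sum_distrib_left)
  finally show ?thesis
    using sum_residues_shift[where s = "r - 1" and G = G, OF n _ per shift] r by (simp add: mult.assoc)
qed

section \<open>Schur polynomials as quotients of alternants\<close>

lemma altern_cong:
  assumes "\<And>i. i < r \<Longrightarrow> k i = l i" "\<And>i. i < r \<Longrightarrow> t i = s i"
  shows "altern r k t = altern r l s"
  unfolding altern_def lmon_def
proof (rule sum.cong[OF refl])
  fix p assume "p \<in> {p. p permutes {..<r}}"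
  hence "\<And>i. i < r \<Longrightarrow> p i < r" by (simp add: permutes_less)
  thus "of_int (sign p) * (\<Prod>i<r. t i powi (k \<circ> p) i) = of_int (sign p) * (\<Prod>i<r. s i powi (l \<circ> p) i)"
    using assms by simp
qed

lemma lmon_const_tuple: "c \<noteq> 0 \<Longrightarrow> lmon r m (\<lambda>i. c) = c powi (\<Sum>i<r. m i)"
  unfolding lmon_def by (induction r) (simp_all add: power_int_add mult.commute)

lemma lmon_const_expo: "lmon r (\<lambda>i. c) t = (\<Prod>i<r. t i) powi c"
  unfolding lmon_def by (induction r) (simp_all add: power_int_mult_distrib)

lemma altern_scale:
  assumes "c \<noteq> 0"
  shows "altern r k (\<lambda>i. c * t i) = c powi (\<Sum>i<r. k i) * altern r k t"
  unfolding altern_def sum_distrib_left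
proof (rule sum.cong[OF refl])
  fix p assume "p \<in> {p. p permutes {..<r}}"
  hence "(\<Sum>i<r. (k \<circ> p) i) = (\<Sum>i<r. k i)" using sum.permute[of p "{..<r}" k] by simp
  hence "lmon r (k \<circ> p) (\<lambda>i. c * t i) = c powi (\<Sum>i<r. k i) * lmon r (k \<circ> p) t"
    using lmon_mult[of r "k \<circ> p" "\<lambda>i. c" t] lmon_const_tuple[OF assms, of r "k \<circ> p"] by simp
  thus "of_int (sign p) * lmon r (k \<circ> p) (\<lambda>i. c * t i) = c powi (\<Sum>i<r. k i) * (of_int (sign p) * lmon r (k \<circ> p) t)"
    by simp
qed

lemma altern_add_const:
  assumes "t \<in> torus r"
  shows "altern r (\<lambda>i. k i + c) t = (\<Prod>i<r. t i) powi c * altern r k t"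
  unfolding altern_def sum_distrib_left
proof (rule sum.cong[OF refl])
  fix p
  show "of_int (sign p) * lmon r ((\<lambda>i. k i + c) \<circ> p) t = (\<Prod>i<r. t i) powi c * (of_int (sign p) * lmon r (k \<circ> p) t)"
    using lmon_add[OF assms, of "k \<circ> p" "\<lambda>i. c"] by (simp add: lmon_const_expo o_def)
qed

lemma altern_permute_expo:
  assumes q: "q permutes {..<r}"
  shows "altern r (k \<circ> q) t = of_int (sign q) * altern r k t"
proof -
  have "altern r k t = (\<Sum>p | p permutes {..<r}. of_int (sign (q \<circ> p)) * lmon r (k \<circ> (q \<circ> p)) t)"
    unfolding altern_def by (rule setum_permutations_compose_left[OF q])
  also have "\<dots> = (\<Sum>p | p permutes {..<r}. of_int (sign q) * (of_int (sign p) * lmon r ((k \<circ> q) \<circ> p) t))"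
  proof (rule sum.cong[OF refl], goal_cases)
    case (1 p)
    hence "permutation p" "permutation q" using q by (auto simp: permutation_permutes)
    thus ?case by (simp add: sign_compose o_assoc)
  qed
  also have "\<dots> = of_int (sign q) * altern r (k \<circ> q) t" by (simp add: altern_def sum_distrib_left)
  finally have "of_int (sign q) * altern r k t = (of_int (sign q * sign q) :: complex) * altern r (k \<circ> q) t"
    by (simp only: of_int_mult mult.assoc)
  thus ?thesis by (simp add: sign_idempotent del: of_int_mult)
qed

text \<open>A zero of the Vandermonde determinant has two equal coordinates, where every alternant
  vanishes.\<close>

lemma altern_rho_zero: "altern r (rho r) t = 0 \<Longrightarrow> altern r k t = 0"
  using altern_rho_nonzero[of r t] altern_coincide[of _ r _ t k] by (metis order.strict_trans less_irrefl)

abbreviation weyl_numerator :: "nat \<Rightarrow> int list \<Rightarrow> (nat \<Rightarrow> complex) \<Rightarrow> complex" where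
  "weyl_numerator r lam \<equiv> altern r (\<lambda>i. expo_of lam i + rho r i)"

lemma schur_weyl:
  assumes "length lam = r"
  shows "schur lam (map t [0..<r]) = weyl_numerator r lam t / altern r (rho r) t"
proof -
  have "mat r r (\<lambda>(i, j). map t [0..<r] ! j powi (lam ! i + int (r - 1 - i))) = mat r r (\<lambda>(i, j). t j powi (expo_of lam i + rho r i))"
    by (rule eq_matI) (simp_all add: assms expo_of_def rho_def)
  moreover have "mat r r (\<lambda>(i, j). map t [0..<r] ! j ^ (r - 1 - i)) = mat r r (\<lambda>(i, j). t j powi rho r i)"
    by (rule eq_matI) (simp_all add: rho_def power_int_of_nat del: of_nat_diff)
  ultimately show ?thesis unfolding schur_def Let_def assms by (simp only: det_eq_altern)
qed

lemma schur_shift: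
  assumes lam: "length lam = r" and t: "t \<in> torus r"
  shows "schur (map (\<lambda>x. c + x) lam) (map t [0..<r]) = (\<Prod>i<r. t i) powi c * schur lam (map t [0..<r])"
proof -
  have "weyl_numerator r (map (\<lambda>x. c + x) lam) t = altern r (\<lambda>i. (expo_of lam i + rho r i) + c) t"
    by (rule altern_cong) (simp_all add: expo_of_def lam)
  thus ?thesis using lam by (simp add: schur_weyl altern_add_const[OF t])
qed

text \<open>On the unit circle conjugation negates exponents. Reversal of the positions and a shift
  by r - 1 turn -(nu + rho) into the dual of nu plus rho, and -rho into rho, so numerator and
  denominator acquire the same nonzero factor.\<close>

lemma schur_dual:
  assumes nu: "length nu = r" and t: "\<And>i. i < r \<Longrightarrow> norm (t i) = 1"
  shows "schur (dual_partition nu) (map t [0..<r]) = cnj (schur nu (map t [0..<r]))"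
proof -
  define q where "q i = (if i < r then r - 1 - i else i)" for i
  have q: "q permutes {..<r}"
  proof (rule bij_imp_permutes)
    show "bij_betw q {..<r} {..<r}"
      by (rule bij_betw_byWitness[where f' = q]) (auto simp: q_def)
  qed (simp add: q_def)
  have tt: "t \<in> torus r" using t by (auto simp: torus_def) (metis norm_zero zero_neq_one)
  define e where "e = of_int (sign q) * (\<Prod>i<r. t i) powi int (r - 1)"
  have "(\<Prod>i<r. t i) \<noteq> 0" using tt by (auto simp: torus_def)
  hence e0: "e \<noteq> 0" by (simp add: e_def sign_def)
  have rev: "altern r (\<lambda>i. - (k (q i) + rho r (q i)) + int (r - 1)) t = e * cnj (altern r (\<lambda>i. k i + rho r i) t)" for k
  proof -
    have "altern r (\<lambda>i. - (k (q i) + rho r (q i)) + int (r - 1)) t =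
      (\<Prod>i<r. t i) powi int (r - 1) * altern r ((\<lambda>i. - (k i + rho r i)) \<circ> q) t"
      using altern_add_const[OF tt, of "\<lambda>i. - (k (q i) + rho r (q i))"] by (simp add: o_def)
    moreover have "cnj (altern r (\<lambda>i. k i + rho r i) t) = altern r (\<lambda>i. - (k i + rho r i)) t"
      by (rule cnj_altern) (rule t)
    ultimately show ?thesis unfolding altern_permute_expo[OF q] e_def by (simp only: mult_ac)
  qed
  have "weyl_numerator r (dual_partition nu) t = altern r (\<lambda>i. - (expo_of nu (q i) + rho r (q i)) + int (r - 1)) t"
    by (rule altern_cong) (auto simp: expo_of_def rho_def q_def dual_partition_def nu rev_nth of_nat_diff)
  moreover have "altern r (rho r) t = altern r (\<lambda>i. - (0 + rho r (q i)) + int (r - 1)) t"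
    by (rule altern_cong) (auto simp: rho_def q_def of_nat_diff)
  ultimately have "schur (dual_partition nu) (map t [0..<r]) =
      (e * cnj (weyl_numerator r nu t)) / (e * cnj (altern r (rho r) t))"
    using schur_weyl[of "dual_partition nu" r t] rev[of "expo_of nu"] rev[of "\<lambda>i. 0"] nu
    by (simp add: dual_partition_def)
  thus ?thesis using e0 by (simp add: schur_weyl[OF nu])
qed

section \<open>The integrand\<close>

text \<open>Where arguments coincide the quotient is 0/0, which is 0; the integrand vanishes there anyway.\<close>

definition integrand :: "nat \<Rightarrow> int list \<Rightarrow> int list \<Rightarrow> int list \<Rightarrow> (nat \<Rightarrow> complex) \<Rightarrow> complex" where
  "integrand r lam mu nu t =
     weyl_numerator r lam t * (weyl_numerator r mu t / altern r (rho r) t) * cnj (weyl_numerator r nu t)"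

lemma sum_expo_of: "length lam = r \<Longrightarrow> (\<Sum>i<r. expo_of lam i) = sum_list lam"
  by (auto simp: expo_of_def sum_list_sum_nth lessThan_atLeast0 intro: sum.cong)

lemma integrand_permute:
  assumes p: "p permutes {..<r}"
  shows "integrand r lam mu nu (t \<circ> p) = integrand r lam mu nu t"
  by (simp add: integrand_def altern_permute[OF p] sign_def)

lemma integrand_coincide:
  "i < r \<Longrightarrow> j < r \<Longrightarrow> i \<noteq> j \<Longrightarrow> t i = t j \<Longrightarrow> integrand r lam mu nu t = 0"
  by (simp add: integrand_def altern_coincide[of i r j t])

text \<open>Homogeneity: conjugation negates the degree of the last factor, the contributions of rho
  cancel, and |lam| + |mu| = |nu| leaves degree 0.\<close>

lemma integrand_scale:
  assumes len: "length lam = r" "length mu = r" "length nu = r"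
    and sum: "sum_list lam + sum_list mu = sum_list nu" and c: "norm c = 1"
  shows "integrand r lam mu nu (\<lambda>i. c * t i) = integrand r lam mu nu t"
proof -
  have c0: "c \<noteq> 0" using c by auto
  define a where "a = (\<Sum>i<r. rho r i)"
  have W: "weyl_numerator r l (\<lambda>i. c * t i) = c powi (sum_list l + a) * weyl_numerator r l t" if "length l = r" for l
    unfolding altern_scale[OF c0] sum.distrib a_def using sum_expo_of[OF that] by simp
  have D: "altern r (rho r) (\<lambda>i. c * t i) = c powi a * altern r (rho r) t"
    unfolding altern_scale[OF c0] a_def ..
  have "c * cnj c = 1" using c by (simp add: complex_norm_square[symmetric])
  hence cc: "cnj c = inverse c" by (metis inverse_unique)
  have "c powi (sum_list lam + a) * (c powi (sum_list mu + a) / c powi a) * cnj (c powi (sum_list nu + a)) =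
     c powi (sum_list lam + a + (sum_list mu + a) - a - (sum_list nu + a))"
    using c0 by (simp add: cc power_int_add power_int_diff power_int_inverse divide_simps)
  also have "\<dots> = 1" using sum by simp
  finally have one: "c powi (sum_list lam + a) * (c powi (sum_list mu + a) / c powi a) * cnj (c powi (sum_list nu + a)) = 1" .
  have "integrand r lam mu nu (\<lambda>i. c * t i) =
    (c powi (sum_list lam + a) * (c powi (sum_list mu + a) / c powi a) * cnj (c powi (sum_list nu + a))) * integrand r lam mu nu t"
    unfolding integrand_def W[OF len(1)] W[OF len(2)] W[OF len(3)] D by simp
  thus ?thesis unfolding one by simp
qed

lemma root_tuple_mod:
  assumes n: "n > 0" and "v i mod int n = w i mod int n"
  shows "root_tuple n v i = root_tuple n w i"
proof -
  have "int n dvd v i - w i" using assms(2) by (simp add: mod_eq_dvd_iff)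
  hence "cis (2 * pi * of_int (v i - w i) / of_nat n) = 1" using cis_root_eq_1[OF n] by blast
  moreover have "root_tuple n v i = cis (2 * pi * of_int (v i - w i) / of_nat n) * root_tuple n w i"
    unfolding root_tuple_def cis_mult by (simp add: field_simps flip: add_divide_distrib)
  ultimately show ?thesis by simp
qed

lemma integrand_sum_decreasing:
  assumes r: "r > 0" and n: "n > 0" and len: "length lam = r" "length mu = r" "length nu = r"
    and sum: "sum_list lam + sum_list mu = sum_list nu"
  shows "(\<Sum>v\<in>residues r n. integrand r lam mu nu (root_tuple n v)) =
    of_nat n * fact (r - 1) * (\<Sum>v\<in>decreasing_residues r n. integrand r lam mu nu (root_tuple n v))"
proof (rule sum_residues_symmetric[OF n r])
  fix v w :: "nat \<Rightarrow> int" assume vw: "\<And>i. i < r \<Longrightarrow> v i mod int n = w i mod int n"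
  have "root_tuple n v i = root_tuple n w i" if "i < r" for i using root_tuple_mod[of n v i w, OF n vw[OF that]] .
  hence "altern r k (root_tuple n v) = altern r k (root_tuple n w)" for k by (intro altern_cong) auto
  thus "integrand r lam mu nu (root_tuple n v) = integrand r lam mu nu (root_tuple n w)" unfolding integrand_def by simp
next
  fix v :: "nat \<Rightarrow> int" and c
  have "root_tuple n (\<lambda>i. v i + c) = (\<lambda>i. cis (2 * pi * of_int c / of_nat n) * root_tuple n v i)"
    unfolding root_tuple_def cis_mult by (simp add: field_simps flip: add_divide_distrib)
  thus "integrand r lam mu nu (root_tuple n (\<lambda>i. v i + c)) = integrand r lam mu nu (root_tuple n v)"
    using integrand_scale[OF len sum, of "cis (2 * pi * of_int c / of_nat n)"] by simp
next
  fix v :: "nat \<Rightarrow> int" and p assume p: "p permutes {..<r}"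
  have "root_tuple n (v \<circ> p) = root_tuple n v \<circ> p" by (simp add: root_tuple_def o_def)
  thus "integrand r lam mu nu (root_tuple n (v \<circ> p)) = integrand r lam mu nu (root_tuple n v)"
    using integrand_permute[OF p] by simp
next
  fix v :: "nat \<Rightarrow> int" and i j assume "i < r" "j < r" "i \<noteq> j" "v i = v j"
  thus "integrand r lam mu nu (root_tuple n v) = 0"
    by (intro integrand_coincide[of i r j]) (simp_all add: root_tuple_def)
qed

text \<open>By \<open>LR_bounds\<close> the width of a constituent k is at most that of lam plus
  that of mu; the term 2 (r - 1) is the width of rho, counted once for k + rho and once for nu +
  rho.\<close>

lemma integrand_sum_residues:
  assumes r: "r > 0" and n: "n > 0"
    and lam: "lam \<in> partitions r" and mu: "mu \<in> partitions r" and nu: "nu \<in> partitions r"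
    and sum: "sum_list lam + sum_list mu = sum_list nu"
    and width: "lam ! 0 - lam ! (r - 1) + mu ! 0 - mu ! (r - 1) + nu ! 0 - nu ! (r - 1) + 2 * int (r - 1) < 2 * int n"
  shows "(\<Sum>v\<in>residues r n. integrand r lam mu nu (root_tuple n v)) =
    of_nat (LR_coeff r lam mu nu) * (of_nat n ^ r * fact r)"
proof -
  let ?z = "root_tuple n" and ?c = "LR_coeff r lam mu"
  have len: "length lam = r" "length mu = r" "length nu = r" using lam mu nu by (auto simp: partitions_def)
  obtain ks where ks: "LR_spec r lam mu ?c ks" using LR_coeff_spec[OF lam mu] by blast
  have kp: "k \<in> partitions r" if "k \<in> set ks" for k using ks that by (auto simp: LR_spec_def)
  have "integrand r lam mu nu t = (\<Sum>k\<in>set ks. of_nat (?c k) * (weyl_numerator r k t * cnj (weyl_numerator r nu t)))"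
    if t: "t \<in> torus r" for t
  proof -
    \<comment> \<open>Where the Vandermonde determinant vanishes, the quotient is 0 by convention,
      and the first factor is 0 as well.\<close>
    have "weyl_numerator r lam t * (weyl_numerator r mu t / altern r (rho r) t) =
      weyl_numerator r lam t * tr (highest_weight_rep r mu (dg r t))"
    proof (cases "altern r (rho r) t = 0")
      case True
      thus ?thesis using altern_rho_zero[OF True] by simp
    next
      case False
      thus ?thesis using highest_weight_rep_character[OF mu t] by (simp add: field_simps)
    qed
    thus ?thesis unfolding integrand_def LR_character[OF lam mu ks t]
      by (simp add: sum_distrib_right mult.assoc)
  qed
  hence "(\<Sum>v\<in>residues r n. integrand r lam mu nu (?z v)) =
    (\<Sum>v\<in>residues r n. \<Sum>k\<in>set ks. of_nat (?c k) * (weyl_numerator r k (?z v) * cnj (weyl_numerator r nu (?z v))))"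
    using root_tuple_torus by simp
  also have "\<dots> = (\<Sum>k\<in>set ks. of_nat (?c k) * (\<Sum>v\<in>residues r n. weyl_numerator r k (?z v) * cnj (weyl_numerator r nu (?z v))))"
    unfolding sum_distrib_left by (rule sum.swap)
  also have "\<dots> = (\<Sum>k\<in>set ks. if k = nu then of_nat (?c nu) * (of_nat n ^ r * fact r) else 0)"
  proof (rule sum.cong[OF refl])
    fix k assume "k \<in> set ks"
    note k = kp[OF this]
    show "of_nat (?c k) * (\<Sum>v\<in>residues r n. weyl_numerator r k (?z v) * cnj (weyl_numerator r nu (?z v))) =
      (if k = nu then of_nat (?c nu) * (of_nat n ^ r * fact r) else 0)"
    proof (cases "?c k = 0")
      case True
      thus ?thesis by auto
    next
      case False
      note b = LR_bounds[OF r lam mu ks k False]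
      have e: "expo_of l 0 = l ! 0" "expo_of l (r - 1) = l ! (r - 1)" if "length l = r" for l :: "int list"
        using that r by (auto simp: expo_of_def)
      have "(\<Sum>v\<in>residues r n. weyl_numerator r k (?z v) * cnj (weyl_numerator r nu (?z v))) =
        (if (\<lambda>i. expo_of k i + rho r i) = (\<lambda>i. expo_of nu i + rho r i) then of_nat n ^ r * fact r else 0)"
      proof (rule altern_orthogonal[OF n r])
        show "(\<lambda>i. expo_of k i + rho r i) \<in> expo r" "(\<lambda>i. expo_of nu i + rho r i) \<in> expo r"
          by (intro expo_add expo_of_expo rho_expo k nu)+
        show "expo_of k j + rho r j < expo_of k i + rho r i" if "i < j" "j < r" for i j
          by (rule dominant_shift_strict[OF expo_of_dominant[OF k] that])
        show "expo_of nu j + rho r j < expo_of nu i + rho r i" if "i < j" "j < r" for i j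
          by (rule dominant_shift_strict[OF expo_of_dominant[OF nu] that])
        show "(\<Sum>i<r. expo_of k i + rho r i) = (\<Sum>i<r. expo_of nu i + rho r i)"
          using b(3) sum len by (simp add: sum.distrib sum_expo_of)
        have "rho r 0 = int (r - 1)" "rho r (r - 1) = 0" using r by (simp_all add: rho_def)
        thus "expo_of k 0 + rho r 0 - (expo_of k (r - 1) + rho r (r - 1)) +
          (expo_of nu 0 + rho r 0 - (expo_of nu (r - 1) + rho r (r - 1))) < 2 * int n"
          using b(1,2) width e[OF len(1)] e[OF len(2)] e[OF len(3)] by linarith
      qed
      moreover have "(\<lambda>i. expo_of k i + rho r i) = (\<lambda>i. expo_of nu i + rho r i) \<longleftrightarrow> k = nu"
        unfolding expo_of_inject[OF k nu, symmetric] by (simp add: fun_eq_iff)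
      ultimately show ?thesis by simp
    qed
  qed
  also have "\<dots> = of_nat (?c nu) * (of_nat n ^ r * fact r)"
    using ks by (auto simp: LR_spec_def)
  finally show ?thesis .
qed

text \<open>The constant is n^r r! divided by n (r - 1)!, from the two evaluations of the sum over
  all tuples.\<close>

lemma integrand_average:
  assumes r: "r > 0" and n: "n > 0"
    and lam: "lam \<in> partitions r" and mu: "mu \<in> partitions r" and nu: "nu \<in> partitions r"
    and sum: "sum_list lam + sum_list mu = sum_list nu"
    and width: "lam ! 0 - lam ! (r - 1) + mu ! 0 - mu ! (r - 1) + nu ! 0 - nu ! (r - 1) + 2 * int (r - 1) < 2 * int n"
  shows "(\<Sum>v\<in>decreasing_residues r n. integrand r lam mu nu (root_tuple n v)) =
    of_nat r * of_nat n ^ (r - 1) * of_nat (LR_coeff r lam mu nu)"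
proof -
  have len: "length lam = r" "length mu = r" "length nu = r" using lam mu nu by (auto simp: partitions_def)
  obtain s where s: "r = Suc s" using r by (cases r) auto
  have "of_nat n * fact (r - 1) * (\<Sum>v\<in>decreasing_residues r n. integrand r lam mu nu (root_tuple n v)) =
    of_nat n * fact (r - 1) * (of_nat r * of_nat n ^ (r - 1) * of_nat (LR_coeff r lam mu nu))"
    unfolding integrand_sum_decreasing[OF r n len sum, symmetric] integrand_sum_residues[OF r n lam mu nu sum width]
    by (simp add: s algebra_simps)
  moreover have "of_nat n * fact (r - 1) \<noteq> (0 :: complex)" using n by simp
  ultimately show ?thesis by (simp only: mult_cancel_left) simp
qed

section \<open>From the summand of the theorem to the integrand\<close>

lemma cis_diff_norm: "(cis a - cis b) * cnj (cis a - cis b) = of_real ((2 * sin ((a - b) / 2))\<^sup>2)"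
proof -
  have "(norm (cis a - cis b))\<^sup>2 = (cos a - cos b)\<^sup>2 + (sin a - sin b)\<^sup>2" by (simp add: cmod_power2)
  also have "\<dots> = (sin a)\<^sup>2 + (cos a)\<^sup>2 + ((sin b)\<^sup>2 + (cos b)\<^sup>2) - 2 * (cos a * cos b + sin a * sin b)"
    by (simp add: power2_eq_square algebra_simps)
  also have "\<dots> = 2 - 2 * cos (a - b)" by (simp add: cos_diff del: sin_cos_squared_add2)
  also have "cos (a - b) = 1 - 2 * (sin ((a - b) / 2))\<^sup>2" using cos_double_sin[of "(a - b) / 2"] by (simp only: nonzero_mult_div_cancel_left times_divide_eq_right)
  finally have "(norm (cis a - cis b))\<^sup>2 = (2 * sin ((a - b) / 2))\<^sup>2" by (simp add: power_mult_distrib)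
  thus ?thesis by (metis complex_norm_square)
qed

lemma sin_product:
  "complex_of_real (\<Prod>(i, j)\<in>{(i, j). i < j \<and> j < r}. (2 * sin (pi * real_of_int (w i - w j) / real n))\<^sup>2) =
   altern r (rho r) (root_tuple n w) * cnj (altern r (rho r) (root_tuple n w))"
  unfolding altern_rho cnj_prod prod.distrib[symmetric] of_real_prod
proof (rule prod.cong[OF refl])
  fix x :: "nat \<times> nat"
  obtain i j where x: "x = (i, j)" by (cases x)
  have "pi * real_of_int (w i - w j) / real n = (2 * pi * of_int (w i) / of_nat n - 2 * pi * of_int (w j) / of_nat n) / 2"
    by (simp add: algebra_simps diff_divide_distrib)
  thus "complex_of_real (case x of (i, j) \<Rightarrow> (2 * sin (pi * real_of_int (w i - w j) / real n))\<^sup>2) =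
    (case x of (i, j) \<Rightarrow> root_tuple n w i - root_tuple n w j) * cnj (case x of (i, j) \<Rightarrow> root_tuple n w i - root_tuple n w j)"
    unfolding x root_tuple_def prod.case cis_diff_norm by (simp only:)
qed

lemma prod_root_tuple: "(\<Prod>i<r. root_tuple n w i) = cis (2 * pi * of_int (\<Sum>i<r. w i) / of_nat n)"
  unfolding root_tuple_def by (induction r) (simp_all add: cis_mult ring_distribs add_divide_distrib)

text \<open>With a numerator divisible by r the exponential is an integral power of the product of
  the coordinates, which can cancel the powers from the shifts.\<close>

lemma exp_factor:
  assumes "r > 0" "n > 0"
  shows "exp (2 * pi * \<i> * (- (of_int (int r * C) / (of_nat r * of_nat n))) * of_int (\<Sum>i<r. w i)) =
    (\<Prod>i<r. root_tuple n w i) powi (- C)"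
proof -
  have "(\<Prod>i<r. root_tuple n w i) powi (- C) = cis (of_int (- C) * (2 * pi * of_int (\<Sum>i<r. w i) / of_nat n))"
    unfolding prod_root_tuple by (rule cis_power_int)
  also have "\<dots> = exp (\<i> * complex_of_real (of_int (- C) * (2 * pi * of_int (\<Sum>i<r. w i) / of_nat n)))"
    by (rule cis_conv_exp)
  also have "\<i> * complex_of_real (of_int (- C) * (2 * pi * of_int (\<Sum>i<r. w i) / of_nat n)) =
      2 * pi * \<i> * (- (of_int (int r * C) / (of_nat r * of_nat n))) * of_int (\<Sum>i<r. w i)"
    using assms by (simp add: field_simps)
  finally show ?thesis ..
qed

lemma sum_list_shift: "sum_list (map (\<lambda>x. c + x) xs) = int (length xs) * c + sum_list xs" for c :: int
  by (induction xs) (simp_all add: algebra_simps)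

lemma sum_list_dual: "sum_list (dual_partition nu) = - sum_list nu"
  unfolding dual_partition_def by (induction nu) simp_all

lemma exp_tuple_root_tuple: "exp_tuple r K (map w [0..<r]) = map (root_tuple (r + K) w) [0..<r]"
  unfolding exp_tuple_def root_tuple_def cis_conv_exp map_map
  by (rule map_cong[OF refl]) (simp add: o_def mult_ac)

lemma summand_eq_integrand:
  assumes r: "r > 0" and len: "length lam = r" "length mu = r" "length nu = r"
    and sum: "sum_list lam + sum_list mu = sum_list nu"
    and S: "absSigma = sum_list (shift_partition K lam) + sum_list (shift_partition K mu) + sum_list (shift_partition K (dual_partition nu))"
    and t: "t = root_tuple (r + K) w"
  shows "exp (2 * pi * \<i> * (- (of_int absSigma / (of_nat r * of_nat (r + K)))) * of_int (\<Sum>i<r. w i)) *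
       complex_of_real (\<Prod>(i, j)\<in>{(i, j). i < j \<and> j < r}. (2 * sin (pi * real_of_int (w i - w j) / real (r + K)))\<^sup>2) *
       (schur (shift_partition K lam) (map t [0..<r]) * schur (shift_partition K mu) (map t [0..<r]) *
        schur (shift_partition K (dual_partition nu)) (map t [0..<r])) = integrand r lam mu nu t"
proof -
  \<comment> \<open>Total shift of the three partitions; since |lam| + |mu| - |nu| = 0, the size of
    Sigma is r C.\<close>
  define C where "C = (int K - lam ! 0) + (int K - mu ! 0) + (int K - dual_partition nu ! 0)"
  let ?e = "\<Prod>i<r. t i" and ?D = "altern r (rho r) t"
  have ld: "length (dual_partition nu) = r" using len by (simp add: dual_partition_def)
  have "absSigma = int r * C"
    unfolding S C_def shift_partition_def sum_list_shift using len ld sum by (simp add: sum_list_dual algebra_simps)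
  hence E: "exp (2 * pi * \<i> * (- (of_int absSigma / (of_nat r * of_nat (r + K)))) * of_int (\<Sum>i<r. w i)) = ?e powi (- C)"
    unfolding t using exp_factor[of r "r + K" C w] r by (simp only: add_gr_0 simp_thms)
  have unit: "norm (t i) = 1" for i by (simp add: t root_tuple_def)
  have tt: "t \<in> torus r" unfolding t by (rule root_tuple_torus)
  have e0: "?e \<noteq> 0" using tt by (auto simp: torus_def)
  have reorder: "e * X * ((a * A) * (b * B) * (c * N)) = X * (A * B * N)" if "e * (a * b * c) = 1"
    for e X a A b B c N :: complex
  proof -
    have "e * X * ((a * A) * (b * B) * (c * N)) = e * (a * b * c) * (X * (A * B * N))" by (simp only: mult_ac)
    thus ?thesis by (simp add: that)
  qed
  have "?e powi (- C) * (?e powi (int K - lam ! 0) * ?e powi (int K - mu ! 0) * ?e powi (int K - dual_partition nu ! 0)) = 1"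
    using e0 by (simp add: C_def flip: power_int_add)
  hence "?e powi (- C) * (?D * cnj ?D) *
      ((?e powi (int K - lam ! 0) * (weyl_numerator r lam t / ?D)) * (?e powi (int K - mu ! 0) * (weyl_numerator r mu t / ?D)) *
       (?e powi (int K - dual_partition nu ! 0) * cnj (weyl_numerator r nu t / ?D))) =
      (?D * cnj ?D) * ((weyl_numerator r lam t / ?D) * (weyl_numerator r mu t / ?D) * cnj (weyl_numerator r nu t / ?D))"
    by (rule reorder)
  also have "\<dots> = integrand r lam mu nu t"
    \<comment> \<open>If the Vandermonde determinant is 0, all alternants vanish and both sides are
      0.\<close>
    by (cases "?D = 0") (simp_all add: integrand_def altern_rho_zero)
  finally show ?thesis
    unfolding E t sin_product unfolding t[symmetric] shift_partition_def
      schur_shift[OF len(1) tt] schur_shift[OF len(2) tt] schur_shift[OF ld tt]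
      schur_dual[OF len(3) unit] schur_weyl[OF len(1)] schur_weyl[OF len(2)] schur_weyl[OF len(3)] .
qed

lemma verlinde_vectors_sum:
  assumes r: "r > 0"
  shows "(\<Sum>v\<in>verlinde_vectors r K. H v) = (\<Sum>w\<in>decreasing_residues r (r + K). H (map w [0..<r]))"
proof (rule sum.reindex_bij_witness[of _ "\<lambda>w. map w [0..<r]" "\<lambda>v. restrict (\<lambda>i. v ! i) {..<r}"])
  fix v assume v: "v \<in> verlinde_vectors r K"
  hence len: "length v = r" and dec: "\<And>i j. i < j \<Longrightarrow> j < r \<Longrightarrow> v ! j < v ! i"
    by (auto simp: verlinde_vectors_def sorted_wrt_iff_nth_less)
  show eq: "map (restrict (\<lambda>i. v ! i) {..<r}) [0..<r] = v" by (rule nth_equalityI) (simp_all add: len)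
  have "0 \<le> v ! i \<and> v ! i < int (r + K)" if "i < r" for i
    using dec[of i "r - 1"] dec[of 0 i] v that by (cases "i = 0"; cases "i = r - 1"; force simp: verlinde_vectors_def)
  thus "restrict (\<lambda>i. v ! i) {..<r} \<in> decreasing_residues r (r + K)"
    using v dec r by (auto simp: decreasing_residues_def residues_def verlinde_vectors_def)
  show "H (map (restrict (\<lambda>i. v ! i) {..<r}) [0..<r]) = H v" by (simp only: eq)
next
  fix w assume w: "w \<in> decreasing_residues r (r + K)"
  show "restrict (\<lambda>i. map w [0..<r] ! i) {..<r} = w"
    using w by (auto simp: decreasing_residues_def residues_def PiE_iff extensional_def fun_eq_iff)
  show "map w [0..<r] \<in> verlinde_vectors r K"
    using w r by (auto simp: decreasing_residues_def residues_def PiE_iff verlinde_vectors_def sorted_wrt_iff_nth_less)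
qed

theorem theorem1p2:
  fixes r K :: nat and lam mu nu :: "int list"
  assumes "r \<ge> 1"
    and "lam \<in> partitions r" and "mu \<in> partitions r" and "nu \<in> partitions r"
    and "sum_list lam + sum_list mu = sum_list nu"
    and "K > 0"
    and "real_of_int (lam ! 0 - lam ! (r - 1) + mu ! 0 - mu ! (r - 1) + nu ! 0 - nu ! (r - 1)) / real K
           < 1 / real r"
  defines "lamK \<equiv> shift_partition K lam"
    and "muK \<equiv> shift_partition K mu"
    and "nuK \<equiv> shift_partition K (dual_partition nu)"
  defines "absSigma \<equiv> sum_list lamK + sum_list muK + sum_list nuK"
    and "S \<equiv> \<lambda>z. schur lamK z * schur muK z * schur nuK z"
  shows "of_nat (LR_coeff r lam mu nu) =
    1 / (of_nat r * of_nat (r + K) ^ (r - 1)) *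
    (\<Sum>v\<in>verlinde_vectors r K.
       exp (2 * pi * \<i> * (- (of_int absSigma / (of_nat r * of_nat (r + K)))) * of_int (\<Sum>i<r. v ! i)) *
       complex_of_real (\<Prod>(i, j)\<in>{(i, j). i < j \<and> j < r}.
          (2 * sin (pi * real_of_int (v ! i - v ! j) / real (r + K)))\<^sup>2) *
       S (exp_tuple r K v))"
proof -
  let ?n = "r + K"
  let ?f = "\<lambda>v. exp (2 * pi * \<i> * (- (of_int absSigma / (of_nat r * of_nat (r + K)))) * of_int (\<Sum>i<r. v ! i)) *
       complex_of_real (\<Prod>(i, j)\<in>{(i, j). i < j \<and> j < r}.
          (2 * sin (pi * real_of_int (v ! i - v ! j) / real (r + K)))\<^sup>2) * S (exp_tuple r K v)"
  have r: "r > 0" using assms(1) by simp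
  have len: "length lam = r" "length mu = r" "length nu = r" using assms(2-4) by (auto simp: partitions_def)
  let ?d = "lam ! 0 - lam ! (r - 1) + mu ! 0 - mu ! (r - 1) + nu ! 0 - nu ! (r - 1)"
  \<comment> \<open>The bound on K enters as d < K, because 1 / r is at most 1; then d + 2 (r - 1) <
    K + 2 r, which is at most 2 (r + K).\<close>
  have "real_of_int ?d < real K / real r" using assms(6,7) r by (simp add: field_simps)
  also have "\<dots> \<le> real K" using r by (simp add: field_simps mult_le_cancel_left1)
  finally have "?d < int K" by linarith
  hence width: "?d + 2 * int (r - 1) < 2 * int ?n" using r by simp
  have "?f (map w [0..<r]) = integrand r lam mu nu (root_tuple ?n w)" for w
  proof -
    have "(\<Sum>i<r. map w [0..<r] ! i) = (\<Sum>i<r. w i)" by (rule sum.cong) auto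
    moreover have "(\<Prod>(i, j)\<in>{(i, j). i < j \<and> j < r}. (2 * sin (pi * real_of_int (map w [0..<r] ! i - map w [0..<r] ! j) / real (r + K)))\<^sup>2) =
      (\<Prod>(i, j)\<in>{(i, j). i < j \<and> j < r}. (2 * sin (pi * real_of_int (w i - w j) / real (r + K)))\<^sup>2)"
      by (rule prod.cong) auto
    ultimately show ?thesis
      using summand_eq_integrand[OF r len assms(5) _ refl, of absSigma K w]
      by (simp only: S_def exp_tuple_root_tuple absSigma_def lamK_def muK_def nuK_def)
  qed
  hence "(\<Sum>v\<in>verlinde_vectors r K. ?f v) = (\<Sum>w\<in>decreasing_residues r ?n. integrand r lam mu nu (root_tuple ?n w))"
    unfolding verlinde_vectors_sum[OF r] by (rule sum.cong[OF refl])
  also have "\<dots> = of_nat r * of_nat ?n ^ (r - 1) * of_nat (LR_coeff r lam mu nu)"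
    by (rule integrand_average[OF r _ assms(2-5) width]) (use r in simp)
  finally have sum: "(\<Sum>v\<in>verlinde_vectors r K. ?f v) = of_nat r * of_nat ?n ^ (r - 1) * of_nat (LR_coeff r lam mu nu)" .
  have "of_nat r * of_nat ?n ^ (r - 1) \<noteq> (0 :: complex)" using r by (simp del: of_nat_add)
  thus ?thesis unfolding sum by simp
qed

end
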